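(* Let $N\ge2$ and let $\Phi$ be a non-negative function on $[0,\infty)$ such that there exist $R\ge0$ and $c_\Phi>0$ with $\Phi(r)\ge c_\Phi$ for all $r\ge R$. Let $D^{La}$ be the linearized Landau entropy dissipation functional with kernel $\Phi$, and $D^{La}_0$ the one with kernel $\Phi_0\equiv1$. Then for all $h\in L^2(M)$ $$D^{La}(h)\ \ge\ C^{La}_\Phi\,D^{La}_0(h),\qquad C^{La}_\Phi=\frac{c_\Phi\,\beta_R}{8\,\alpha_N},$$ where $$\alpha_N=\int_{\mathbb{R}^{N-1}}e^{-|V|^2}\,dV,\qquad \beta_R=\int_{\{V\in\mathbb{R}^{N-1}\,:\,|V|\ge2R\}}e^{-|V|^2}\,dV.$$ As a consequence, for all $h\in L^2(M)$ orthogonal in $L^2(M)$ to $1$, $v$ (that is, to each coordinate $v_1,\dots,v_N$) and $|v|^2$, $$D^{La}(h)\ \ge\ C^{La}_\Phi\,|\lambda^{La}_0|\,\|h\|^2_{L^2(M)},$$ where $\lambda^{La}_0$ is the first non-zero eigenvalue (the one of smallest modulus) of the linearized Landau operator $L^{La}$ with $\Phi_0\equiv1$. Moreover, in dimension $N=3$, $$|\lambda^{La}_0|\ \ge\ 2\pi.$$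
   Context: $M(v)=e^{-|v|^2}$ on $\mathbb{R}^N$, $M=M(v)$, $M_*=M(v_* )$, and $L^2(M)$ is the real weighted space with norm $\|h\|_{L^2(M)}^2=\int_{\mathbb{R}^N}h^2M\,dv$. For $z\in\mathbb{R}^N\setminus\{0\}$, $\Pi_{z^\perp}$ is the orthogonal projection onto $z^\perp$, i.e. $(\Pi_{z^\perp})_{i,j}=\delta_{i,j}-z_iz_j/|z|^2$, and $\mathbf{a}(z)=|z|^2\,\Phi(|z|)\,\Pi_{z^\perp}$. The linearized Landau operator with kernel $\Phi$ is $$L^{La}h(v)=M(v)^{-1}\,\nabla_v\cdot\left(\int_{\mathbb{R}^N}\mathbf{a}(v-v_* )\,[\nabla h(v)-\nabla h(v_* )]\,M\,M_*\,dv_*\right),$$ and its entropy dissipation functional, which formally equals $-\langle h,L^{La}h\rangle_{L^2(M)}$, is $$D^{La}(h)=\frac12\int_{\mathbb{R}^N}\int_{\mathbb{R}^N}\Phi(|v-v_*|)\,|v-v_*|^2\,\left\|\Pi_{(v-v_* )^\perp}[\nabla h(v)-\nabla h(v_* )]\right\|^2M\,M_*\,dv_*\,dv\in[0,+\infty].$$ Here $\nabla h$ is the distributional gradient, and $D^{La}(h)=+\infty$ by convention if $\nabla h$ is not a locally integrable function. *)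

theory Defs
  imports "HOL-Analysis.Analysis"
begin

section \<open>Test functions and weak derivatives\<close>

definition partial_deriv :: "'n::finite \<Rightarrow> (real^'n \<Rightarrow> real) \<Rightarrow> real^'n \<Rightarrow> real" where
  "partial_deriv i f = (\<lambda>x. frechet_derivative f (at x) (axis i 1))"

primrec C_k :: "nat \<Rightarrow> (real^'n::finite \<Rightarrow> real) \<Rightarrow> bool" where
  "C_k 0 f \<longleftrightarrow> continuous_on UNIV f"
| "C_k (Suc k) f \<longleftrightarrow> (\<forall>x. f differentiable (at x)) \<and> (\<forall>i. C_k k (partial_deriv i f))"

definition test_function :: "(real^'n::finite \<Rightarrow> real) \<Rightarrow> bool" where
  "test_function \<phi> \<longleftrightarrow> (\<forall>k. C_k k \<phi>) \<and> compact (closure {x. \<phi> x \<noteq> 0})"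

definition locally_integrable ::
    "(real^'n::finite \<Rightarrow> 'b::{banach, second_countable_topology}) \<Rightarrow> bool" where
  "locally_integrable f \<longleftrightarrow> (\<forall>K. compact K \<longrightarrow> set_integrable lborel K f)"

definition weak_gradient :: "(real^'n::finite \<Rightarrow> real) \<Rightarrow> (real^'n \<Rightarrow> real^'n) \<Rightarrow> bool" where
  "weak_gradient h g \<longleftrightarrow> locally_integrable h \<and> locally_integrable g \<and>
     (\<forall>\<phi> i. test_function \<phi> \<longrightarrow>
        (LINT v|lborel. h v * partial_deriv i \<phi> v) = - (LINT v|lborel. g v $ i * \<phi> v))"

definition weak_divergence :: "(real^'n::finite \<Rightarrow> real^'n) \<Rightarrow> (real^'n \<Rightarrow> real) \<Rightarrow> bool" where
  "weak_divergence F u \<longleftrightarrow> locally_integrable F \<and> locally_integrable u \<and>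
     (\<forall>\<phi>. test_function \<phi> \<longrightarrow>
        (LINT v|lborel. (\<Sum>i\<in>UNIV. F v $ i * partial_deriv i \<phi> v)) = - (LINT v|lborel. u v * \<phi> v))"


section \<open>The weighted space\<close>

definition maxw :: "real^'n::finite \<Rightarrow> real" where
  "maxw v = exp (- (norm v)\<^sup>2)"

text \<open>Elements of the space are represented by Borel functions; the notions below do not
  depend on the representative chosen in a class modulo null sets.\<close>

definition L2M :: "(real^'n::finite \<Rightarrow> real) set" where
  "L2M = {h. h \<in> borel_measurable lborel \<and> integrable lborel (\<lambda>v. (h v)\<^sup>2 * maxw v)}"

definition L2M_inner :: "(real^'n::finite \<Rightarrow> real) \<Rightarrow> (real^'n \<Rightarrow> real) \<Rightarrow> real" where
  "L2M_inner h k = (LINT v|lborel. h v * k v * maxw v)"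

definition L2M_norm :: "(real^'n::finite \<Rightarrow> real) \<Rightarrow> real" where
  "L2M_norm h = sqrt (LINT v|lborel. (h v)\<^sup>2 * maxw v)"


section \<open>The linearized Landau operator and its entropy dissipation\<close>

text \<open>At \<open>z = 0\<close> this is the identity matrix (division by zero); it is only used there
  multiplied by \<open>(norm z)\<^sup>2\<close>.\<close>

definition perp_proj :: "real^'n::finite \<Rightarrow> real^'n^'n" where
  "perp_proj z = (\<chi> i j. (if i = j then 1 else 0) - z $ i * z $ j / (norm z)\<^sup>2)"

definition landau_matrix :: "(real \<Rightarrow> real) \<Rightarrow> real^'n::finite \<Rightarrow> real^'n^'n" where
  "landau_matrix \<Phi> z = ((norm z)\<^sup>2 * \<Phi> (norm z)) *\<^sub>R perp_proj z"

definition landau_dissipation :: "(real \<Rightarrow> real) \<Rightarrow> (real^'n::finite \<Rightarrow> real) \<Rightarrow> ennreal" where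
  "landau_dissipation \<Phi> h =
     (if \<exists>g. weak_gradient h g then
        let g = (SOME g. weak_gradient h g) in
        ennreal (1/2) * (\<integral>\<^sup>+ v. (\<integral>\<^sup>+ w.
            ennreal (\<Phi> (norm (v - w)) * (norm (v - w))\<^sup>2 *
              (norm (perp_proj (v - w) *v (g v - g w)))\<^sup>2 * maxw v * maxw w)
          \<partial>lborel) \<partial>lborel)
      else \<infinity>)"

definition landau_integrand ::
    "(real \<Rightarrow> real) \<Rightarrow> (real^'n::finite \<Rightarrow> real^'n) \<Rightarrow> real^'n \<Rightarrow> real^'n \<Rightarrow> real^'n" where
  "landau_integrand \<Phi> g v w =
     (maxw v * maxw w) *\<^sub>R (landau_matrix \<Phi> (v - w) *v (g v - g w))"

text \<open>\<open>landau_op \<Phi> h f\<close> means that \<open>h\<close> is in the domain of the operator and is mapped to \<open>f\<close>.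
  The operator is unbounded on the weighted space; it is taken on its maximal domain, that is,
  on all \<open>h\<close> for which the defining formula makes sense with distributional derivatives, with an
  absolutely convergent inner integral, and gives an element of the space. It is a relation
  because \<open>f\<close> is determined only up to null sets.\<close>

definition landau_op ::
    "(real \<Rightarrow> real) \<Rightarrow> (real^'n::finite \<Rightarrow> real) \<Rightarrow> (real^'n \<Rightarrow> real) \<Rightarrow> bool" where
  "landau_op \<Phi> h f \<longleftrightarrow> h \<in> L2M \<and> f \<in> L2M \<and>
     (\<exists>g. weak_gradient h g \<and>
        (AE v in lborel. integrable lborel (landau_integrand \<Phi> g v)) \<and>
        weak_divergence (\<lambda>v. LINT w|lborel. landau_integrand \<Phi> g v w) (\<lambda>v. maxw v * f v))"

definition L2M_eigenvalue ::
    "((real^'n::finite \<Rightarrow> real) \<Rightarrow> (real^'n \<Rightarrow> real) \<Rightarrow> bool) \<Rightarrow> real \<Rightarrow> bool" where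
  "L2M_eigenvalue L \<mu> \<longleftrightarrow>
     (\<exists>h\<in>L2M. \<not> (AE v in lborel. h v = 0) \<and> L h (\<lambda>v. \<mu> * h v))"

definition first_nonzero_eigenvalue ::
    "((real^'n::finite \<Rightarrow> real) \<Rightarrow> (real^'n \<Rightarrow> real) \<Rightarrow> bool) \<Rightarrow> real \<Rightarrow> bool" where
  "first_nonzero_eigenvalue L \<mu> \<longleftrightarrow> L2M_eigenvalue L \<mu> \<and> \<mu> \<noteq> 0 \<and>
     (\<forall>\<nu>. L2M_eigenvalue L \<nu> \<and> \<nu> \<noteq> 0 \<longrightarrow> \<bar>\<mu>\<bar> \<le> \<bar>\<nu>\<bar>)"


section \<open>The constants\<close>

text \<open>\<open>\<real>\<^bsup>N-1\<^esup>\<close> is the space of functions on \<open>{..<N - 1}\<close> with the product Lebesgue measure.\<close>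

definition alpha_const :: "nat \<Rightarrow> real" where
  "alpha_const N =
     (LINT V|(PiM {..<N - 1} (\<lambda>_. lborel)). exp (- (\<Sum>i<N - 1. (V i)\<^sup>2)))"

definition beta_const :: "nat \<Rightarrow> real \<Rightarrow> real" where
  "beta_const N R =
     (LINT V:{V \<in> space (PiM {..<N - 1} (\<lambda>_. lborel)). sqrt (\<Sum>i<N - 1. (V i)\<^sup>2) \<ge> 2 * R}
        |(PiM {..<N - 1} (\<lambda>_. lborel)). exp (- (\<Sum>i<N - 1. (V i)\<^sup>2)))"

definition landau_const :: "nat \<Rightarrow> real \<Rightarrow> real \<Rightarrow> real" where
  "landau_const N c R = c * beta_const N R / (8 * alpha_const N)"

end

theory Submission
  imports Defs "HOL-Probability.Distributions" "HOL-Computational_Algebra.Polynomial"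
begin

text \<open>
  Restricted to a line, the matrix \<open>|z|\<^sup>2 \<Pi>\<close> only sees differences of a scalar function, and two points at distance
  less than \<open>R\<close> can be compared through a third one, at distance at least \<open>2 R\<close> from one of them, at the price
  of the factor \<open>8 \<alpha> / \<beta>\<close>; integrating over all lines of a plane and averaging over all planes
  gives the comparison with the kernel 1.

  For the kernel 1 the operator maps polynomials to polynomials and preserves the degree \<open>k\<close> of Hermite
  polynomials. With \<open>m = \<pi> ^ (N / 2)\<close> it is, for \<open>k \<ge> 3\<close>, \<open>- m\<close> times \<open>(N - 1) k\<close>
  minus the spherical Laplacian; for \<open>k = 2\<close> there is an extra \<open>2\<close> on functions orthogonal to
  \<open>|v|\<^sup>2\<close>, and \<open>k = 0, 1\<close> belong to the kernel. Hence the gap is \<open>4 (N - 1) m\<close>, attained by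
  the radial polynomial of degree 4. The form inequality \<open>D h \<ge> 2 D(h, p) - D p\<close>, applied to
  the Hermite truncations \<open>p\<close> of \<open>h\<close>, carries the bound to every \<open>h\<close> of finite dissipation; testing the
  weak eigenvalue equation with polynomials carries it to every eigenfunction.
\<close>

section \<open>Gaussian integrals\<close>

text \<open>The lines are lines of a two-dimensional plane only: the other N - 2 coordinates stay
  free, so each slice is a hyperplane, and this is why \<open>alpha_const\<close> and
  \<open>beta_const\<close> live on R^(N-1). For two points of one slice only the component of the
  gradient along the normal of the slice enters, which is one scalar function per slice. The 8 in
  \<open>landau_const\<close> is 4 times 2: the 4 is the price of the three-point comparison, the 2
  comes from keeping a half-space of the far region, which bounds the far mass from below by beta /
  2 whatever the centre is. The spherical Laplacian is never diagonalised: its nonnegativity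
  suffices for k >= 4, and an explicit norm bound on the Laplacian settles k = 3. The analytic
  obstacle is that a function of finite dissipation, and an eigenfunction, come with a gradient that
  is merely locally integrable. Every integration by parts therefore runs against cut-off
  polynomials, and in the limit only the function itself, which is in the weighted space, is paired
  with polynomials.\<close>

lemma nn_integral_lborel_translate:
  fixes c :: "'a::euclidean_space"
  assumes [measurable]: "f \<in> borel_measurable borel"
  shows "(\<integral>\<^sup>+x. f (x + c) \<partial>lborel) = (\<integral>\<^sup>+x. f x \<partial>lborel)"
proof -
  have "(\<integral>\<^sup>+x. f x \<partial>lborel) = (\<integral>\<^sup>+x. f x \<partial>distr lborel borel ((+) c))"
    by (simp add: lborel_distr_plus)
  also have "\<dots> = (\<integral>\<^sup>+x. f (c + x) \<partial>lborel)"
    by (subst nn_integral_distr) auto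
  finally show ?thesis by (simp add: add.commute)
qed

lemma nn_integral_lborel_uminus:
  fixes f :: "'a::euclidean_space \<Rightarrow> ennreal"
  assumes [measurable]: "f \<in> borel_measurable borel"
  shows "(\<integral>\<^sup>+x. f (- x) \<partial>lborel) = (\<integral>\<^sup>+x. f x \<partial>lborel)"
proof -
  have "(\<integral>\<^sup>+x. f x \<partial>lborel) = (\<integral>\<^sup>+x. f x \<partial>distr lborel borel (\<lambda>x. 0 + (-1) *\<^sub>R x))"
    by (subst lborel_affine[of "-1" 0]) (auto simp: density_1)
  also have "\<dots> = (\<integral>\<^sup>+x. f (- x) \<partial>lborel)"
    by (subst nn_integral_distr) auto
  finally show ?thesis by simp
qed

lemma nn_integral_exp_neg_square: "(\<integral>\<^sup>+x. ennreal (exp (- x\<^sup>2)) \<partial>lborel) = ennreal (sqrt pi)"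
proof -
  have "has_bochner_integral lborel (\<lambda>x::real. exp (- x\<^sup>2)) (2 *\<^sub>R (sqrt pi / 2))"
    using gaussian_moment_0 by (intro has_bochner_integral_even_function) auto
  then show ?thesis
    by (subst nn_integral_eq_integral) (auto simp: has_bochner_integral_iff)
qed

section \<open>Integrating out one coordinate, and comparison with the product measure on
  R^(N-1)\<close>

definition set_coord :: "'n \<Rightarrow> real \<Rightarrow> real^'n::finite \<Rightarrow> real^'n" where
  "set_coord j t v = v + (t - v $ j) *\<^sub>R axis j 1"

lemma set_coord_nth [simp]: "set_coord j t v $ k = (if k = j then t else v $ k)"
  by (auto simp: set_coord_def axis_def)

lemma borel_measurable_axis_nth [measurable]: "(\<lambda>v::real^'n::finite. v $ k) \<in> borel_measurable borel"
  by (intro borel_measurable_continuous_onI continuous_intros)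

lemma measurable_set_coord [measurable]:
  assumes [measurable]: "f \<in> borel_measurable N" "g \<in> borel_measurable N"
  shows "(\<lambda>x. set_coord j (f x) (g x)) \<in> borel_measurable N"
  unfolding set_coord_def by measurable

text \<open>Fubini in coordinate j without splitting the space: moving \<open>v\<close> by t along
  the axis is a translation, so the old coordinate becomes a free variable that only \<eta> sees.
  With a Gaussian \<eta> the extra factor is finite and nonzero and can be cancelled later.\<close>

lemma nn_integral_resample:
  fixes f :: "real^'n::finite \<Rightarrow> ennreal" and \<eta> :: "real \<Rightarrow> ennreal"
  assumes [measurable]: "f \<in> borel_measurable borel" "\<eta> \<in> borel_measurable borel"
  shows "(\<integral>\<^sup>+v. \<integral>\<^sup>+t. f (set_coord j t v) * \<eta> (v $ j) \<partial>lborel \<partial>lborel)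
     = (\<integral>\<^sup>+t. \<eta> t \<partial>lborel) * (\<integral>\<^sup>+v. f v \<partial>lborel)"
proof -
  let ?e = "axis j 1 :: real^'n"
  have "(\<integral>\<^sup>+v. \<integral>\<^sup>+t. f (set_coord j t v) * \<eta> (v $ j) \<partial>lborel \<partial>lborel)
      = (\<integral>\<^sup>+v. \<integral>\<^sup>+t. f (v + t *\<^sub>R ?e) * \<eta> (v $ j) \<partial>lborel \<partial>lborel)"
  proof (rule nn_integral_cong)
    fix v :: "real^'n"
    have "(\<integral>\<^sup>+t. f (v + t *\<^sub>R ?e) * \<eta> (v $ j) \<partial>lborel)
        = (\<integral>\<^sup>+t. f (v + (t + (- v $ j)) *\<^sub>R ?e) * \<eta> (v $ j) \<partial>lborel)"
      by (rule nn_integral_lborel_translate[symmetric]) measurable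
    then show "(\<integral>\<^sup>+t. f (set_coord j t v) * \<eta> (v $ j) \<partial>lborel)
        = (\<integral>\<^sup>+t. f (v + t *\<^sub>R ?e) * \<eta> (v $ j) \<partial>lborel)"
      by (simp add: set_coord_def)
  qed
  also have "\<dots> = (\<integral>\<^sup>+t. \<integral>\<^sup>+v. f (v + t *\<^sub>R ?e) * \<eta> (v $ j) \<partial>lborel \<partial>lborel)"
    by (rule lborel_pair.Fubini') measurable
  also have "\<dots> = (\<integral>\<^sup>+t. \<integral>\<^sup>+v. f v * \<eta> (v $ j - t) \<partial>lborel \<partial>lborel)"
  proof (rule nn_integral_cong)
    fix t :: real
    show "(\<integral>\<^sup>+v. f (v + t *\<^sub>R ?e) * \<eta> (v $ j) \<partial>lborel) = (\<integral>\<^sup>+v. f v * \<eta> (v $ j - t) \<partial>lborel)"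
      using nn_integral_lborel_translate[of "\<lambda>v. f v * \<eta> (v $ j - t)" "t *\<^sub>R ?e"] by (simp add: axis_def)
  qed
  also have "\<dots> = (\<integral>\<^sup>+v. \<integral>\<^sup>+t. f v * \<eta> (v $ j - t) \<partial>lborel \<partial>lborel)"
    by (rule lborel_pair.Fubini') measurable
  also have "\<dots> = (\<integral>\<^sup>+v. f v * (\<integral>\<^sup>+t. \<eta> t \<partial>lborel) \<partial>lborel)"
  proof (rule nn_integral_cong)
    fix v :: "real^'n"
    have "(\<integral>\<^sup>+t. \<eta> (v $ j - t) \<partial>lborel) = (\<integral>\<^sup>+t. \<eta> t \<partial>lborel)"
      using nn_integral_real_affine[of \<eta> "-1" "v $ j"] by simp
    then show "(\<integral>\<^sup>+t. f v * \<eta> (v $ j - t) \<partial>lborel) = f v * (\<integral>\<^sup>+t. \<eta> t \<partial>lborel)"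
      by (simp add: nn_integral_cmult)
  qed
  also have "\<dots> = (\<integral>\<^sup>+t. \<eta> t \<partial>lborel) * (\<integral>\<^sup>+v. f v \<partial>lborel)"
    by (simp add: nn_integral_multc mult.commute)
  finally show ?thesis .
qed

text \<open>The constants are integrals over functions on {..<N - 1}, whereas all substitutions take
  place in \<open>real^'n\<close>. Both measures agree on boxes, and these determine Lebesgue
  measure; \<sigma> renumbers the coordinates other than j.\<close>

lemma distr_insert_coord:
  fixes j :: "'n::finite"
  assumes \<sigma>: "bij_betw \<sigma> (UNIV - {j}) {..<CARD('n) - 1}"
  shows "distr (PiM {..<CARD('n) - 1} (\<lambda>_. lborel) \<Otimes>\<^sub>M lborel) borel
     (\<lambda>(V, t). (\<chi> k. if k = j then t else V (\<sigma> k)) :: real^'n) = lborel"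
proof -
  let ?I = "{..<CARD('n) - 1}"
  let ?P = "PiM ?I (\<lambda>_. lborel :: real measure)"
  let ?f = "\<lambda>(V, t). (\<chi> k. if k = j then t else V (\<sigma> k)) :: real^'n"
  interpret P: product_sigma_finite "\<lambda>_::nat. lborel :: real measure" ..
  interpret PS: sigma_finite_measure ?P by (rule P.sigma_finite) simp
  interpret PP: pair_sigma_finite ?P "lborel :: real measure" ..
  have \<sigma>I: "\<sigma> k \<in> ?I" if "k \<noteq> j" for k using \<sigma> that by (auto simp: bij_betw_def)
  have mf[measurable]: "?f \<in> ?P \<Otimes>\<^sub>M lborel \<rightarrow>\<^sub>M borel"
  proof (rule borel_measurable_euclidean_space[THEN iffD2], intro ballI)
    fix b :: "real^'n" assume "b \<in> Basis"
    then obtain k where b: "b = axis k 1" by (auto simp: Basis_vec_def)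
    have "(\<lambda>x. ?f x \<bullet> b) = (\<lambda>x. if k = j then snd x else fst x (\<sigma> k))"
      by (auto simp: b inner_axis case_prod_beta)
    then show "(\<lambda>x. ?f x \<bullet> b) \<in> borel_measurable (?P \<Otimes>\<^sub>M lborel)"
      using \<sigma>I[of k] by (cases "k = j") auto
  qed
  have "lborel = distr (?P \<Otimes>\<^sub>M lborel) borel ?f"
  proof (rule lborel_eqI)
    fix l u :: "real^'n" assume le: "\<And>b. b \<in> Basis \<Longrightarrow> l \<bullet> b \<le> u \<bullet> b"
    have le': "l $ k \<le> u $ k" for k using le[of "axis k 1"] by (simp add: inner_axis axis_in_Basis_iff)
    define \<tau> where "\<tau> = inv_into (UNIV - {j}) \<sigma>"
    have \<tau>: "\<tau> (\<sigma> k) = k" if "k \<noteq> j" for k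
      using \<sigma> that by (simp add: \<tau>_def bij_betw_def inv_into_f_f)
    have \<sigma>\<tau>: "\<sigma> (\<tau> i) = i" "\<tau> i \<noteq> j" if "i \<in> ?I" for i
      using \<sigma> that bij_betw_inv_into_right[OF \<sigma>] inv_into_into[of i \<sigma> "UNIV - {j}"]
      by (auto simp: \<tau>_def bij_betw_def)
    have vim: "?f -` box l u \<inter> space (?P \<Otimes>\<^sub>M lborel)
        = (\<Pi>\<^sub>E i\<in>?I. {l $ \<tau> i<..<u $ \<tau> i}) \<times> {l $ j<..<u $ j}" (is "?L = ?R")
    proof (rule set_eqI)
      fix x :: "(nat \<Rightarrow> real) \<times> real"
      obtain V t where x: "x = (V, t)" by (cases x)
      have "x \<in> ?L \<longleftrightarrow> V \<in> extensional ?I \<and> (\<forall>k. l $ k < (if k = j then t else V (\<sigma> k)) \<and> (if k = j then t else V (\<sigma> k)) < u $ k)"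
        by (auto simp: x mem_box_cart space_pair_measure space_PiM PiE_def)
      also have "\<dots> \<longleftrightarrow> V \<in> extensional ?I \<and> l $ j < t \<and> t < u $ j \<and> (\<forall>i\<in>?I. l $ \<tau> i < V i \<and> V i < u $ \<tau> i)"
        (is "_ \<and> ?A \<longleftrightarrow> _ \<and> ?B")
      proof -
        have ?B if ?A
          using that \<sigma>\<tau> by (metis (full_types))
        moreover have ?A if ?B
        proof
          fix k show "l $ k < (if k = j then t else V (\<sigma> k)) \<and> (if k = j then t else V (\<sigma> k)) < u $ k"
            using that \<tau>[of k] \<sigma>I[of k] by (cases "k = j") (auto dest: bspec[of _ _ "\<sigma> k"])
        qed
        ultimately show ?thesis by blast
      qed
      also have "\<dots> \<longleftrightarrow> x \<in> ?R" by (auto simp: x PiE_def Pi_def)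
      finally show "x \<in> ?L \<longleftrightarrow> x \<in> ?R" .
    qed
    have "emeasure (distr (?P \<Otimes>\<^sub>M lborel) borel ?f) (box l u) = emeasure (?P \<Otimes>\<^sub>M lborel) ?R"
      by (subst emeasure_distr) (use mf vim in auto)
    also have "\<dots> = emeasure ?P (\<Pi>\<^sub>E i\<in>?I. {l $ \<tau> i<..<u $ \<tau> i}) * emeasure lborel {l $ j<..<u $ j}"
      by (rule lborel.emeasure_pair_measure_Times) (auto intro!: sets_PiM_I_finite)
    also have "\<dots> = (\<Prod>i\<in>?I. ennreal (u $ \<tau> i - l $ \<tau> i)) * ennreal (u $ j - l $ j)"
      by (subst P.emeasure_PiM) (auto simp: le')
    also have "(\<Prod>i\<in>?I. ennreal (u $ \<tau> i - l $ \<tau> i)) = (\<Prod>k\<in>UNIV - {j}. ennreal (u $ k - l $ k))"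
      by (rule prod.reindex_bij_betw[OF \<sigma>, symmetric, THEN trans]) (auto intro!: prod.cong simp: \<tau>)
    also have "\<dots> * ennreal (u $ j - l $ j) = (\<Prod>k\<in>UNIV. ennreal (u $ k - l $ k))"
      by (subst (2) prod.remove[of _ j]) (auto simp: mult.commute)
    also have "\<dots> = ennreal (\<Prod>k\<in>UNIV. u $ k - l $ k)"
      by (rule prod_ennreal) (simp add: le')
    also have "(\<Prod>k\<in>UNIV. u $ k - l $ k) = (\<Prod>b\<in>Basis. (u - l) \<bullet> b)"
    proof -
      have "(\<Prod>b\<in>Basis. (u - l) \<bullet> b) = (\<Prod>b\<in>range (\<lambda>k. axis k (1::real)). (u - l) \<bullet> b)"
        by (rule prod.cong) (auto simp: Basis_vec_def)
      also have "\<dots> = (\<Prod>k\<in>UNIV. (u - l) \<bullet> axis k 1)"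
        by (subst prod.reindex) (auto simp: inj_on_def axis_eq_axis)
      finally show ?thesis by (simp add: inner_axis)
    qed
    finally show "emeasure (distr (?P \<Otimes>\<^sub>M lborel) borel ?f) (box l u) = (\<Prod>b\<in>Basis. (u - l) \<bullet> b)" .
  qed simp
  then show ?thesis by simp
qed

lemma nn_integral_PiM_insert_coord:
  fixes j :: "'n::finite" and F :: "real \<Rightarrow> ennreal" and G :: "real \<Rightarrow> ennreal"
  assumes [measurable]: "F \<in> borel_measurable borel" "G \<in> borel_measurable borel"
  shows "(\<integral>\<^sup>+V. F (\<Sum>i<CARD('n) - 1. (V i)\<^sup>2) \<partial>PiM {..<CARD('n) - 1} (\<lambda>_. lborel)) * (\<integral>\<^sup>+t. G t \<partial>lborel)
     = (\<integral>\<^sup>+v. F (\<Sum>k\<in>UNIV - {j}. (v $ k)\<^sup>2) * G (v $ j) \<partial>(lborel :: (real^'n) measure))"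
proof -
  let ?I = "{..<CARD('n) - 1}"
  let ?P = "PiM ?I (\<lambda>_. lborel :: real measure)"
  obtain \<sigma> where \<sigma>: "bij_betw \<sigma> (UNIV - {j}) ?I"
    using finite_same_card_bij[of "UNIV - {j}" ?I] by (auto simp: card_Diff_singleton)
  let ?f = "\<lambda>(V, t). (\<chi> k. if k = j then t else V (\<sigma> k)) :: real^'n"
  interpret P: product_sigma_finite "\<lambda>_::nat. lborel :: real measure" ..
  interpret PS: sigma_finite_measure ?P by (rule P.sigma_finite) simp
  interpret PP: pair_sigma_finite ?P "lborel :: real measure" ..
  have mf[measurable]: "?f \<in> ?P \<Otimes>\<^sub>M lborel \<rightarrow>\<^sub>M borel"
  proof (rule borel_measurable_euclidean_space[THEN iffD2], intro ballI)
    fix b :: "real^'n" assume "b \<in> Basis"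
    then obtain k where b: "b = axis k 1" by (auto simp: Basis_vec_def)
    have "(\<lambda>x. ?f x \<bullet> b) = (\<lambda>x. if k = j then snd x else fst x (\<sigma> k))"
      by (auto simp: b inner_axis case_prod_beta)
    moreover have "\<sigma> k \<in> ?I" if "k \<noteq> j" using \<sigma> that by (auto simp: bij_betw_def)
    ultimately show "(\<lambda>x. ?f x \<bullet> b) \<in> borel_measurable (?P \<Otimes>\<^sub>M lborel)"
      by (cases "k = j") auto
  qed
  have [measurable]: "(\<lambda>v::real^'n. \<Sum>k\<in>UNIV - {j}. (v $ k)\<^sup>2) \<in> borel_measurable borel"
    by measurable
  have "(\<integral>\<^sup>+v. F (\<Sum>k\<in>UNIV - {j}. (v $ k)\<^sup>2) * G (v $ j) \<partial>(lborel :: (real^'n) measure))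
    = (\<integral>\<^sup>+v. F (\<Sum>k\<in>UNIV - {j}. (v $ k)\<^sup>2) * G (v $ j) \<partial>distr (?P \<Otimes>\<^sub>M lborel) borel ?f)"
    unfolding distr_insert_coord[OF \<sigma>] ..
  also have "\<dots> = (\<integral>\<^sup>+x. F (\<Sum>k\<in>UNIV - {j}. (?f x $ k)\<^sup>2) * G (?f x $ j) \<partial>(?P \<Otimes>\<^sub>M lborel))"
    by (rule nn_integral_distr) measurable
  also have "\<dots> = (\<integral>\<^sup>+x. F (\<Sum>i\<in>?I. (fst x i)\<^sup>2) * G (snd x) \<partial>(?P \<Otimes>\<^sub>M lborel))"
  proof (rule nn_integral_cong)
    fix x :: "(nat \<Rightarrow> real) \<times> real"
    have "(\<Sum>k\<in>UNIV - {j}. (?f x $ k)\<^sup>2) = (\<Sum>k\<in>UNIV - {j}. (fst x (\<sigma> k))\<^sup>2)"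
      by (rule sum.cong) (auto simp: case_prod_beta)
    also have "\<dots> = (\<Sum>i\<in>?I. (fst x i)\<^sup>2)"
      by (rule sum.reindex_bij_betw[OF \<sigma>])
    finally show "F (\<Sum>k\<in>UNIV - {j}. (?f x $ k)\<^sup>2) * G (?f x $ j) = F (\<Sum>i\<in>?I. (fst x i)\<^sup>2) * G (snd x)"
      by (simp add: case_prod_beta)
  qed
  also have "\<dots> = (\<integral>\<^sup>+V. \<integral>\<^sup>+t. F (\<Sum>i\<in>?I. (V i)\<^sup>2) * G t \<partial>lborel \<partial>?P)"
    by (subst lborel.nn_integral_fst[symmetric]) auto
  also have "\<dots> = (\<integral>\<^sup>+V. F (\<Sum>i\<in>?I. (V i)\<^sup>2) \<partial>?P) * (\<integral>\<^sup>+t. G t \<partial>lborel)"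
    by (simp add: nn_integral_cmult nn_integral_multc)
  finally show ?thesis by simp
qed

lemma norm_vec_square_sum: "(norm (v :: real^'n::finite))\<^sup>2 = (\<Sum>k\<in>UNIV. (v $ k)\<^sup>2)"
  by (simp add: norm_vec_def L2_set_def sum_nonneg)

lemma maxw_pos [simp]: "maxw v > 0" and maxw_nonneg [simp]: "maxw v \<ge> 0" and maxw_nonzero [simp]: "maxw v \<noteq> 0"
  by (auto simp: maxw_def)

lemma borel_measurable_maxw [measurable]: "maxw \<in> borel_measurable borel"
  unfolding maxw_def by measurable

lemma nn_integral_exp_PiM:
  "(\<integral>\<^sup>+V. ennreal (exp (- (\<Sum>i<n. (V i)\<^sup>2))) \<partial>PiM {..<n} (\<lambda>_. lborel)) = ennreal (sqrt pi ^ n)"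
proof -
  interpret P: product_sigma_finite "\<lambda>_::nat. lborel :: real measure" ..
  have "(\<integral>\<^sup>+V. ennreal (exp (- (\<Sum>i<n. (V i)\<^sup>2))) \<partial>PiM {..<n} (\<lambda>_. lborel))
      = (\<integral>\<^sup>+V. (\<Prod>i\<in>{..<n}. ennreal (exp (- (V i)\<^sup>2))) \<partial>PiM {..<n} (\<lambda>_. lborel))"
    by (intro nn_integral_cong) (simp add: sum_negf[symmetric] exp_sum prod_ennreal)
  also have "\<dots> = (\<Prod>i\<in>{..<n}. \<integral>\<^sup>+x. ennreal (exp (- x\<^sup>2)) \<partial>lborel)"
    by (rule P.product_nn_integral_prod) auto
  also have "\<dots> = ennreal (sqrt pi ^ n)"
    by (simp add: nn_integral_exp_neg_square ennreal_power)
  finally show ?thesis .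
qed

lemma alpha_const_eq: "alpha_const N = sqrt pi ^ (N - 1)"
  unfolding alpha_const_def by (subst integral_eq_nn_integral) (auto simp: nn_integral_exp_PiM)

lemma nn_integral_maxw: "(\<integral>\<^sup>+v. ennreal (maxw v) \<partial>(lborel :: (real^'n::finite) measure)) = ennreal (sqrt pi ^ CARD('n))"
proof -
  fix j :: 'n
  have C: "CARD('n) = Suc (CARD('n) - 1)" by simp
  have "(\<integral>\<^sup>+v. ennreal (maxw v) \<partial>(lborel :: (real^'n::finite) measure))
     = (\<integral>\<^sup>+v. ennreal (exp (- (\<Sum>k\<in>UNIV - {j}. (v $ k)\<^sup>2))) * ennreal (exp (- (v $ j)\<^sup>2)) \<partial>(lborel :: (real^'n) measure))"
    by (intro nn_integral_cong)
       (simp add: maxw_def norm_vec_square_sum ennreal_mult[symmetric] exp_add[symmetric] sum.remove[of UNIV j])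
  also have "\<dots> = ennreal (sqrt pi ^ (CARD('n) - 1)) * ennreal (sqrt pi)"
    by (subst nn_integral_PiM_insert_coord[symmetric]) (auto simp: nn_integral_exp_PiM nn_integral_exp_neg_square)
  also have "\<dots> = ennreal (sqrt pi ^ CARD('n))"
    by (simp add: ennreal_mult[symmetric] power_minus_mult[of "CARD('n)", simplified])
  finally show ?thesis .
qed

lemma nn_integral_lborel_orthogonal:
  fixes Q :: "real^'n::finite \<Rightarrow> real^'n"
  assumes Q: "orthogonal_transformation Q" and [measurable]: "f \<in> borel_measurable borel"
  shows "(\<integral>\<^sup>+x. f (Q x) \<partial>lborel) = (\<integral>\<^sup>+x. f x \<partial>lborel)"
proof -
  \<comment> \<open>The image measure is translation invariant, hence proportional to Lebesgue measure;
    the radial function \<open>maxw\<close> fixes the factor.\<close>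
  let ?m = "\<lambda>x::real^'n. ennreal (maxw x)" and ?c = "ennreal (sqrt pi ^ CARD('n))"
  have lin: "linear Q" using Q by (rule orthogonal_transformation_linear)
  have [measurable]: "Q \<in> borel_measurable borel"
    by (intro borel_measurable_continuous_onI linear_continuous_on linear_conv_bounded_linear[THEN iffD1] lin)
  have surj: "Q (inv Q y) = y" for y
    using orthogonal_transformation_surj[OF Q] by (simp add: surj_f_inv_f)
  have Qm: "maxw (Q x) = maxw x" for x
    by (simp add: maxw_def orthogonal_transformation_norm[OF Q])
  have "(\<integral>\<^sup>+x. f (Q x) \<partial>lborel) * ?c = (\<integral>\<^sup>+y. \<integral>\<^sup>+x. f (Q x) * ?m y \<partial>lborel \<partial>lborel)"
    by (simp add: nn_integral_multc nn_integral_cmult nn_integral_maxw)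
  also have "\<dots> = (\<integral>\<^sup>+y. \<integral>\<^sup>+x. f (Q x + y) * ?m y \<partial>lborel \<partial>lborel)"
  proof (rule nn_integral_cong)
    fix y
    show "(\<integral>\<^sup>+x. f (Q x) * ?m y \<partial>lborel) = (\<integral>\<^sup>+x. f (Q x + y) * ?m y \<partial>lborel)"
      using nn_integral_lborel_translate[of "\<lambda>x. f (Q x) * ?m y" "inv Q y"]
      by (simp add: linear_add[OF lin] surj)
  qed
  also have "\<dots> = (\<integral>\<^sup>+x. \<integral>\<^sup>+y. f (Q x + y) * ?m y \<partial>lborel \<partial>lborel)"
    by (rule lborel_pair.Fubini') measurable
  also have "\<dots> = (\<integral>\<^sup>+x. \<integral>\<^sup>+y. f y * ?m (y - Q x) \<partial>lborel \<partial>lborel)"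
  proof (rule nn_integral_cong)
    fix x
    show "(\<integral>\<^sup>+y. f (Q x + y) * ?m y \<partial>lborel) = (\<integral>\<^sup>+y. f y * ?m (y - Q x) \<partial>lborel)"
      using nn_integral_lborel_translate[of "\<lambda>y. f y * ?m (y - Q x)" "Q x"] by (simp add: add.commute)
  qed
  also have "\<dots> = (\<integral>\<^sup>+y. \<integral>\<^sup>+x. f y * ?m (y - Q x) \<partial>lborel \<partial>lborel)"
    by (rule lborel_pair.Fubini') measurable
  also have "\<dots> = (\<integral>\<^sup>+y. f y * ?c \<partial>lborel)"
  proof (rule nn_integral_cong)
    fix y
    have "maxw (y - Q x) = maxw (x + (- inv Q y))" for x
      using Qm[of "x - inv Q y"] by (simp add: linear_diff[OF lin] surj maxw_def norm_minus_commute)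
    then have "(\<integral>\<^sup>+x. ?m (y - Q x) \<partial>lborel) = ?c"
      by (simp only: nn_integral_lborel_translate[of ?m] measurable_ennreal borel_measurable_maxw nn_integral_maxw
          measurable_compose[OF borel_measurable_maxw measurable_ennreal])
    then show "(\<integral>\<^sup>+x. f y * ?m (y - Q x) \<partial>lborel) = f y * ?c"
      by (simp add: nn_integral_cmult)
  qed
  also have "\<dots> = (\<integral>\<^sup>+y. f y \<partial>lborel) * ?c"
    by (simp add: nn_integral_multc)
  finally have e: "(\<integral>\<^sup>+x. f (Q x) \<partial>lborel) * ?c = (\<integral>\<^sup>+y. f y \<partial>lborel) * ?c" .
  have cc: "?c * ennreal (1 / sqrt pi ^ CARD('n)) = 1"
    by (simp add: ennreal_mult[symmetric])
  from e have "(\<integral>\<^sup>+x. f (Q x) \<partial>lborel) * ?c * ennreal (1 / sqrt pi ^ CARD('n))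
     = (\<integral>\<^sup>+y. f y \<partial>lborel) * ?c * ennreal (1 / sqrt pi ^ CARD('n))" by simp
  then show ?thesis by (simp only: mult.assoc cc mult_1_right)
qed

lemma beta_const_nonneg: "beta_const N R \<ge> 0"
  unfolding beta_const_def set_lebesgue_integral_def by (rule integral_nonneg_AE) auto

text \<open>In the full space the far region is a cylinder: coordinate j is unconstrained and
  contributes the factor sqrt pi.\<close>

lemma nn_integral_beta_const:
  fixes j :: "'n::finite"
  assumes "R \<ge> 0"
  shows "(\<integral>\<^sup>+v. indicator {v. (\<Sum>k\<in>UNIV - {j}. (v $ k)\<^sup>2) \<ge> (2 * R)\<^sup>2} v * ennreal (maxw v) \<partial>(lborel :: (real^'n) measure))
     = ennreal (beta_const CARD('n) R * sqrt pi)"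
proof -
  let ?I = "{..<CARD('n) - 1}"
  let ?P = "PiM ?I (\<lambda>_. lborel :: real measure)"
  let ?F = "\<lambda>s. indicator {(2 * R)\<^sup>2..} s * ennreal (exp (- s))"
  have "(\<integral>\<^sup>+v. indicator {v. (\<Sum>k\<in>UNIV - {j}. (v $ k)\<^sup>2) \<ge> (2 * R)\<^sup>2} v * ennreal (maxw v) \<partial>(lborel :: (real^'n) measure))
    = (\<integral>\<^sup>+v. ?F (\<Sum>k\<in>UNIV - {j}. (v $ k)\<^sup>2) * ennreal (exp (- (v $ j)\<^sup>2)) \<partial>(lborel :: (real^'n) measure))"
    by (intro nn_integral_cong)
       (auto simp: maxw_def norm_vec_square_sum ennreal_mult[symmetric] exp_add[symmetric] sum.remove[of UNIV j] split: split_indicator)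
  also have "\<dots> = (\<integral>\<^sup>+V. ?F (\<Sum>i\<in>?I. (V i)\<^sup>2) \<partial>?P) * ennreal (sqrt pi)"
    by (subst nn_integral_PiM_insert_coord[symmetric]) (auto simp: nn_integral_exp_neg_square)
  also have "(\<integral>\<^sup>+V. ?F (\<Sum>i\<in>?I. (V i)\<^sup>2) \<partial>?P) = ennreal (beta_const CARD('n) R)"
  proof -
    let ?g = "\<lambda>V::nat\<Rightarrow>real. indicator {V \<in> space ?P. sqrt (\<Sum>i\<in>?I. (V i)\<^sup>2) \<ge> 2 * R} V *\<^sub>R exp (- (\<Sum>i\<in>?I. (V i)\<^sup>2))"
    have eq: "2 * R \<le> sqrt s \<longleftrightarrow> (2 * R)\<^sup>2 \<le> s" if "s \<ge> 0" for s
      using assms that by (metis mult_nonneg_nonneg real_le_rsqrt real_sqrt_ge_0_iff real_sqrt_le_iff real_sqrt_unique zero_le_numeral)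
    have e: "?F (\<Sum>i\<in>?I. (V i)\<^sup>2) = ennreal (?g V)" if "V \<in> space ?P" for V
      using that by (auto simp: eq sum_nonneg split: split_indicator)
    have "(\<integral>\<^sup>+V. ?F (\<Sum>i\<in>?I. (V i)\<^sup>2) \<partial>?P) = (\<integral>\<^sup>+V. ennreal (?g V) \<partial>?P)"
      using e by (rule nn_integral_cong)
    also have "\<dots> = ennreal (LINT V|?P. ?g V)"
    proof (rule nn_integral_eq_integral)
      show "integrable ?P ?g"
      proof (rule integrableI_bounded)
        have "(\<integral>\<^sup>+V. ennreal (norm (?g V)) \<partial>?P) \<le> (\<integral>\<^sup>+V. ennreal (exp (- (\<Sum>i\<in>?I. (V i)\<^sup>2))) \<partial>?P)"
          by (intro nn_integral_mono) (auto split: split_indicator)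
        also have "\<dots> < \<infinity>" by (simp add: nn_integral_exp_PiM)
        finally show "(\<integral>\<^sup>+V. ennreal (norm (?g V)) \<partial>?P) < \<infinity>" .
      qed measurable
    qed auto
    finally show ?thesis by (simp add: beta_const_def set_lebesgue_integral_def)
  qed
  finally show ?thesis by (simp add: ennreal_mult'' beta_const_nonneg ennreal_mult)
qed

section \<open>Dissipation at large relative velocities\<close>

text \<open>For a pair at distance less than \<open>R\<close>, pass through a third point at distance at least \<open>2 * R\<close> from
  one of the two: it is at distance at least \<open>R\<close> from both.
  The weight \<open>norm ^ 3\<close> contains the Jacobian of the passage from pairs of points to lines.\<close>

lemma three_point_inequality:
  fixes T :: "'a::euclidean_space \<Rightarrow> 'b::euclidean_space" and g :: "'a \<Rightarrow> real"
    and A b :: ennreal and R :: real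
  assumes fin: "finite_measure \<mu>" and [measurable_cong]: "sets \<mu> = sets borel"
    and [measurable]: "T \<in> borel_measurable borel" "g \<in> borel_measurable borel"
    and "R \<ge> 0"
    and b: "\<And>x. b \<le> (\<integral>\<^sup>+z. indicator {z. norm (T x - T z) \<ge> 2 * R} z \<partial>\<mu>)"
    and A: "A = emeasure \<mu> (space \<mu>)"
  shows "b * (\<integral>\<^sup>+x. \<integral>\<^sup>+y. ennreal (norm (T x - T y) ^ 3 * (g x - g y)\<^sup>2) \<partial>\<mu> \<partial>\<mu>)
    \<le> 4 * A * (\<integral>\<^sup>+x. \<integral>\<^sup>+y. indicator {R..} (norm (T x - T y)) * ennreal (norm (T x - T y) ^ 3 * (g x - g y)\<^sup>2) \<partial>\<mu> \<partial>\<mu>)"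
proof -
  interpret finite_measure \<mu> by fact
  interpret P: pair_sigma_finite \<mu> \<mu> ..
  let ?d = "\<lambda>x y. norm (T x - T y)"
  let ?K = "\<lambda>x y. ennreal (?d x y ^ 3 * (g x - g y)\<^sup>2)"
  let ?F = "\<lambda>x y. indicator {R..} (?d x y) :: ennreal"
  let ?N = "\<lambda>x y. indicator {..<R} (?d x y) :: ennreal"
  define E where "E = (\<integral>\<^sup>+x. \<integral>\<^sup>+y. ?F x y * ?K x y \<partial>\<mu> \<partial>\<mu>)"
  have split: "?K x y = ?N x y * ?K x y + ?F x y * ?K x y" for x y
    by (auto split: split_indicator)
  have step: "b * (?N x y * ?K x y) \<le> (\<integral>\<^sup>+z. 2 * (?N x y * (?F x z * ?K x z)) + 2 * (?N x y * (?F y z * ?K y z)) \<partial>\<mu>)" for x y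
  proof -
    have "b * (?N x y * ?K x y) \<le> (\<integral>\<^sup>+z. indicator {z. ?d x z \<ge> 2 * R} z \<partial>\<mu>) * (?N x y * ?K x y)"
      by (intro mult_right_mono b) auto
    also have "\<dots> = (\<integral>\<^sup>+z. indicator {z. ?d x z \<ge> 2 * R} z * (?N x y * ?K x y) \<partial>\<mu>)"
      by (rule nn_integral_multc[symmetric]) measurable
    also have "\<dots> \<le> (\<integral>\<^sup>+z. 2 * (?N x y * (?F x z * ?K x z)) + 2 * (?N x y * (?F y z * ?K y z)) \<partial>\<mu>)"
    proof (rule nn_integral_mono)
      fix z
      show "indicator {z. ?d x z \<ge> 2 * R} z * (?N x y * ?K x y) \<le> 2 * (?N x y * (?F x z * ?K x z)) + 2 * (?N x y * (?F y z * ?K y z))"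
      proof (cases "?d x z \<ge> 2 * R \<and> ?d x y < R")
        case True
        have tri: "?d x z \<le> ?d x y + ?d y z"
          using norm_triangle_ineq[of "T x - T y" "T y - T z"] by simp
        from True tri have far: "?d y z \<ge> R" "?d x z \<ge> R" using \<open>R \<ge> 0\<close> by auto
        \<comment> \<open>Both detours are at least as long as the near distance, which is below R;
          of the weight only the monotonicity of the cube matters.\<close>
        have c1: "?d x y ^ 3 \<le> ?d x z ^ 3" and c2: "?d x y ^ 3 \<le> ?d y z ^ 3"
          using True far by (auto intro!: power_mono)
        have "(g x - g y)\<^sup>2 \<le> 2 * (g x - g z)\<^sup>2 + 2 * (g y - g z)\<^sup>2"
          using zero_le_power2[of "(g x - g z) + (g y - g z)"] by (simp add: power2_eq_square algebra_simps)
        then have "?d x y ^ 3 * (g x - g y)\<^sup>2 \<le> ?d x y ^ 3 * (2 * (g x - g z)\<^sup>2 + 2 * (g y - g z)\<^sup>2)"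
          by (intro mult_left_mono) auto
        also have "\<dots> \<le> 2 * (?d x z ^ 3 * (g x - g z)\<^sup>2) + 2 * (?d y z ^ 3 * (g y - g z)\<^sup>2)"
          using mult_right_mono[OF c1, of "(g x - g z)\<^sup>2"] mult_right_mono[OF c2, of "(g y - g z)\<^sup>2"]
          by (simp add: algebra_simps)
        finally have "?K x y \<le> ennreal (2 * (?d x z ^ 3 * (g x - g z)\<^sup>2) + 2 * (?d y z ^ 3 * (g y - g z)\<^sup>2))"
          by (rule ennreal_leI)
        also have "\<dots> = 2 * ?K x z + 2 * ?K y z"
          by (simp add: ennreal_plus ennreal_mult)
        finally show ?thesis using True far by simp
      qed (auto split: split_indicator)
    qed
    finally show ?thesis .
  qed
  define B where "B x = (\<integral>\<^sup>+y. ?N x y \<partial>\<mu>)" for x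
  have [measurable]: "B \<in> borel_measurable borel"
    unfolding B_def by measurable
  \<comment> \<open>The near ball and the far region are disjoint. Estimating the sum B + b, and not
    \<open>B\<close> alone, later absorbs the far pairs, so that the constant stays 4 * A.\<close>
  have Bb: "B x + b \<le> A" for x
  proof -
    have "B x + b \<le> B x + (\<integral>\<^sup>+z. indicator {z. ?d x z \<ge> 2 * R} z \<partial>\<mu>)"
      by (intro add_left_mono b)
    also have "\<dots> = (\<integral>\<^sup>+z. ?N x z + indicator {z. ?d x z \<ge> 2 * R} z \<partial>\<mu>)"
      unfolding B_def by (rule nn_integral_add[symmetric]) measurable
    also have "\<dots> \<le> (\<integral>\<^sup>+z. 1 \<partial>\<mu>)"
      using \<open>R \<ge> 0\<close> by (intro nn_integral_mono) (auto split: split_indicator)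
    also have "\<dots> = A" by (simp add: A)
    finally show ?thesis .
  qed
  have t1: "(\<integral>\<^sup>+x. \<integral>\<^sup>+y. \<integral>\<^sup>+z. ?N x y * (?F x z * ?K x z) \<partial>\<mu> \<partial>\<mu> \<partial>\<mu>) = (\<integral>\<^sup>+x. B x * (\<integral>\<^sup>+z. ?F x z * ?K x z \<partial>\<mu>) \<partial>\<mu>)"
    unfolding B_def by (simp add: nn_integral_cmult nn_integral_multc)
  have sym: "?N x y = ?N y x" for x y by (simp add: norm_minus_commute)
  have t2: "(\<integral>\<^sup>+x. \<integral>\<^sup>+y. \<integral>\<^sup>+z. ?N x y * (?F y z * ?K y z) \<partial>\<mu> \<partial>\<mu> \<partial>\<mu>) = (\<integral>\<^sup>+x. B x * (\<integral>\<^sup>+z. ?F x z * ?K x z \<partial>\<mu>) \<partial>\<mu>)"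
  proof -
    have "(\<integral>\<^sup>+x. \<integral>\<^sup>+y. \<integral>\<^sup>+z. ?N x y * (?F y z * ?K y z) \<partial>\<mu> \<partial>\<mu> \<partial>\<mu>) = (\<integral>\<^sup>+y. \<integral>\<^sup>+x. \<integral>\<^sup>+z. ?N x y * (?F y z * ?K y z) \<partial>\<mu> \<partial>\<mu> \<partial>\<mu>)"
      by (rule P.Fubini') measurable
    also have "\<dots> = (\<integral>\<^sup>+y. \<integral>\<^sup>+x. \<integral>\<^sup>+z. ?N y x * (?F y z * ?K y z) \<partial>\<mu> \<partial>\<mu> \<partial>\<mu>)"
      by (subst sym) simp
    finally show ?thesis by (simp only: t1)
  qed
  have "b * (\<integral>\<^sup>+x. \<integral>\<^sup>+y. ?N x y * ?K x y \<partial>\<mu> \<partial>\<mu>) = (\<integral>\<^sup>+x. \<integral>\<^sup>+y. b * (?N x y * ?K x y) \<partial>\<mu> \<partial>\<mu>)"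
    by (simp add: nn_integral_cmult)
  also have "\<dots> \<le> (\<integral>\<^sup>+x. \<integral>\<^sup>+y. \<integral>\<^sup>+z. 2 * (?N x y * (?F x z * ?K x z)) + 2 * (?N x y * (?F y z * ?K y z)) \<partial>\<mu> \<partial>\<mu> \<partial>\<mu>)"
    by (intro nn_integral_mono step)
  also have "\<dots> = 2 * (\<integral>\<^sup>+x. \<integral>\<^sup>+y. \<integral>\<^sup>+z. ?N x y * (?F x z * ?K x z) \<partial>\<mu> \<partial>\<mu> \<partial>\<mu>)
      + 2 * (\<integral>\<^sup>+x. \<integral>\<^sup>+y. \<integral>\<^sup>+z. ?N x y * (?F y z * ?K y z) \<partial>\<mu> \<partial>\<mu> \<partial>\<mu>)"
    by (simp add: nn_integral_add nn_integral_cmult)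
  also have "\<dots> = 4 * (\<integral>\<^sup>+x. B x * (\<integral>\<^sup>+z. ?F x z * ?K x z \<partial>\<mu>) \<partial>\<mu>)"
    unfolding t1 t2 by (simp add: distrib_right[symmetric])
  finally have near: "b * (\<integral>\<^sup>+x. \<integral>\<^sup>+y. ?N x y * ?K x y \<partial>\<mu> \<partial>\<mu>) \<le> 4 * (\<integral>\<^sup>+x. B x * (\<integral>\<^sup>+z. ?F x z * ?K x z \<partial>\<mu>) \<partial>\<mu>)" .
  have "(\<integral>\<^sup>+x. \<integral>\<^sup>+y. ?K x y \<partial>\<mu> \<partial>\<mu>) = (\<integral>\<^sup>+x. \<integral>\<^sup>+y. ?N x y * ?K x y + ?F x y * ?K x y \<partial>\<mu> \<partial>\<mu>)"
    by (subst split) simp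
  also have "\<dots> = (\<integral>\<^sup>+x. \<integral>\<^sup>+y. ?N x y * ?K x y \<partial>\<mu> \<partial>\<mu>) + E"
    unfolding E_def by (simp add: nn_integral_add)
  finally have tot: "(\<integral>\<^sup>+x. \<integral>\<^sup>+y. ?K x y \<partial>\<mu> \<partial>\<mu>) = (\<integral>\<^sup>+x. \<integral>\<^sup>+y. ?N x y * ?K x y \<partial>\<mu> \<partial>\<mu>) + E" .
  \<comment> \<open>Far pairs need no detour; they are inflated by 4 so as to join the near ones
    under the factor B + b.\<close>
  have "b * E \<le> 4 * (b * E)"
    using mult_right_mono[of 1 4 "b * E"] by simp
  with near have "b * (\<integral>\<^sup>+x. \<integral>\<^sup>+y. ?K x y \<partial>\<mu> \<partial>\<mu>) \<le> 4 * (\<integral>\<^sup>+x. B x * (\<integral>\<^sup>+z. ?F x z * ?K x z \<partial>\<mu>) \<partial>\<mu>) + 4 * (b * E)"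
    unfolding tot distrib_left by (rule add_mono)
  also have "\<dots> = 4 * (\<integral>\<^sup>+x. (B x + b) * (\<integral>\<^sup>+z. ?F x z * ?K x z \<partial>\<mu>) \<partial>\<mu>)"
    unfolding E_def by (simp add: nn_integral_add nn_integral_cmult distrib_left distrib_right)
  also have "\<dots> \<le> 4 * (\<integral>\<^sup>+x. A * (\<integral>\<^sup>+z. ?F x z * ?K x z \<partial>\<mu>) \<partial>\<mu>)"
    by (intro mult_left_mono nn_integral_mono mult_right_mono Bb) auto
  also have "\<dots> = 4 * A * E"
    unfolding E_def by (simp add: nn_integral_cmult mult.assoc)
  finally show ?thesis unfolding E_def .
qed

section \<open>Slicing pairs of points by hyperplanes\<close>

lemma nn_integral_scale_coord:
  fixes f :: "real^'n::finite \<Rightarrow> ennreal"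
  assumes [measurable]: "f \<in> borel_measurable borel" and "c \<noteq> 0"
  shows "(\<integral>\<^sup>+v. f v \<partial>lborel) = ennreal \<bar>c\<bar> * (\<integral>\<^sup>+v. f (set_coord i (a + c * v $ i) v) \<partial>lborel)"
proof -
  let ?\<eta> = "\<lambda>t. ennreal (exp (- t\<^sup>2))"
  let ?f = "\<lambda>v. f (set_coord i (a + c * v $ i) v)"
  have twice: "set_coord i s (set_coord i t v) = set_coord i s v" for s t and v :: "real^'n"
    by (simp add: vec_eq_iff)
  have \<eta>: "(\<integral>\<^sup>+t. ?\<eta> t \<partial>lborel) = ennreal (sqrt pi)" by (rule nn_integral_exp_neg_square)
  have "ennreal (sqrt pi) * (\<integral>\<^sup>+v. f v \<partial>lborel) = (\<integral>\<^sup>+v. \<integral>\<^sup>+t. f (set_coord i t v) * ?\<eta> (v $ i) \<partial>lborel \<partial>lborel)"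
    by (subst nn_integral_resample) (simp_all add: \<eta>)
  also have "\<dots> = (\<integral>\<^sup>+v. ennreal \<bar>c\<bar> * (\<integral>\<^sup>+t. ?f (set_coord i t v) * ?\<eta> (v $ i) \<partial>lborel) \<partial>lborel)"
  proof (rule nn_integral_cong)
    fix v :: "real^'n"
    show "(\<integral>\<^sup>+t. f (set_coord i t v) * ?\<eta> (v $ i) \<partial>lborel) = ennreal \<bar>c\<bar> * (\<integral>\<^sup>+t. ?f (set_coord i t v) * ?\<eta> (v $ i) \<partial>lborel)"
      by (subst nn_integral_real_affine[of _ c a]) (use \<open>c \<noteq> 0\<close> in \<open>auto simp: twice\<close>)
  qed
  also have "\<dots> = ennreal \<bar>c\<bar> * (\<integral>\<^sup>+v. \<integral>\<^sup>+t. ?f (set_coord i t v) * ?\<eta> (v $ i) \<partial>lborel \<partial>lborel)"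
    by (rule nn_integral_cmult) measurable
  also have "\<dots> = ennreal \<bar>c\<bar> * (ennreal (sqrt pi) * (\<integral>\<^sup>+v. ?f v \<partial>lborel))"
    by (subst nn_integral_resample) (simp_all add: \<eta>)
  finally have e: "ennreal (sqrt pi) * (\<integral>\<^sup>+v. f v \<partial>lborel) = ennreal (sqrt pi) * (ennreal \<bar>c\<bar> * (\<integral>\<^sup>+v. ?f v \<partial>lborel))"
    by (simp add: ac_simps)
  show ?thesis
    using e by (subst (asm) ennreal_mult_cancel_left) auto
qed

lemma AE_coord_neq: "AE w in (lborel :: (real^'n::finite) measure). w $ i \<noteq> c"
proof -
  have [measurable]: "{w::real^'n. w $ i = c} \<in> sets borel" by measurable
  let ?\<eta> = "\<lambda>t. ennreal (exp (- t\<^sup>2))"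
  have "(\<integral>\<^sup>+t. indicator {w::real^'n. w $ i = c} (set_coord i t v) * ?\<eta> (v $ i) \<partial>lborel) = 0" for v
  proof -
    have "(\<integral>\<^sup>+t. indicator {w::real^'n. w $ i = c} (set_coord i t v) * ?\<eta> (v $ i) \<partial>lborel) = (\<integral>\<^sup>+t. ?\<eta> (v $ i) * indicator {c} t \<partial>lborel)"
      by (intro nn_integral_cong) (auto split: split_indicator)
    then show ?thesis by (simp add: nn_integral_cmult)
  qed
  then have "ennreal (sqrt pi) * (\<integral>\<^sup>+v. indicator {w::real^'n. w $ i = c} v \<partial>lborel) = 0"
    by (subst nn_integral_exp_neg_square[symmetric], subst nn_integral_resample[symmetric, where j = i]) auto
  then have "emeasure lborel {w::real^'n. w $ i = c} = 0" by simp
  then show ?thesis by (intro AE_I[of _ _ "{w::real^'n. w $ i = c}"]) auto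
qed

text \<open>On the line \<open>v $ j = p * v $ i + q\<close> the \<open>j\<close>-th coordinate of \<open>v\<close> is a dummy variable, integrated against a
  Gaussian weight; this avoids an integration over a space of lower dimension.\<close>

definition on_line :: "'n \<Rightarrow> 'n \<Rightarrow> real \<Rightarrow> real \<Rightarrow> real^'n::finite \<Rightarrow> real^'n" where
  "on_line i j p q v = set_coord j (p * v $ i + q) v"

lemma on_line_nth [simp]: "on_line i j p q v $ k = (if k = j then p * v $ i + q else v $ k)"
  by (simp add: on_line_def)

lemma measurable_on_line [measurable]:
  assumes [measurable]: "P \<in> borel_measurable N" "Q \<in> borel_measurable N" "g \<in> borel_measurable N"
  shows "(\<lambda>x. on_line i j (P x) (Q x) (g x)) \<in> borel_measurable N"
  unfolding on_line_def by measurable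

text \<open>For two points with different i-th coordinates exactly one slope and one intercept
  describe the line through their projections to the (i, j) plane, so the two j-th coordinates can
  be traded for p and q; the Jacobian is |v $ i - w $ i|. The former j-th coordinates survive as
  Gaussian dummies: hence the factor pi on the left and the two exponentials on the right.\<close>

lemma nn_integral_line_coords:
  fixes F :: "real^'n::finite \<Rightarrow> real^'n \<Rightarrow> ennreal"
  assumes F[measurable]: "(\<lambda>(v, w). F v w) \<in> borel_measurable borel" and "i \<noteq> j"
  shows "ennreal pi * (\<integral>\<^sup>+v. \<integral>\<^sup>+w. F v w \<partial>lborel \<partial>lborel)
    = (\<integral>\<^sup>+p. \<integral>\<^sup>+q. \<integral>\<^sup>+v. \<integral>\<^sup>+w. ennreal \<bar>v $ i - w $ i\<bar> * F (on_line i j p q v) (on_line i j p q w)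
         * (ennreal (exp (- (v $ j)\<^sup>2)) * ennreal (exp (- (w $ j)\<^sup>2))) \<partial>lborel \<partial>lborel \<partial>lborel \<partial>lborel)"
proof -
  let ?\<eta> = "\<lambda>t. ennreal (exp (- t\<^sup>2))"
  have F'[measurable (raw)]: "(\<lambda>x. F (f x) (g x)) \<in> borel_measurable N"
    if [measurable]: "f \<in> borel_measurable N" "g \<in> borel_measurable N" for f g and N :: "'z measure"
    using measurable_compose[of "\<lambda>x. (f x, g x)" N borel "\<lambda>(v, w). F v w" borel] F by (simp add: borel_prod[symmetric])
  have \<eta>: "(\<integral>\<^sup>+t. ?\<eta> t \<partial>lborel) = ennreal (sqrt pi)" by (rule nn_integral_exp_neg_square)
  have pi: "ennreal pi = ennreal (sqrt pi) * ennreal (sqrt pi)" by (simp add: ennreal_mult[symmetric])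
  have "ennreal pi * (\<integral>\<^sup>+v. \<integral>\<^sup>+w. F v w \<partial>lborel \<partial>lborel)
     = ennreal (sqrt pi) * (\<integral>\<^sup>+v. ennreal (sqrt pi) * (\<integral>\<^sup>+w. F v w \<partial>lborel) \<partial>lborel)"
    by (simp add: pi nn_integral_cmult mult.assoc)
  also have "\<dots> = ennreal (sqrt pi) * (\<integral>\<^sup>+v. (\<integral>\<^sup>+w. \<integral>\<^sup>+s. F v (set_coord j s w) * ?\<eta> (w $ j) \<partial>lborel \<partial>lborel) \<partial>lborel)"
    by (subst nn_integral_resample) (simp_all add: \<eta>)
  also have "\<dots> = (\<integral>\<^sup>+v. \<integral>\<^sup>+t. (\<integral>\<^sup>+w. \<integral>\<^sup>+s. F (set_coord j t v) (set_coord j s w) * ?\<eta> (w $ j) \<partial>lborel \<partial>lborel) * ?\<eta> (v $ j) \<partial>lborel \<partial>lborel)"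
    by (subst nn_integral_resample) (simp_all add: \<eta>)
  also have "\<dots> = (\<integral>\<^sup>+v. \<integral>\<^sup>+t. \<integral>\<^sup>+w. \<integral>\<^sup>+s. F (set_coord j t v) (set_coord j s w) * (?\<eta> (v $ j) * ?\<eta> (w $ j)) \<partial>lborel \<partial>lborel \<partial>lborel \<partial>lborel)"
  proof (intro nn_integral_cong)
    fix v :: "real^'n" and t
    show "(\<integral>\<^sup>+w. \<integral>\<^sup>+s. F (set_coord j t v) (set_coord j s w) * ?\<eta> (w $ j) \<partial>lborel \<partial>lborel) * ?\<eta> (v $ j)
      = (\<integral>\<^sup>+w. \<integral>\<^sup>+s. F (set_coord j t v) (set_coord j s w) * (?\<eta> (v $ j) * ?\<eta> (w $ j)) \<partial>lborel \<partial>lborel)"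
      by (subst nn_integral_multc[symmetric], measurable, subst nn_integral_multc[symmetric], measurable)
        (simp only: ac_simps)
  qed
  also have "\<dots> = (\<integral>\<^sup>+v. \<integral>\<^sup>+w. \<integral>\<^sup>+t. \<integral>\<^sup>+s. F (set_coord j t v) (set_coord j s w) * (?\<eta> (v $ j) * ?\<eta> (w $ j)) \<partial>lborel \<partial>lborel \<partial>lborel \<partial>lborel)"
    by (intro nn_integral_cong lborel_pair.Fubini') measurable
  also have "\<dots> = (\<integral>\<^sup>+v. \<integral>\<^sup>+w. \<integral>\<^sup>+p. \<integral>\<^sup>+q. ennreal \<bar>v $ i - w $ i\<bar> * F (on_line i j p q v) (on_line i j p q w)
         * (?\<eta> (v $ j) * ?\<eta> (w $ j)) \<partial>lborel \<partial>lborel \<partial>lborel \<partial>lborel)"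
  proof (rule nn_integral_cong, rule nn_integral_cong_AE)
    fix v :: "real^'n"
    show "AE w in lborel. (\<integral>\<^sup>+t. \<integral>\<^sup>+s. F (set_coord j t v) (set_coord j s w) * (?\<eta> (v $ j) * ?\<eta> (w $ j)) \<partial>lborel \<partial>lborel)
      = (\<integral>\<^sup>+p. \<integral>\<^sup>+q. ennreal \<bar>v $ i - w $ i\<bar> * F (on_line i j p q v) (on_line i j p q w)
         * (?\<eta> (v $ j) * ?\<eta> (w $ j)) \<partial>lborel \<partial>lborel)"
      using AE_coord_neq[of i "v $ i"]
    proof eventually_elim
      fix w :: "real^'n" assume ne: "w $ i \<noteq> v $ i"
      define c where "c = w $ i - v $ i"
      have "c \<noteq> 0" using ne by (simp add: c_def)
      have ac: "\<bar>v $ i - w $ i\<bar> = \<bar>c\<bar>" by (simp add: c_def)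
      define H where "H = ?\<eta> (v $ j) * ?\<eta> (w $ j)"
      \<comment> \<open>The slope comes first: s = t + c * p with t fixed, Jacobian |c|. The
        intercept is then t shifted by p * v $ i.\<close>
      have "(\<integral>\<^sup>+t. \<integral>\<^sup>+s. F (set_coord j t v) (set_coord j s w) * H \<partial>lborel \<partial>lborel)
         = (\<integral>\<^sup>+t. \<integral>\<^sup>+p. ennreal \<bar>c\<bar> * (F (set_coord j t v) (set_coord j (t + c * p) w) * H) \<partial>lborel \<partial>lborel)"
      proof (rule nn_integral_cong)
        fix t
        show "(\<integral>\<^sup>+s. F (set_coord j t v) (set_coord j s w) * H \<partial>lborel) = (\<integral>\<^sup>+p. ennreal \<bar>c\<bar> * (F (set_coord j t v) (set_coord j (t + c * p) w) * H) \<partial>lborel)"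
          by (subst nn_integral_real_affine[of _ c t]) (use \<open>c \<noteq> 0\<close> in \<open>auto simp: nn_integral_cmult\<close>)
      qed
      also have "\<dots> = (\<integral>\<^sup>+p. \<integral>\<^sup>+t. ennreal \<bar>c\<bar> * (F (set_coord j t v) (set_coord j (t + c * p) w) * H) \<partial>lborel \<partial>lborel)"
        by (rule lborel_pair.Fubini') measurable
      also have "\<dots> = (\<integral>\<^sup>+p. \<integral>\<^sup>+q. ennreal \<bar>c\<bar> * (F (on_line i j p q v) (on_line i j p q w) * H) \<partial>lborel \<partial>lborel)"
      proof (rule nn_integral_cong)
        fix p
        have "(\<integral>\<^sup>+t. ennreal \<bar>c\<bar> * (F (set_coord j t v) (set_coord j (t + c * p) w) * H) \<partial>lborel)
          = (\<integral>\<^sup>+q. ennreal \<bar>c\<bar> * (F (set_coord j (q + p * v $ i) v) (set_coord j ((q + p * v $ i) + c * p) w) * H) \<partial>lborel)"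
          by (rule nn_integral_lborel_translate[symmetric]) measurable
        then show "(\<integral>\<^sup>+t. ennreal \<bar>c\<bar> * (F (set_coord j t v) (set_coord j (t + c * p) w) * H) \<partial>lborel)
          = (\<integral>\<^sup>+q. ennreal \<bar>c\<bar> * (F (on_line i j p q v) (on_line i j p q w) * H) \<partial>lborel)"
          by (simp add: on_line_def c_def algebra_simps)
      qed
      finally show "(\<integral>\<^sup>+t. \<integral>\<^sup>+s. F (set_coord j t v) (set_coord j s w) * (?\<eta> (v $ j) * ?\<eta> (w $ j)) \<partial>lborel \<partial>lborel)
      = (\<integral>\<^sup>+p. \<integral>\<^sup>+q. ennreal \<bar>v $ i - w $ i\<bar> * F (on_line i j p q v) (on_line i j p q w)
         * (?\<eta> (v $ j) * ?\<eta> (w $ j)) \<partial>lborel \<partial>lborel)"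
        unfolding H_def ac by (simp add: mult.assoc)
    qed
  qed
  also have "\<dots> = (\<integral>\<^sup>+v. \<integral>\<^sup>+p. \<integral>\<^sup>+w. \<integral>\<^sup>+q. ennreal \<bar>v $ i - w $ i\<bar> * F (on_line i j p q v) (on_line i j p q w)
         * (?\<eta> (v $ j) * ?\<eta> (w $ j)) \<partial>lborel \<partial>lborel \<partial>lborel \<partial>lborel)"
    by (intro nn_integral_cong lborel_pair.Fubini') measurable
  also have "\<dots> = (\<integral>\<^sup>+p. \<integral>\<^sup>+v. \<integral>\<^sup>+w. \<integral>\<^sup>+q. ennreal \<bar>v $ i - w $ i\<bar> * F (on_line i j p q v) (on_line i j p q w)
         * (?\<eta> (v $ j) * ?\<eta> (w $ j)) \<partial>lborel \<partial>lborel \<partial>lborel \<partial>lborel)"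
    by (rule lborel_pair.Fubini') measurable
  also have "\<dots> = (\<integral>\<^sup>+p. \<integral>\<^sup>+v. \<integral>\<^sup>+q. \<integral>\<^sup>+w. ennreal \<bar>v $ i - w $ i\<bar> * F (on_line i j p q v) (on_line i j p q w)
         * (?\<eta> (v $ j) * ?\<eta> (w $ j)) \<partial>lborel \<partial>lborel \<partial>lborel \<partial>lborel)"
    by (intro nn_integral_cong lborel_pair.Fubini') measurable
  also have "\<dots> = (\<integral>\<^sup>+p. \<integral>\<^sup>+q. \<integral>\<^sup>+v. \<integral>\<^sup>+w. ennreal \<bar>v $ i - w $ i\<bar> * F (on_line i j p q v) (on_line i j p q w)
         * (?\<eta> (v $ j) * ?\<eta> (w $ j)) \<partial>lborel \<partial>lborel \<partial>lborel \<partial>lborel)"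
    by (intro nn_integral_cong lborel_pair.Fubini') measurable
  finally show ?thesis .
qed

text \<open>The far region is symmetric under z -> - z, and at least one of z and - z satisfies the
  linear inequality, so the half-space carries at least half of the Gaussian mass. As c is
  arbitrary, the resulting bound is uniform in the centre.\<close>

lemma half_space_mass:
  fixes j :: "'n::finite" and c :: "real^'n"
  assumes "R \<ge> 0"
  shows "ennreal (beta_const CARD('n) R * sqrt pi)
    \<le> 2 * (\<integral>\<^sup>+z. indicator {z. (\<Sum>k\<in>UNIV - {j}. (z $ k)\<^sup>2) \<ge> (2 * R)\<^sup>2 \<and> (\<Sum>k\<in>UNIV - {j}. c $ k * z $ k) \<le> 0} z
        * ennreal (maxw z) \<partial>(lborel :: (real^'n) measure))"
proof -
  let ?S = "{z. (\<Sum>k\<in>UNIV - {j}. (z $ k)\<^sup>2) \<ge> (2 * R)\<^sup>2} :: (real^'n) set"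
  let ?H = "{z. (\<Sum>k\<in>UNIV - {j}. (z $ k)\<^sup>2) \<ge> (2 * R)\<^sup>2 \<and> (\<Sum>k\<in>UNIV - {j}. c $ k * z $ k) \<le> 0} :: (real^'n) set"
  have mH[measurable]: "?H \<in> sets borel" by measurable
  let ?f = "\<lambda>z. indicator ?H z * ennreal (maxw z)"
  have "ennreal (beta_const CARD('n) R * sqrt pi) = (\<integral>\<^sup>+z. indicator ?S z * ennreal (maxw z) \<partial>lborel)"
    by (rule nn_integral_beta_const[OF assms, symmetric])
  also have "\<dots> \<le> (\<integral>\<^sup>+z. ?f z + ?f (- z) \<partial>lborel)"
  proof (rule nn_integral_mono)
    fix z :: "real^'n"
    have "(\<Sum>k\<in>UNIV - {j}. c $ k * (- z) $ k) = - (\<Sum>k\<in>UNIV - {j}. c $ k * z $ k)"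
      by (simp add: sum_negf)
    then have "z \<in> ?S \<Longrightarrow> z \<in> ?H \<or> - z \<in> ?H" by (auto simp del: vector_uminus_component) (auto simp: sum_negf)
    moreover have "maxw (- z) = maxw z" by (simp add: maxw_def)
    ultimately show "indicator ?S z * ennreal (maxw z) \<le> ?f z + ?f (- z)"
      by (cases "z \<in> ?S"; cases "z \<in> ?H"; cases "- z \<in> ?H") (simp_all only: indicator_simps if_True if_False mult_1_left mult_zero_left add_0_left add_0_right order_refl zero_le add_increasing2, auto)
  qed
  also have "\<dots> = (\<integral>\<^sup>+z. ?f z \<partial>lborel) + (\<integral>\<^sup>+z. ?f (- z) \<partial>lborel)"
    by (rule nn_integral_add) measurable
  also have "(\<integral>\<^sup>+z. ?f (- z) \<partial>lborel) = (\<integral>\<^sup>+z. ?f z \<partial>lborel)"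
    by (rule nn_integral_lborel_uminus) measurable
  finally show ?thesis by (simp only: mult_2[symmetric])
qed

lemma sum_UNIV_split2:
  fixes i j :: "'n::finite" and f :: "'n \<Rightarrow> real"
  assumes "i \<noteq> j"
  shows "sum f UNIV = f i + f j + sum f (UNIV - {i, j})" "sum f (UNIV - {j}) = f i + sum f (UNIV - {i, j})"
proof -
  have "UNIV - {j} - {i} = UNIV - {i, j}" by auto
  then show *: "sum f (UNIV - {j}) = f i + sum f (UNIV - {i, j})"
    using assms by (subst sum.remove[of "UNIV - {j}" i]) auto
  show "sum f UNIV = f i + f j + sum f (UNIV - {i, j})"
    by (subst sum.remove[of UNIV j]) (auto simp: *)
qed

text \<open>Completing the square: y^2 + (p y + q)^2 = (q / s)^2 + (s y + p q / s)^2. After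
  rescaling coordinate i the Gaussian on the slice is again the standard one, times exp (- (q /
  s)^2) / s; the dummy coordinate j supplies the missing direction.\<close>

lemma on_line_mass:
  fixes i j :: "'n::finite" and p q :: real
  assumes "i \<noteq> j"
  defines "s \<equiv> sqrt (1 + p\<^sup>2)"
  assumes [measurable]: "f \<in> borel_measurable (borel :: (real^'n) measure)"
  shows "(\<integral>\<^sup>+z. f z * ennreal (exp (- (z $ j)\<^sup>2) * maxw (on_line i j p q z)) \<partial>lborel)
    = ennreal (exp (- (q / s)\<^sup>2) / s) * (\<integral>\<^sup>+z. f (set_coord i ((z $ i - p * q / s) / s) z) * ennreal (maxw z) \<partial>lborel)"
proof -
  have s: "s > 0" "s\<^sup>2 = 1 + p\<^sup>2" unfolding s_def by (auto simp: add_pos_nonneg)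
  define \<phi> where "\<phi> z = set_coord i (- (p * q / s) / s + 1 / s * z $ i) z" for z :: "real^'n"
  have \<phi>': "\<phi> z = set_coord i ((z $ i - p * q / s) / s) z" for z
    using s by (simp add: \<phi>_def diff_divide_distrib)
  have w: "exp (- (\<phi> z $ j)\<^sup>2) * maxw (on_line i j p q (\<phi> z)) = exp (- (q / s)\<^sup>2) * maxw z" for z :: "real^'n"
  proof -
    define y where "y = (z $ i - p * q / s) / s"
    have zi: "z $ i = s * y + p * q / s" using s by (simp add: y_def)
    have "(z $ j)\<^sup>2 + (norm (on_line i j p q (\<phi> z)))\<^sup>2 = (z $ j)\<^sup>2 + (y\<^sup>2 + (p * y + q)\<^sup>2 + (\<Sum>k\<in>UNIV - {i, j}. (z $ k)\<^sup>2))"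
      unfolding norm_vec_square_sum sum_UNIV_split2(1)[OF \<open>i \<noteq> j\<close>] using \<open>i \<noteq> j\<close>
      by (simp add: \<phi>' y_def)
    moreover have "(q / s)\<^sup>2 + (norm z)\<^sup>2 = (q / s)\<^sup>2 + ((z $ i)\<^sup>2 + (z $ j)\<^sup>2 + (\<Sum>k\<in>UNIV - {i, j}. (z $ k)\<^sup>2))"
      unfolding norm_vec_square_sum sum_UNIV_split2(1)[OF \<open>i \<noteq> j\<close>] by simp
    moreover have "y\<^sup>2 + (p * y + q)\<^sup>2 = (q / s)\<^sup>2 + (z $ i)\<^sup>2"
    proof -
      have "(z $ i)\<^sup>2 = s\<^sup>2 * y\<^sup>2 + 2 * p * q * y + (p * q / s)\<^sup>2"
        using s(1) by (simp add: zi power2_sum power_mult_distrib)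
      moreover have "(q / s)\<^sup>2 + (p * q / s)\<^sup>2 = q\<^sup>2"
      proof -
        have "(q / s)\<^sup>2 + (p * q / s)\<^sup>2 = q\<^sup>2 * (1 + p\<^sup>2) / s\<^sup>2"
          by (simp add: power_divide power_mult_distrib add_divide_distrib[symmetric] algebra_simps)
        moreover have "1 + p\<^sup>2 \<noteq> 0" using zero_le_power2[of p] by linarith
        ultimately show ?thesis using s by simp
      qed
      ultimately show ?thesis unfolding s(2) by (simp add: power2_eq_square algebra_simps)
    qed
    ultimately have "(z $ j)\<^sup>2 + (norm (on_line i j p q (\<phi> z)))\<^sup>2 = (q / s)\<^sup>2 + (norm z)\<^sup>2" by simp
    moreover have "\<phi> z $ j = z $ j" using \<open>i \<noteq> j\<close> by (simp add: \<phi>_def)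
    ultimately show ?thesis by (simp add: maxw_def exp_add[symmetric] del: add_uminus_conv_diff)
  qed
  have "(\<integral>\<^sup>+z. f z * ennreal (exp (- (z $ j)\<^sup>2) * maxw (on_line i j p q z)) \<partial>lborel)
     = ennreal \<bar>1 / s\<bar> * (\<integral>\<^sup>+z. f (\<phi> z) * ennreal (exp (- (\<phi> z $ j)\<^sup>2) * maxw (on_line i j p q (\<phi> z))) \<partial>lborel)"
    unfolding \<phi>_def
  proof (rule nn_integral_scale_coord)
    show "1 / s \<noteq> 0" using s by simp
  qed measurable
  also have "\<dots> = ennreal (1 / s) * (\<integral>\<^sup>+z. ennreal (exp (- (q / s)\<^sup>2)) * (f (\<phi> z) * ennreal (maxw z)) \<partial>lborel)"
    using s unfolding w by (simp add: ennreal_mult ac_simps)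
  also have "\<dots> = ennreal (1 / s) * (ennreal (exp (- (q / s)\<^sup>2)) * (\<integral>\<^sup>+z. f (\<phi> z) * ennreal (maxw z) \<partial>lborel))"
    by (subst nn_integral_cmult) (auto simp: \<phi>_def)
  also have "\<dots> = ennreal (exp (- (q / s)\<^sup>2) / s) * (\<integral>\<^sup>+z. f (\<phi> z) * ennreal (maxw z) \<partial>lborel)"
    using s by (simp add: mult.assoc[symmetric] ennreal_mult[symmetric])
  finally show ?thesis unfolding \<phi>' .
qed

lemma on_line_dist:
  fixes i j :: "'n::finite" and x z :: "real^'n"
  assumes "i \<noteq> j"
  shows "(norm (on_line i j p q x - on_line i j p q z))\<^sup>2 = (1 + p\<^sup>2) * (x $ i - z $ i)\<^sup>2 + (\<Sum>k\<in>UNIV - {i, j}. (x $ k - z $ k)\<^sup>2)"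
proof -
  show ?thesis
    unfolding norm_vec_square_sum sum_UNIV_split2(1)[OF assms] using assms by (simp add: power2_eq_square algebra_simps)
qed

text \<open>Rescaling coordinate i makes distances within the slice Euclidean and sends x to a
  centre c. Where c and z have nonpositive inner product, the distance from c to z is at least the
  length of z, so being far from the origin implies being far from c. Dependence on the centre
  disappears at the cost of a factor 2.\<close>

lemma on_line_far_mass:
  fixes i j :: "'n::finite" and x :: "real^'n"
  assumes "i \<noteq> j" "R \<ge> 0"
  shows "ennreal (beta_const CARD('n) R * sqrt pi) * ennreal (exp (- (q / sqrt (1 + p\<^sup>2))\<^sup>2) / sqrt (1 + p\<^sup>2))
    \<le> 2 * (\<integral>\<^sup>+z. indicator {z. norm (on_line i j p q x - on_line i j p q z) \<ge> 2 * R} z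
          * ennreal (exp (- (z $ j)\<^sup>2) * maxw (on_line i j p q z)) \<partial>lborel)"
proof -
  define s where "s = sqrt (1 + p\<^sup>2)"
  have s: "s > 0" "s\<^sup>2 = 1 + p\<^sup>2" unfolding s_def by (auto simp: add_pos_nonneg)
  \<comment> \<open>The image of x under the inverse of the substitution in
    \<open>on_line_mass\<close>.\<close>
  define c where "c = set_coord i (s * x $ i + p * q / s) x"
  let ?H = "{z. (\<Sum>k\<in>UNIV - {j}. (z $ k)\<^sup>2) \<ge> (2 * R)\<^sup>2 \<and> (\<Sum>k\<in>UNIV - {j}. c $ k * z $ k) \<le> 0} :: (real^'n) set"
  let ?D = "{z. norm (on_line i j p q x - on_line i j p q z) \<ge> 2 * R} :: (real^'n) set"
  have [measurable]: "?H \<in> sets borel" "?D \<in> sets borel" by measurable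
  have sub: "set_coord i ((z $ i - p * q / s) / s) z \<in> ?D" if "z \<in> ?H" for z
  proof -
    let ?y = "set_coord i ((z $ i - p * q / s) / s) z"
    have "s * (x $ i - (z $ i - p * q / s) / s) = c $ i - z $ i"
      using s by (simp add: c_def field_simps)
    then have ci: "(1 + p\<^sup>2) * (x $ i - (z $ i - p * q / s) / s)\<^sup>2 = (c $ i - z $ i)\<^sup>2"
      unfolding s(2)[symmetric] by (metis power_mult_distrib)
    have "(norm (on_line i j p q x - on_line i j p q ?y))\<^sup>2 = (\<Sum>k\<in>UNIV - {j}. (c $ k - z $ k)\<^sup>2)"
      unfolding on_line_dist[OF \<open>i \<noteq> j\<close>] sum_UNIV_split2(2)[OF \<open>i \<noteq> j\<close>] using ci by (simp add: c_def)
    also have "\<dots> = (\<Sum>k\<in>UNIV - {j}. (c $ k)\<^sup>2) - 2 * (\<Sum>k\<in>UNIV - {j}. c $ k * z $ k) + (\<Sum>k\<in>UNIV - {j}. (z $ k)\<^sup>2)"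
      by (simp add: power2_diff sum.distrib sum_subtractf sum_distrib_left algebra_simps)
    also have "\<dots> \<ge> (2 * R)\<^sup>2"
      using that sum_nonneg[of "UNIV - {j}" "\<lambda>k. (c $ k)\<^sup>2"] by auto
    finally show ?thesis using power2_le_imp_le[of "2 * R" "norm (on_line i j p q x - on_line i j p q ?y)"] by simp
  qed
  have "ennreal (beta_const CARD('n) R * sqrt pi) \<le> 2 * (\<integral>\<^sup>+z. indicator ?H z * ennreal (maxw z) \<partial>lborel)"
    by (rule half_space_mass) fact
  also have "\<dots> \<le> 2 * (\<integral>\<^sup>+z. indicator ?D (set_coord i ((z $ i - p * q / s) / s) z) * ennreal (maxw z) \<partial>lborel)"
    using sub by (intro mult_left_mono nn_integral_mono mult_right_mono) (auto simp: indicator_def)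
  finally have "ennreal (beta_const CARD('n) R * sqrt pi) * ennreal (exp (- (q / s)\<^sup>2) / s)
    \<le> 2 * (\<integral>\<^sup>+z. indicator ?D (set_coord i ((z $ i - p * q / s) / s) z) * ennreal (maxw z) \<partial>lborel) * ennreal (exp (- (q / s)\<^sup>2) / s)"
    by (rule mult_right_mono) simp
  also have "\<dots> = 2 * (\<integral>\<^sup>+z. indicator ?D z * ennreal (exp (- (z $ j)\<^sup>2) * maxw (on_line i j p q z)) \<partial>lborel)"
    unfolding s_def by (subst on_line_mass[OF \<open>i \<noteq> j\<close>]) (auto simp: ac_simps)
  finally show ?thesis unfolding s_def .
qed

text \<open>The three-point inequality for the slice, carrying the measure of density
  \<open>w\<close>. Total mass and far mass share the factor sqrt pi * \<kappa>, which cancels; what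
  remains is 4 * alpha against beta / 2.\<close>

lemma on_line_inequality:
  fixes i j :: "'n::finite" and g :: "real^'n \<Rightarrow> real" and p q :: real
  assumes "i \<noteq> j" "R \<ge> 0" and [measurable]: "g \<in> borel_measurable borel"
  defines "T \<equiv> on_line i j p q"
  defines "w \<equiv> \<lambda>z. ennreal (exp (- (z $ j)\<^sup>2) * maxw (T z))"
  shows "ennreal (beta_const CARD('n) R) * (\<integral>\<^sup>+x. \<integral>\<^sup>+y. ennreal (norm (T x - T y) ^ 3 * (g x - g y)\<^sup>2) * (w x * w y) \<partial>lborel \<partial>lborel)
    \<le> ennreal (8 * alpha_const CARD('n)) * (\<integral>\<^sup>+x. \<integral>\<^sup>+y. indicator {R..} (norm (T x - T y))
        * (ennreal (norm (T x - T y) ^ 3 * (g x - g y)\<^sup>2) * (w x * w y)) \<partial>lborel \<partial>lborel)"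
proof -
  define s where "s = sqrt (1 + p\<^sup>2)"
  have s: "s > 0" unfolding s_def by (auto simp: add_pos_nonneg)
  define \<kappa> where "\<kappa> = exp (- (q / s)\<^sup>2) / s"
  have \<kappa>: "\<kappa> > 0" using s by (simp add: \<kappa>_def)
  have [measurable]: "T \<in> borel_measurable borel" "w \<in> borel_measurable borel"
    unfolding T_def w_def by measurable
  define \<mu> where "\<mu> = density lborel w"
  have sets[measurable_cong]: "sets \<mu> = sets borel" by (simp add: \<mu>_def)
  have a: "alpha_const CARD('n) * sqrt pi = sqrt pi ^ CARD('n)"
    by (simp add: alpha_const_eq power_minus_mult[of "CARD('n)", simplified])
  have A: "emeasure \<mu> (space \<mu>) = ennreal (alpha_const CARD('n) * sqrt pi * \<kappa>)"
  proof -
    have "emeasure \<mu> (space \<mu>) = (\<integral>\<^sup>+z. 1 * w z \<partial>lborel)"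
      by (simp add: \<mu>_def emeasure_density)
    also have "\<dots> = ennreal \<kappa> * (\<integral>\<^sup>+z. 1 * ennreal (maxw z) \<partial>(lborel :: (real^'n) measure))"
      unfolding w_def T_def \<kappa>_def s_def by (rule on_line_mass[OF \<open>i \<noteq> j\<close>, of "\<lambda>_. 1"]) simp
    also have "\<dots> = ennreal (alpha_const CARD('n) * sqrt pi * \<kappa>)"
      unfolding a using \<kappa> by (simp add: nn_integral_maxw ennreal_mult[symmetric] mult.commute)
    finally show ?thesis .
  qed
  have fin: "finite_measure \<mu>" by (rule finite_measureI) (simp add: A)
  have b: "ennreal (beta_const CARD('n) R * sqrt pi * \<kappa> / 2) \<le> (\<integral>\<^sup>+z. indicator {z. norm (T x - T z) \<ge> 2 * R} z \<partial>\<mu>)" for x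
  proof -
    have "ennreal (beta_const CARD('n) R * sqrt pi * \<kappa>) = ennreal (beta_const CARD('n) R * sqrt pi) * ennreal \<kappa>"
      using \<kappa> by (simp add: ennreal_mult beta_const_nonneg)
    also have "\<dots> \<le> 2 * (\<integral>\<^sup>+z. indicator {z. norm (T x - T z) \<ge> 2 * R} z * w z \<partial>lborel)"
      unfolding \<kappa>_def w_def T_def s_def by (rule on_line_far_mass) fact+
    also have "(\<integral>\<^sup>+z. indicator {z. norm (T x - T z) \<ge> 2 * R} z * w z \<partial>lborel) = (\<integral>\<^sup>+z. indicator {z. norm (T x - T z) \<ge> 2 * R} z \<partial>\<mu>)"
      unfolding \<mu>_def by (subst nn_integral_density) (auto simp: mult.commute)
    finally have le: "ennreal (1/2) * ennreal (beta_const CARD('n) R * sqrt pi * \<kappa>) \<le> ennreal (1/2) * (2 * (\<integral>\<^sup>+z. indicator {z. norm (T x - T z) \<ge> 2 * R} z \<partial>\<mu>))"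
      by (rule mult_left_mono) simp
    have half: "ennreal (1/2) * 2 = 1"
      using ennreal_mult[of "1/2" 2] by simp
    have "ennreal (beta_const CARD('n) R * sqrt pi * \<kappa> / 2) = ennreal (1/2) * ennreal (beta_const CARD('n) R * sqrt pi * \<kappa>)"
      using \<kappa> by (subst ennreal_mult[symmetric]) (auto simp: beta_const_nonneg)
    with le show ?thesis by (simp only: mult.assoc[symmetric] half mult_1_left)
  qed
  define E where "E = (\<integral>\<^sup>+x. \<integral>\<^sup>+y. ennreal (norm (T x - T y) ^ 3 * (g x - g y)\<^sup>2) \<partial>\<mu> \<partial>\<mu>)"
  define E' where "E' = (\<integral>\<^sup>+x. \<integral>\<^sup>+y. indicator {R..} (norm (T x - T y)) * ennreal (norm (T x - T y) ^ 3 * (g x - g y)\<^sup>2) \<partial>\<mu> \<partial>\<mu>)"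
  have dens: "(\<integral>\<^sup>+x. \<integral>\<^sup>+y. F x y \<partial>\<mu> \<partial>\<mu>) = (\<integral>\<^sup>+x. \<integral>\<^sup>+y. F x y * (w x * w y) \<partial>lborel \<partial>lborel)"
    if [measurable]: "(\<lambda>(x, y). F x y) \<in> borel_measurable (borel \<Otimes>\<^sub>M borel)" for F :: "real^'n \<Rightarrow> real^'n \<Rightarrow> ennreal"
  proof -
    have "(\<integral>\<^sup>+x. \<integral>\<^sup>+y. F x y \<partial>\<mu> \<partial>\<mu>) = (\<integral>\<^sup>+x. w x * (\<integral>\<^sup>+y. w y * F x y \<partial>lborel) \<partial>lborel)"
      unfolding \<mu>_def by (subst nn_integral_density; (subst nn_integral_density)?; measurable)
    also have "\<dots> = (\<integral>\<^sup>+x. \<integral>\<^sup>+y. w x * (w y * F x y) \<partial>lborel \<partial>lborel)"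
      by (intro nn_integral_cong nn_integral_cmult[symmetric]) measurable
    finally show ?thesis by (simp add: ac_simps)
  qed
  have "ennreal (beta_const CARD('n) R * sqrt pi * \<kappa> / 2) * E \<le> 4 * ennreal (alpha_const CARD('n) * sqrt pi * \<kappa>) * E'"
    unfolding E_def E'_def A[symmetric]
    by (rule three_point_inequality[OF fin sets _ _ \<open>R \<ge> 0\<close> b refl]) measurable
  then have "ennreal (2 / (sqrt pi * \<kappa>)) * (ennreal (beta_const CARD('n) R * sqrt pi * \<kappa> / 2) * E)
     \<le> ennreal (2 / (sqrt pi * \<kappa>)) * (4 * ennreal (alpha_const CARD('n) * sqrt pi * \<kappa>) * E')"
    by (rule mult_left_mono) simp
  moreover have "ennreal (2 / (sqrt pi * \<kappa>)) * ennreal (beta_const CARD('n) R * sqrt pi * \<kappa> / 2) = ennreal (beta_const CARD('n) R)"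
    using \<kappa> beta_const_nonneg[of "CARD('n)" R] by (simp flip: ennreal_mult)
  moreover have "ennreal (2 / (sqrt pi * \<kappa>)) * (4 * ennreal (alpha_const CARD('n) * sqrt pi * \<kappa>)) = ennreal (8 * alpha_const CARD('n))"
    using \<kappa> by (simp flip: ennreal_mult ennreal_numeral add: alpha_const_eq)
  ultimately have "ennreal (beta_const CARD('n) R) * E \<le> ennreal (8 * alpha_const CARD('n)) * E'"
    by (simp add: mult.assoc[symmetric])
  then show ?thesis
    unfolding E_def E'_def by (subst (asm) (1 2) dens) (measurable, simp add: mult.assoc)
qed

section \<open>From coordinate planes to arbitrary planes\<close>

definition frame_kernel :: "real^'n::finite \<Rightarrow> real^'n \<Rightarrow> real^'n \<Rightarrow> real^'n \<Rightarrow> real" where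
  "frame_kernel a b u X =
     norm u ^ 3 / sqrt ((u \<bullet> a)\<^sup>2 + (u \<bullet> b)\<^sup>2) ^ 3 * ((u \<bullet> a) * (X \<bullet> b) - (u \<bullet> b) * (X \<bullet> a))\<^sup>2"

lemma frame_kernel_nonneg [simp]: "frame_kernel a b u X \<ge> 0"
  by (simp add: frame_kernel_def)

lemma measurable_frame_kernel [measurable (raw)]:
  assumes [measurable]: "f1 \<in> borel_measurable N" "f2 \<in> borel_measurable N" "f3 \<in> borel_measurable N" "f4 \<in> borel_measurable N"
  shows "(\<lambda>x. frame_kernel (f1 x) (f2 x) (f3 x) (f4 x)) \<in> borel_measurable N"
  unfolding frame_kernel_def by measurable

text \<open>This identity dictates the shape of \<open>frame_kernel\<close>. The Jacobian |u|, two
  powers of |u| from the square and the cube in the denominator cancel, leaving a function of the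
  distance times the square of X $ j - p * X $ i. For X a difference of field values this is a
  squared difference of one scalar function.\<close>

lemma frame_kernel_on_line:
  fixes v w :: "real^'n::finite"
  assumes "i \<noteq> j" "v $ i \<noteq> w $ i"
  shows "\<bar>v $ i - w $ i\<bar> * frame_kernel (axis i 1) (axis j 1) (on_line i j p q v - on_line i j p q w) X
    = (1 / sqrt (1 + p\<^sup>2) ^ 3) * (norm (on_line i j p q v - on_line i j p q w) ^ 3 * (X $ j - p * X $ i)\<^sup>2)"
proof -
  define u where "u = v $ i - w $ i"
  have "u \<noteq> 0" using assms by (simp add: u_def)
  have 1: "(on_line i j p q v - on_line i j p q w) $ i = u" "(on_line i j p q v - on_line i j p q w) $ j = p * u"
    using assms by (simp_all add: u_def algebra_simps)
  have "u\<^sup>2 + (p * u)\<^sup>2 = (1 + p\<^sup>2) * u\<^sup>2" by (simp add: power2_eq_square algebra_simps)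
  then have r: "sqrt (u\<^sup>2 + (p * u)\<^sup>2) = sqrt (1 + p\<^sup>2) * \<bar>u\<bar>" by (simp add: real_sqrt_mult)
  have d: "(u * (X $ j) - p * u * (X $ i))\<^sup>2 = \<bar>u\<bar>\<^sup>2 * (X $ j - p * X $ i)\<^sup>2"
    by (simp add: power2_eq_square algebra_simps)
  have s: "sqrt (1 + p\<^sup>2) > 0" by (auto simp: add_pos_nonneg)
  have cancel: "a * (D / (\<sigma> * a) ^ 3 * (a\<^sup>2 * Y)) = 1 / \<sigma> ^ 3 * (D * Y)" if "a > 0" "\<sigma> > 0" for a \<sigma> D Y :: real
    using that by (simp add: power_mult_distrib power2_eq_square power3_eq_cube field_simps)
  show ?thesis
    unfolding frame_kernel_def inner_axis 1 u_def[symmetric] real_inner_1_right inner_real_def mult_1_right r d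
    by (rule cancel) (use \<open>u \<noteq> 0\<close> s in auto)
qed

lemma axis_frame_inequality:
  fixes i j :: "'n::finite" and G :: "real^'n \<Rightarrow> real^'n"
  assumes "i \<noteq> j" "R \<ge> 0" and [measurable]: "G \<in> borel_measurable borel"
  defines "K \<equiv> \<lambda>v w. ennreal (frame_kernel (axis i 1) (axis j 1) (v - w) (G v - G w) * (maxw v * maxw w))"
  shows "ennreal (beta_const CARD('n) R) * (\<integral>\<^sup>+v. \<integral>\<^sup>+w. K v w \<partial>lborel \<partial>lborel)
    \<le> ennreal (8 * alpha_const CARD('n)) * (\<integral>\<^sup>+v. \<integral>\<^sup>+w. indicator {R..} (norm (v - w)) * K v w \<partial>lborel \<partial>lborel)"
proof -
  let ?\<eta> = "\<lambda>t. ennreal (exp (- t\<^sup>2))"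
  let ?T = "on_line i j"
  define g where "g p q v = G (?T p q v) $ j - p * G (?T p q v) $ i" for p q v
  have [measurable (raw)]: "(\<lambda>x. g (a x) (b x) (c x)) \<in> borel_measurable N"
    if [measurable]: "a \<in> borel_measurable N" "b \<in> borel_measurable N" "c \<in> borel_measurable N"
    for a b c and N :: "'z measure"
    unfolding g_def by measurable
  define J where "J p q v w = ennreal (norm (?T p q v - ?T p q w) ^ 3 * (g p q v - g p q w)\<^sup>2)
     * (ennreal (exp (- (v $ j)\<^sup>2) * maxw (?T p q v)) * ennreal (exp (- (w $ j)\<^sup>2) * maxw (?T p q w)))" for p q v w
  have [measurable (raw)]: "(\<lambda>x. J (a x) (b x) (c x) (d x)) \<in> borel_measurable N"
    if [measurable]: "a \<in> borel_measurable N" "b \<in> borel_measurable N" "c \<in> borel_measurable N" "d \<in> borel_measurable N"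
    for a b c d and N :: "'z measure"
    unfolding J_def by measurable
  have [measurable (raw)]: "(\<lambda>x. K (a x) (b x)) \<in> borel_measurable N"
    if [measurable]: "a \<in> borel_measurable N" "b \<in> borel_measurable N" for a b and N :: "'z measure"
    unfolding K_def by measurable
  \<comment> \<open>The radial factor \<open>I\<close> is left open so that one formula serves both
    sides: the constant 1 on the left, the far indicator on the right.\<close>
  have main: "ennreal pi * (\<integral>\<^sup>+v. \<integral>\<^sup>+w. I (norm (v - w)) * K v w \<partial>lborel \<partial>lborel)
     = (\<integral>\<^sup>+p. ennreal (1 / sqrt (1 + p\<^sup>2) ^ 3) * (\<integral>\<^sup>+q. \<integral>\<^sup>+v. \<integral>\<^sup>+w. I (norm (?T p q v - ?T p q w)) * J p q v w \<partial>lborel \<partial>lborel \<partial>lborel) \<partial>lborel)"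
    if [measurable]: "I \<in> borel_measurable borel" for I :: "real \<Rightarrow> ennreal"
  proof -
    have "ennreal pi * (\<integral>\<^sup>+v. \<integral>\<^sup>+w. I (norm (v - w)) * K v w \<partial>lborel \<partial>lborel)
     = (\<integral>\<^sup>+p. \<integral>\<^sup>+q. \<integral>\<^sup>+v. \<integral>\<^sup>+w. ennreal \<bar>v $ i - w $ i\<bar> * (I (norm (?T p q v - ?T p q w)) * K (?T p q v) (?T p q w))
         * (?\<eta> (v $ j) * ?\<eta> (w $ j)) \<partial>lborel \<partial>lborel \<partial>lborel \<partial>lborel)"
    proof (rule nn_integral_line_coords[OF _ \<open>i \<noteq> j\<close>])
      have "(\<lambda>x. I (norm (fst x - snd x)) * K (fst x) (snd x)) \<in> borel_measurable (borel \<Otimes>\<^sub>M borel)" by measurable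
      then show "(\<lambda>(v, w). I (norm (v - w)) * K v w) \<in> borel_measurable borel" by (simp add: borel_prod case_prod_beta)
    qed
    also have "\<dots> = (\<integral>\<^sup>+p. \<integral>\<^sup>+q. \<integral>\<^sup>+v. \<integral>\<^sup>+w. ennreal (1 / sqrt (1 + p\<^sup>2) ^ 3) * (I (norm (?T p q v - ?T p q w)) * J p q v w) \<partial>lborel \<partial>lborel \<partial>lborel \<partial>lborel)"
    proof (rule nn_integral_cong, rule nn_integral_cong, rule nn_integral_cong, rule nn_integral_cong_AE)
      fix p q and v :: "real^'n"
      show "AE w in lborel. ennreal \<bar>v $ i - w $ i\<bar> * (I (norm (?T p q v - ?T p q w)) * K (?T p q v) (?T p q w)) * (?\<eta> (v $ j) * ?\<eta> (w $ j))
         = ennreal (1 / sqrt (1 + p\<^sup>2) ^ 3) * (I (norm (?T p q v - ?T p q w)) * J p q v w)"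
        using AE_coord_neq[of i "v $ i"]
      proof eventually_elim
        fix w :: "real^'n" assume "w $ i \<noteq> v $ i"
        then have ne: "v $ i \<noteq> w $ i" by simp
        have "ennreal \<bar>v $ i - w $ i\<bar> * K (?T p q v) (?T p q w)
          = ennreal (\<bar>v $ i - w $ i\<bar> * frame_kernel (axis i 1) (axis j 1) (?T p q v - ?T p q w) (G (?T p q v) - G (?T p q w)))
            * (ennreal (maxw (?T p q v)) * ennreal (maxw (?T p q w)))"
          by (simp add: K_def ennreal_mult mult.assoc)
        also have "\<dots> = ennreal (1 / sqrt (1 + p\<^sup>2) ^ 3) * ennreal (norm (?T p q v - ?T p q w) ^ 3 * (g p q v - g p q w)\<^sup>2)
            * (ennreal (maxw (?T p q v)) * ennreal (maxw (?T p q w)))"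
          unfolding frame_kernel_on_line[OF \<open>i \<noteq> j\<close> ne] by (subst ennreal_mult) (simp_all add: g_def algebra_simps)
        finally have k: "ennreal \<bar>v $ i - w $ i\<bar> * K (?T p q v) (?T p q w) = ennreal (1 / sqrt (1 + p\<^sup>2) ^ 3) * ennreal (norm (?T p q v - ?T p q w) ^ 3 * (g p q v - g p q w)\<^sup>2)
            * (ennreal (maxw (?T p q v)) * ennreal (maxw (?T p q w)))" .
        have "ennreal \<bar>v $ i - w $ i\<bar> * (I (norm (?T p q v - ?T p q w)) * K (?T p q v) (?T p q w)) * (?\<eta> (v $ j) * ?\<eta> (w $ j))
          = (ennreal \<bar>v $ i - w $ i\<bar> * K (?T p q v) (?T p q w)) * (I (norm (?T p q v - ?T p q w)) * (?\<eta> (v $ j) * ?\<eta> (w $ j)))"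
          by (simp only: ac_simps)
        also have "\<dots> = ennreal (1 / sqrt (1 + p\<^sup>2) ^ 3) * (I (norm (?T p q v - ?T p q w)) * J p q v w)"
          unfolding k J_def by (simp only: ennreal_mult maxw_nonneg exp_ge_zero ac_simps)
        finally show "ennreal \<bar>v $ i - w $ i\<bar> * (I (norm (?T p q v - ?T p q w)) * K (?T p q v) (?T p q w)) * (?\<eta> (v $ j) * ?\<eta> (w $ j))
         = ennreal (1 / sqrt (1 + p\<^sup>2) ^ 3) * (I (norm (?T p q v - ?T p q w)) * J p q v w)" .
      qed
    qed
    also have "\<dots> = (\<integral>\<^sup>+p. ennreal (1 / sqrt (1 + p\<^sup>2) ^ 3) * (\<integral>\<^sup>+q. \<integral>\<^sup>+v. \<integral>\<^sup>+w. I (norm (?T p q v - ?T p q w)) * J p q v w \<partial>lborel \<partial>lborel \<partial>lborel) \<partial>lborel)"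
      by (simp add: nn_integral_cmult)
    finally show ?thesis .
  qed
  have slice: "ennreal (beta_const CARD('n) R) * (\<integral>\<^sup>+v. \<integral>\<^sup>+w. J p q v w \<partial>lborel \<partial>lborel)
     \<le> ennreal (8 * alpha_const CARD('n)) * (\<integral>\<^sup>+v. \<integral>\<^sup>+w. indicator {R..} (norm (?T p q v - ?T p q w)) * J p q v w \<partial>lborel \<partial>lborel)" for p q
    unfolding J_def by (rule on_line_inequality[OF \<open>i \<noteq> j\<close> \<open>R \<ge> 0\<close>]) measurable
  have pull: "c * (\<integral>\<^sup>+p. a p * (\<integral>\<^sup>+q. H p q \<partial>lborel) \<partial>lborel) = (\<integral>\<^sup>+p. a p * (\<integral>\<^sup>+q. c * H p q \<partial>lborel) \<partial>lborel)"
    if [measurable]: "(\<lambda>(p, q). H p q) \<in> borel_measurable (borel \<Otimes>\<^sub>M borel)" "a \<in> borel_measurable borel"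
    for c and a :: "real \<Rightarrow> ennreal" and H :: "real \<Rightarrow> real \<Rightarrow> ennreal"
  proof -
    have "(\<integral>\<^sup>+p. a p * (\<integral>\<^sup>+q. c * H p q \<partial>lborel) \<partial>lborel) = (\<integral>\<^sup>+p. c * (a p * (\<integral>\<^sup>+q. H p q \<partial>lborel)) \<partial>lborel)"
      by (simp add: nn_integral_cmult ac_simps)
    then show ?thesis by (simp add: nn_integral_cmult)
  qed
  have "ennreal (beta_const CARD('n) R) * (ennreal pi * (\<integral>\<^sup>+v. \<integral>\<^sup>+w. K v w \<partial>lborel \<partial>lborel))
     = (\<integral>\<^sup>+p. ennreal (1 / sqrt (1 + p\<^sup>2) ^ 3) * (\<integral>\<^sup>+q. ennreal (beta_const CARD('n) R) * (\<integral>\<^sup>+v. \<integral>\<^sup>+w. J p q v w \<partial>lborel \<partial>lborel) \<partial>lborel) \<partial>lborel)"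
    using main[of "\<lambda>_. 1"] by (subst pull[symmetric]) simp_all
  also have "\<dots> \<le> (\<integral>\<^sup>+p. ennreal (1 / sqrt (1 + p\<^sup>2) ^ 3) * (\<integral>\<^sup>+q. ennreal (8 * alpha_const CARD('n)) *
       (\<integral>\<^sup>+v. \<integral>\<^sup>+w. indicator {R..} (norm (?T p q v - ?T p q w)) * J p q v w \<partial>lborel \<partial>lborel) \<partial>lborel) \<partial>lborel)"
    by (intro nn_integral_mono mult_left_mono slice) auto
  also have "\<dots> = ennreal (8 * alpha_const CARD('n)) * (ennreal pi * (\<integral>\<^sup>+v. \<integral>\<^sup>+w. indicator {R..} (norm (v - w)) * K v w \<partial>lborel \<partial>lborel))"
    using main[of "indicator {R..}"] by (subst pull[symmetric]) simp_all
  finally have le: "ennreal (beta_const CARD('n) R) * (ennreal pi * (\<integral>\<^sup>+v. \<integral>\<^sup>+w. K v w \<partial>lborel \<partial>lborel))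
     \<le> ennreal (8 * alpha_const CARD('n)) * (ennreal pi * (\<integral>\<^sup>+v. \<integral>\<^sup>+w. indicator {R..} (norm (v - w)) * K v w \<partial>lborel \<partial>lborel))" .
  have one: "ennreal (1 / pi) * (c * (ennreal pi * I)) = c * I" for c I
  proof -
    have "ennreal (1 / pi) * (c * (ennreal pi * I)) = (ennreal (1 / pi) * ennreal pi) * (c * I)" by (simp only: ac_simps)
    also have "ennreal (1 / pi) * ennreal pi = 1" by (simp flip: ennreal_mult)
    finally show ?thesis by simp
  qed
  from mult_left_mono[OF le, of "ennreal (1 / pi)"] show ?thesis unfolding one by simp
qed

text \<open>An orthogonal map taking the first axis to \<open>a\<close> is followed by the
  reflection that exchanges the image of the second axis with \<open>b\<close>. The reflection fixes
  \<open>a\<close>, since \<open>a\<close> is orthogonal to both of these vectors.\<close>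

lemma exists_orthogonal_frame:
  fixes a b :: "real^'n::finite"
  assumes "i \<noteq> j" "norm a = 1" "norm b = 1" "a \<bullet> b = 0"
  obtains Q :: "real^'n \<Rightarrow> real^'n" where "orthogonal_transformation Q" "Q (axis i 1) = a" "Q (axis j 1) = b"
proof -
  have "norm (axis i 1 :: real^'n) = norm a" using assms by simp
  then obtain Q1 :: "real^'n \<Rightarrow> real^'n" where Q1: "orthogonal_transformation Q1" "Q1 (axis i 1) = a"
    by (rule orthogonal_transformation_exists)
  define e where "e = Q1 (axis j 1)"
  have e: "norm e = 1" "a \<bullet> e = 0"
  proof -
    show "norm e = 1" using Q1 by (simp add: e_def orthogonal_transformation_norm)
    have "Q1 (axis i 1) \<bullet> Q1 (axis j 1) = axis i 1 \<bullet> (axis j 1 :: real^'n)"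
      using Q1(1) unfolding orthogonal_transformation_def by blast
    then show "a \<bullet> e = 0" using \<open>i \<noteq> j\<close> by (simp add: e_def Q1 inner_axis_axis)
  qed
  define d where "d = e - b"
  define S where "S x = x - (2 * (x \<bullet> d) / (d \<bullet> d)) *\<^sub>R d" for x
  have ad: "a \<bullet> d = 0" using e assms by (simp add: d_def inner_diff_right)
  have S: "orthogonal_transformation S"
    unfolding orthogonal_transformation
  proof (intro conjI allI)
    show "linear S" unfolding S_def
      by (rule linearI) (simp_all add: inner_add_left algebra_simps add_divide_distrib scaleR_left_distrib)
    fix x
    have "(norm (S x))\<^sup>2 = (norm x)\<^sup>2"
      by (cases "d = 0") (auto simp: S_def power2_norm_eq_inner inner_diff_left inner_diff_right inner_commute field_simps)
    then show "norm (S x) = norm x" by simp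
  qed
  have Sa: "S a = a" by (simp add: S_def ad)
  have Se: "S e = b"
  proof (cases "d = 0")
    case False
    have "e \<bullet> e = 1" "b \<bullet> b = 1" using e assms by (simp_all add: dot_square_norm)
    then have "2 * (e \<bullet> d) = d \<bullet> d" by (simp add: d_def inner_diff_left inner_diff_right inner_commute)
    then have "S e = e - d" using False by (simp add: S_def)
    then show ?thesis by (simp add: d_def)
  qed (simp add: S_def d_def)
  show ?thesis
  proof (rule that)
    show "orthogonal_transformation (S \<circ> Q1)" by (rule orthogonal_transformation_compose) fact+
    show "(S \<circ> Q1) (axis i 1) = a" by (simp add: Q1 Sa)
    show "(S \<circ> Q1) (axis j 1) = b" by (simp add: e_def[symmetric] Se)
  qed
qed

lemma orthogonal_transformation_inner:
  "orthogonal_transformation Q \<Longrightarrow> Q x \<bullet> Q y = x \<bullet> y"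
  by (simp add: orthogonal_transformation_def)

lemma frame_inequality:
  fixes a b :: "real^'n::finite" and G :: "real^'n \<Rightarrow> real^'n"
  assumes card: "CARD('n) \<ge> 2" and ab: "norm a = 1" "norm b = 1" "a \<bullet> b = 0" and "R \<ge> 0"
    and [measurable]: "G \<in> borel_measurable borel"
  defines "K \<equiv> \<lambda>v w. ennreal (frame_kernel a b (v - w) (G v - G w) * (maxw v * maxw w))"
  shows "ennreal (beta_const CARD('n) R) * (\<integral>\<^sup>+v. \<integral>\<^sup>+w. K v w \<partial>lborel \<partial>lborel)
    \<le> ennreal (8 * alpha_const CARD('n)) * (\<integral>\<^sup>+v. \<integral>\<^sup>+w. indicator {R..} (norm (v - w)) * K v w \<partial>lborel \<partial>lborel)"
proof -
  obtain i j :: 'n where "i \<noteq> j"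
    using card by (metis One_nat_def card_1_singleton_iff card_2_iff' ex_card subset_UNIV)
  obtain Q :: "real^'n \<Rightarrow> real^'n" where Q: "orthogonal_transformation Q" "Q (axis i 1) = a" "Q (axis j 1) = b"
    using exists_orthogonal_frame[OF \<open>i \<noteq> j\<close> ab] by blast
  have iQ: "orthogonal_transformation (inv Q)" using Q(1) by (rule orthogonal_transformation_inv)
  have lin: "linear Q" "linear (inv Q)" using Q iQ by (auto intro: orthogonal_transformation_linear)
  have QiQ: "Q (inv Q x) = x" for x
    using orthogonal_transformation_surj[OF Q(1)] by (simp add: surj_f_inv_f)
  have [measurable]: "Q \<in> borel_measurable borel" "inv Q \<in> borel_measurable borel"
    by (intro borel_measurable_continuous_onI linear_continuous_on linear_conv_bounded_linear[THEN iffD1] lin)+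
  define G' where "G' v = inv Q (G (Q v))" for v
  have [measurable]: "G' \<in> borel_measurable borel" unfolding G'_def by measurable
  have [measurable (raw)]: "(\<lambda>x. K (f x) (g x)) \<in> borel_measurable N"
    if [measurable]: "f \<in> borel_measurable N" "g \<in> borel_measurable N" for f g and N :: "'z measure"
    unfolding K_def by measurable
  have inn: "x \<bullet> axis i 1 = Q x \<bullet> a" "x \<bullet> axis j 1 = Q x \<bullet> b" for x
    using orthogonal_transformation_inner[OF Q(1), of x] by (simp_all flip: Q(2,3))
  have K: "ennreal (frame_kernel (axis i 1) (axis j 1) (v - w) (G' v - G' w) * (maxw v * maxw w)) = K (Q v) (Q w)" for v w
    by (simp add: K_def frame_kernel_def inn linear_diff[OF lin(1)] linear_diff[OF lin(2)] G'_def QiQ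
        maxw_def orthogonal_transformation_norm[OF Q(1)] flip: orthogonal_transformation_norm[OF Q(1), of "v - w"])
  have rot: "(\<integral>\<^sup>+v. \<integral>\<^sup>+w. I (norm (v - w)) * K (Q v) (Q w) \<partial>lborel \<partial>lborel) = (\<integral>\<^sup>+v. \<integral>\<^sup>+w. I (norm (v - w)) * K v w \<partial>lborel \<partial>lborel)"
    if [measurable]: "I \<in> borel_measurable borel" for I :: "real \<Rightarrow> ennreal"
  proof -
    have "(\<integral>\<^sup>+v. \<integral>\<^sup>+w. I (norm (v - w)) * K (Q v) (Q w) \<partial>lborel \<partial>lborel)
      = (\<integral>\<^sup>+v. \<integral>\<^sup>+w. I (norm (Q v - Q w)) * K (Q v) (Q w) \<partial>lborel \<partial>lborel)"
      by (simp add: linear_diff[OF lin(1), symmetric] orthogonal_transformation_norm[OF Q(1)])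
    also have "\<dots> = (\<integral>\<^sup>+v. \<integral>\<^sup>+w. I (norm (Q v - w)) * K (Q v) w \<partial>lborel \<partial>lborel)"
      by (intro nn_integral_cong nn_integral_lborel_orthogonal[OF Q(1)]) measurable
    also have "\<dots> = (\<integral>\<^sup>+v. \<integral>\<^sup>+w. I (norm (v - w)) * K v w \<partial>lborel \<partial>lborel)"
      by (intro nn_integral_lborel_orthogonal[OF Q(1)]) measurable
    finally show ?thesis .
  qed
  have "ennreal (beta_const CARD('n) R) * (\<integral>\<^sup>+v. \<integral>\<^sup>+w. K (Q v) (Q w) \<partial>lborel \<partial>lborel)
    \<le> ennreal (8 * alpha_const CARD('n)) * (\<integral>\<^sup>+v. \<integral>\<^sup>+w. indicator {R..} (norm (v - w)) * K (Q v) (Q w) \<partial>lborel \<partial>lborel)"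
    unfolding K[symmetric] by (rule axis_frame_inequality) fact+
  then show ?thesis
    using rot[of "\<lambda>_. 1"] rot[of "indicator {R..}"] by simp
qed

text \<open>The kernel of an orthonormal frame, written for an arbitrary basis of its plane. The
  vector (\<xi> \<bullet> u) \<zeta> - (\<zeta> \<bullet> u) \<xi> is the direction of the plane
  orthogonal to u, and the root of the Gram determinant makes the expression independent of the
  basis. An average over pairs of vectors can then replace one over the Grassmannian; dependent
  pairs contribute 0.\<close>

definition span_kernel :: "real^'n::finite \<Rightarrow> real^'n \<Rightarrow> real^'n \<Rightarrow> real^'n \<Rightarrow> real" where
  "span_kernel \<xi> \<zeta> u X = norm u ^ 3 * sqrt ((\<xi> \<bullet> \<xi>) * (\<zeta> \<bullet> \<zeta>) - (\<xi> \<bullet> \<zeta>)\<^sup>2)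
     * ((((\<xi> \<bullet> u) *\<^sub>R \<zeta> - (\<zeta> \<bullet> u) *\<^sub>R \<xi>) \<bullet> X)\<^sup>2 / norm ((\<xi> \<bullet> u) *\<^sub>R \<zeta> - (\<zeta> \<bullet> u) *\<^sub>R \<xi>) ^ 3)"

lemma measurable_span_kernel [measurable (raw)]:
  assumes [measurable]: "f1 \<in> borel_measurable N" "f2 \<in> borel_measurable N" "f3 \<in> borel_measurable N" "f4 \<in> borel_measurable N"
  shows "(\<lambda>x. span_kernel (f1 x) (f2 x) (f3 x) (f4 x)) \<in> borel_measurable N"
  unfolding span_kernel_def by measurable

lemma gram_nonneg: "(\<xi> \<bullet> \<xi>) * (\<zeta> \<bullet> \<zeta>) - (\<xi> \<bullet> \<zeta>)\<^sup>2 \<ge> (0::real)"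
  using Cauchy_Schwarz_ineq[of \<xi> \<zeta>] by linarith

lemma span_kernel_nonneg [simp]: "span_kernel \<xi> \<zeta> u X \<ge> 0"
  unfolding span_kernel_def by (intro mult_nonneg_nonneg divide_nonneg_nonneg real_sqrt_ge_zero gram_nonneg) auto

text \<open>Gram-Schmidt: \<xi> = x a and \<zeta> = y a + z b. The Gram determinant is (x z)^2 and
  the normal vector scales by x z, so all powers of x z cancel.\<close>

lemma span_kernel_frame:
  fixes \<xi> \<zeta> :: "real^'n::finite"
  assumes ne: "(\<xi> \<bullet> \<xi>) * (\<zeta> \<bullet> \<zeta>) - (\<xi> \<bullet> \<zeta>)\<^sup>2 \<noteq> 0"
  obtains a b where "norm a = 1" "norm b = 1" "a \<bullet> b = 0" "\<And>u X. span_kernel \<xi> \<zeta> u X = frame_kernel a b u X"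
proof -
  define x where "x = norm \<xi>"
  have "\<xi> \<noteq> 0" using ne by auto
  then have x: "x > 0" by (simp add: x_def)
  define a where "a = \<xi> /\<^sub>R x"
  have a: "norm a = 1" "\<xi> = x *\<^sub>R a" using x by (simp_all add: a_def x_def)
  define y where "y = \<zeta> \<bullet> a"
  define c where "c = \<zeta> - y *\<^sub>R a"
  have aa: "a \<bullet> a = 1" using a by (simp add: dot_square_norm)
  have ca: "c \<bullet> a = 0" by (simp add: c_def inner_diff_left y_def aa)
  define z where "z = norm c"
  have \<zeta>: "\<zeta> = y *\<^sub>R a + c" by (simp add: c_def)
  have gram: "(\<xi> \<bullet> \<xi>) * (\<zeta> \<bullet> \<zeta>) - (\<xi> \<bullet> \<zeta>)\<^sup>2 = x\<^sup>2 * z\<^sup>2"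
    unfolding \<zeta> a(2) z_def power2_norm_eq_inner
    by (simp add: inner_add_left inner_add_right aa ca inner_commute[of a c] power2_eq_square algebra_simps)
  with ne have z: "z > 0" by (auto simp: z_def)
  define b where "b = c /\<^sub>R z"
  have b: "norm b = 1" "c = z *\<^sub>R b" using z by (simp_all add: b_def z_def)
  have ab: "a \<bullet> b = 0" using ca by (simp add: b_def inner_commute)
  have bb: "b \<bullet> b = 1" using b by (simp add: dot_square_norm)
  have \<zeta>': "\<zeta> = y *\<^sub>R a + z *\<^sub>R b" using \<zeta> b by simp
  have "span_kernel \<xi> \<zeta> u X = frame_kernel a b u X" for u X
  proof -
    define N where "N = (u \<bullet> a) *\<^sub>R b - (u \<bullet> b) *\<^sub>R a"
    have n: "(\<xi> \<bullet> u) *\<^sub>R \<zeta> - (\<zeta> \<bullet> u) *\<^sub>R \<xi> = (x * z) *\<^sub>R N"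
      unfolding \<zeta>' a(2) N_def by (simp add: inner_add_left inner_commute algebra_simps)
    have N2: "norm N = sqrt ((u \<bullet> a)\<^sup>2 + (u \<bullet> b)\<^sup>2)"
      unfolding norm_eq_sqrt_inner N_def
      by (simp add: inner_diff_left inner_diff_right aa bb ab inner_commute[of b a] power2_eq_square)
    have NX: "N \<bullet> X = (u \<bullet> a) * (X \<bullet> b) - (u \<bullet> b) * (X \<bullet> a)"
      by (simp add: N_def inner_diff_left inner_commute[of X])
    have gen: "n3 * t * ((t * r)\<^sup>2 / (t * s) ^ 3) = n3 / s ^ 3 * r\<^sup>2" if "t > 0" for n3 t r s :: real
      using that by (simp add: power_mult_distrib power2_eq_square power3_eq_cube)
    have "sqrt ((\<xi> \<bullet> \<xi>) * (\<zeta> \<bullet> \<zeta>) - (\<xi> \<bullet> \<zeta>)\<^sup>2) = x * z"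
      unfolding gram using x z by (simp add: real_sqrt_mult)
    then show ?thesis
      unfolding span_kernel_def frame_kernel_def n N2[symmetric] NX[symmetric]
      using gen[of "x * z" "norm u ^ 3" "N \<bullet> X" "norm N"] x z by simp
  qed
  then show ?thesis using that a(1) b(1) ab by blast
qed

lemma span_inequality:
  fixes \<xi> \<zeta> :: "real^'n::finite" and G :: "real^'n \<Rightarrow> real^'n"
  assumes card: "CARD('n) \<ge> 2" and "R \<ge> 0" and [measurable]: "G \<in> borel_measurable borel"
  defines "K \<equiv> \<lambda>v w. ennreal (span_kernel \<xi> \<zeta> (v - w) (G v - G w) * (maxw v * maxw w))"
  shows "ennreal (beta_const CARD('n) R) * (\<integral>\<^sup>+v. \<integral>\<^sup>+w. K v w \<partial>lborel \<partial>lborel)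
    \<le> ennreal (8 * alpha_const CARD('n)) * (\<integral>\<^sup>+v. \<integral>\<^sup>+w. indicator {R..} (norm (v - w)) * K v w \<partial>lborel \<partial>lborel)"
proof (cases "(\<xi> \<bullet> \<xi>) * (\<zeta> \<bullet> \<zeta>) - (\<xi> \<bullet> \<zeta>)\<^sup>2 = 0")
  case True
  then show ?thesis by (simp add: K_def span_kernel_def)
next
  case False
  then obtain a b where "norm a = 1" "norm b = 1" "a \<bullet> b = 0" and k: "\<And>u X. span_kernel \<xi> \<zeta> u X = frame_kernel a b u X"
    using span_kernel_frame by blast
  then show ?thesis
    unfolding K_def k by (intro frame_inequality card \<open>R \<ge> 0\<close>) auto
qed

text \<open>Averaging over the planes spanned by \<open>\<xi>\<close> and \<open>\<zeta>\<close> gives, by rotation invariance, a multiple of the Landau kernel.\<close>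

definition mean_kernel :: "real^'n::finite \<Rightarrow> real^'n \<Rightarrow> ennreal" where
  "mean_kernel u X = (\<integral>\<^sup>+\<xi>. \<integral>\<^sup>+\<zeta>. indicator (ball 0 1) \<xi> * (indicator (ball 0 1) \<zeta> * ennreal (span_kernel \<xi> \<zeta> u X)) \<partial>lborel \<partial>lborel)"

lemma span_kernel_orthogonal:
  assumes "orthogonal_transformation Q"
  shows "span_kernel (Q \<xi>) (Q \<zeta>) (Q u) (Q X) = span_kernel \<xi> \<zeta> u X"
proof -
  have lin: "linear Q" using assms by (rule orthogonal_transformation_linear)
  have n: "(Q \<xi> \<bullet> Q u) *\<^sub>R Q \<zeta> - (Q \<zeta> \<bullet> Q u) *\<^sub>R Q \<xi> = Q ((\<xi> \<bullet> u) *\<^sub>R \<zeta> - (\<zeta> \<bullet> u) *\<^sub>R \<xi>)"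
    by (simp add: linear_diff[OF lin] linear_scale[OF lin] orthogonal_transformation_inner[OF assms])
  show ?thesis
    unfolding span_kernel_def n by (simp add: orthogonal_transformation_inner[OF assms] orthogonal_transformation_norm[OF assms])
qed

lemma mean_kernel_orthogonal:
  fixes Q :: "real^'n::finite \<Rightarrow> real^'n"
  assumes Q: "orthogonal_transformation Q"
  shows "mean_kernel (Q u) (Q X) = mean_kernel u X"
proof -
  let ?f = "\<lambda>\<xi> \<zeta>. indicator (ball 0 1) \<xi> * (indicator (ball 0 1) \<zeta> * ennreal (span_kernel \<xi> \<zeta> (Q u) (Q X)))"
  have [measurable]: "ball (0 :: real^'n) 1 \<in> sets borel" by simp
  have ind: "indicator (ball 0 1) (Q x) = (indicator (ball 0 1) x :: ennreal)" for x
    by (simp add: indicator_def dist_norm orthogonal_transformation_norm[OF Q])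
  have "mean_kernel (Q u) (Q X) = (\<integral>\<^sup>+\<xi>. \<integral>\<^sup>+\<zeta>. ?f (Q \<xi>) \<zeta> \<partial>lborel \<partial>lborel)"
    unfolding mean_kernel_def by (rule nn_integral_lborel_orthogonal[OF Q, symmetric]) measurable
  also have "\<dots> = (\<integral>\<^sup>+\<xi>. \<integral>\<^sup>+\<zeta>. ?f (Q \<xi>) (Q \<zeta>) \<partial>lborel \<partial>lborel)"
    by (intro nn_integral_cong nn_integral_lborel_orthogonal[OF Q, symmetric]) measurable
  also have "\<dots> = mean_kernel u X"
    by (simp add: ind span_kernel_orthogonal[OF Q] mean_kernel_def)
  finally show ?thesis .
qed

text \<open>A rotation brings u and X into the plane of two axes, as r e and s e + t f. There
  homogeneity yields the factor r^2 t^2, which is the Gram determinant of u and X; the part of X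
  along u drops out because the normal vector is orthogonal to u.\<close>

lemma mean_kernel_eq:
  fixes u X :: "real^'n::finite" and i j :: 'n
  assumes "i \<noteq> j"
  shows "mean_kernel u X = mean_kernel (axis i 1 :: real^'n) (axis j 1) * ennreal ((u \<bullet> u) * (X \<bullet> X) - (u \<bullet> X)\<^sup>2)"
proof (cases "(u \<bullet> u) * (X \<bullet> X) - (u \<bullet> X)\<^sup>2 = 0")
  case True
  have "span_kernel \<xi> \<zeta> u X = 0" for \<xi> \<zeta>
  proof (cases "u = 0")
    case False
    then have uu: "u \<bullet> u \<noteq> 0" by simp
    define t where "t = (u \<bullet> X) / (u \<bullet> u)"
    have "(X - t *\<^sub>R u) \<bullet> (X - t *\<^sub>R u) = 0"
      using True uu by (simp add: t_def inner_diff_left inner_diff_right inner_commute power2_eq_square field_simps)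
    then have "X = t *\<^sub>R u" by simp
    then show ?thesis by (simp add: span_kernel_def inner_diff_left)
  qed (simp add: span_kernel_def)
  then show ?thesis by (simp add: mean_kernel_def True)
next
  case False
  have "u \<noteq> 0" using False by auto
  then obtain a b where ab: "norm a = 1" "norm b = 1" "a \<bullet> b = 0" and "\<exists>r s t. u = r *\<^sub>R a \<and> X = s *\<^sub>R a + t *\<^sub>R b"
  proof -
    define x where "x = norm u"
    have x: "x > 0" using \<open>u \<noteq> 0\<close> by (simp add: x_def)
    define a where "a = u /\<^sub>R x"
    have a: "norm a = 1" "u = x *\<^sub>R a" using x by (simp_all add: a_def x_def)
    define c where "c = X - (X \<bullet> a) *\<^sub>R a"
    have aa: "a \<bullet> a = 1" using a by (simp add: dot_square_norm)
    have ca: "c \<bullet> a = 0" by (simp add: c_def inner_diff_left aa)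
    have "c \<noteq> 0"
    proof
      assume "c = 0"
      then have "X = (X \<bullet> a) *\<^sub>R a" by (simp add: c_def)
      then have "(u \<bullet> u) * (X \<bullet> X) - (u \<bullet> X)\<^sup>2 = 0"
        unfolding a(2) by (metis (no_types, lifting) aa inner_scaleR_left inner_scaleR_right mult.assoc mult.commute mult_1 power2_eq_square right_minus_eq)
      with False show False by simp
    qed
    then have "X = (X \<bullet> a) *\<^sub>R a + norm c *\<^sub>R (c /\<^sub>R norm c)" "norm (c /\<^sub>R norm c) = 1" "a \<bullet> (c /\<^sub>R norm c) = 0"
      using ca by (simp_all add: c_def inner_commute)
    then show thesis using that[of a "c /\<^sub>R norm c"] a by blast
  qed
  then obtain r s t where rst: "u = r *\<^sub>R a" "X = s *\<^sub>R a + t *\<^sub>R b" by blast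
  obtain Q :: "real^'n \<Rightarrow> real^'n" where Q: "orthogonal_transformation Q" "Q (axis i 1) = a" "Q (axis j 1) = b"
    using exists_orthogonal_frame[OF \<open>i \<noteq> j\<close> ab] by blast
  have lin: "linear Q" using Q(1) by (rule orthogonal_transformation_linear)
  let ?e = "axis i 1 :: real^'n" and ?f = "axis j 1 :: real^'n"
  have "u = Q (r *\<^sub>R ?e)" "X = Q (s *\<^sub>R ?e + t *\<^sub>R ?f)"
    unfolding linear_add[OF lin] linear_scale[OF lin] Q(2,3) by (fact rst)+
  then have "mean_kernel u X = mean_kernel (r *\<^sub>R ?e) (s *\<^sub>R ?e + t *\<^sub>R ?f)"
    using mean_kernel_orthogonal[OF Q(1)] by simp
  also have "\<dots> = mean_kernel ?e ?f * ennreal (r\<^sup>2 * t\<^sup>2)"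
  proof -
    have "span_kernel \<xi> \<zeta> (r *\<^sub>R ?e) (s *\<^sub>R ?e + t *\<^sub>R ?f) = span_kernel \<xi> \<zeta> ?e ?f * (r\<^sup>2 * t\<^sup>2)" for \<xi> \<zeta>
    proof -
      define N where "N = (\<xi> \<bullet> ?e) *\<^sub>R \<zeta> - (\<zeta> \<bullet> ?e) *\<^sub>R \<xi>"
      have n: "(\<xi> \<bullet> (r *\<^sub>R ?e)) *\<^sub>R \<zeta> - (\<zeta> \<bullet> (r *\<^sub>R ?e)) *\<^sub>R \<xi> = r *\<^sub>R N"
        by (simp add: N_def algebra_simps)
      have NX: "(r *\<^sub>R N) \<bullet> (s *\<^sub>R ?e + t *\<^sub>R ?f) = r * t * (N \<bullet> ?f)"
        by (simp add: N_def inner_add_right inner_diff_left)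
      have gen: "\<bar>r\<bar> ^ 3 * D * ((r * t * y)\<^sup>2 / (\<bar>r\<bar> * m) ^ 3) = 1 ^ 3 * D * (y\<^sup>2 / m ^ 3) * (r\<^sup>2 * t\<^sup>2)" for D y m :: real
        by (cases "r = 0") (simp_all add: power_mult_distrib)
      show ?thesis
        unfolding span_kernel_def n NX N_def[symmetric] norm_scaleR norm_axis_1 mult_1_right
        by (rule gen)
    qed
    then have k: "ennreal (span_kernel \<xi> \<zeta> (r *\<^sub>R ?e) (s *\<^sub>R ?e + t *\<^sub>R ?f)) = ennreal (span_kernel \<xi> \<zeta> ?e ?f) * ennreal (r\<^sup>2 * t\<^sup>2)" for \<xi> \<zeta>
      by (simp add: ennreal_mult)
    have [measurable]: "ball (0 :: real^'n) 1 \<in> sets borel" by simp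
    show ?thesis
      unfolding mean_kernel_def k mult.assoc[symmetric] by (subst nn_integral_multc, measurable)+
  qed
  also have "r\<^sup>2 * t\<^sup>2 = (u \<bullet> u) * (X \<bullet> X) - (u \<bullet> X)\<^sup>2"
  proof -
    have "a \<bullet> a = 1" "b \<bullet> b = 1" "b \<bullet> a = 0"
      using ab by (simp_all add: dot_square_norm inner_commute)
    with ab(3) show ?thesis
      unfolding rst by (simp add: inner_add_left inner_add_right power2_eq_square algebra_simps)
  qed
  finally show ?thesis .
qed

section \<open>The averaged kernel is finite and nonzero\<close>

lemma nn_integral_inverse_sqrt_finite:
  "(\<integral>\<^sup>+t. indicator {-1..1} t * ennreal (1 / sqrt \<bar>t\<bar>) \<partial>lborel) < \<infinity>"
proof -
  let ?h = "\<lambda>t::real. ennreal (t powr (-1/2)) * indicator {0..1} t"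
  have "((\<lambda>t. t powr (-1/2)) has_integral (1 powr (-1/2 + 1) / (-1/2 + 1))) {0..1::real}"
    by (rule has_integral_powr_from_0) auto
  then have h: "(\<integral>\<^sup>+t. ?h t \<partial>lborel) = ennreal (1 powr (-1/2 + 1) / (-1/2 + 1))"
    by (intro nn_integral_has_integral_lebesgue') auto
  have "(\<integral>\<^sup>+t. indicator {-1..1} t * ennreal (1 / sqrt \<bar>t\<bar>) \<partial>lborel) \<le> (\<integral>\<^sup>+t. ?h t + ?h (- t) \<partial>lborel)"
    by (intro nn_integral_mono) (auto split: split_indicator simp: powr_minus_divide powr_half_sqrt)
  also have "\<dots> = (\<integral>\<^sup>+t. ?h t \<partial>lborel) + (\<integral>\<^sup>+t. ?h (- t) \<partial>lborel)"
    by (rule nn_integral_add) measurable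
  also have "(\<integral>\<^sup>+t. ?h (- t) \<partial>lborel) = (\<integral>\<^sup>+t. ?h t \<partial>lborel)"
    by (rule nn_integral_lborel_uminus) measurable
  also have "(\<integral>\<^sup>+t. ?h t \<partial>lborel) + (\<integral>\<^sup>+t. ?h t \<partial>lborel) < \<infinity>"
    unfolding h by simp
  finally show ?thesis .
qed

lemma nn_integral_ball_inverse_sqrt_finite:
  "(\<integral>\<^sup>+v. indicator (ball 0 1) v * ennreal (1 / sqrt \<bar>v $ i\<bar>) \<partial>(lborel :: (real^'n::finite) measure)) < \<infinity>"
proof -
  let ?C = "cbox (\<chi> k. - 1) (\<chi> k. 1) :: (real^'n) set"
  let ?S = "\<lambda>v. indicator ?C v * ennreal (1 / sqrt \<bar>v $ i\<bar>)"
  let ?I = "\<integral>\<^sup>+t. indicator {-1..1} t * ennreal (1 / sqrt \<bar>t\<bar>) \<partial>lborel"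
  have [measurable]: "?C \<in> sets borel" "ball (0 :: real^'n) 1 \<in> sets borel" by simp_all
  have sub: "ball 0 1 \<subseteq> ?C"
  proof
    fix v :: "real^'n" assume "v \<in> ball 0 1"
    then have "\<bar>v $ k\<bar> \<le> 1" for k using component_le_norm_cart[of v k] by simp
    then show "v \<in> ?C" by (auto simp: mem_box_cart abs_le_iff minus_le_iff)
  qed
  have "(\<integral>\<^sup>+v. indicator (ball 0 1) v * ennreal (1 / sqrt \<bar>v $ i\<bar>) \<partial>lborel) \<le> (\<integral>\<^sup>+v. ?S v \<partial>lborel)"
    using sub by (intro nn_integral_mono mult_right_mono) (auto split: split_indicator)
  \<comment> \<open>Here the dummy weight is the indicator of [-1, 1], of mass 2 >= 1, which keeps
    the integration inside the cube.\<close>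
  also have "\<dots> \<le> (\<integral>\<^sup>+t. indicator {-1..1::real} t \<partial>lborel) * (\<integral>\<^sup>+v. ?S v \<partial>lborel)"
    using mult_right_mono[of 1 2 "\<integral>\<^sup>+v. ?S v \<partial>lborel"] by simp
  also have "\<dots> = (\<integral>\<^sup>+v. \<integral>\<^sup>+t. ?S (set_coord i t v) * indicator {-1..1} (v $ i) \<partial>lborel \<partial>lborel)"
    by (rule nn_integral_resample[symmetric]) measurable
  also have "\<dots> \<le> (\<integral>\<^sup>+v. \<integral>\<^sup>+t. (indicator {-1..1} t * ennreal (1 / sqrt \<bar>t\<bar>)) * indicator ?C v \<partial>lborel \<partial>lborel)"
  proof (intro nn_integral_mono)
    fix v :: "real^'n" and t
    have "v \<in> ?C \<and> t \<in> {-1..1}" if "set_coord i t v \<in> ?C" "v $ i \<in> {-1..1}"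
    proof -
      have "-1 \<le> v $ k \<and> v $ k \<le> 1" for k
        using that by (cases "k = i") (auto simp: mem_box_cart dest!: spec[of _ k])
      moreover have "-1 \<le> t \<and> t \<le> 1" using that(1) by (auto simp: mem_box_cart dest!: spec[of _ i])
      ultimately show ?thesis by (auto simp: mem_box_cart)
    qed
    then show "?S (set_coord i t v) * indicator {-1..1} (v $ i) \<le> (indicator {-1..1} t * ennreal (1 / sqrt \<bar>t\<bar>)) * indicator ?C v"
      by (cases "set_coord i t v \<in> ?C"; cases "v $ i \<in> {-1..1}") simp_all
  qed
  also have "\<dots> = ?I * emeasure lborel ?C"
    by (simp add: nn_integral_multc nn_integral_cmult)
  also have "\<dots> < \<infinity>"
    using nn_integral_inverse_sqrt_finite emeasure_lborel_cbox_finite[of "\<chi> k. - 1 :: real^'n" "\<chi> k. 1"]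
    by (auto intro!: ennreal_mult_less_top[THEN iffD2])
  finally show ?thesis .
qed

text \<open>The pair m, n arises from \<xi>, \<zeta> by a rotation scaled by \<rho>, so its Gram
  determinant is \<rho>^4 D. As the norm of m is at most 2 \<rho>, sqrt D * \<rho> is at most 2 norm
  n, which tames the singularity of the kernel at n = 0. The remaining 1 / \<rho> is bounded by a
  product that can be integrated separately in \<xi> and \<zeta>.\<close>

lemma span_kernel_axis_le:
  fixes \<xi> \<zeta> :: "real^'n::finite"
  assumes ne: "\<xi> $ i \<noteq> 0" "\<zeta> $ i \<noteq> 0" and le: "norm \<xi> \<le> 1" "norm \<zeta> \<le> 1"
  shows "span_kernel \<xi> \<zeta> (axis i 1) (axis j 1) \<le> 2 * ((1 / sqrt \<bar>\<xi> $ i\<bar>) * (1 / sqrt \<bar>\<zeta> $ i\<bar>))"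
proof -
  let ?x = "\<xi> $ i" and ?y = "\<zeta> $ i"
  define n where "n = ?x *\<^sub>R \<zeta> - ?y *\<^sub>R \<xi>"
  define m where "m = ?x *\<^sub>R \<xi> + ?y *\<^sub>R \<zeta>"
  define D where "D = (\<xi> \<bullet> \<xi>) * (\<zeta> \<bullet> \<zeta>) - (\<xi> \<bullet> \<zeta>)\<^sup>2"
  define \<rho> where "\<rho> = sqrt (?x\<^sup>2 + ?y\<^sup>2)"
  have \<rho>2: "\<rho>\<^sup>2 = ?x\<^sup>2 + ?y\<^sup>2" by (simp add: \<rho>_def)
  have \<rho>: "\<rho> > 0" using ne by (simp add: \<rho>_def add_pos_pos)
  have "D * (\<rho>\<^sup>2)\<^sup>2 = (m \<bullet> m) * (n \<bullet> n) - (m \<bullet> n)\<^sup>2"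
    unfolding \<rho>2 D_def m_def n_def
    by (simp add: inner_add_left inner_add_right inner_diff_left inner_diff_right inner_commute[of \<zeta> \<xi>] power2_eq_square algebra_simps)
  also have "\<dots> \<le> (norm m * norm n)\<^sup>2" by (simp add: dot_square_norm power_mult_distrib)
  finally have "sqrt (D * (\<rho>\<^sup>2)\<^sup>2) \<le> norm m * norm n"
    by (metis abs_of_nonneg mult_nonneg_nonneg norm_ge_zero real_sqrt_abs real_sqrt_le_mono)
  moreover have "sqrt (D * (\<rho>\<^sup>2)\<^sup>2) = sqrt D * \<rho>\<^sup>2"
    unfolding real_sqrt_mult real_sqrt_abs by simp
  ultimately have 1: "sqrt D * \<rho>\<^sup>2 \<le> norm m * norm n" by simp
  have "norm m \<le> \<bar>?x\<bar> * norm \<xi> + \<bar>?y\<bar> * norm \<zeta>"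
    unfolding m_def by (rule norm_triangle_le) simp
  also have "\<dots> \<le> \<rho> * 1 + \<rho> * 1"
    using le by (intro add_mono mult_mono) (auto simp: \<rho>_def intro!: real_le_rsqrt)
  finally have "norm m \<le> 2 * \<rho>" by simp
  then have "norm m * norm n \<le> 2 * \<rho> * norm n" by (rule mult_right_mono) simp
  with 1 have "(sqrt D * \<rho>) * \<rho> \<le> (2 * norm n) * \<rho>" by (simp add: power2_eq_square algebra_simps)
  then have 2: "sqrt D * \<rho> \<le> 2 * norm n" using \<rho> by simp
  have k: "span_kernel \<xi> \<zeta> (axis i 1) (axis j 1) = sqrt D * ((n $ j)\<^sup>2 / norm n ^ 3)"
    unfolding span_kernel_def D_def n_def by (simp add: inner_axis)
  have "span_kernel \<xi> \<zeta> (axis i 1) (axis j 1) \<le> 2 / \<rho>"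
  proof (cases "n = 0")
    case True
    then show ?thesis using \<rho> by (simp add: k)
  next
    case False
    have "(n $ j)\<^sup>2 \<le> (norm n)\<^sup>2"
      using component_le_norm_cart[of n j] by (simp add: power2_le_iff_abs_le)
    then have "(n $ j)\<^sup>2 / norm n ^ 3 \<le> (norm n)\<^sup>2 / norm n ^ 3" by (rule divide_right_mono) simp
    also have "\<dots> = 1 / norm n" using False by (simp add: power2_eq_square power3_eq_cube)
    finally have "span_kernel \<xi> \<zeta> (axis i 1) (axis j 1) \<le> sqrt D * (1 / norm n)"
      unfolding k by (rule mult_left_mono) (simp add: D_def gram_nonneg[of \<xi> \<zeta>, simplified])
    also have "\<dots> \<le> 2 / \<rho>" using 2 \<rho> False by (simp add: field_simps)
    finally show ?thesis .
  qed
  also have "\<dots> \<le> 2 * (1 / sqrt (\<bar>?x\<bar> * \<bar>?y\<bar>))"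
  proof -
    have "\<bar>?x\<bar> * \<bar>?y\<bar> \<le> ?x\<^sup>2 + ?y\<^sup>2"
      using sum_squares_bound[of "\<bar>?x\<bar>" "\<bar>?y\<bar>"] mult_nonneg_nonneg[OF abs_ge_zero[of ?x] abs_ge_zero[of ?y]]
      unfolding power2_abs by linarith
    then have "sqrt (\<bar>?x\<bar> * \<bar>?y\<bar>) \<le> \<rho>" unfolding \<rho>_def by simp
    then show ?thesis using ne \<rho> by (simp add: frac_le)
  qed
  also have "\<dots> = 2 * ((1 / sqrt \<bar>?x\<bar>) * (1 / sqrt \<bar>?y\<bar>))" by (simp add: real_sqrt_mult)
  finally show ?thesis .
qed

lemma mean_kernel_finite: "mean_kernel (axis i 1) (axis j 1 :: real^'n::finite) < \<infinity>"
proof -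
  let ?B = "ball (0 :: real^'n) 1"
  let ?S = "\<lambda>v :: real^'n. indicator ?B v * ennreal (1 / sqrt \<bar>v $ i\<bar>)"
  have [measurable]: "?B \<in> sets borel" by simp
  have "mean_kernel (axis i 1) (axis j 1 :: real^'n) \<le> (\<integral>\<^sup>+\<xi>. \<integral>\<^sup>+\<zeta>. 2 * (?S \<xi> * ?S \<zeta>) \<partial>lborel \<partial>lborel)"
    unfolding mean_kernel_def
  proof (rule nn_integral_mono_AE)
    show "AE \<xi> in lborel. (\<integral>\<^sup>+\<zeta>. indicator ?B \<xi> * (indicator ?B \<zeta> * ennreal (span_kernel \<xi> \<zeta> (axis i 1) (axis j 1))) \<partial>lborel)
       \<le> (\<integral>\<^sup>+\<zeta>. 2 * (?S \<xi> * ?S \<zeta>) \<partial>lborel)"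
      using AE_coord_neq[of i 0]
    proof eventually_elim
      fix \<xi> :: "real^'n" assume \<xi>: "\<xi> $ i \<noteq> 0"
      show "(\<integral>\<^sup>+\<zeta>. indicator ?B \<xi> * (indicator ?B \<zeta> * ennreal (span_kernel \<xi> \<zeta> (axis i 1) (axis j 1))) \<partial>lborel)
       \<le> (\<integral>\<^sup>+\<zeta>. 2 * (?S \<xi> * ?S \<zeta>) \<partial>lborel)"
      proof (rule nn_integral_mono_AE)
        show "AE \<zeta> in lborel. indicator ?B \<xi> * (indicator ?B \<zeta> * ennreal (span_kernel \<xi> \<zeta> (axis i 1) (axis j 1))) \<le> 2 * (?S \<xi> * ?S \<zeta>)"
          using AE_coord_neq[of i 0]
        proof eventually_elim
          fix \<zeta> :: "real^'n" assume \<zeta>: "\<zeta> $ i \<noteq> 0"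
          show "indicator ?B \<xi> * (indicator ?B \<zeta> * ennreal (span_kernel \<xi> \<zeta> (axis i 1) (axis j 1))) \<le> 2 * (?S \<xi> * ?S \<zeta>)"
          proof (cases "\<xi> \<in> ?B \<and> \<zeta> \<in> ?B")
            case True
            then have "ennreal (span_kernel \<xi> \<zeta> (axis i 1) (axis j 1)) \<le> ennreal (2 * ((1 / sqrt \<bar>\<xi> $ i\<bar>) * (1 / sqrt \<bar>\<zeta> $ i\<bar>)))"
              by (intro ennreal_leI span_kernel_axis_le \<xi> \<zeta>) auto
            also have "\<dots> = 2 * (ennreal (1 / sqrt \<bar>\<xi> $ i\<bar>) * ennreal (1 / sqrt \<bar>\<zeta> $ i\<bar>))"
              by (subst ennreal_mult, simp, simp, subst ennreal_mult, simp, simp, simp)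
            finally show ?thesis using True by simp
          qed auto
        qed
      qed
    qed
  qed
  also have "\<dots> = 2 * ((\<integral>\<^sup>+\<xi>. ?S \<xi> \<partial>lborel) * (\<integral>\<^sup>+\<xi>. ?S \<xi> \<partial>lborel))"
  proof -
    have "(\<integral>\<^sup>+\<xi>. \<integral>\<^sup>+\<zeta>. 2 * (S \<xi> * S \<zeta>) \<partial>lborel \<partial>lborel) = 2 * ((\<integral>\<^sup>+\<xi>. S \<xi> \<partial>lborel) * (\<integral>\<^sup>+\<xi>. S \<xi> \<partial>lborel))"
      if [measurable]: "S \<in> borel_measurable borel" for S :: "real^'n \<Rightarrow> ennreal"
      by (simp add: nn_integral_cmult nn_integral_multc)
    from this[of ?S] show ?thesis by measurable
  qed
  also have "\<dots> < \<infinity>"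
    using nn_integral_ball_inverse_sqrt_finite[of i] by (auto intro!: ennreal_mult_less_top[THEN iffD2])
  finally show ?thesis .
qed

lemma AE_lborel_ball:
  fixes P :: "'a::euclidean_space \<Rightarrow> bool"
  assumes "AE x in lborel. P x" "r > 0"
  shows "\<exists>x\<in>ball c r. P x"
proof (rule ccontr)
  assume "\<not> ?thesis"
  with assms(1) have "AE x in lborel. x \<notin> ball c r" by (auto elim: eventually_mono)
  then have "emeasure lborel (ball c r) = 0"
    by (subst (asm) AE_iff_measurable[OF _ refl]) (auto simp: ball_def)
  then have "measure lborel (ball c r) = 0" by (simp add: measure_def)
  then show False using content_ball_pos[OF \<open>r > 0\<close>, of c] by simp
qed

text \<open>Together with finiteness this permits cancelling the constant. If the average vanished,
  so would the kernel at some \<xi> near half of one axis vector and some \<zeta> near half of the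
  other; but there the Gram determinant and the j-th entry of the normal vector are
  positive.\<close>

lemma mean_kernel_pos:
  assumes "i \<noteq> j"
  shows "mean_kernel (axis i 1) (axis j 1 :: real^'n::finite) \<noteq> 0"
proof
  let ?B = "ball (0 :: real^'n) 1"
  have [measurable]: "?B \<in> sets borel" by simp
  assume "mean_kernel (axis i 1) (axis j 1 :: real^'n) = 0"
  then have "AE \<xi> in lborel. (\<integral>\<^sup>+\<zeta>. indicator ?B \<xi> * (indicator ?B \<zeta> * ennreal (span_kernel \<xi> \<zeta> (axis i 1) (axis j 1))) \<partial>lborel) = 0"
    unfolding mean_kernel_def by (subst (asm) nn_integral_0_iff_AE) measurable
  \<comment> \<open>Radius 1/8 around half an axis vector keeps the large coordinate above 3/8,
    every other one below 1/8 in modulus, and the point inside the unit ball.\<close>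
  from AE_lborel_ball[OF this, of "1/8" "(1/2) *\<^sub>R axis i 1"]
  obtain \<xi> where \<xi>: "\<xi> \<in> ball ((1/2) *\<^sub>R axis i 1) (1/8)"
    and "(\<integral>\<^sup>+\<zeta>. indicator ?B \<xi> * (indicator ?B \<zeta> * ennreal (span_kernel \<xi> \<zeta> (axis i 1) (axis j 1))) \<partial>lborel) = 0" by auto
  then have "AE \<zeta> in lborel. indicator ?B \<xi> * (indicator ?B \<zeta> * ennreal (span_kernel \<xi> \<zeta> (axis i 1) (axis j 1))) = 0"
    by (subst (asm) nn_integral_0_iff_AE) measurable
  from AE_lborel_ball[OF this, of "1/8" "(1/2) *\<^sub>R axis j 1"]
  obtain \<zeta> where \<zeta>: "\<zeta> \<in> ball ((1/2) *\<^sub>R axis j 1) (1/8)"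
    and z: "indicator ?B \<xi> * (indicator ?B \<zeta> * ennreal (span_kernel \<xi> \<zeta> (axis i 1) (axis j 1))) = 0" by auto
  have near: "\<bar>x $ k - (if k = l then 1/2 else 0)\<bar> < 1/8" "x \<in> ?B" if "x \<in> ball ((1/2) *\<^sub>R axis l 1) (1/8)" for x :: "real^'n" and k l
  proof -
    have d: "norm (x - (1/2) *\<^sub>R axis l 1) < 1/8" using that by (simp add: dist_norm norm_minus_commute)
    have "\<bar>(x - (1/2) *\<^sub>R axis l 1) $ k\<bar> < 1/8" using component_le_norm_cart[of "x - (1/2) *\<^sub>R axis l 1" k] d by linarith
    then show "\<bar>x $ k - (if k = l then 1/2 else 0)\<bar> < 1/8" by (auto simp: axis_def)
    have "norm x \<le> norm (x - (1/2) *\<^sub>R axis l 1) + norm ((1/2) *\<^sub>R axis l 1 :: real^'n)"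
      using norm_triangle_ineq[of "x - (1/2) *\<^sub>R axis l 1" "(1/2) *\<^sub>R axis l 1"] by simp
    with d show "x \<in> ?B" by simp
  qed
  have c: "\<xi> $ i > 3/8" "\<bar>\<xi> $ j\<bar> < 1/8" "\<zeta> $ j > 3/8" "\<bar>\<zeta> $ i\<bar> < 1/8"
    using near(1)[OF \<xi>, of i] near(1)[OF \<xi>, of j] near(1)[OF \<zeta>, of i] near(1)[OF \<zeta>, of j] \<open>i \<noteq> j\<close>
    by (simp_all add: abs_real_def split: if_splits)
  define n where "n = (\<xi> $ i) *\<^sub>R \<zeta> - (\<zeta> $ i) *\<^sub>R \<xi>"
  have nj: "n $ j > 0"
  proof -
    have "\<zeta> $ i * \<xi> $ j \<le> \<bar>\<zeta> $ i\<bar> * \<bar>\<xi> $ j\<bar>" by (metis abs_ge_self abs_mult)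
    also have "\<dots> \<le> 1/8 * (1/8)" using c by (intro mult_mono) auto
    also have "\<dots> < 3/8 * (3/8)" by simp
    also have "\<dots> \<le> \<xi> $ i * \<zeta> $ j" using c by (intro mult_mono) auto
    finally show ?thesis by (simp add: n_def)
  qed
  have "(\<xi> \<bullet> \<xi>) * (\<zeta> \<bullet> \<zeta>) - (\<xi> \<bullet> \<zeta>)\<^sup>2 \<noteq> 0"
  proof
    assume D: "(\<xi> \<bullet> \<xi>) * (\<zeta> \<bullet> \<zeta>) - (\<xi> \<bullet> \<zeta>)\<^sup>2 = 0"
    have xx: "\<xi> \<bullet> \<xi> \<noteq> 0" using c by auto
    define t where "t = (\<xi> \<bullet> \<zeta>) / (\<xi> \<bullet> \<xi>)"
    have "(\<zeta> - t *\<^sub>R \<xi>) \<bullet> (\<zeta> - t *\<^sub>R \<xi>) = 0"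
      using D xx by (simp add: t_def inner_diff_left inner_diff_right inner_commute power2_eq_square field_simps)
    then have "\<zeta> = t *\<^sub>R \<xi>" by simp
    then show False using nj by (simp add: n_def)
  qed
  then have "(\<xi> \<bullet> \<xi>) * (\<zeta> \<bullet> \<zeta>) - (\<xi> \<bullet> \<zeta>)\<^sup>2 > 0" using gram_nonneg[of \<xi> \<zeta>] by linarith
  moreover have "norm n > 0" using nj by auto
  moreover have "span_kernel \<xi> \<zeta> (axis i 1) (axis j 1) = sqrt ((\<xi> \<bullet> \<xi>) * (\<zeta> \<bullet> \<zeta>) - (\<xi> \<bullet> \<zeta>)\<^sup>2) * ((n $ j)\<^sup>2 / norm n ^ 3)"
    unfolding span_kernel_def n_def by (simp add: inner_axis)
  ultimately have "span_kernel \<xi> \<zeta> (axis i 1) (axis j 1) > 0" using nj by simp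
  then show False using z near(2)[OF \<xi>] near(2)[OF \<zeta>] by simp
qed

lemma nn_integral_swap4:
  fixes F :: "'a::euclidean_space \<Rightarrow> 'a \<Rightarrow> 'a \<Rightarrow> 'a \<Rightarrow> ennreal"
  assumes m[measurable (raw)]: "\<And>(N :: ('a \<times> 'a \<times> 'a \<times> 'a) measure) a b c d. a \<in> borel_measurable N \<Longrightarrow> b \<in> borel_measurable N \<Longrightarrow>
      c \<in> borel_measurable N \<Longrightarrow> d \<in> borel_measurable N \<Longrightarrow> (\<lambda>x. F (a x) (b x) (c x) (d x)) \<in> borel_measurable N"
  shows "(\<integral>\<^sup>+a. \<integral>\<^sup>+b. \<integral>\<^sup>+c. \<integral>\<^sup>+d. F a b c d \<partial>lborel \<partial>lborel \<partial>lborel \<partial>lborel)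
    = (\<integral>\<^sup>+c. \<integral>\<^sup>+d. \<integral>\<^sup>+a. \<integral>\<^sup>+b. F a b c d \<partial>lborel \<partial>lborel \<partial>lborel \<partial>lborel)"
proof -
  have F0: "(\<lambda>x. F (fst x) (fst (snd x)) (fst (snd (snd x))) (snd (snd (snd x)))) \<in> borel_measurable (borel \<Otimes>\<^sub>M (borel \<Otimes>\<^sub>M (borel \<Otimes>\<^sub>M borel)))"
    by measurable
  from measurable_compose[OF _ this] have F: "(\<lambda>x. F (a x) (b x) (c x) (d x)) \<in> borel_measurable N"
    if "a \<in> borel_measurable N" "b \<in> borel_measurable N" "c \<in> borel_measurable N" "d \<in> borel_measurable N"
    for a b c d and N :: "'z measure"
    using measurable_compose[OF _ F0, of "\<lambda>x. (a x, b x, c x, d x)" N] that by simp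
  note F[measurable (raw)]
  have "(\<integral>\<^sup>+a. \<integral>\<^sup>+b. \<integral>\<^sup>+c. \<integral>\<^sup>+d. F a b c d \<partial>lborel \<partial>lborel \<partial>lborel \<partial>lborel)
    = (\<integral>\<^sup>+a. \<integral>\<^sup>+c. \<integral>\<^sup>+b. \<integral>\<^sup>+d. F a b c d \<partial>lborel \<partial>lborel \<partial>lborel \<partial>lborel)"
    by (intro nn_integral_cong lborel_pair.Fubini') measurable
  also have "\<dots> = (\<integral>\<^sup>+c. \<integral>\<^sup>+a. \<integral>\<^sup>+b. \<integral>\<^sup>+d. F a b c d \<partial>lborel \<partial>lborel \<partial>lborel \<partial>lborel)"
    by (rule lborel_pair.Fubini') measurable
  also have "\<dots> = (\<integral>\<^sup>+c. \<integral>\<^sup>+a. \<integral>\<^sup>+d. \<integral>\<^sup>+b. F a b c d \<partial>lborel \<partial>lborel \<partial>lborel \<partial>lborel)"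
    by (intro nn_integral_cong lborel_pair.Fubini') measurable
  also have "\<dots> = (\<integral>\<^sup>+c. \<integral>\<^sup>+d. \<integral>\<^sup>+a. \<integral>\<^sup>+b. F a b c d \<partial>lborel \<partial>lborel \<partial>lborel \<partial>lborel)"
    by (intro nn_integral_cong lborel_pair.Fubini') measurable
  finally show ?thesis .
qed

definition perp_form :: "real^'n::finite \<Rightarrow> real^'n \<Rightarrow> real" where
  "perp_form u X = (u \<bullet> u) * (X \<bullet> X) - (u \<bullet> X)\<^sup>2"

lemma perp_form_nonneg [simp]: "perp_form u X \<ge> 0"
  by (simp only: perp_form_def gram_nonneg)

lemma measurable_perp_form [measurable (raw)]:
  assumes [measurable]: "f \<in> borel_measurable N" "g \<in> borel_measurable N"
  shows "(\<lambda>x. perp_form (f x) (g x)) \<in> borel_measurable N"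
  unfolding perp_form_def by measurable

text \<open>The constants in \<open>span_inequality\<close> do not depend on the plane. Integrating
  over pairs in the unit ball and exchanging the integrals multiplies both sides by the same finite
  nonzero A.\<close>

lemma far_dissipation_inequality:
  fixes G :: "real^'n::finite \<Rightarrow> real^'n"
  assumes card: "CARD('n) \<ge> 2" and "R \<ge> 0" and [measurable]: "G \<in> borel_measurable borel"
  defines "K \<equiv> \<lambda>v w. ennreal (perp_form (v - w) (G v - G w) * (maxw v * maxw w))"
  shows "ennreal (beta_const CARD('n) R) * (\<integral>\<^sup>+v. \<integral>\<^sup>+w. K v w \<partial>lborel \<partial>lborel)
    \<le> ennreal (8 * alpha_const CARD('n)) * (\<integral>\<^sup>+v. \<integral>\<^sup>+w. indicator {R..} (norm (v - w)) * K v w \<partial>lborel \<partial>lborel)"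
proof -
  obtain i j :: 'n where "i \<noteq> j"
    using card by (metis One_nat_def card_1_singleton_iff card_2_iff' ex_card subset_UNIV)
  define A where "A = mean_kernel (axis i 1 :: real^'n) (axis j 1)"
  have A: "A \<noteq> 0" "A < \<infinity>"
    unfolding A_def by (rule mean_kernel_pos[OF \<open>i \<noteq> j\<close>], rule mean_kernel_finite)
  let ?B = "ball (0 :: real^'n) 1"
  have [measurable]: "?B \<in> sets borel" by simp
  define S where "S \<xi> \<zeta> v w = ennreal (span_kernel \<xi> \<zeta> (v - w) (G v - G w) * (maxw v * maxw w))" for \<xi> \<zeta> v w
  have S[measurable (raw)]: "(\<lambda>x. S (a x) (b x) (c x) (d x)) \<in> borel_measurable N"
    if [measurable]: "a \<in> borel_measurable N" "b \<in> borel_measurable N" "c \<in> borel_measurable N" "d \<in> borel_measurable N"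
    for a b c d and N :: "'z measure"
    unfolding S_def by measurable
  have [measurable (raw)]: "(\<lambda>x. K (a x) (b x)) \<in> borel_measurable N"
    if [measurable]: "a \<in> borel_measurable N" "b \<in> borel_measurable N" for a b and N :: "'z measure"
    unfolding K_def by measurable
  define W where "W \<xi> \<zeta> = indicator ?B \<xi> * (indicator ?B \<zeta> :: ennreal)" for \<xi> \<zeta>
  have W[measurable (raw)]: "(\<lambda>x. W (a x) (b x)) \<in> borel_measurable N"
    if [measurable]: "a \<in> borel_measurable N" "b \<in> borel_measurable N" for a b and N :: "'z measure"
    unfolding W_def by measurable
  have avg: "(\<integral>\<^sup>+\<xi>. \<integral>\<^sup>+\<zeta>. W \<xi> \<zeta> * S \<xi> \<zeta> v w \<partial>lborel \<partial>lborel) = A * K v w" for v w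
  proof -
    have "(\<integral>\<^sup>+\<xi>. \<integral>\<^sup>+\<zeta>. W \<xi> \<zeta> * S \<xi> \<zeta> v w \<partial>lborel \<partial>lborel)
       = (\<integral>\<^sup>+\<xi>. \<integral>\<^sup>+\<zeta>. W \<xi> \<zeta> * ennreal (span_kernel \<xi> \<zeta> (v - w) (G v - G w)) * ennreal (maxw v * maxw w) \<partial>lborel \<partial>lborel)"
      by (simp add: S_def ennreal_mult mult.assoc)
    also have "\<dots> = mean_kernel (v - w) (G v - G w) * ennreal (maxw v * maxw w)"
      unfolding mean_kernel_def W_def by (subst nn_integral_multc, measurable)+ (simp add: mult.assoc)
    also have "\<dots> = A * K v w"
      by (subst mean_kernel_eq[OF \<open>i \<noteq> j\<close>]) (simp add: A_def K_def perp_form_def[symmetric] ennreal_mult mult.assoc)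
    finally show ?thesis .
  qed
  have swap: "(\<integral>\<^sup>+\<xi>. \<integral>\<^sup>+\<zeta>. W \<xi> \<zeta> * (c * (\<integral>\<^sup>+v. \<integral>\<^sup>+w. I (norm (v - w)) * S \<xi> \<zeta> v w \<partial>lborel \<partial>lborel)) \<partial>lborel \<partial>lborel)
     = c * (A * (\<integral>\<^sup>+v. \<integral>\<^sup>+w. I (norm (v - w)) * K v w \<partial>lborel \<partial>lborel))"
    if I[measurable]: "I \<in> borel_measurable borel" for I :: "real \<Rightarrow> ennreal" and c
  proof -
    have "(\<integral>\<^sup>+\<xi>. \<integral>\<^sup>+\<zeta>. W \<xi> \<zeta> * (c * (\<integral>\<^sup>+v. \<integral>\<^sup>+w. I (norm (v - w)) * S \<xi> \<zeta> v w \<partial>lborel \<partial>lborel)) \<partial>lborel \<partial>lborel)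
      = (\<integral>\<^sup>+\<xi>. \<integral>\<^sup>+\<zeta>. \<integral>\<^sup>+v. \<integral>\<^sup>+w. (c * I (norm (v - w))) * (W \<xi> \<zeta> * S \<xi> \<zeta> v w) \<partial>lborel \<partial>lborel \<partial>lborel \<partial>lborel)"
    proof (intro nn_integral_cong)
      fix \<xi> \<zeta>
      have "(\<integral>\<^sup>+v. \<integral>\<^sup>+w. (W \<xi> \<zeta> * c) * (I (norm (v - w)) * S \<xi> \<zeta> v w) \<partial>lborel \<partial>lborel)
        = (W \<xi> \<zeta> * c) * (\<integral>\<^sup>+v. \<integral>\<^sup>+w. I (norm (v - w)) * S \<xi> \<zeta> v w \<partial>lborel \<partial>lborel)"
        by (subst nn_integral_cmult, measurable)+
      then show "W \<xi> \<zeta> * (c * (\<integral>\<^sup>+v. \<integral>\<^sup>+w. I (norm (v - w)) * S \<xi> \<zeta> v w \<partial>lborel \<partial>lborel))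
        = (\<integral>\<^sup>+v. \<integral>\<^sup>+w. (c * I (norm (v - w))) * (W \<xi> \<zeta> * S \<xi> \<zeta> v w) \<partial>lborel \<partial>lborel)"
        by (simp add: ac_simps)
    qed
    also have "\<dots> = (\<integral>\<^sup>+v. \<integral>\<^sup>+w. \<integral>\<^sup>+\<xi>. \<integral>\<^sup>+\<zeta>. (c * I (norm (v - w))) * (W \<xi> \<zeta> * S \<xi> \<zeta> v w) \<partial>lborel \<partial>lborel \<partial>lborel \<partial>lborel)"
    proof (rule nn_integral_swap4)
      fix N :: "((real^'n) \<times> (real^'n) \<times> (real^'n) \<times> (real^'n)) measure" and \<xi> \<zeta> v w :: "_ \<Rightarrow> real^'n"
      assume [measurable]: "\<xi> \<in> borel_measurable N" "\<zeta> \<in> borel_measurable N" "v \<in> borel_measurable N" "w \<in> borel_measurable N"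
      show "(\<lambda>x. (c * I (norm (v x - w x))) * (W (\<xi> x) (\<zeta> x) * S (\<xi> x) (\<zeta> x) (v x) (w x))) \<in> borel_measurable N"
        by measurable
    qed
    also have "\<dots> = (\<integral>\<^sup>+v. \<integral>\<^sup>+w. (c * I (norm (v - w))) * (A * K v w) \<partial>lborel \<partial>lborel)"
      unfolding avg[symmetric] by (subst nn_integral_cmult, measurable)+
    also have "\<dots> = (\<integral>\<^sup>+v. \<integral>\<^sup>+w. (c * A) * (I (norm (v - w)) * K v w) \<partial>lborel \<partial>lborel)"
      by (simp only: ac_simps)
    also have "\<dots> = c * (A * (\<integral>\<^sup>+v. \<integral>\<^sup>+w. I (norm (v - w)) * K v w \<partial>lborel \<partial>lborel))"
      by (simp add: nn_integral_cmult mult.assoc)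
    finally show ?thesis .
  qed
  let ?b = "ennreal (beta_const CARD('n) R)" and ?a = "ennreal (8 * alpha_const CARD('n))"
  have "?b * (A * (\<integral>\<^sup>+v. \<integral>\<^sup>+w. K v w \<partial>lborel \<partial>lborel))
     = (\<integral>\<^sup>+\<xi>. \<integral>\<^sup>+\<zeta>. W \<xi> \<zeta> * (?b * (\<integral>\<^sup>+v. \<integral>\<^sup>+w. S \<xi> \<zeta> v w \<partial>lborel \<partial>lborel)) \<partial>lborel \<partial>lborel)"
    using swap[of "\<lambda>_. 1" ?b] by simp
  also have "\<dots> \<le> (\<integral>\<^sup>+\<xi>. \<integral>\<^sup>+\<zeta>. W \<xi> \<zeta> * (?a * (\<integral>\<^sup>+v. \<integral>\<^sup>+w. indicator {R..} (norm (v - w)) * S \<xi> \<zeta> v w \<partial>lborel \<partial>lborel)) \<partial>lborel \<partial>lborel)"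
    unfolding S_def by (intro nn_integral_mono mult_left_mono span_inequality card \<open>R \<ge> 0\<close>) auto
  also have "\<dots> = ?a * (A * (\<integral>\<^sup>+v. \<integral>\<^sup>+w. indicator {R..} (norm (v - w)) * K v w \<partial>lborel \<partial>lborel))"
    by (rule swap) measurable
  finally have "A * (?b * (\<integral>\<^sup>+v. \<integral>\<^sup>+w. K v w \<partial>lborel \<partial>lborel))
    \<le> A * (?a * (\<integral>\<^sup>+v. \<integral>\<^sup>+w. indicator {R..} (norm (v - w)) * K v w \<partial>lborel \<partial>lborel))"
    by (simp add: ac_simps)
  then show ?thesis using A by (simp add: ennreal_mult_le_mult_iff)
qed

lemma perp_proj_form:
  fixes z x :: "real^'n::finite"
  shows "(norm z)\<^sup>2 * (norm (perp_proj z *v x))\<^sup>2 = perp_form z x"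
proof (cases "z = 0")
  case False
  have p: "perp_proj z *v x = x - ((z \<bullet> x) / (norm z)\<^sup>2) *\<^sub>R z"
  proof (rule vec_eq_iff[THEN iffD2], rule allI)
    fix k
    have "(perp_proj z *v x) $ k = (\<Sum>l\<in>UNIV. (if k = l then 1 else 0) * x $ l) - (\<Sum>l\<in>UNIV. z $ k * z $ l / (norm z)\<^sup>2 * x $ l)"
      by (simp add: matrix_vector_mult_def perp_proj_def left_diff_distrib sum_subtractf)
    also have "(\<Sum>l\<in>UNIV. (if k = l then 1 else 0) * x $ l) = x $ k"
      by (simp add: if_distrib[of "\<lambda>a. a * _"] cong: if_cong)
    also have "(\<Sum>l\<in>UNIV. z $ k * z $ l / (norm z)\<^sup>2 * x $ l) = (\<Sum>l\<in>UNIV. z $ l * x $ l) / (norm z)\<^sup>2 * z $ k"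
      unfolding sum_divide_distrib sum_distrib_right by (rule sum.cong) simp_all
    also have "\<dots> = (z \<bullet> x) / (norm z)\<^sup>2 * z $ k" by (simp add: inner_vec_def)
    finally show "(perp_proj z *v x) $ k = (x - ((z \<bullet> x) / (norm z)\<^sup>2) *\<^sub>R z) $ k" by simp
  qed
  have zz: "z \<bullet> z \<noteq> 0" using False by simp
  show ?thesis
    unfolding p power2_norm_eq_inner perp_form_def using zz
    by (simp add: inner_diff_left inner_diff_right inner_commute[of x z] power2_eq_square field_simps)
qed (simp add: perp_form_def)

section \<open>Smooth functions, cutoffs and weak derivatives\<close>

text \<open>\<open>bump1 q s = q(1/s) exp(-1/s)\<close> for positive \<open>s\<close>: a family of smooth functions closed under
  differentiation, which supplies the cutoffs.\<close>

definition bump1 :: "real poly \<Rightarrow> real \<Rightarrow> real" where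
  "bump1 q s = (if s > 0 then poly q (1 / s) * exp (- (1 / s)) else 0)"

text \<open>Chain rule in y = 1 / s: d/ds is - y^2 d/dy, and the derivative of q(y) exp (- y) is (q'
  - q)(y) exp (- y).\<close>

definition bump1_deriv :: "real poly \<Rightarrow> real poly" where
  "bump1_deriv q = monom 1 2 * (q - pderiv q)"

lemma poly_exp_bounded: "\<exists>C\<ge>0. \<forall>y\<ge>0. \<bar>poly q y * exp (- y)\<bar> \<le> (C :: real)"
proof -
  have pw: "y ^ k * exp (- y) \<le> fact k" if "y \<ge> 0" for y :: real and k
  proof -
    have "(\<Sum>n\<in>{k}. y ^ n /\<^sub>R fact n) \<le> (\<Sum>n. y ^ n /\<^sub>R fact n)"
      using that by (intro sum_le_suminf summable_exp_generic) auto
    then have "y ^ k / fact k \<le> exp y" by (simp add: exp_def divide_inverse mult.commute)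
    then show ?thesis by (simp add: exp_minus field_simps)
  qed
  define C where "C = (\<Sum>i\<le>degree q. \<bar>coeff q i\<bar> * fact i)"
  have "\<bar>poly q y * exp (- y)\<bar> \<le> C" if "y \<ge> 0" for y
  proof -
    have "\<bar>poly q y * exp (- y)\<bar> = \<bar>\<Sum>i\<le>degree q. coeff q i * (y ^ i * exp (- y))\<bar>"
      by (simp add: poly_altdef sum_distrib_right mult.assoc)
    also have "\<dots> \<le> (\<Sum>i\<le>degree q. \<bar>coeff q i * (y ^ i * exp (- y))\<bar>)" by (rule sum_abs)
    also have "\<dots> \<le> C"
      unfolding C_def using that pw by (intro sum_mono) (simp add: abs_mult mult_left_mono)
    finally show ?thesis .
  qed
  moreover have "C \<ge> 0" unfolding C_def by (intro sum_nonneg) simp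
  ultimately show ?thesis by blast
qed

lemma bump1_bounded: "\<exists>C\<ge>0. \<forall>s. \<bar>bump1 q s\<bar> \<le> C"
proof -
  obtain C where C: "C \<ge> 0" "\<And>y. y \<ge> 0 \<Longrightarrow> \<bar>poly q y * exp (- y)\<bar> \<le> C" using poly_exp_bounded by blast
  then have "\<bar>bump1 q s\<bar> \<le> C" for s using C(2)[of "1 / s"] by (auto simp: bump1_def)
  with C(1) show ?thesis by blast
qed

lemma has_field_derivative_bump1:
  "(bump1 q has_real_derivative bump1 (bump1_deriv q) s) (at s)"
proof -
  consider "s > 0" | "s < 0" | "s = 0" by linarith
  then show ?thesis
  proof cases
    case 1
    have "((\<lambda>s. poly q (1 / s) * exp (- (1 / s))) has_real_derivative bump1 (bump1_deriv q) s) (at s)"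
      using 1 by (auto intro!: derivative_eq_intros simp: bump1_def bump1_deriv_def poly_monom power2_eq_square field_simps)
    then show ?thesis
      by (rule has_field_derivative_transform_within_open[of _ _ _ "{0<..}"]) (use 1 in \<open>auto simp: bump1_def\<close>)
  next
    case 2
    have "((\<lambda>s. 0) has_real_derivative bump1 (bump1_deriv q) s) (at s)"
      using 2 by (simp add: bump1_def)
    then show ?thesis
      by (rule has_field_derivative_transform_within_open[of _ _ _ "{..<0}"]) (use 2 in \<open>auto simp: bump1_def\<close>)
  next
    case 3
    \<comment> \<open>Applying the bound to y^2 q instead of q gives |bump1 q h| <= C h^2, hence
      derivative 0 at the origin.\<close>
    obtain C where C: "C \<ge> 0" "\<And>y. y \<ge> 0 \<Longrightarrow> \<bar>poly (monom 1 2 * q) y * exp (- y)\<bar> \<le> C" using poly_exp_bounded by blast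
    have b: "\<bar>bump1 q h\<bar> \<le> C * \<bar>h\<bar> * \<bar>h\<bar>" for h
    proof (cases "h > 0")
      case True
      have "\<bar>bump1 q h\<bar> = \<bar>poly (monom 1 2 * q) (1 / h) * exp (- (1 / h))\<bar> * \<bar>h\<bar> * \<bar>h\<bar>"
        using True by (simp add: bump1_def poly_monom abs_mult power2_eq_square)
      also have "\<dots> \<le> C * \<bar>h\<bar> * \<bar>h\<bar>" using True C(2)[of "1 / h"] by (intro mult_right_mono) auto
      finally show ?thesis .
    qed (use C in \<open>auto simp: bump1_def mult.assoc\<close>)
    have "((\<lambda>h. (bump1 q (0 + h) - bump1 q 0) / h) \<longlongrightarrow> 0) (at 0)"
    proof (rule Lim_null_comparison)
      show "\<forall>\<^sub>F h in at 0. norm ((bump1 q (0 + h) - bump1 q 0) / h) \<le> C * \<bar>h\<bar>"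
      proof (intro always_eventually allI)
        fix h :: real
        have "bump1 q 0 = 0" by (simp add: bump1_def)
        then show "norm ((bump1 q (0 + h) - bump1 q 0) / h) \<le> C * \<bar>h\<bar>"
          using b[of h] by (cases "h = 0") (simp_all add: field_simps)
      qed
      have "((\<lambda>h::real. C * \<bar>h\<bar>) \<longlongrightarrow> C * \<bar>0\<bar>) (at 0)" by (intro tendsto_intros)
      then show "((\<lambda>h. C * \<bar>h\<bar>) \<longlongrightarrow> 0) (at 0)" by simp
    qed
    then show ?thesis by (simp add: 3 DERIV_def bump1_def)
  qed
qed

text \<open>A syntactic class closed under \<open>partial_deriv\<close>: membership yields every
  \<open>C_k\<close> at once, so no cutoff needs a regularity proof of its own.\<close>

inductive_set smooth_class :: "(real^'n::finite \<Rightarrow> real) set" where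
  smooth_const: "(\<lambda>_. c) \<in> smooth_class"
| smooth_coord: "(\<lambda>v. v $ i) \<in> smooth_class"
| smooth_add: "f \<in> smooth_class \<Longrightarrow> g \<in> smooth_class \<Longrightarrow> (\<lambda>v. f v + g v) \<in> smooth_class"
| smooth_mult: "f \<in> smooth_class \<Longrightarrow> g \<in> smooth_class \<Longrightarrow> (\<lambda>v. f v * g v) \<in> smooth_class"
| smooth_maxw: "maxw \<in> smooth_class"
| smooth_bump: "(\<lambda>v. bump1 q (1 - r * (norm v)\<^sup>2)) \<in> smooth_class"

lemma has_derivative_norm_square: "((\<lambda>v. (norm v)\<^sup>2) has_derivative (\<lambda>x. 2 * (v \<bullet> x))) (at (v::'a::real_inner))"
proof -
  have "((\<lambda>v. v \<bullet> v) has_derivative (\<lambda>x. v \<bullet> x + x \<bullet> v)) (at v)"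
    by (auto intro!: derivative_eq_intros)
  then show ?thesis by (simp add: power2_norm_eq_inner inner_commute)
qed

lemma partial_deriv_eq:
  assumes "(f has_derivative D) (at v)"
  shows "partial_deriv i f v = D (axis i 1)"
  using frechet_derivative_at[OF assms] by (simp add: partial_deriv_def)

lemma partial_deriv_const [simp]: "partial_deriv i (\<lambda>_. c) = (\<lambda>_. 0)"
  by (rule ext) (subst partial_deriv_eq[OF has_derivative_const], simp)

lemma partial_deriv_coord: "partial_deriv i (\<lambda>v::real^'n::finite. v $ k) = (\<lambda>_. if i = k then 1 else 0)"
proof
  fix v :: "real^'n"
  have "((\<lambda>v::real^'n. v $ k) has_derivative (\<lambda>x. x $ k)) (at v)"
    by (rule bounded_linear_imp_has_derivative) (rule bounded_linear_vec_nth)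
  then show "partial_deriv i (\<lambda>v. v $ k) v = (if i = k then 1 else 0)"
    by (subst partial_deriv_eq, assumption) (simp add: axis_def)
qed

lemma partial_deriv_add:
  assumes "f differentiable (at v)" "g differentiable (at v)"
  shows "partial_deriv i (\<lambda>v. f v + g v) v = partial_deriv i f v + partial_deriv i g v"
proof -
  have "(f has_derivative frechet_derivative f (at v)) (at v)" "(g has_derivative frechet_derivative g (at v)) (at v)"
    using assms by (simp_all add: frechet_derivative_works)
  from has_derivative_add[OF this] show ?thesis by (subst partial_deriv_eq) (auto simp: partial_deriv_def)
qed

lemma partial_deriv_mult:
  assumes "f differentiable (at v)" "g differentiable (at v)"
  shows "partial_deriv i (\<lambda>v. f v * g v) v = partial_deriv i f v * g v + f v * partial_deriv i g v"
proof -
  have "(f has_derivative frechet_derivative f (at v)) (at v)" "(g has_derivative frechet_derivative g (at v)) (at v)"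
    using assms by (simp_all add: frechet_derivative_works)
  from has_derivative_mult[OF this] show ?thesis by (subst partial_deriv_eq) (assumption, simp add: partial_deriv_def)
qed

lemma has_derivative_maxw: "(maxw has_derivative (\<lambda>x. - 2 * (v \<bullet> x) * maxw v)) (at v)"
  unfolding maxw_def[abs_def] by (auto intro!: derivative_eq_intros has_derivative_norm_square)

lemma partial_deriv_maxw: "partial_deriv i maxw = (\<lambda>v. - 2 * v $ i * maxw v)"
  by (rule ext, subst partial_deriv_eq[OF has_derivative_maxw]) (simp add: inner_axis)

lemma has_derivative_bump:
  fixes v :: "real^'n::finite"
  shows "((\<lambda>v. bump1 q (1 - r * (norm v)\<^sup>2)) has_derivative
     (\<lambda>x. bump1 (bump1_deriv q) (1 - r * (norm v)\<^sup>2) * (- (r * (2 * (v \<bullet> x)))))) (at v)"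
proof -
  have "((\<lambda>v. 1 - r * (norm v)\<^sup>2) has_derivative (\<lambda>x. - (r * (2 * (v \<bullet> x))))) (at v)"
    by (auto intro!: derivative_eq_intros has_derivative_norm_square)
  from has_derivative_compose[OF this, of "bump1 q"] has_field_derivative_bump1[of q "1 - r * (norm v)\<^sup>2"]
  show ?thesis unfolding has_field_derivative_def by blast
qed

lemma partial_deriv_bump:
  "partial_deriv i (\<lambda>v. bump1 q (1 - r * (norm v)\<^sup>2)) = (\<lambda>v. bump1 (bump1_deriv q) (1 - r * (norm v)\<^sup>2) * (- 2 * r * v $ i))"
  by (rule ext, subst partial_deriv_eq[OF has_derivative_bump]) (simp add: inner_axis)

lemma smooth_class_deriv:
  "f \<in> smooth_class \<Longrightarrow> (\<forall>v. f differentiable (at v)) \<and> (\<forall>i. partial_deriv i f \<in> smooth_class)"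
proof (induction rule: smooth_class.induct)
  case (smooth_const c)
  then show ?case by (auto intro: smooth_class.intros)
next
  case (smooth_coord i)
  have "(\<lambda>v::real^'a. v $ i) differentiable (at v)" for v
    by (rule differentiableI, rule bounded_linear_imp_has_derivative) (rule bounded_linear_vec_nth)
  then show ?case by (auto simp: partial_deriv_coord intro: smooth_class.intros)
next
  case (smooth_add f g)
  then have "partial_deriv i (\<lambda>v. f v + g v) = (\<lambda>v. partial_deriv i f v + partial_deriv i g v)" for i
    by (auto intro!: partial_deriv_add)
  then show ?case using smooth_add by (auto intro: smooth_class.intros)
next
  case (smooth_mult f g)
  then have "partial_deriv i (\<lambda>v. f v * g v) = (\<lambda>v. partial_deriv i f v * g v + f v * partial_deriv i g v)" for i
    by (auto intro!: partial_deriv_mult)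
  then show ?case using smooth_mult by (auto intro!: smooth_class.intros)
next
  case smooth_maxw
  have "partial_deriv i maxw \<in> smooth_class" for i
    unfolding partial_deriv_maxw by (intro smooth_class.intros)
  then show ?case using has_derivative_maxw by (auto simp: differentiable_def)
next
  case (smooth_bump q r)
  have "partial_deriv i (\<lambda>v. bump1 q (1 - r * (norm v)\<^sup>2)) \<in> smooth_class" for i
    unfolding partial_deriv_bump by (intro smooth_class.intros)
  then show ?case using differentiableI[OF has_derivative_bump] by blast
qed

lemma smooth_differentiable: "f \<in> smooth_class \<Longrightarrow> f differentiable (at v)"
  and smooth_partial_deriv: "f \<in> smooth_class \<Longrightarrow> partial_deriv i f \<in> smooth_class"
  using smooth_class_deriv by auto

lemma smooth_continuous: "f \<in> smooth_class \<Longrightarrow> continuous_on A f"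
  by (meson continuous_at_imp_continuous_on differentiable_imp_continuous_within smooth_differentiable)

lemma smooth_C_k: "f \<in> smooth_class \<Longrightarrow> C_k k f"
  by (induction k arbitrary: f) (auto intro: smooth_continuous smooth_differentiable smooth_partial_deriv)

section \<open>Test functions\<close>

lemma compact_closure_support:
  fixes f :: "real^'n::finite \<Rightarrow> real"
  assumes "\<And>v. norm v > r \<Longrightarrow> f v = 0"
  shows "compact (closure {v. f v \<noteq> 0})"
proof -
  have "{v. f v \<noteq> 0} \<subseteq> cball 0 r" using assms by (force simp: not_less[symmetric])
  then have "bounded {v. f v \<noteq> 0}" using bounded_cball bounded_subset by blast
  then show ?thesis by (simp add: compact_closure)
qed

lemma test_functionI:
  assumes "f \<in> smooth_class" "\<And>v. norm v > r \<Longrightarrow> f v = 0"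
  shows "test_function f"
  using assms compact_closure_support[of r f] by (auto simp: test_function_def intro: smooth_C_k)

lemma smooth_borel [measurable_dest]: "f \<in> smooth_class \<Longrightarrow> f \<in> borel_measurable borel"
  by (intro borel_measurable_continuous_onI smooth_continuous)

lemma integrable_compact_support:
  fixes f :: "real^'n::finite \<Rightarrow> real"
  assumes "continuous_on UNIV f" "\<And>v. norm v > r \<Longrightarrow> f v = 0"
  shows "integrable lborel f"
proof -
  have "integrable lborel (\<lambda>v. indicator (cball 0 r) v *\<^sub>R f v)"
    by (intro borel_integrable_compact continuous_on_subset[OF assms(1)]) auto
  also have "(\<lambda>v. indicator (cball 0 r) v *\<^sub>R f v) = f"
    using assms(2) by (auto split: split_indicator)
  finally show ?thesis .
qed

text \<open>The integral of \<open>f (v + t e)\<close> does not depend on \<open>t\<close>; difference quotients converge dominatedly.\<close>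

lemma integral_partial_deriv_zero:
  fixes f :: "real^'n::finite \<Rightarrow> real"
  assumes d: "\<And>v. f differentiable (at v)" and c: "continuous_on UNIV (partial_deriv i f)"
    and supp: "\<And>v. norm v > r \<Longrightarrow> f v = 0"
  shows "(LINT v|lborel. partial_deriv i f v) = 0"
proof -
  let ?e = "axis i 1 :: real^'n"
  have cf: "continuous_on UNIV f"
    using d by (meson continuous_at_imp_continuous_on differentiable_imp_continuous_within)
  note [measurable] = borel_measurable_continuous_onI[OF cf] borel_measurable_continuous_onI[OF c]
  have df: "((\<lambda>t. f (v + t *\<^sub>R ?e)) has_real_derivative partial_deriv i f (v + t *\<^sub>R ?e)) (at t)" for v t
  proof -
    have "(f has_derivative frechet_derivative f (at (v + t *\<^sub>R ?e))) (at (v + t *\<^sub>R ?e))"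
      using d by (simp add: frechet_derivative_works)
    moreover have "((\<lambda>t. v + t *\<^sub>R ?e) has_derivative (\<lambda>h. h *\<^sub>R ?e)) (at t)"
      by (auto intro!: derivative_eq_intros)
    ultimately have "((\<lambda>t. f (v + t *\<^sub>R ?e)) has_derivative (\<lambda>h. frechet_derivative f (at (v + t *\<^sub>R ?e)) (h *\<^sub>R ?e))) (at t)"
      by (rule has_derivative_compose[rotated])
    moreover have "frechet_derivative f (at (v + t *\<^sub>R ?e)) (h *\<^sub>R ?e) = partial_deriv i f (v + t *\<^sub>R ?e) * h" for h
      using linear_scale[OF has_derivative_linear, of f "frechet_derivative f (at (v + t *\<^sub>R ?e))" "at (v + t *\<^sub>R ?e)" h ?e] d
      by (simp add: partial_deriv_def frechet_derivative_works)
    ultimately show ?thesis by (simp add: has_field_derivative_def)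
  qed
  \<comment> \<open>The steps of the difference quotients are at most 1, so all quotients vanish
    outside the ball of radius |r| + 1.\<close>
  have "compact (partial_deriv i f ` cball 0 (\<bar>r\<bar> + 1))"
    by (intro compact_continuous_image continuous_on_subset[OF c]) auto
  then obtain B where B: "\<And>v. v \<in> cball 0 (\<bar>r\<bar> + 1) \<Longrightarrow> \<bar>partial_deriv i f v\<bar> \<le> B"
    by (metis compact_imp_bounded bounded_iff image_eqI real_norm_def)
  define q where "q n v = (f (v + (1 / real (Suc n)) *\<^sub>R ?e) - f v) * real (Suc n)" for n v
  have "(\<lambda>n. LINT v|lborel. q n v) \<longlonglongrightarrow> (LINT v|lborel. partial_deriv i f v)"
  proof (rule integral_dominated_convergence)
    show "integrable lborel (\<lambda>v::real^'n. indicator (cball 0 (\<bar>r\<bar> + 1)) v *\<^sub>R B)"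
      by (intro borel_integrable_compact) auto
    show "AE v in lborel. (\<lambda>n. q n v) \<longlonglongrightarrow> partial_deriv i f v"
    proof (rule AE_I2)
      fix v
      have "((\<lambda>h. (f (v + h *\<^sub>R ?e) - f v) / h) \<longlongrightarrow> partial_deriv i f v) (at 0)"
        using df[of v 0] by (simp add: DERIV_def)
      moreover have "filterlim (\<lambda>n. 1 / real (Suc n)) (at 0) sequentially"
        unfolding filterlim_at using LIMSEQ_Suc[OF lim_1_over_n] by auto
      ultimately have "(\<lambda>n. (f (v + (1 / real (Suc n)) *\<^sub>R ?e) - f v) / (1 / real (Suc n))) \<longlonglongrightarrow> partial_deriv i f v"
        by (rule filterlim_compose)
      then show "(\<lambda>n. q n v) \<longlonglongrightarrow> partial_deriv i f v" by (simp add: q_def)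
    qed
    fix n
    show "AE v in lborel. norm (q n v) \<le> indicator (cball 0 (\<bar>r\<bar> + 1)) v *\<^sub>R B"
    proof (rule AE_I2)
      fix v
      define t where "t = 1 / real (Suc n)"
      have t: "0 < t" "t \<le> 1" by (auto simp: t_def)
      obtain z where z: "0 < z" "z < t" "f (v + t *\<^sub>R ?e) - f (v + 0 *\<^sub>R ?e) = (t - 0) * partial_deriv i f (v + z *\<^sub>R ?e)"
        using MVT2[of 0 t "\<lambda>t. f (v + t *\<^sub>R ?e)" "\<lambda>t. partial_deriv i f (v + t *\<^sub>R ?e)"] df t by auto
      have qz: "q n v = partial_deriv i f (v + z *\<^sub>R ?e)"
        using z(3) t(1) by (simp add: q_def t_def field_simps)
      have near: "norm v \<le> norm (v + s *\<^sub>R ?e) + 1" if "0 \<le> s" "s \<le> 1" for s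
        using norm_triangle_ineq4[of "v + s *\<^sub>R ?e" "s *\<^sub>R ?e"] that by simp
      show "norm (q n v) \<le> indicator (cball 0 (\<bar>r\<bar> + 1)) v *\<^sub>R B"
      proof (cases "norm v \<le> \<bar>r\<bar> + 1")
        case True
        show ?thesis
        proof (cases "norm (v + z *\<^sub>R ?e) \<le> \<bar>r\<bar> + 1")
          case True
          then show ?thesis using B[of "v + z *\<^sub>R ?e"] \<open>norm v \<le> \<bar>r\<bar> + 1\<close> by (simp add: qz)
        next
          case False
          have "open {x :: real^'n. norm x > \<bar>r\<bar>}" by (intro open_Collect_less continuous_intros)
          moreover have "v + z *\<^sub>R ?e \<in> {x. norm x > \<bar>r\<bar>}" using False by simp
          moreover have "0 = f x" if "x \<in> {x. norm x > \<bar>r\<bar>}" for x using that supp by auto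
          ultimately have "(f has_derivative (\<lambda>_. 0)) (at (v + z *\<^sub>R ?e))"
            by (rule has_derivative_transform_within_open[OF has_derivative_const])
          then have "partial_deriv i f (v + z *\<^sub>R ?e) = 0" by (simp add: partial_deriv_eq)
          moreover have "B \<ge> 0" using B[of 0] by (auto intro: order_trans[OF abs_ge_zero])
          ultimately show ?thesis by (simp add: qz)
        qed
      next
        case False
        have "f v = 0" using supp[of v] False by auto
        moreover have "f (v + t *\<^sub>R ?e) = 0" using supp[of "v + t *\<^sub>R ?e"] near[of t] t False by auto
        ultimately show ?thesis using False by (simp add: q_def t_def)
      qed
    qed
  qed (auto simp: q_def)
  moreover have "(LINT v|lborel. q n v) = 0" for n
  proof -
    have i: "integrable lborel f" by (rule integrable_compact_support[OF cf supp])
    have tr: "has_bochner_integral lborel (\<lambda>v. f (v + c)) (LINT v|lborel. f v)" for c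
    proof -
      have "has_bochner_integral (distr lborel borel ((+) c)) f (LINT v|lborel. f v)"
        using i by (simp add: lborel_distr_plus has_bochner_integral_iff)
      then show ?thesis by (simp add: has_bochner_integral_iff integrable_distr_eq integral_distr add.commute)
    qed
    show ?thesis unfolding q_def
      using tr[of "(1 / real (Suc n)) *\<^sub>R ?e"] i by (simp add: has_bochner_integral_iff)
  qed
  ultimately show ?thesis by (simp add: LIMSEQ_const_iff)
qed

section \<open>Polynomials in the weighted space\<close>

inductive_set Pol :: "(real^'n::finite \<Rightarrow> real) set" where
  Pol_const: "(\<lambda>_. c) \<in> Pol"
| Pol_coord: "(\<lambda>v. v $ i) \<in> Pol"
| Pol_add: "f \<in> Pol \<Longrightarrow> g \<in> Pol \<Longrightarrow> (\<lambda>v. f v + g v) \<in> Pol"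
| Pol_mult: "f \<in> Pol \<Longrightarrow> g \<in> Pol \<Longrightarrow> (\<lambda>v. f v * g v) \<in> Pol"

lemma Pol_smooth: "f \<in> Pol \<Longrightarrow> f \<in> smooth_class"
  by (induction rule: Pol.induct) (auto intro: smooth_class.intros)

lemma Pol_partial_deriv: "f \<in> Pol \<Longrightarrow> partial_deriv i f \<in> Pol"
proof (induction rule: Pol.induct)
  case (Pol_coord k)
  then show ?case by (auto simp: partial_deriv_coord intro: Pol_const)
next
  case (Pol_add f g)
  then have "partial_deriv i (\<lambda>v. f v + g v) = (\<lambda>v. partial_deriv i f v + partial_deriv i g v)"
    by (auto intro!: partial_deriv_add smooth_differentiable Pol_smooth)
  then show ?case using Pol_add by (auto intro: Pol.intros)
next
  case (Pol_mult f g)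
  then have "partial_deriv i (\<lambda>v. f v * g v) = (\<lambda>v. partial_deriv i f v * g v + f v * partial_deriv i g v)"
    by (auto intro!: partial_deriv_mult smooth_differentiable Pol_smooth)
  then show ?case using Pol_mult by (auto intro!: Pol.intros)
qed (auto intro: Pol_const)

lemma Pol_minus: "f \<in> Pol \<Longrightarrow> (\<lambda>v. - f v) \<in> Pol"
  using Pol_mult[OF Pol_const[of "-1"]] by simp

lemma Pol_diff: "f \<in> Pol \<Longrightarrow> g \<in> Pol \<Longrightarrow> (\<lambda>v. f v - g v) \<in> Pol"
  using Pol_add[OF _ Pol_minus] by simp

lemma Pol_sum: "(\<And>k. k \<in> A \<Longrightarrow> f k \<in> Pol) \<Longrightarrow> (\<lambda>v. \<Sum>k\<in>A. f k v) \<in> Pol"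
  by (induction A rule: infinite_finite_induct) (auto intro: Pol_const Pol_add)

lemma Pol_power: "f \<in> Pol \<Longrightarrow> (\<lambda>v. f v ^ k) \<in> Pol"
  by (induction k) (auto intro: Pol_const Pol_mult)

lemma Pol_cmult: "f \<in> Pol \<Longrightarrow> (\<lambda>v. c * f v) \<in> Pol"
  by (rule Pol_mult[OF Pol_const])

lemma Pol_norm_square: "(\<lambda>v. (norm v)\<^sup>2) \<in> Pol"
  unfolding norm_vec_square_sum by (intro Pol_sum Pol_power Pol_coord)

lemmas Pol_intros = Pol_const Pol_coord Pol_add Pol_mult Pol_minus Pol_diff Pol_sum Pol_power Pol_norm_square Pol_partial_deriv

lemma Pol_borel [measurable_dest]: "f \<in> Pol \<Longrightarrow> f \<in> borel_measurable borel"
  by (intro smooth_borel Pol_smooth)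

lemma norm_le_1_plus_square: "norm v \<le> 1 + (norm v)\<^sup>2"
  using sum_squares_bound[of "norm v" 1] norm_ge_zero[of v] unfolding power2_eq_square by linarith

lemma Pol_bound: "f \<in> Pol \<Longrightarrow> \<exists>C\<ge>0. \<exists>k. \<forall>v. \<bar>f v\<bar> \<le> C * (1 + (norm v)\<^sup>2) ^ k"
proof (induction rule: Pol.induct)
  case (Pol_const c)
  show ?case by (intro exI[of _ "\<bar>c\<bar>"] exI[of _ 0] conjI) auto
next
  case (Pol_coord i)
  have "\<bar>v $ i\<bar> \<le> 1 * (1 + (norm v)\<^sup>2) ^ 1" for v :: "real^'a"
  proof -
    have "\<bar>v $ i\<bar> \<le> norm v" by (rule component_le_norm_cart)
    also have "\<dots> \<le> 1 + (norm v)\<^sup>2" by (rule norm_le_1_plus_square)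
    finally show ?thesis by simp
  qed
  then show ?case by (intro exI[of _ 1] exI[of _ 1] conjI) auto
next
  case (Pol_add f g)
  then obtain C k D l where C: "C \<ge> 0" "\<And>v. \<bar>f v\<bar> \<le> C * (1 + (norm v)\<^sup>2) ^ k"
    and D: "D \<ge> 0" "\<And>v. \<bar>g v\<bar> \<le> D * (1 + (norm v)\<^sup>2) ^ l" by blast
  have "\<bar>f v + g v\<bar> \<le> (C + D) * (1 + (norm v)\<^sup>2) ^ (k + l)" for v
  proof -
    have "(1 + (norm v)\<^sup>2) ^ k \<le> (1 + (norm v)\<^sup>2) ^ (k + l)" "(1 + (norm v)\<^sup>2) ^ l \<le> (1 + (norm v)\<^sup>2) ^ (k + l)"
      by (auto intro: power_increasing)
    then have "C * (1 + (norm v)\<^sup>2) ^ k + D * (1 + (norm v)\<^sup>2) ^ l \<le> C * (1 + (norm v)\<^sup>2) ^ (k + l) + D * (1 + (norm v)\<^sup>2) ^ (k + l)"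
      using C D by (intro add_mono mult_left_mono)
    then show ?thesis using C(2)[of v] D(2)[of v] by (simp add: algebra_simps)
  qed
  then show ?case using C D by (intro exI[of _ "C + D"] exI[of _ "k + l"] conjI) auto
next
  case (Pol_mult f g)
  then obtain C k D l where C: "C \<ge> 0" "\<And>v. \<bar>f v\<bar> \<le> C * (1 + (norm v)\<^sup>2) ^ k"
    and D: "D \<ge> 0" "\<And>v. \<bar>g v\<bar> \<le> D * (1 + (norm v)\<^sup>2) ^ l" by blast
  have "\<bar>f v * g v\<bar> \<le> (C * D) * (1 + (norm v)\<^sup>2) ^ (k + l)" for v
    using mult_mono[OF C(2)[of v] D(2)[of v]] C by (simp add: abs_mult power_add mult_ac)
  then show ?case using C D by (intro exI[of _ "C * D"] exI[of _ "k + l"] conjI) auto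
qed

lemma nn_integral_gauss_half: "(\<integral>\<^sup>+v. ennreal (exp (- ((norm v)\<^sup>2 / 2))) \<partial>(lborel :: (real^'n::finite) measure)) < \<infinity>"
proof -
  let ?f = "\<lambda>v::real^'n. ennreal (exp (- ((norm v)\<^sup>2 / 2)))"
  have "(\<integral>\<^sup>+v. ?f v \<partial>lborel) = (\<integral>\<^sup>+v. ?f v \<partial>density (distr lborel borel (\<lambda>x. 0 + sqrt 2 *\<^sub>R x)) (\<lambda>_. ennreal (\<bar>sqrt 2\<bar> ^ DIM(real^'n))))"
    by (subst lborel_affine[of "sqrt 2" 0]) auto
  also have "\<dots> = ennreal (\<bar>sqrt 2\<bar> ^ DIM(real^'n)) * (\<integral>\<^sup>+v. ?f (sqrt 2 *\<^sub>R v) \<partial>lborel)"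
    by (subst nn_integral_density) (auto simp: nn_integral_cmult nn_integral_distr)
  also have "(\<integral>\<^sup>+v. ?f (sqrt 2 *\<^sub>R v) \<partial>lborel) = (\<integral>\<^sup>+v. ennreal (maxw v) \<partial>(lborel :: (real^'n) measure))"
    by (simp add: maxw_def power_mult_distrib)
  finally show ?thesis by (simp add: nn_integral_maxw ennreal_mult[symmetric])
qed

lemma Pol_integrable: "f \<in> Pol \<Longrightarrow> integrable lborel (\<lambda>v. f v * maxw v)"
proof -
  assume f: "f \<in> Pol"
  note [measurable] = Pol_borel[OF f]
  obtain C k where C: "C \<ge> 0" "\<And>v. \<bar>f v\<bar> \<le> C * (1 + (norm v)\<^sup>2) ^ k" using Pol_bound[OF f] by blast
  \<comment> \<open>At y = |v|^2 / 2 this polynomial is (1 + |v|^2)^k: one half of the Gaussian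
    exponent absorbs the growth, the other half remains integrable.\<close>
  define q :: "real poly" where "q = [:1, 2:] ^ k"
  obtain B where B: "B \<ge> 0" "\<And>y. y \<ge> 0 \<Longrightarrow> \<bar>poly q y * exp (- y)\<bar> \<le> B" using poly_exp_bounded by blast
  have b: "\<bar>f v * maxw v\<bar> \<le> C * B * exp (- ((norm v)\<^sup>2 / 2))" for v
  proof -
    have "(1 + (norm v)\<^sup>2) ^ k * exp (- ((norm v)\<^sup>2 / 2)) \<le> B"
      using B(2)[of "(norm v)\<^sup>2 / 2"] by (simp add: q_def)
    then have "C * ((1 + (norm v)\<^sup>2) ^ k * exp (- ((norm v)\<^sup>2 / 2))) * exp (- ((norm v)\<^sup>2 / 2)) \<le> C * B * exp (- ((norm v)\<^sup>2 / 2))"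
      using C by (intro mult_right_mono mult_left_mono) auto
    moreover have "\<bar>f v * maxw v\<bar> \<le> C * (1 + (norm v)\<^sup>2) ^ k * maxw v"
      using C(2)[of v] by (simp add: abs_mult mult_right_mono)
    moreover have "maxw v = exp (- ((norm v)\<^sup>2 / 2)) * exp (- ((norm v)\<^sup>2 / 2))"
      by (simp add: maxw_def exp_add[symmetric])
    ultimately show ?thesis by (simp add: mult.assoc)
  qed
  have "integrable lborel (\<lambda>v::real^'a. exp (- ((norm v)\<^sup>2 / 2)))"
    using nn_integral_gauss_half[where 'n = 'a] by (intro integrableI_bounded) auto
  then have "integrable lborel (\<lambda>v::real^'a. C * B * exp (- ((norm v)\<^sup>2 / 2)))" by (rule integrable_mult_right)
  then show ?thesis by (rule Bochner_Integration.integrable_bound) (use b in \<open>auto intro!: order_trans[OF _ abs_ge_self]\<close>)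
qed

lemma Pol_L2M: "f \<in> Pol \<Longrightarrow> f \<in> L2M"
  using Pol_integrable[OF Pol_power[of f 2]] Pol_borel by (auto simp: L2M_def)

lemma L2M_borel [measurable_dest]: "h \<in> L2M \<Longrightarrow> h \<in> borel_measurable borel"
  by (simp add: L2M_def)

lemma L2M_mult_integrable:
  assumes "h \<in> L2M" "k \<in> L2M"
  shows "integrable lborel (\<lambda>v. h v * k v * maxw v)"
proof (rule Bochner_Integration.integrable_bound)
  show "integrable lborel (\<lambda>v. (h v)\<^sup>2 * maxw v + (k v)\<^sup>2 * maxw v)"
    using assms by (intro Bochner_Integration.integrable_add) (auto simp: L2M_def)
  show "AE v in lborel. norm (h v * k v * maxw v) \<le> norm ((h v)\<^sup>2 * maxw v + (k v)\<^sup>2 * maxw v)"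
  proof (rule AE_I2)
    fix v
    have "\<bar>h v * k v\<bar> \<le> (h v)\<^sup>2 + (k v)\<^sup>2"
      using sum_squares_bound[of "\<bar>h v\<bar>" "\<bar>k v\<bar>"] mult_nonneg_nonneg[OF abs_ge_zero[of "h v"] abs_ge_zero[of "k v"]]
      unfolding power2_abs abs_mult by linarith
    then show "norm (h v * k v * maxw v) \<le> norm ((h v)\<^sup>2 * maxw v + (k v)\<^sup>2 * maxw v)"
      by (simp add: abs_mult distrib_right[symmetric] mult_right_mono)
  qed
qed (use assms in measurable)

lemma L2M_Pol_integrable:
  assumes "h \<in> L2M" "f \<in> Pol"
  shows "integrable lborel (\<lambda>v. h v * f v * maxw v)"
  by (intro L2M_mult_integrable Pol_L2M assms)

lemma L2M_add: "h \<in> L2M \<Longrightarrow> k \<in> L2M \<Longrightarrow> (\<lambda>v. h v + k v) \<in> L2M"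
proof -
  assume h: "h \<in> L2M" "k \<in> L2M"
  have "integrable lborel (\<lambda>v. (h v)\<^sup>2 * maxw v + (2 * (h v * k v * maxw v) + (k v)\<^sup>2 * maxw v))"
    using h by (intro Bochner_Integration.integrable_add integrable_mult_right L2M_mult_integrable) (auto simp: L2M_def)
  moreover have "(\<lambda>v. (h v)\<^sup>2 * maxw v + (2 * (h v * k v * maxw v) + (k v)\<^sup>2 * maxw v)) = (\<lambda>v. (h v + k v)\<^sup>2 * maxw v)"
    by (auto simp: power2_sum algebra_simps)
  ultimately show ?thesis using h by (auto simp: L2M_def)
qed

lemma L2M_cmult: "h \<in> L2M \<Longrightarrow> (\<lambda>v. c * h v) \<in> L2M"
  by (auto simp: L2M_def power_mult_distrib mult.assoc)

lemma L2M_diff: "h \<in> L2M \<Longrightarrow> k \<in> L2M \<Longrightarrow> (\<lambda>v. h v - k v) \<in> L2M"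
  using L2M_add[OF _ L2M_cmult[of k "-1"]] by simp

section \<open>Smooth cutoffs at radius n + 1\<close>

definition cut :: "nat \<Rightarrow> real^'n::finite \<Rightarrow> real" where
  "cut n v = exp 1 * bump1 1 (1 - 1 / (real (Suc n))\<^sup>2 * (norm v)\<^sup>2)"

lemma cut_smooth: "cut n \<in> smooth_class"
  unfolding cut_def[abs_def] by (intro smooth_mult smooth_const smooth_bump)

lemma cut_support: "norm v > real (Suc n) \<Longrightarrow> cut n v = 0"
proof -
  assume a: "norm v > real (Suc n)"
  then have sq: "(real (Suc n))\<^sup>2 \<le> (norm v)\<^sup>2" by (rule power_mono[OF less_imp_le]) (rule of_nat_0_le_iff)
  have pos: "0 < (real (Suc n))\<^sup>2" by simp
  have "1 \<le> (norm v)\<^sup>2 / (real (Suc n))\<^sup>2" using sq le_divide_eq_1_pos[OF pos] by blast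
  then have "1 - 1 / (real (Suc n))\<^sup>2 * (norm v)\<^sup>2 \<le> 0"
    by (simp only: times_divide_eq_left mult_1_left diff_le_0_iff_le)
  then show ?thesis unfolding cut_def bump1_def by (simp only: not_less[symmetric] if_False mult_zero_right)
qed

lemma cut_nonneg: "cut n v \<ge> 0"
  by (simp add: cut_def bump1_def)

lemma cut_le_1: "cut n v \<le> 1"
proof -
  have "exp 1 * exp (- (1 / s)) \<le> 1" if "0 < s" "s \<le> 1" for s :: real
  proof -
    have "1 \<le> 1 / s" using that by simp
    then show ?thesis by (simp add: exp_add[symmetric])
  qed
  moreover have "1 - 1 / (real (Suc n))\<^sup>2 * (norm v)\<^sup>2 \<le> 1" by simp
  ultimately show ?thesis by (simp add: cut_def bump1_def)
qed

lemma cut_scale_tendsto: "(\<lambda>n. 1 / (real (Suc n))\<^sup>2) \<longlonglongrightarrow> 0"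
  using tendsto_power[OF LIMSEQ_Suc[OF lim_1_over_n], of 2] by (simp add: power_divide)

lemma cut_tendsto: "(\<lambda>n. cut n v) \<longlonglongrightarrow> 1"
proof -
  have "isCont (bump1 1) 1" using has_field_derivative_bump1 by (rule DERIV_isCont)
  moreover have "(\<lambda>n. 1 - 1 / (real (Suc n))\<^sup>2 * (norm v)\<^sup>2) \<longlonglongrightarrow> 1 - 0 * (norm v)\<^sup>2"
    by (intro tendsto_intros cut_scale_tendsto)
  ultimately have "(\<lambda>n. bump1 1 (1 - 1 / (real (Suc n))\<^sup>2 * (norm v)\<^sup>2)) \<longlonglongrightarrow> bump1 1 1"
    by (intro isCont_tendsto_compose[of _ "bump1 1"]) auto
  then have "(\<lambda>n. exp 1 * bump1 1 (1 - 1 / (real (Suc n))\<^sup>2 * (norm v)\<^sup>2)) \<longlonglongrightarrow> exp 1 * bump1 1 1"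
    by (intro tendsto_intros)
  moreover have "exp 1 * bump1 1 1 = 1" by (simp add: bump1_def exp_add[symmetric])
  ultimately show ?thesis by (simp add: cut_def)
qed

lemma cut_deriv:
  "partial_deriv i (cut n) v = exp 1 * (bump1 (bump1_deriv 1) (1 - 1 / (real (Suc n))\<^sup>2 * (norm v)\<^sup>2) * (- 2 * (1 / (real (Suc n))\<^sup>2) * v $ i))"
  unfolding cut_def[abs_def]
  unfolding partial_deriv_mult[OF smooth_differentiable[OF smooth_const] smooth_differentiable[OF smooth_bump]] partial_deriv_bump partial_deriv_const
  by simp

lemma cut_deriv2:
  fixes v :: "real^'n::finite"
  defines "r n \<equiv> 1 / (real (Suc n))\<^sup>2"
  shows "partial_deriv j (partial_deriv i (cut n)) v = exp 1 * (bump1 (bump1_deriv (bump1_deriv 1)) (1 - r n * (norm v)\<^sup>2) * (2 * r n * v $ j) * (2 * r n * v $ i)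
      + bump1 (bump1_deriv 1) (1 - r n * (norm v)\<^sup>2) * (- 2 * r n * (if j = i then 1 else 0)))"
proof -
  have d: "partial_deriv i (cut n) = (\<lambda>v. bump1 (bump1_deriv 1) (1 - r n * (norm v)\<^sup>2) * (- 2 * exp 1 * r n * v $ i))"
    unfolding cut_deriv r_def by (simp add: mult_ac)
  have c: "(\<lambda>v::real^'n. - 2 * exp 1 * r n * v $ i) \<in> smooth_class"
    by (intro smooth_mult smooth_const smooth_coord)
  have "partial_deriv j (\<lambda>v::real^'n. - 2 * exp 1 * r n * v $ i) v = - 2 * exp 1 * r n * (if j = i then 1 else 0)"
    by (subst partial_deriv_mult) (auto intro: smooth_differentiable smooth_const smooth_coord simp: partial_deriv_coord)
  then show ?thesis
    unfolding d partial_deriv_mult[OF smooth_differentiable[OF smooth_bump] smooth_differentiable[OF c]] partial_deriv_bump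
    by (simp add: algebra_simps)
qed

text \<open>The bounds decay like (n + 1)^(-2) at the price of a growth 1 + |v|^2, which is harmless
  wherever the Gaussian weight is present. Second derivatives are included because a derivative of
  the cutoff is itself used as a smooth factor in an integration by parts.\<close>

lemma cut_deriv_bounds:
  "\<exists>C\<ge>0. \<forall>n (v::real^'n::finite). (\<forall>i. \<bar>partial_deriv i (cut n) v\<bar> \<le> C * (1 / (real (Suc n))\<^sup>2) * (1 + (norm v)\<^sup>2))
     \<and> (\<forall>i j. \<bar>partial_deriv j (partial_deriv i (cut n)) v\<bar> \<le> C * (1 / (real (Suc n))\<^sup>2) * (1 + (norm v)\<^sup>2))"
proof -
  obtain A where A: "A \<ge> 0" "\<And>s. \<bar>bump1 (bump1_deriv 1) s\<bar> \<le> A" using bump1_bounded by blast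
  obtain B where B: "B \<ge> 0" "\<And>s. \<bar>bump1 (bump1_deriv (bump1_deriv 1)) s\<bar> \<le> B" using bump1_bounded by blast
  define C where "C = exp 1 * (2 * A + 4 * B)"
  have C: "C \<ge> 0" using A B by (simp add: C_def)
  have 1: "\<bar>partial_deriv i (cut n) v\<bar> \<le> C * (1 / (real (Suc n))\<^sup>2) * (1 + (norm v)\<^sup>2)" for i n and v :: "real^'n"
  proof -
    define r where "r = 1 / (real (Suc n))\<^sup>2"
    have r: "r \<ge> 0" by (simp add: r_def)
    have "\<bar>v $ i\<bar> \<le> 1 + (norm v)\<^sup>2"
      using component_le_norm_cart[of v i] norm_le_1_plus_square[of v] by linarith
    then have "\<bar>bump1 (bump1_deriv 1) (1 - r * (norm v)\<^sup>2)\<bar> * (2 * r * \<bar>v $ i\<bar>) \<le> A * (2 * r * (1 + (norm v)\<^sup>2))"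
      using A r by (intro mult_mono) auto
    also have "\<dots> \<le> (2 * A + 4 * B) * r * (1 + (norm v)\<^sup>2)"
      using B r mult_nonneg_nonneg[OF mult_nonneg_nonneg[OF B(1) r], of "1 + (norm v)\<^sup>2"] by (simp add: algebra_simps)
    finally have "exp 1 * (\<bar>bump1 (bump1_deriv 1) (1 - r * (norm v)\<^sup>2)\<bar> * (2 * r * \<bar>v $ i\<bar>)) \<le> exp 1 * ((2 * A + 4 * B) * r * (1 + (norm v)\<^sup>2))"
      by (rule mult_left_mono) simp
    then show ?thesis
      unfolding cut_deriv r_def[symmetric] C_def using r by (simp add: abs_mult mult_ac)
  qed
  have 2: "\<bar>partial_deriv j (partial_deriv i (cut n)) v\<bar> \<le> C * (1 / (real (Suc n))\<^sup>2) * (1 + (norm v)\<^sup>2)" for i j n and v :: "real^'n"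
  proof -
    define r where "r = 1 / (real (Suc n))\<^sup>2"
    have r: "r \<ge> 0" "r \<le> 1" by (auto simp: r_def divide_simps)
    let ?b = "bump1 (bump1_deriv (bump1_deriv 1)) (1 - r * (norm v)\<^sup>2)" and ?a = "bump1 (bump1_deriv 1) (1 - r * (norm v)\<^sup>2)"
    have "\<bar>v $ j\<bar> * \<bar>v $ i\<bar> \<le> norm v * norm v"
      by (intro mult_mono component_le_norm_cart) auto
    then have vv: "r * (\<bar>v $ j\<bar> * \<bar>v $ i\<bar>) \<le> 1 * (1 + (norm v)\<^sup>2)"
      using r by (intro mult_mono) (auto simp: power2_eq_square)
    have "\<bar>?b * (2 * r * v $ j) * (2 * r * v $ i)\<bar> = \<bar>?b\<bar> * (4 * r * (r * (\<bar>v $ j\<bar> * \<bar>v $ i\<bar>)))"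
      using r by (simp add: abs_mult)
    also have "\<dots> \<le> B * (4 * r * (1 * (1 + (norm v)\<^sup>2)))"
      using B(1) r by (intro mult_mono[OF B(2)] mult_left_mono[OF vv]) auto
    finally have b: "\<bar>?b * (2 * r * v $ j) * (2 * r * v $ i)\<bar> \<le> 4 * B * r * (1 + (norm v)\<^sup>2)" by (simp add: mult_ac)
    have "\<bar>?a * (- 2 * r * (if j = i then 1 else 0))\<bar> \<le> A * (2 * r * (1 + (norm v)\<^sup>2))"
      unfolding abs_mult using A r by (intro mult_mono) auto
    with b have "\<bar>?b * (2 * r * v $ j) * (2 * r * v $ i) + ?a * (- 2 * r * (if j = i then 1 else 0))\<bar> \<le> (2 * A + 4 * B) * r * (1 + (norm v)\<^sup>2)"
      by (simp add: algebra_simps)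
    from mult_left_mono[OF this, of "exp 1"]
    show ?thesis unfolding cut_deriv2 r_def[symmetric] C_def by (simp add: abs_mult mult_ac)
  qed
  show ?thesis using C 1 2 by blast
qed

lemma cut_mult_tendsto:
  fixes f :: "real^'n::finite \<Rightarrow> real"
  assumes f: "integrable lborel f"
  shows "(\<lambda>n. LINT v|lborel. cut n v * f v) \<longlonglongrightarrow> (LINT v|lborel. f v)"
proof (rule integral_dominated_convergence[where w = "\<lambda>v. \<bar>f v\<bar>"])
  note [measurable] = smooth_borel[OF cut_smooth] and fm = borel_measurable_integrable[OF f]
  show "f \<in> borel_measurable lborel" by (rule fm)
  show "(\<lambda>v. cut n v * f v) \<in> borel_measurable lborel" for n using fm by measurable
  show "integrable lborel (\<lambda>v. \<bar>f v\<bar>)" using f by simp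
  show "AE v in lborel. (\<lambda>n. cut n v * f v) \<longlonglongrightarrow> f v"
    using tendsto_mult[OF cut_tendsto tendsto_const] by (intro AE_I2) fastforce
  show "AE v in lborel. norm (cut n v * f v) \<le> \<bar>f v\<bar>" for n
    using mult_right_mono[OF cut_le_1, of "\<bar>f v\<bar>" n v for v] by (intro AE_I2) (simp add: abs_mult cut_nonneg)
qed

lemma cut_error_tendsto:
  fixes f :: "real^'n::finite \<Rightarrow> real"
  assumes f: "integrable lborel (\<lambda>v. (1 + (norm v)\<^sup>2) * f v)" and [measurable]: "f \<in> borel_measurable borel"
    and e[measurable]: "\<And>n. e n \<in> borel_measurable borel"
    and bound: "\<And>n v. \<bar>e n v\<bar> \<le> C * (1 / (real (Suc n))\<^sup>2) * (1 + (norm v)\<^sup>2)" and "C \<ge> 0"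
  shows "(\<lambda>n. LINT v|lborel. e n v * f v) \<longlonglongrightarrow> 0"
proof -
  have lim: "(\<lambda>n. C * (1 / (real (Suc n))\<^sup>2) * y) \<longlonglongrightarrow> 0" for y
    using tendsto_mult[OF tendsto_mult[OF tendsto_const cut_scale_tendsto] tendsto_const, of C y] by simp
  have r: "1 / (real (Suc n))\<^sup>2 \<le> 1" for n by (simp add: divide_simps)
  have "(\<lambda>n. LINT v|lborel. e n v * f v) \<longlonglongrightarrow> (LINT (v::real^'n)|lborel. 0)"
  proof (rule integral_dominated_convergence[where w = "\<lambda>v. C * \<bar>(1 + (norm v)\<^sup>2) * f v\<bar>"])
    show "integrable lborel (\<lambda>v. C * \<bar>(1 + (norm v)\<^sup>2) * f v\<bar>)" using f by (intro integrable_mult_right integrable_abs)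
    have b: "\<bar>e n v * f v\<bar> \<le> C * (1 / (real (Suc n))\<^sup>2) * ((1 + (norm v)\<^sup>2) * \<bar>f v\<bar>)" for n v
      using mult_right_mono[OF bound[of n v], of "\<bar>f v\<bar>"] by (simp add: abs_mult mult_ac)
    show "AE v in lborel. (\<lambda>n. e n v * f v) \<longlonglongrightarrow> 0"
      using b by (intro AE_I2 Lim_null_comparison[OF _ lim] always_eventually allI) auto
    show "AE v in lborel. norm (e n v * f v) \<le> C * \<bar>(1 + (norm v)\<^sup>2) * f v\<bar>" for n
    proof (rule AE_I2)
      fix v
      have "C * (1 / (real (Suc n))\<^sup>2) * ((1 + (norm v)\<^sup>2) * \<bar>f v\<bar>) \<le> C * 1 * ((1 + (norm v)\<^sup>2) * \<bar>f v\<bar>)"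
        using r \<open>C \<ge> 0\<close> by (intro mult_right_mono mult_left_mono) auto
      with b[of n v] show "norm (e n v * f v) \<le> C * \<bar>(1 + (norm v)\<^sup>2) * f v\<bar>" by (simp add: abs_mult)
    qed
  qed (auto simp: e)
  then show ?thesis by simp
qed

lemma smooth_cut_mult_deriv:
  assumes "f \<in> smooth_class"
  shows "partial_deriv i (\<lambda>v. cut n v * f v) v = partial_deriv i (cut n) v * f v + cut n v * partial_deriv i f v"
  by (intro partial_deriv_mult smooth_differentiable cut_smooth assms)

lemma cut_mult_test_function: "f \<in> smooth_class \<Longrightarrow> test_function (\<lambda>v. cut n v * f v)"
  by (rule test_functionI[of _ "real (Suc n)"]) (auto intro!: smooth_mult cut_smooth simp: cut_support)

section \<open>Classical derivatives of smooth functions as weak derivatives\<close>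

lemma test_functionD:
  fixes \<phi> :: "real^'n::finite \<Rightarrow> real"
  assumes "test_function \<phi>"
  shows "\<phi> differentiable (at v)" "continuous_on UNIV \<phi>" "continuous_on UNIV (partial_deriv i \<phi>)"
    "\<exists>r. \<forall>v. norm v > r \<longrightarrow> \<phi> v = 0"
proof -
  have C: "C_k (Suc 0) \<phi>" "C_k 0 \<phi>" using assms by (auto simp only: test_function_def)
  then show "\<phi> differentiable (at v)" "continuous_on UNIV \<phi>" "continuous_on UNIV (partial_deriv i \<phi>)" by auto
  have "bounded (closure {x. \<phi> x \<noteq> 0})" using assms by (auto simp: test_function_def compact_imp_bounded)
  then obtain r where r: "\<And>x. x \<in> closure {x. \<phi> x \<noteq> 0} \<Longrightarrow> norm x \<le> r" by (auto simp: bounded_iff)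
  have "\<phi> v = 0" if "norm v > r" for v
    using r[of v] closure_subset[of "{x. \<phi> x \<noteq> 0}"] that by force
  then show "\<exists>r. \<forall>v. norm v > r \<longrightarrow> \<phi> v = 0" by blast
qed

lemma test_function_partial_support:
  fixes \<phi> :: "real^'n::finite \<Rightarrow> real"
  assumes "\<And>v. norm v > r \<Longrightarrow> \<phi> v = 0" "norm v > r"
  shows "partial_deriv i \<phi> v = 0"
proof -
  have "open {x :: real^'n. norm x > r}" by (intro open_Collect_less continuous_intros)
  moreover have "v \<in> {x. norm x > r}" using assms(2) by simp
  moreover have "0 = \<phi> x" if "x \<in> {x. norm x > r}" for x using that assms(1) by auto
  ultimately have "(\<phi> has_derivative (\<lambda>_. 0)) (at v)"
    by (rule has_derivative_transform_within_open[OF has_derivative_const])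
  then show ?thesis by (simp add: partial_deriv_eq)
qed

lemma smooth_test_ibp:
  fixes f \<phi> :: "real^'n::finite \<Rightarrow> real"
  assumes f: "f \<in> smooth_class" and \<phi>: "test_function \<phi>"
  shows "integrable lborel (\<lambda>v. f v * partial_deriv i \<phi> v)" "integrable lborel (\<lambda>v. partial_deriv i f v * \<phi> v)"
    "(LINT v|lborel. f v * partial_deriv i \<phi> v) = - (LINT v|lborel. partial_deriv i f v * \<phi> v)"
proof -
  obtain r where r: "\<And>v. norm v > r \<Longrightarrow> \<phi> v = 0" using test_functionD(4)[OF \<phi>] by blast
  have c: "continuous_on UNIV (\<lambda>v. f v * partial_deriv i \<phi> v)" "continuous_on UNIV (\<lambda>v. partial_deriv i f v * \<phi> v)"
    by (intro continuous_on_mult smooth_continuous f smooth_partial_deriv test_functionD[OF \<phi>])+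
  show 1: "integrable lborel (\<lambda>v. f v * partial_deriv i \<phi> v)"
    by (rule integrable_compact_support[OF c(1), of r]) (simp add: test_function_partial_support[OF r])
  show 2: "integrable lborel (\<lambda>v. partial_deriv i f v * \<phi> v)"
    by (rule integrable_compact_support[OF c(2), of r]) (simp add: r)
  have e: "partial_deriv i (\<lambda>v. f v * \<phi> v) = (\<lambda>v. partial_deriv i f v * \<phi> v + f v * partial_deriv i \<phi> v)"
    by (rule ext) (intro partial_deriv_mult smooth_differentiable f test_functionD(1)[OF \<phi>])
  have "(LINT v|lborel. partial_deriv i (\<lambda>v. f v * \<phi> v) v) = 0"
  proof (rule integral_partial_deriv_zero)
    show "(\<lambda>v. f v * \<phi> v) differentiable (at v)" for v
      by (intro differentiable_mult smooth_differentiable f test_functionD(1)[OF \<phi>])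
    show "continuous_on UNIV (partial_deriv i (\<lambda>v. f v * \<phi> v))" unfolding e by (intro continuous_on_add c)
    show "f v * \<phi> v = 0" if "norm v > r" for v using r[OF that] by simp
  qed
  then show "(LINT v|lborel. f v * partial_deriv i \<phi> v) = - (LINT v|lborel. partial_deriv i f v * \<phi> v)"
    unfolding e using 1 2 by simp
qed

lemma continuous_locally_integrable:
  fixes f :: "real^'n::finite \<Rightarrow> 'b::{banach, second_countable_topology}"
  shows "continuous_on UNIV f \<Longrightarrow> locally_integrable f"
  unfolding locally_integrable_def set_integrable_def
  by (auto intro!: borel_integrable_compact intro: continuous_on_subset)

lemma smooth_weak_gradient:
  assumes f: "f \<in> smooth_class"
  shows "weak_gradient f (\<lambda>v. \<chi> i. partial_deriv i f v)"
  unfolding weak_gradient_def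
proof (intro conjI allI impI)
  show "locally_integrable f" by (intro continuous_locally_integrable smooth_continuous f)
  show "locally_integrable (\<lambda>v. \<chi> i. partial_deriv i f v)"
    by (intro continuous_locally_integrable continuous_on_vec_lambda smooth_continuous smooth_partial_deriv f)
  fix \<phi> :: "real^'a \<Rightarrow> real" and i assume "test_function \<phi>"
  then show "(LINT v|lborel. f v * partial_deriv i \<phi> v) = - (LINT v|lborel. (\<chi> i. partial_deriv i f v) $ i * \<phi> v)"
    using smooth_test_ibp(3)[OF f] by simp
qed

lemma smooth_weak_divergence:
  fixes F :: "'n::finite \<Rightarrow> real^'n \<Rightarrow> real"
  assumes F: "\<And>i. F i \<in> smooth_class"
  shows "weak_divergence (\<lambda>v. \<chi> i. F i v) (\<lambda>v. \<Sum>i\<in>UNIV. partial_deriv i (F i) v)"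
  unfolding weak_divergence_def
proof (intro conjI allI impI)
  show "locally_integrable (\<lambda>v. \<chi> i. F i v)"
    by (intro continuous_locally_integrable continuous_on_vec_lambda smooth_continuous F)
  show "locally_integrable (\<lambda>v. \<Sum>i\<in>UNIV. partial_deriv i (F i) v)"
    by (intro continuous_locally_integrable continuous_on_sum smooth_continuous smooth_partial_deriv F)
  fix \<phi> :: "real^'n \<Rightarrow> real" assume \<phi>: "test_function \<phi>"
  have "(LINT v|lborel. (\<Sum>i\<in>UNIV. F i v * partial_deriv i \<phi> v)) = (\<Sum>i\<in>UNIV. LINT v|lborel. F i v * partial_deriv i \<phi> v)"
    by (intro Bochner_Integration.integral_sum smooth_test_ibp F \<phi>)
  also have "\<dots> = (\<Sum>i\<in>UNIV. - (LINT v|lborel. partial_deriv i (F i) v * \<phi> v))"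
    by (intro sum.cong refl smooth_test_ibp(3) F \<phi>)
  also have "\<dots> = - (LINT v|lborel. (\<Sum>i\<in>UNIV. partial_deriv i (F i) v * \<phi> v))"
    by (subst Bochner_Integration.integral_sum) (auto intro: smooth_test_ibp F \<phi> simp: sum_negf)
  finally show "(LINT v|lborel. (\<Sum>i\<in>UNIV. (\<chi> i. F i v) $ i * partial_deriv i \<phi> v))
     = - (LINT v|lborel. (\<Sum>i\<in>UNIV. partial_deriv i (F i) v) * \<phi> v)"
    by (simp add: sum_distrib_right)
qed

section \<open>Integration by parts against the Gaussian weight\<close>

lemma Pol_maxw_deriv:
  assumes "f \<in> Pol"
  shows "partial_deriv i (\<lambda>v. f v * maxw v) v = (partial_deriv i f v - 2 * v $ i * f v) * maxw v"
  by (subst partial_deriv_mult) (auto intro: smooth_differentiable Pol_smooth assms smooth_maxw simp: partial_deriv_maxw algebra_simps)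

lemma Pol_maxw_deriv_integral:
  fixes f :: "real^'n::finite \<Rightarrow> real"
  assumes f: "f \<in> Pol"
  shows "(LINT v|lborel. (partial_deriv i f v - 2 * v $ i * f v) * maxw v) = 0"
proof -
  let ?g = "\<lambda>v. f v * maxw v" and ?d = "\<lambda>v. (partial_deriv i f v - 2 * v $ i * f v) * maxw v"
  have g: "?g \<in> smooth_class" by (intro smooth_mult Pol_smooth f smooth_maxw)
  have d: "integrable lborel ?d" by (intro Pol_integrable Pol_intros f)
  obtain C where C: "C \<ge> 0" "\<And>n (v::real^'n) i. \<bar>partial_deriv i (cut n) v\<bar> \<le> C * (1 / (real (Suc n))\<^sup>2) * (1 + (norm v)\<^sup>2)"
    using cut_deriv_bounds by blast
  have "(\<lambda>n. LINT v|lborel. partial_deriv i (cut n) v * ?g v) \<longlonglongrightarrow> 0"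
  proof (rule cut_error_tendsto[OF _ _ _ C(2,1)])
    have "integrable lborel (\<lambda>v. ((1 + (norm v)\<^sup>2) * f v) * maxw v)" by (intro Pol_integrable Pol_intros f)
    then show "integrable lborel (\<lambda>v. (1 + (norm v)\<^sup>2) * ?g v)" by (simp add: mult.assoc)
  qed (auto intro: smooth_borel g smooth_partial_deriv cut_smooth)
  moreover have "(\<lambda>n. LINT v|lborel. cut n v * ?d v) \<longlonglongrightarrow> (LINT v|lborel. ?d v)"
    by (rule cut_mult_tendsto[OF d])
  moreover have "(LINT v|lborel. partial_deriv i (cut n) v * ?g v) = - (LINT v|lborel. cut n v * ?d v)" for n
  proof -
    have "test_function (cut n)" using cut_mult_test_function[OF smooth_const[of 1], of n] by simp
    from smooth_test_ibp(3)[OF g this, of i] show ?thesis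
      unfolding Pol_maxw_deriv[OF f] by (simp add: mult.commute)
  qed
  ultimately have "(\<lambda>n. - (LINT v|lborel. cut n v * ?d v)) \<longlonglongrightarrow> 0" by simp
  then have "(\<lambda>n. LINT v|lborel. cut n v * ?d v) \<longlonglongrightarrow> 0" by (auto dest: tendsto_minus)
  with cut_mult_tendsto[OF d] show ?thesis by (rule LIMSEQ_unique)
qed

text \<open>The adjoint of \<open>partial_deriv i\<close> in the weighted space and the creation
  operator of the Hermite polynomials. For a field F, the sum of the \<open>raise i (F i)\<close> is
  minus the divergence of F M, divided by M.\<close>

definition raise :: "'n \<Rightarrow> (real^'n::finite \<Rightarrow> real) \<Rightarrow> real^'n \<Rightarrow> real" where
  "raise i p = (\<lambda>v. 2 * v $ i * p v - partial_deriv i p v)"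

lemma Pol_raise: "p \<in> Pol \<Longrightarrow> raise i p \<in> Pol"
  unfolding raise_def by (intro Pol_intros)

abbreviation ip :: "(real^'n::finite \<Rightarrow> real) \<Rightarrow> (real^'n \<Rightarrow> real) \<Rightarrow> real" where
  "ip \<equiv> L2M_inner"

lemma ip_commute: "ip h k = ip k h"
  by (simp add: L2M_inner_def mult.commute)

lemma ip_add_left: "h \<in> L2M \<Longrightarrow> h' \<in> L2M \<Longrightarrow> k \<in> L2M \<Longrightarrow> ip (\<lambda>v. h v + h' v) k = ip h k + ip h' k"
  unfolding L2M_inner_def distrib_right by (intro Bochner_Integration.integral_add L2M_mult_integrable)

lemma ip_diff_left: "h \<in> L2M \<Longrightarrow> h' \<in> L2M \<Longrightarrow> k \<in> L2M \<Longrightarrow> ip (\<lambda>v. h v - h' v) k = ip h k - ip h' k"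
  unfolding L2M_inner_def left_diff_distrib by (intro Bochner_Integration.integral_diff L2M_mult_integrable)

lemma ip_cmult_left: "ip (\<lambda>v. c * h v) k = c * ip h k"
  by (simp add: L2M_inner_def mult.assoc)

lemma ip_zero_left [simp]: "ip (\<lambda>v. 0) k = 0"
  by (simp add: L2M_inner_def)

lemma L2M_zero: "(\<lambda>v. 0) \<in> L2M"
  by (simp add: L2M_def)

lemma L2M_sum: "(\<And>m. m \<in> A \<Longrightarrow> f m \<in> L2M) \<Longrightarrow> (\<lambda>v. \<Sum>m\<in>A. f m v) \<in> L2M"
  by (induction A rule: infinite_finite_induct) (auto intro: L2M_zero L2M_add)

lemma ip_sum_left: "(\<And>m. m \<in> A \<Longrightarrow> f m \<in> L2M) \<Longrightarrow> k \<in> L2M \<Longrightarrow> ip (\<lambda>v. \<Sum>m\<in>A. f m v) k = (\<Sum>m\<in>A. ip (f m) k)"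
  by (induction A rule: infinite_finite_induct) (simp_all add: ip_add_left L2M_sum)

lemma ip_self_nonneg: "ip h h \<ge> 0"
  unfolding L2M_inner_def by (intro integral_nonneg_AE AE_I2) simp

lemma L2M_norm_square: "(L2M_norm h)\<^sup>2 = ip h h"
  unfolding L2M_norm_def L2M_inner_def
  by (subst real_sqrt_pow2) (auto intro!: integral_nonneg_AE simp: power2_eq_square)

lemma Pol_ibp:
  assumes p: "p \<in> Pol" and q: "q \<in> Pol"
  shows "ip (partial_deriv i p) q = ip p (raise i q)"
proof -
  have "(LINT v|lborel. (partial_deriv i (\<lambda>v. p v * q v) v - 2 * v $ i * (p v * q v)) * maxw v) = 0"
    by (intro Pol_maxw_deriv_integral Pol_intros p q)
  moreover have "(partial_deriv i (\<lambda>v. p v * q v) v - 2 * v $ i * (p v * q v)) * maxw v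
     = partial_deriv i p v * q v * maxw v - p v * raise i q v * maxw v" for v
    by (subst partial_deriv_mult) (auto intro: smooth_differentiable Pol_smooth p q simp: raise_def algebra_simps)
  ultimately have "(LINT v|lborel. partial_deriv i p v * q v * maxw v - p v * raise i q v * maxw v) = 0" by simp
  then show ?thesis
    unfolding L2M_inner_def
    by (subst (asm) Bochner_Integration.integral_diff) (auto intro!: L2M_mult_integrable Pol_L2M Pol_partial_deriv Pol_raise p q)
qed

section \<open>Integration by parts for weak gradients of functions in the weighted space\<close>

lemma compact_support_bounded:
  fixes s :: "real^'n::finite \<Rightarrow> real"
  assumes c: "continuous_on UNIV s" and z: "\<And>v. norm v > r \<Longrightarrow> s v = 0"
  shows "\<exists>B\<ge>0. \<forall>v. \<bar>s v\<bar> \<le> B"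
proof -
  have "bounded (s ` cball 0 r)"
    by (intro compact_imp_bounded compact_continuous_image continuous_on_subset[OF c]) auto
  then obtain B where B: "\<And>v. v \<in> cball 0 r \<Longrightarrow> \<bar>s v\<bar> \<le> B"
    by (metis bounded_iff image_eqI real_norm_def)
  have "\<bar>s v\<bar> \<le> \<bar>B\<bar>" for v
    using B[of v] z[of v] by (cases "norm v \<le> r") auto
  then show ?thesis by (intro exI[of _ "\<bar>B\<bar>"]) auto
qed

lemma integrable_mult_bounded:
  fixes f s :: "real^'n::finite \<Rightarrow> real"
  assumes f: "integrable lborel f" and s: "s \<in> borel_measurable borel" and B: "\<And>v. \<bar>s v\<bar> \<le> B"
  shows "integrable lborel (\<lambda>v. s v * f v)"
proof (rule Bochner_Integration.integrable_bound)
  show "integrable lborel (\<lambda>v. B * f v)" using f by simp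
  show "(\<lambda>v. s v * f v) \<in> borel_measurable lborel" using s borel_measurable_integrable[OF f] by measurable
  show "AE v in lborel. norm (s v * f v) \<le> norm (B * f v)"
  proof (rule AE_I2)
    fix v
    have "\<bar>s v\<bar> \<le> \<bar>B\<bar>" using B[of v] by linarith
    then show "norm (s v * f v) \<le> norm (B * f v)" by (simp add: abs_mult mult_right_mono)
  qed
qed

lemma locally_integrable_mult:
  fixes g :: "real^'n::finite \<Rightarrow> real^'n" and s :: "real^'n \<Rightarrow> real"
  assumes g: "locally_integrable g" and c: "continuous_on UNIV s" and z: "\<And>v. norm v > r \<Longrightarrow> s v = 0"
  shows "integrable lborel (\<lambda>v. g v $ i * s v)"
proof -
  obtain B where B: "B \<ge> 0" "\<And>v. \<bar>s v\<bar> \<le> B" using compact_support_bounded[OF c z] by blast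
  have "integrable lborel (\<lambda>v. indicator (cball 0 r) v *\<^sub>R g v)"
    using g by (auto simp: locally_integrable_def set_integrable_def)
  then have "integrable lborel (\<lambda>v. (indicator (cball 0 r) v *\<^sub>R g v) $ i)"
    by (rule integrable_bounded_linear[OF bounded_linear_vec_nth])
  then have "integrable lborel (\<lambda>v. s v * (indicator (cball 0 r) v *\<^sub>R g v) $ i)"
    by (rule integrable_mult_bounded[OF _ borel_measurable_continuous_onI[OF c] B(2)])
  moreover have "s v * (indicator (cball 0 r) v *\<^sub>R g v) $ i = g v $ i * s v" for v
    using z[of v] by (cases "norm v \<le> r") auto
  ultimately show ?thesis by (simp only:)
qed

lemma weak_ibp_local:
  fixes h :: "real^'n::finite \<Rightarrow> real"
  assumes g: "weak_gradient h g" and h: "h \<in> L2M" and A: "A \<in> Pol"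
    and s: "s \<in> smooth_class" "\<And>v. norm v > r \<Longrightarrow> s v = 0"
  shows "integrable lborel (\<lambda>v. g v $ i * (s v * A v * maxw v))"
    and "(LINT v|lborel. g v $ i * (s v * A v * maxw v))
      = (LINT v|lborel. s v * (h v * raise i A v * maxw v)) - (LINT v|lborel. partial_deriv i s v * (h v * A v * maxw v))"
proof -
  have sm: "(\<lambda>v. A v * maxw v) \<in> smooth_class" by (intro smooth_mult Pol_smooth A smooth_maxw)
  define \<phi> where "\<phi> = (\<lambda>v. s v * (A v * maxw v))"
  have \<phi>: "\<phi> \<in> smooth_class" unfolding \<phi>_def by (intro smooth_mult s sm)
  have t: "test_function \<phi>" by (rule test_functionI[OF \<phi>, of r]) (simp add: \<phi>_def s)
  show "integrable lborel (\<lambda>v. g v $ i * (s v * A v * maxw v))"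
    using locally_integrable_mult[of g \<phi> r i] g smooth_continuous[OF \<phi>] s(2)
    by (simp add: \<phi>_def weak_gradient_def mult.assoc)
  obtain B where B: "B \<ge> 0" "\<And>v. \<bar>s v\<bar> \<le> B" using compact_support_bounded[OF smooth_continuous[OF s(1)] s(2)] by blast
  have s': "partial_deriv i s v = 0" if "norm v > r" for v
    by (rule test_function_partial_support[OF s(2) that])
  obtain B' where B': "B' \<ge> 0" "\<And>v. \<bar>partial_deriv i s v\<bar> \<le> B'"
    using compact_support_bounded[OF smooth_continuous[OF smooth_partial_deriv[OF s(1)]] s'] by blast
  have i1: "integrable lborel (\<lambda>v. s v * (h v * raise i A v * maxw v))"
    by (rule integrable_mult_bounded[OF L2M_Pol_integrable[OF h Pol_raise[OF A]] smooth_borel[OF s(1)] B(2)])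
  have i2: "integrable lborel (\<lambda>v. partial_deriv i s v * (h v * A v * maxw v))"
    by (rule integrable_mult_bounded[OF L2M_Pol_integrable[OF h A] smooth_borel[OF smooth_partial_deriv[OF s(1)]] B'(2)])
  have d: "partial_deriv i \<phi> v = partial_deriv i s v * (A v * maxw v) - s v * (raise i A v * maxw v)" for v
  proof -
    have "partial_deriv i \<phi> v = partial_deriv i s v * (A v * maxw v) + s v * partial_deriv i (\<lambda>v. A v * maxw v) v"
      unfolding \<phi>_def by (intro partial_deriv_mult smooth_differentiable s sm)
    then show ?thesis unfolding Pol_maxw_deriv[OF A] raise_def by (simp add: algebra_simps)
  qed
  have "(LINT v|lborel. g v $ i * (s v * A v * maxw v)) = (LINT v|lborel. g v $ i * \<phi> v)" by (simp add: \<phi>_def mult.assoc)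
  also have "\<dots> = - (LINT v|lborel. h v * partial_deriv i \<phi> v)" using g t by (auto simp: weak_gradient_def)
  also have "(LINT v|lborel. h v * partial_deriv i \<phi> v)
    = (LINT v|lborel. partial_deriv i s v * (h v * A v * maxw v) - s v * (h v * raise i A v * maxw v))"
    unfolding d by (simp add: algebra_simps)
  also have "- \<dots> = (LINT v|lborel. s v * (h v * raise i A v * maxw v)) - (LINT v|lborel. partial_deriv i s v * (h v * A v * maxw v))"
    by (subst Bochner_Integration.integral_diff[OF i2 i1]) simp
  finally show "(LINT v|lborel. g v $ i * (s v * A v * maxw v))
      = (LINT v|lborel. s v * (h v * raise i A v * maxw v)) - (LINT v|lborel. partial_deriv i s v * (h v * A v * maxw v))" .
qed

lemma cut_deriv_tendsto:
  fixes f :: "real^'n::finite \<Rightarrow> real"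
  assumes f: "f \<in> L2M" and A: "A \<in> Pol"
  shows "(\<lambda>n. LINT v|lborel. partial_deriv i (cut n) v * (f v * A v * maxw v)) \<longlonglongrightarrow> 0"
    "(\<lambda>n. LINT v|lborel. partial_deriv j (partial_deriv i (cut n)) v * (f v * A v * maxw v)) \<longlonglongrightarrow> 0"
proof -
  obtain C where C: "C \<ge> 0" "\<And>n (v::real^'n) i. \<bar>partial_deriv i (cut n) v\<bar> \<le> C * (1 / (real (Suc n))\<^sup>2) * (1 + (norm v)\<^sup>2)"
    "\<And>n (v::real^'n) i j. \<bar>partial_deriv j (partial_deriv i (cut n)) v\<bar> \<le> C * (1 / (real (Suc n))\<^sup>2) * (1 + (norm v)\<^sup>2)"
    using cut_deriv_bounds by blast
  have "integrable lborel (\<lambda>v. f v * ((1 + (norm v)\<^sup>2) * A v) * maxw v)"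
    by (intro L2M_Pol_integrable f Pol_intros A)
  then have i: "integrable lborel (\<lambda>v. (1 + (norm v)\<^sup>2) * (f v * A v * maxw v))" by (simp add: mult_ac)
  have m: "(\<lambda>v. f v * A v * maxw v) \<in> borel_measurable borel"
    using borel_measurable_integrable[OF L2M_Pol_integrable[OF f A]] by simp
  show "(\<lambda>n. LINT v|lborel. partial_deriv i (cut n) v * (f v * A v * maxw v)) \<longlonglongrightarrow> 0"
    by (rule cut_error_tendsto[OF i m _ C(2,1)]) (intro smooth_borel smooth_partial_deriv cut_smooth)
  show "(\<lambda>n. LINT v|lborel. partial_deriv j (partial_deriv i (cut n)) v * (f v * A v * maxw v)) \<longlonglongrightarrow> 0"
    by (rule cut_error_tendsto[OF i m _ C(3,1)]) (intro smooth_borel smooth_partial_deriv cut_smooth)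
qed

lemma cut_L2M_tendsto:
  assumes f: "f \<in> L2M" and A: "A \<in> Pol"
  shows "(\<lambda>n. LINT v|lborel. cut n v * (f v * A v * maxw v)) \<longlonglongrightarrow> ip f A"
  unfolding L2M_inner_def by (intro cut_mult_tendsto L2M_Pol_integrable f A)

text \<open>A weak gradient is only locally integrable, so its product with a polynomial and the
  weight need not be integrable. The truncated integrals converge all the same: once the derivative
  is moved onto the smooth compactly supported factor, only \<open>h\<close> remains, and it lies in
  the weighted space.\<close>

lemma weak_cut_tendsto:
  assumes g: "weak_gradient h g" and h: "h \<in> L2M" and A: "A \<in> Pol"
  shows "(\<lambda>n. LINT v|lborel. g v $ i * (cut n v * A v * maxw v)) \<longlonglongrightarrow> ip h (raise i A)"
    "(\<lambda>n. LINT v|lborel. g v $ i * (partial_deriv k (cut n) v * A v * maxw v)) \<longlonglongrightarrow> 0"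
    "integrable lborel (\<lambda>v. g v $ i * (cut n v * A v * maxw v))"
    "integrable lborel (\<lambda>v. g v $ i * (partial_deriv k (cut n) v * A v * maxw v))"
proof -
  note c = cut_smooth cut_support
  have c': "partial_deriv k (cut n) v = 0" if "norm v > real (Suc n)" for n k and v :: "real^'a"
    by (rule test_function_partial_support[OF cut_support that])
  note d = smooth_partial_deriv[OF cut_smooth] c'
  show "integrable lborel (\<lambda>v. g v $ i * (cut n v * A v * maxw v))"
    by (rule weak_ibp_local(1)[OF g h A c])
  show "integrable lborel (\<lambda>v. g v $ i * (partial_deriv k (cut n) v * A v * maxw v))"
    by (rule weak_ibp_local(1)[OF g h A d])
  have e: "(LINT v|lborel. g v $ i * (cut n v * A v * maxw v))
      = (LINT v|lborel. cut n v * (h v * raise i A v * maxw v)) - (LINT v|lborel. partial_deriv i (cut n) v * (h v * A v * maxw v))" for n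
    by (rule weak_ibp_local(2)[OF g h A c])
  show "(\<lambda>n. LINT v|lborel. g v $ i * (cut n v * A v * maxw v)) \<longlonglongrightarrow> ip h (raise i A)"
    unfolding e
    using tendsto_diff[OF cut_L2M_tendsto[OF h Pol_raise[OF A, of i]] cut_deriv_tendsto(1)[OF h A, of i]] by simp
  have e': "(LINT v|lborel. g v $ i * (partial_deriv k (cut n) v * A v * maxw v))
      = (LINT v|lborel. partial_deriv k (cut n) v * (h v * raise i A v * maxw v)) - (LINT v|lborel. partial_deriv i (partial_deriv k (cut n)) v * (h v * A v * maxw v))" for n
    by (rule weak_ibp_local(2)[OF g h A d])
  show "(\<lambda>n. LINT v|lborel. g v $ i * (partial_deriv k (cut n) v * A v * maxw v)) \<longlonglongrightarrow> 0"
    unfolding e'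
    using tendsto_diff[OF cut_deriv_tendsto(1)[OF h Pol_raise[OF A, of i], of k] cut_deriv_tendsto(2)[OF h A, of i k]] by simp
qed

text \<open>Integrability is asked of the sum over i and not of its terms: for an eigenfunction it
  is known only for such a combination, the one with the nonlocal field of a polynomial.\<close>

lemma weak_ibp:
  fixes h :: "real^'n::finite \<Rightarrow> real"
  assumes g: "weak_gradient h g" and h: "h \<in> L2M" and Y: "\<And>i. Y i \<in> Pol"
    and int: "integrable lborel (\<lambda>v. (\<Sum>i\<in>UNIV. g v $ i * Y i v) * maxw v)"
  shows "(LINT v|lborel. (\<Sum>i\<in>UNIV. g v $ i * Y i v) * maxw v) = ip h (\<lambda>v. \<Sum>i\<in>UNIV. raise i (Y i) v)"
proof (rule LIMSEQ_unique)
  show "(\<lambda>n. LINT v|lborel. cut n v * ((\<Sum>i\<in>UNIV. g v $ i * Y i v) * maxw v))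
      \<longlonglongrightarrow> (LINT v|lborel. (\<Sum>i\<in>UNIV. g v $ i * Y i v) * maxw v)"
    by (rule cut_mult_tendsto[OF int])
  have "cut n v * ((\<Sum>i\<in>UNIV. g v $ i * Y i v) * maxw v) = (\<Sum>i\<in>UNIV. g v $ i * (cut n v * Y i v * maxw v))" for n v
    by (simp add: sum_distrib_left sum_distrib_right mult_ac)
  then have "(LINT v|lborel. cut n v * ((\<Sum>i\<in>UNIV. g v $ i * Y i v) * maxw v))
      = (\<Sum>i\<in>UNIV. LINT v|lborel. g v $ i * (cut n v * Y i v * maxw v))" for n
    by (simp only:) (intro Bochner_Integration.integral_sum weak_cut_tendsto(3)[OF g h Y])
  moreover have "ip h (\<lambda>v. \<Sum>i\<in>UNIV. raise i (Y i) v) = (\<Sum>i\<in>UNIV. ip h (raise i (Y i)))"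
    unfolding ip_commute[of h] by (intro ip_sum_left Pol_L2M Pol_raise Y h)
  ultimately show "(\<lambda>n. LINT v|lborel. cut n v * ((\<Sum>i\<in>UNIV. g v $ i * Y i v) * maxw v))
      \<longlonglongrightarrow> ip h (\<lambda>v. \<Sum>i\<in>UNIV. raise i (Y i) v)"
    by (simp only:) (intro tendsto_sum weak_cut_tendsto(1)[OF g h Y])
qed

section \<open>Hermite polynomials\<close>

fun hermite :: "nat \<Rightarrow> real \<Rightarrow> real" where
  "hermite 0 x = 1"
| "hermite (Suc 0) x = 2 * x"
| "hermite (Suc (Suc n)) x = 2 * x * hermite (Suc n) x - 2 * real (Suc n) * hermite n x"

lemma hermite_Suc: "hermite (Suc n) x = 2 * x * hermite n x - 2 * real n * hermite (n - 1) x"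
  by (cases n) auto

lemma hermite_deriv: "(hermite n has_real_derivative 2 * real n * hermite (n - 1) x) (at x)"
proof (induction n rule: induct_nat_012)
  case 0
  have "hermite 0 = (\<lambda>_. 1)" by auto
  then show ?case by simp
next
  case 1
  have "hermite (Suc 0) = (\<lambda>x. 2 * x)" by auto
  then show ?case by (auto intro!: derivative_eq_intros)
next
  case (ge2 n)
  have "hermite (Suc (Suc n)) = (\<lambda>x. 2 * x * hermite (Suc n) x - 2 * real (Suc n) * hermite n x)" by auto
  moreover have "((\<lambda>x. 2 * x * hermite (Suc n) x - 2 * real (Suc n) * hermite n x) has_real_derivative
     2 * hermite (Suc n) x + 2 * x * (2 * real (Suc n) * hermite n x) - 2 * real (Suc n) * (2 * real n * hermite (n - 1) x)) (at x)"
    using ge2 by (auto intro!: derivative_eq_intros)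
  moreover have "2 * hermite (Suc n) x + 2 * x * (2 * real (Suc n) * hermite n x) - 2 * real (Suc n) * (2 * real n * hermite (n - 1) x)
    = 2 * real (Suc (Suc n)) * hermite (Suc n) x"
    unfolding hermite_Suc by (simp add: algebra_simps)
  ultimately show ?case by simp
qed

definition herm :: "('n::finite \<Rightarrow> nat) \<Rightarrow> real^'n \<Rightarrow> real" where
  "herm m v = (\<Prod>k\<in>UNIV. hermite (m k) (v $ k))"

lemma Pol_prod: "(\<And>k. k \<in> A \<Longrightarrow> f k \<in> Pol) \<Longrightarrow> (\<lambda>v. \<Prod>k\<in>A. f k v) \<in> Pol"
  by (induction A rule: infinite_finite_induct) (auto intro: Pol_const Pol_mult)

lemma Pol_hermite: "(\<lambda>v. hermite n (v $ k)) \<in> Pol"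
  by (induction n rule: induct_nat_012) (auto intro!: Pol_intros simp del: of_nat_Suc)

lemma Pol_herm: "herm m \<in> Pol"
  unfolding herm_def[abs_def] by (intro Pol_prod Pol_hermite)

lemma partial_deriv_line:
  fixes f :: "real^'n::finite \<Rightarrow> real"
  assumes "f differentiable (at v)" "((\<lambda>t. f (v + t *\<^sub>R axis i 1)) has_real_derivative D) (at 0)"
  shows "partial_deriv i f v = D"
proof -
  have "(f has_derivative frechet_derivative f (at v)) (at (v + 0 *\<^sub>R axis i 1))"
    using assms(1) by (simp add: frechet_derivative_works)
  moreover have "((\<lambda>t. v + t *\<^sub>R axis i 1) has_derivative (\<lambda>h. h *\<^sub>R axis i 1)) (at 0)"
    by (auto intro!: derivative_eq_intros)
  ultimately have "((\<lambda>t. f (v + t *\<^sub>R axis i 1)) has_derivative (\<lambda>h. frechet_derivative f (at v) (h *\<^sub>R axis i 1))) (at 0)"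
    by (rule has_derivative_compose[rotated])
  from fun_cong[OF has_derivative_unique[OF this assms(2)[unfolded has_field_derivative_def]], of 1]
  have "frechet_derivative f (at v) (1 *\<^sub>R axis i 1) = D * 1" .
  then show ?thesis by (simp add: partial_deriv_def)
qed

lemma herm_split: "herm m v = hermite (m i) (v $ i) * (\<Prod>k\<in>UNIV - {i}. hermite (m k) (v $ k))"
  unfolding herm_def by (rule prod.remove) auto

lemma herm_lower: "partial_deriv i (herm m) = (\<lambda>v. 2 * real (m i) * herm (m(i := m i - 1)) v)"
proof
  fix v :: "real^'a"
  let ?R = "\<Prod>k\<in>UNIV - {i}. hermite (m k) (v $ k)"
  have e: "herm m (v + t *\<^sub>R axis i 1) = hermite (m i) (v $ i + t) * ?R" for t
  proof -
    have "(\<Prod>k\<in>UNIV - {i}. hermite (m k) ((v + t *\<^sub>R axis i 1) $ k)) = ?R"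
      by (intro prod.cong) (auto simp: axis_def)
    then show ?thesis by (simp add: herm_split[of _ _ i])
  qed
  have "((\<lambda>t. hermite (m i) (v $ i + t)) has_real_derivative 2 * real (m i) * hermite (m i - 1) (v $ i)) (at 0)"
    using DERIV_shift[of "hermite (m i)" _ 0 "v $ i"] hermite_deriv[of "m i" "v $ i"] by (simp add: add.commute)
  then have "((\<lambda>t. hermite (m i) (v $ i + t) * ?R) has_real_derivative 2 * real (m i) * hermite (m i - 1) (v $ i) * ?R) (at 0)"
    by (rule DERIV_cmult_right)
  then have "partial_deriv i (herm m) v = 2 * real (m i) * hermite (m i - 1) (v $ i) * ?R"
    unfolding e[symmetric] by (intro partial_deriv_line smooth_differentiable Pol_smooth Pol_herm)
  moreover have "(\<Prod>k\<in>UNIV - {i}. hermite ((m(i := m i - 1)) k) (v $ k)) = ?R"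
    by (intro prod.cong) auto
  ultimately show "partial_deriv i (herm m) v = 2 * real (m i) * herm (m(i := m i - 1)) v"
    unfolding herm_split[of "m(i := m i - 1)" v i] by (simp only: fun_upd_same mult.assoc)
qed

lemma herm_raise: "raise i (herm m) = herm (m(i := Suc (m i)))"
proof
  fix v :: "real^'a"
  have "(\<Prod>k\<in>UNIV - {i}. hermite ((m(i := x)) k) (v $ k)) = (\<Prod>k\<in>UNIV - {i}. hermite (m k) (v $ k))" for x
    by (intro prod.cong) auto
  then show "raise i (herm m) v = herm (m(i := Suc (m i))) v"
    unfolding raise_def herm_lower herm_split[of _ v i] by (simp add: hermite_Suc algebra_simps)
qed

section \<open>Hermite spaces of fixed total degree\<close>

definition mdeg :: "('n::finite \<Rightarrow> nat) \<Rightarrow> nat" where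
  "mdeg m = (\<Sum>i\<in>UNIV. m i)"

lemma mdeg_upd: "mdeg (m(i := x)) + m i = mdeg m + x"
proof -
  have "(\<Sum>k\<in>UNIV - {i}. (m(i := x)) k) = (\<Sum>k\<in>UNIV - {i}. m k)" by (intro sum.cong) auto
  then show ?thesis unfolding mdeg_def by (simp add: sum.remove[of UNIV i])
qed

lemma finite_mdeg: "finite {m :: 'n::finite \<Rightarrow> nat. mdeg m = k}"
proof -
  have "{m :: 'n \<Rightarrow> nat. mdeg m = k} \<subseteq> PiE UNIV (\<lambda>_. {..k})"
  proof
    fix m :: "'n \<Rightarrow> nat" assume m: "m \<in> {m. mdeg m = k}"
    have "m i \<le> k" for i using member_le_sum[of i UNIV m] m by (simp add: mdeg_def)
    then show "m \<in> PiE UNIV (\<lambda>_. {..k})" by auto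
  qed
  then show ?thesis by (rule finite_subset) (intro finite_PiE, auto)
qed

text \<open>One factor is written as \<open>raise i\<close> of a Hermite product, and
  \<open>raise i\<close> is moved across as a derivative, which lowers both degrees. At an index
  where m and m' differ the lowered exponents still differ, unless the derivative is already 0. The
  pair is swapped when needed so that the exponent to be lowered is positive.\<close>

lemma herm_orthogonal: "m \<noteq> m' \<Longrightarrow> ip (herm m) (herm m') = 0"
proof (induction "mdeg m + mdeg m'" arbitrary: m m' rule: less_induct)
  case less
  have step: "ip (herm p) (herm p') = 0" if i: "p i \<noteq> p' i" "p i > 0" and d: "mdeg p + mdeg p' = mdeg m + mdeg m'" for p p' :: "'a \<Rightarrow> nat" and i
  proof -
    define q where "q = p(i := p i - 1)"
    have p: "herm p = raise i (herm q)" using i by (simp add: herm_raise q_def)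
    have "ip (herm p) (herm p') = ip (partial_deriv i (herm p')) (herm q)"
      unfolding p by (simp add: Pol_ibp Pol_herm ip_commute[of "raise i (herm q)"])
    also have "\<dots> = 2 * real (p' i) * ip (herm (p'(i := p' i - 1))) (herm q)"
      unfolding herm_lower by (rule ip_cmult_left)
    also have "\<dots> = 0"
    proof (cases "p' i = 0")
      case False
      have "mdeg q < mdeg p" using mdeg_upd[of p i "p i - 1"] i by (simp add: q_def)
      moreover have "mdeg (p'(i := p' i - 1)) < mdeg p'" using mdeg_upd[of p' i "p' i - 1"] False by simp
      moreover have "p'(i := p' i - 1) \<noteq> q"
      proof
        assume "p'(i := p' i - 1) = q"
        then have "(p'(i := p' i - 1)) i = q i" by simp
        then show False using i False by (simp add: q_def)
      qed
      ultimately have "ip (herm (p'(i := p' i - 1))) (herm q) = 0" using less(1) d by simp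
      then show ?thesis by simp
    qed simp
    finally show ?thesis .
  qed
  obtain i where i: "m i \<noteq> m' i" using less(2) by auto
  show ?case
  proof (cases "m i > 0")
    case True
    then show ?thesis using step i by blast
  next
    case False
    then have "ip (herm m') (herm m) = 0" using i by (intro step[of m' i m]) auto
    then show ?thesis by (simp add: ip_commute)
  qed
qed

lemma ip_one_one: "ip (\<lambda>_. 1) (\<lambda>_::real^'n::finite. 1) = sqrt pi ^ CARD('n)"
  unfolding L2M_inner_def using nn_integral_maxw[where 'n = 'n] by (subst integral_eq_nn_integral) auto

lemma herm_norm_pos: "ip (herm m) (herm m) > 0"
proof (induction "mdeg m" arbitrary: m rule: less_induct)
  case less
  show ?case
  proof (cases "\<exists>i. m i > 0")
    case True
    then obtain i where i: "m i > 0" by blast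
    define q where "q = m(i := m i - 1)"
    have m: "herm m = raise i (herm q)" using i by (simp add: herm_raise q_def)
    have "ip (herm m) (herm m) = ip (partial_deriv i (herm m)) (herm q)"
      using Pol_ibp[OF Pol_herm[of m] Pol_herm[of q], of i] unfolding m[symmetric] by simp
    also have "\<dots> = 2 * real (m i) * ip (herm q) (herm q)"
      unfolding herm_lower q_def by (rule ip_cmult_left)
    finally show ?thesis
      using less[of q] mdeg_upd[of m i "m i - 1"] i by (simp add: q_def)
  next
    case False
    then have "herm m = (\<lambda>_. 1)" by (auto simp: herm_def)
    then show ?thesis by (simp add: ip_one_one)
  qed
qed

text \<open>The span of the Hermite products of total degree k, on which the number operator is 2 k.
  The inductive form lets linear statements be checked on basis elements.\<close>

inductive_set Herm :: "nat \<Rightarrow> (real^'n::finite \<Rightarrow> real) set" for k where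
  Herm_basis: "mdeg m = k \<Longrightarrow> herm m \<in> Herm k"
| Herm_zero: "(\<lambda>_. 0) \<in> Herm k"
| Herm_add: "p \<in> Herm k \<Longrightarrow> q \<in> Herm k \<Longrightarrow> (\<lambda>v. p v + q v) \<in> Herm k"
| Herm_cmult: "p \<in> Herm k \<Longrightarrow> (\<lambda>v. c * p v) \<in> Herm k"

lemma Herm_Pol: "p \<in> Herm k \<Longrightarrow> p \<in> Pol"
  by (induction rule: Herm.induct) (auto intro: Pol_herm Pol_const Pol_add Pol_cmult)

lemma Herm_L2M: "p \<in> Herm k \<Longrightarrow> p \<in> L2M"
  by (intro Pol_L2M Herm_Pol)

lemma Herm_minus: "p \<in> Herm k \<Longrightarrow> (\<lambda>v. - p v) \<in> Herm k"
  using Herm_cmult[of p k "-1"] by simp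

lemma Herm_diff: "p \<in> Herm k \<Longrightarrow> q \<in> Herm k \<Longrightarrow> (\<lambda>v. p v - q v) \<in> Herm k"
  using Herm_add[OF _ Herm_minus] by simp

lemma Herm_sum: "(\<And>j. j \<in> A \<Longrightarrow> f j \<in> Herm k) \<Longrightarrow> (\<lambda>v. \<Sum>j\<in>A. f j v) \<in> Herm k"
  by (induction A rule: infinite_finite_induct) (auto intro: Herm_zero Herm_add)

lemma partial_deriv_Pol_add: "p \<in> Pol \<Longrightarrow> q \<in> Pol \<Longrightarrow> partial_deriv i (\<lambda>v. p v + q v) = (\<lambda>v. partial_deriv i p v + partial_deriv i q v)"
  by (rule ext) (intro partial_deriv_add smooth_differentiable Pol_smooth)

lemma partial_deriv_Pol_mult: "p \<in> Pol \<Longrightarrow> q \<in> Pol \<Longrightarrow> partial_deriv i (\<lambda>v. p v * q v) = (\<lambda>v. partial_deriv i p v * q v + p v * partial_deriv i q v)"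
  by (rule ext) (intro partial_deriv_mult smooth_differentiable Pol_smooth)

lemma partial_deriv_Pol_cmult: "p \<in> Pol \<Longrightarrow> partial_deriv i (\<lambda>v. c * p v) = (\<lambda>v. c * partial_deriv i p v)"
  by (simp add: partial_deriv_Pol_mult Pol_const)

lemma partial_deriv_Pol_diff: "p \<in> Pol \<Longrightarrow> q \<in> Pol \<Longrightarrow> partial_deriv i (\<lambda>v. p v - q v) = (\<lambda>v. partial_deriv i p v - partial_deriv i q v)"
  using partial_deriv_Pol_add[of p "\<lambda>v. (-1) * q v" i] partial_deriv_Pol_cmult[of q i "-1"] Pol_cmult[of q "-1"] by simp

lemma partial_deriv_Pol_sum: "(\<And>j. j \<in> A \<Longrightarrow> f j \<in> Pol) \<Longrightarrow> partial_deriv i (\<lambda>v. \<Sum>j\<in>A. f j v) = (\<lambda>v. \<Sum>j\<in>A. partial_deriv i (f j) v)"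
  by (induction A rule: infinite_finite_induct) (simp_all add: partial_deriv_Pol_add Pol_sum)

lemma raise_add: "p \<in> Pol \<Longrightarrow> q \<in> Pol \<Longrightarrow> raise i (\<lambda>v. p v + q v) = (\<lambda>v. raise i p v + raise i q v)"
  by (auto simp: raise_def partial_deriv_Pol_add algebra_simps)

lemma raise_cmult: "p \<in> Pol \<Longrightarrow> raise i (\<lambda>v. c * p v) = (\<lambda>v. c * raise i p v)"
  by (auto simp: raise_def partial_deriv_Pol_cmult algebra_simps)

lemma raise_diff: "p \<in> Pol \<Longrightarrow> q \<in> Pol \<Longrightarrow> raise i (\<lambda>v. p v - q v) = (\<lambda>v. raise i p v - raise i q v)"
  by (auto simp: raise_def partial_deriv_Pol_diff algebra_simps)

lemma raise_zero: "raise i (\<lambda>_. 0) = (\<lambda>_. 0)"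
  by (auto simp: raise_def)

lemma raise_sum: "(\<And>j. j \<in> A \<Longrightarrow> f j \<in> Pol) \<Longrightarrow> raise i (\<lambda>v. \<Sum>j\<in>A. f j v) = (\<lambda>v. \<Sum>j\<in>A. raise i (f j) v)"
  by (induction A rule: infinite_finite_induct) (simp_all add: raise_add raise_zero Pol_sum)

lemma Herm_lower: "p \<in> Herm (Suc k) \<Longrightarrow> partial_deriv i p \<in> Herm k"
proof (induction rule: Herm.induct)
  case (Herm_basis m)
  show ?case
  proof (cases "m i = 0")
    case True
    then show ?thesis by (simp add: herm_lower Herm_zero)
  next
    case False
    then have "mdeg (m(i := m i - 1)) = k" using mdeg_upd[of m i "m i - 1"] Herm_basis by simp
    then show ?thesis unfolding herm_lower by (intro Herm_cmult Herm.Herm_basis)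
  qed
qed (auto simp: partial_deriv_Pol_add partial_deriv_Pol_cmult Herm_Pol intro: Herm.intros)

lemma Herm_lower_0: "p \<in> Herm 0 \<Longrightarrow> partial_deriv i p = (\<lambda>_. 0)"
proof (induction rule: Herm.induct)
  case (Herm_basis m)
  then have "m i = 0" by (simp add: mdeg_def)
  then show ?case by (simp add: herm_lower)
qed (auto simp: partial_deriv_Pol_add partial_deriv_Pol_cmult Herm_Pol)

lemma Herm_raise: "p \<in> Herm k \<Longrightarrow> raise i p \<in> Herm (Suc k)"
proof (induction rule: Herm.induct)
  case (Herm_basis m)
  then have "mdeg (m(i := Suc (m i))) = Suc k" using mdeg_upd[of m i "Suc (m i)"] by simp
  then show ?case unfolding herm_raise by (rule Herm.Herm_basis)
qed (auto simp: raise_zero raise_add raise_cmult Herm_Pol intro: Herm.intros)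

lemma Herm_number: "p \<in> Herm k \<Longrightarrow> (\<Sum>i\<in>UNIV. raise i (partial_deriv i p) v) = 2 * real k * p v"
proof (induction rule: Herm.induct)
  case (Herm_basis m)
  have "raise i (partial_deriv i (herm m)) v = 2 * real (m i) * herm m v" for i
    unfolding herm_lower by (cases "m i") (simp_all add: raise_cmult raise_zero Pol_herm herm_raise fun_upd_idem)
  moreover have "real k = (\<Sum>i\<in>UNIV. real (m i))" using Herm_basis by (auto simp: mdeg_def)
  ultimately show ?case by (simp add: sum_distrib_right[symmetric] sum_distrib_left[symmetric])
next
  case (Herm_add p q)
  then show ?case
    by (simp add: partial_deriv_Pol_add raise_add Herm_Pol Pol_partial_deriv sum.distrib algebra_simps)
next
  case (Herm_cmult p c)
  then show ?case
    by (simp add: partial_deriv_Pol_cmult raise_cmult Herm_Pol Pol_partial_deriv sum_distrib_left[symmetric])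
qed (simp add: raise_zero)

lemma Herm_orthogonal:
  assumes "p \<in> Herm k" "q \<in> Herm l" "k \<noteq> l"
  shows "ip p q = 0"
  using assms(1)
proof (induction rule: Herm.induct)
  case (Herm_basis m)
  show ?case using assms(2)
  proof (induction rule: Herm.induct)
    case (Herm_basis m')
    then have "m \<noteq> m'" using \<open>mdeg m = k\<close> \<open>k \<noteq> l\<close> by auto
    then show ?case by (rule herm_orthogonal)
  qed (simp_all add: ip_commute[of "herm m"] ip_add_left ip_cmult_left Herm_L2M Pol_L2M Pol_herm)
qed (simp_all add: ip_add_left ip_cmult_left Herm_L2M Herm_L2M[OF assms(2)])

section \<open>Projections onto the Hermite spaces and finite Hermite sums\<close>

definition herm_proj :: "(real^'n::finite \<Rightarrow> real) \<Rightarrow> nat \<Rightarrow> real^'n \<Rightarrow> real" where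
  "herm_proj h k = (\<lambda>v. \<Sum>m\<in>{m. mdeg m = k}. ip h (herm m) / ip (herm m) (herm m) * herm m v)"

lemma herm_proj_Herm: "herm_proj h k \<in> Herm k"
  unfolding herm_proj_def by (intro Herm_sum Herm_cmult Herm_basis) simp

lemma herm_proj_ip:
  assumes h: "h \<in> L2M" and q: "q \<in> Herm k"
  shows "ip h q = ip (herm_proj h k) q"
  using q
proof (induction rule: Herm.induct)
  case (Herm_basis m)
  have "ip (herm_proj h k) (herm m) = (\<Sum>m'\<in>{m. mdeg m = k}. ip (\<lambda>v. ip h (herm m') / ip (herm m') (herm m') * herm m' v) (herm m))"
    unfolding herm_proj_def by (intro ip_sum_left L2M_cmult Pol_L2M Pol_herm)
  also have "\<dots> = (\<Sum>m'\<in>{m. mdeg m = k}. if m' = m then ip h (herm m) else 0)"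
    unfolding ip_cmult_left using herm_norm_pos[of m] by (intro sum.cong refl) (auto simp: herm_orthogonal)
  also have "\<dots> = ip h (herm m)" using Herm_basis by (simp add: finite_mdeg)
  finally show ?case by simp
qed (simp_all add: ip_commute[of h] ip_commute[of "herm_proj h k"] ip_add_left ip_cmult_left Herm_L2M h Herm_L2M[OF herm_proj_Herm])

definition HermSum :: "(real^'n::finite \<Rightarrow> real) set" where
  "HermSum = {q. \<exists>f n. (\<forall>k. f k \<in> Herm k) \<and> q = (\<lambda>v. \<Sum>k\<le>n. f k v)}"

lemma HermSumI: "p \<in> Herm k \<Longrightarrow> p \<in> HermSum"
proof -
  assume p: "p \<in> Herm k"
  let ?f = "\<lambda>j. if j = k then p else (\<lambda>_. 0)"
  have "\<forall>j. ?f j \<in> Herm j" using p by (auto intro: Herm_zero)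
  moreover have "p = (\<lambda>v. \<Sum>j\<le>k. ?f j v)" by (auto simp: if_distrib[of "\<lambda>f. f _"] cong: if_cong)
  ultimately show ?thesis unfolding HermSum_def by (intro CollectI exI conjI)
qed

lemma HermSum_add: "p \<in> HermSum \<Longrightarrow> q \<in> HermSum \<Longrightarrow> (\<lambda>v. p v + q v) \<in> HermSum"
proof -
  assume "p \<in> HermSum" "q \<in> HermSum"
  then obtain f n g n' where f: "\<forall>k. f k \<in> Herm k" "p = (\<lambda>v. \<Sum>k\<le>n. f k v)" and g: "\<forall>k. g k \<in> Herm k" "q = (\<lambda>v. \<Sum>k\<le>n'. g k v)"
    by (auto simp: HermSum_def)
  let ?h = "\<lambda>k v. (if k \<le> n then f k v else 0) + (if k \<le> n' then g k v else 0)"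
  have "?h k \<in> Herm k" for k
    using f(1) g(1) by (cases "k \<le> n"; cases "k \<le> n'") (auto intro: Herm_add Herm_zero)
  moreover have "(\<lambda>v. p v + q v) = (\<lambda>v. \<Sum>k\<le>max n n'. ?h k v)"
  proof
    fix v
    have "(\<Sum>k\<le>max n n'. if k \<le> n then f k v else 0) = (\<Sum>k\<le>n. f k v)"
      by (rule sum.mono_neutral_cong_right) auto
    moreover have "(\<Sum>k\<le>max n n'. if k \<le> n' then g k v else 0) = (\<Sum>k\<le>n'. g k v)"
      by (rule sum.mono_neutral_cong_right) auto
    ultimately show "p v + q v = (\<Sum>k\<le>max n n'. ?h k v)" by (simp add: f g sum.distrib)
  qed
  ultimately show ?thesis unfolding HermSum_def by (intro CollectI exI[of _ ?h] exI[of _ "max n n'"] conjI allI)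
qed

lemma HermSum_sum: "(\<And>j. j \<in> A \<Longrightarrow> f j \<in> HermSum) \<Longrightarrow> finite A \<Longrightarrow> (\<lambda>v. \<Sum>j\<in>A. f j v) \<in> HermSum"
  by (induction A rule: infinite_finite_induct) (auto intro: HermSumI[OF Herm_zero[of 0]] HermSum_add)

lemma HermSum_cmult: "p \<in> HermSum \<Longrightarrow> (\<lambda>v. c * p v) \<in> HermSum"
proof -
  assume "p \<in> HermSum"
  then obtain f n where f: "\<forall>k. f k \<in> Herm k" "p = (\<lambda>v. \<Sum>k\<le>n. f k v)" by (auto simp: HermSum_def)
  have "\<forall>k. (\<lambda>v. c * f k v) \<in> Herm k" using f(1) by (auto intro: Herm_cmult)
  moreover have "(\<lambda>v. c * p v) = (\<lambda>v. \<Sum>k\<le>n. c * f k v)" by (simp add: f(2) sum_distrib_left)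
  ultimately show ?thesis unfolding HermSum_def by (intro CollectI exI[of _ "\<lambda>k v. c * f k v"] exI[of _ n] conjI)
qed

text \<open>Multiplication by a coordinate is half the sum of \<open>raise i\<close> and
  \<open>partial_deriv i\<close>, which move the degree by one up and down.\<close>

lemma HermSum_coord_mult: "p \<in> HermSum \<Longrightarrow> (\<lambda>v. v $ i * p v) \<in> HermSum"
proof -
  assume "p \<in> HermSum"
  then obtain f n where f: "\<forall>k. f k \<in> Herm k" "p = (\<lambda>v. \<Sum>k\<le>n. f k v)" by (auto simp: HermSum_def)
  have "(\<lambda>v. v $ i * q v) \<in> HermSum" if q: "q \<in> Herm k" for q k
  proof -
    have "partial_deriv i q \<in> HermSum"
      using q by (cases k) (auto intro: HermSumI Herm_lower simp: Herm_lower_0 HermSumI[OF Herm_zero[of 0]])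
    then have "(\<lambda>v. 1/2 * (raise i q v + partial_deriv i q v)) \<in> HermSum"
      using q by (intro HermSum_cmult HermSum_add HermSumI[OF Herm_raise])
    then show ?thesis by (simp add: raise_def)
  qed
  then have "(\<lambda>v. \<Sum>k\<le>n. v $ i * f k v) \<in> HermSum" using f(1) by (intro HermSum_sum) auto
  then show ?thesis by (simp add: f(2) sum_distrib_left)
qed

lemma Pol_HermSum: "(p :: real^'n::finite \<Rightarrow> real) \<in> Pol \<Longrightarrow> p \<in> HermSum"
proof -
  have main: "(\<lambda>v. p v * q v) \<in> HermSum" if "p \<in> Pol" "q \<in> HermSum" for p q :: "real^'n \<Rightarrow> real"
    using that
  proof (induction arbitrary: q rule: Pol.induct)
    case (Pol_add f g)
    then show ?case using HermSum_add[of "\<lambda>v. f v * q v" "\<lambda>v. g v * q v"] by (simp add: distrib_right)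
  next
    case (Pol_mult f g)
    then show ?case by (simp add: mult.assoc)
  qed (auto intro: HermSum_cmult HermSum_coord_mult)
  show "p \<in> Pol \<Longrightarrow> p \<in> HermSum"
  proof -
    assume p: "p \<in> Pol"
    have "herm (\<lambda>_::'n. 0) \<in> HermSum" by (rule HermSumI[OF Herm_basis[OF refl]])
    moreover have "herm (\<lambda>_::'n. 0) = (\<lambda>_. 1)" by (auto simp: herm_def)
    ultimately have "(\<lambda>_::real^'n. 1) \<in> HermSum" by simp
    from main[OF p this] show ?thesis by simp
  qed
qed

lemma ip_add_right: "h \<in> L2M \<Longrightarrow> h' \<in> L2M \<Longrightarrow> k \<in> L2M \<Longrightarrow> ip k (\<lambda>v. h v + h' v) = ip k h + ip k h'"
  by (subst (1 2 3) ip_commute) (rule ip_add_left)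

lemma ip_diff_right: "h \<in> L2M \<Longrightarrow> h' \<in> L2M \<Longrightarrow> k \<in> L2M \<Longrightarrow> ip k (\<lambda>v. h v - h' v) = ip k h - ip k h'"
  by (subst (1 2 3) ip_commute) (rule ip_diff_left)

lemma ip_cmult_right: "ip k (\<lambda>v. c * h v) = c * ip k h"
  by (subst (1 2) ip_commute) (rule ip_cmult_left)

lemma ip_sum_right: "(\<And>m. m \<in> A \<Longrightarrow> f m \<in> L2M) \<Longrightarrow> k \<in> L2M \<Longrightarrow> ip k (\<lambda>v. \<Sum>m\<in>A. f m v) = (\<Sum>m\<in>A. ip k (f m))"
  by (subst (1 2) ip_commute) (rule ip_sum_left)

lemma ip_diff_self:
  assumes "h \<in> L2M" "q \<in> L2M"
  shows "ip (\<lambda>v. h v - q v) (\<lambda>v. h v - q v) = ip h h - 2 * ip h q + ip q q"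
  using assms ip_commute[of q h] by (simp add: ip_diff_left ip_diff_right L2M_diff)

lemma ip_HermSum:
  assumes h: "h \<in> L2M" and f: "\<And>k. f k \<in> Herm k"
  shows "ip h (\<lambda>v. \<Sum>k\<le>n. f k v) = (\<Sum>k\<le>n. ip (herm_proj h k) (f k))"
  by (subst ip_sum_right) (auto intro: Herm_L2M f h simp: herm_proj_ip[OF h f])

text \<open>Pythagoras: no Hermite sum of degree at most n is closer to \<open>h\<close> than the
  sum of its projections. The square is completed in each degree separately, the degrees being
  orthogonal.\<close>

lemma herm_proj_approx:
  assumes h: "h \<in> L2M" and q: "q \<in> Pol"
  obtains n where "(\<Sum>k\<le>n. ip (herm_proj h k) (herm_proj h k)) \<ge> ip h h - ip (\<lambda>v. h v - q v) (\<lambda>v. h v - q v)"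
proof -
  obtain f n where f: "\<And>k. f k \<in> Herm k" "q = (\<lambda>v. \<Sum>k\<le>n. f k v)"
    using Pol_HermSum[OF q] by (auto simp: HermSum_def)
  have qL: "q \<in> L2M" by (rule Pol_L2M[OF q])
  have "ip (\<lambda>v. h v - q v) (\<lambda>v. h v - q v) = ip h h - 2 * ip h q + ip q q"
    by (rule ip_diff_self[OF h qL])
  moreover have "ip h q = (\<Sum>k\<le>n. ip (herm_proj h k) (f k))"
    unfolding f(2) by (rule ip_HermSum[OF h f(1)])
  moreover have "ip q q = (\<Sum>k\<le>n. ip (f k) (f k))"
  proof -
    have "ip q q = (\<Sum>k\<le>n. ip (f k) q)"
      by (subst (1) f(2)) (rule ip_sum_left, auto intro: Herm_L2M f(1) qL)
    also have "\<dots> = (\<Sum>k\<le>n. \<Sum>l\<le>n. ip (f l) (f k))"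
      unfolding f(2) by (subst ip_commute, subst ip_sum_left) (auto intro: Herm_L2M f)
    also have "\<dots> = (\<Sum>k\<le>n. \<Sum>l\<le>n. if l = k then ip (f k) (f k) else 0)"
      using Herm_orthogonal[OF f(1) f(1)] by (intro sum.cong refl) auto
    finally show ?thesis by simp
  qed
  moreover have "2 * ip (herm_proj h k) (f k) - ip (f k) (f k) \<le> ip (herm_proj h k) (herm_proj h k)" for k
  proof -
    have "0 \<le> ip (\<lambda>v. herm_proj h k v - f k v) (\<lambda>v. herm_proj h k v - f k v)" by (rule ip_self_nonneg)
    also have "\<dots> = ip (herm_proj h k) (herm_proj h k) - 2 * ip (herm_proj h k) (f k) + ip (f k) (f k)"
      by (rule ip_diff_self[OF Herm_L2M[OF herm_proj_Herm] Herm_L2M[OF f(1)]])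
    finally show ?thesis by simp
  qed
  then have "(\<Sum>k\<le>n. 2 * ip (herm_proj h k) (f k) - ip (f k) (f k)) \<le> (\<Sum>k\<le>n. ip (herm_proj h k) (herm_proj h k))"
    by (rule sum_mono)
  ultimately have "(\<Sum>k\<le>n. ip (herm_proj h k) (herm_proj h k)) \<ge> ip h h - ip (\<lambda>v. h v - q v) (\<lambda>v. h v - q v)"
    by (simp add: sum_subtractf sum_distrib_left)
  then show ?thesis by (rule that)
qed

section \<open>Density of polynomials\<close>

definition Pol_closure :: "(real^'n::finite \<Rightarrow> real) set" where
  "Pol_closure = {h \<in> L2M. \<forall>\<epsilon>>0. \<exists>q\<in>Pol. ip (\<lambda>v. h v - q v) (\<lambda>v. h v - q v) < \<epsilon>}"

lemma Pol_closureD: "h \<in> Pol_closure \<Longrightarrow> h \<in> L2M"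
  by (simp add: Pol_closure_def)

lemma ip_add_self_le:
  assumes "f \<in> L2M" "g \<in> L2M"
  shows "ip (\<lambda>v. f v + g v) (\<lambda>v. f v + g v) \<le> 2 * ip f f + 2 * ip g g"
proof -
  have "ip (\<lambda>v. f v + g v) (\<lambda>v. f v + g v) + ip (\<lambda>v. f v - g v) (\<lambda>v. f v - g v) = 2 * ip f f + 2 * ip g g"
    using assms by (simp add: ip_diff_left ip_diff_right ip_add_left ip_add_right L2M_diff L2M_add)
  then show ?thesis using ip_self_nonneg[of "\<lambda>v. f v - g v"] by linarith
qed

lemma Pol_closure_closed:
  assumes f: "f \<in> L2M" and ap: "\<And>\<epsilon>. \<epsilon> > 0 \<Longrightarrow> \<exists>g\<in>Pol_closure. ip (\<lambda>v. f v - g v) (\<lambda>v. f v - g v) < \<epsilon>"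
  shows "f \<in> Pol_closure"
  unfolding Pol_closure_def
proof (intro CollectI conjI f allI impI)
  fix \<epsilon> :: real assume "\<epsilon> > 0"
  then obtain g where g: "g \<in> Pol_closure" "ip (\<lambda>v. f v - g v) (\<lambda>v. f v - g v) < \<epsilon> / 4" using ap[of "\<epsilon> / 4"] by auto
  then obtain q where q: "q \<in> Pol" "ip (\<lambda>v. g v - q v) (\<lambda>v. g v - q v) < \<epsilon> / 4"
    using \<open>\<epsilon> > 0\<close> unfolding Pol_closure_def by (auto dest!: spec[of _ "\<epsilon> / 4"])
  have "ip (\<lambda>v. (f v - g v) + (g v - q v)) (\<lambda>v. (f v - g v) + (g v - q v)) \<le> 2 * ip (\<lambda>v. f v - g v) (\<lambda>v. f v - g v) + 2 * ip (\<lambda>v. g v - q v) (\<lambda>v. g v - q v)"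
    by (intro ip_add_self_le L2M_diff f Pol_closureD g Pol_L2M q)
  then have "ip (\<lambda>v. f v - q v) (\<lambda>v. f v - q v) < \<epsilon>" using g(2) q(2) by simp
  with q(1) show "\<exists>q\<in>Pol. ip (\<lambda>v. f v - q v) (\<lambda>v. f v - q v) < \<epsilon>" by blast
qed

lemma Pol_closure_Pol: "q \<in> Pol \<Longrightarrow> q \<in> Pol_closure"
  unfolding Pol_closure_def by (auto intro!: Pol_L2M bexI[of _ q])

lemma Pol_closure_add:
  assumes f: "f \<in> Pol_closure" and g: "g \<in> Pol_closure"
  shows "(\<lambda>v. f v + g v) \<in> Pol_closure"
  unfolding Pol_closure_def
proof (intro CollectI conjI L2M_add Pol_closureD f g allI impI)
  fix \<epsilon> :: real assume "\<epsilon> > 0"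
  then obtain p q where p: "p \<in> Pol" "ip (\<lambda>v. f v - p v) (\<lambda>v. f v - p v) < \<epsilon> / 4" and q: "q \<in> Pol" "ip (\<lambda>v. g v - q v) (\<lambda>v. g v - q v) < \<epsilon> / 4"
    using f g unfolding Pol_closure_def by (auto dest!: spec[of _ "\<epsilon> / 4"])
  have "ip (\<lambda>v. (f v - p v) + (g v - q v)) (\<lambda>v. (f v - p v) + (g v - q v)) \<le> 2 * ip (\<lambda>v. f v - p v) (\<lambda>v. f v - p v) + 2 * ip (\<lambda>v. g v - q v) (\<lambda>v. g v - q v)"
    by (intro ip_add_self_le L2M_diff f Pol_closureD g Pol_L2M q p)
  then have "ip (\<lambda>v. (f v + g v) - (p v + q v)) (\<lambda>v. (f v + g v) - (p v + q v)) < \<epsilon>"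
    using p(2) q(2) by (simp add: algebra_simps)
  then show "\<exists>q\<in>Pol. ip (\<lambda>v. (f v + g v) - q v) (\<lambda>v. (f v + g v) - q v) < \<epsilon>"
    by (intro bexI[of _ "\<lambda>v. p v + q v"] Pol_add p q)
qed

lemma Pol_closure_cmult:
  assumes f: "f \<in> Pol_closure"
  shows "(\<lambda>v. c * f v) \<in> Pol_closure"
  unfolding Pol_closure_def
proof (intro CollectI conjI L2M_cmult Pol_closureD f allI impI)
  fix \<epsilon> :: real assume "\<epsilon> > 0"
  then have "\<epsilon> / (c\<^sup>2 + 1) > 0" by (auto intro!: divide_pos_pos add_nonneg_pos)
  then obtain p where p: "p \<in> Pol" "ip (\<lambda>v. f v - p v) (\<lambda>v. f v - p v) < \<epsilon> / (c\<^sup>2 + 1)"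
    using f unfolding Pol_closure_def by (auto dest!: spec[of _ "\<epsilon> / (c\<^sup>2 + 1)"])
  have c1: "c\<^sup>2 + 1 > 0" by (simp add: add_nonneg_pos)
  have "ip (\<lambda>v. c * f v - c * p v) (\<lambda>v. c * f v - c * p v) = c\<^sup>2 * ip (\<lambda>v. f v - p v) (\<lambda>v. f v - p v)"
    unfolding right_diff_distrib[symmetric] ip_cmult_left ip_cmult_right by (simp add: power2_eq_square)
  also have "\<dots> \<le> (c\<^sup>2 + 1) * ip (\<lambda>v. f v - p v) (\<lambda>v. f v - p v)"
    by (intro mult_right_mono ip_self_nonneg) simp
  also have "\<dots> < \<epsilon>" using p(2) c1 by (simp add: pos_less_divide_eq mult.commute)
  finally show "\<exists>q\<in>Pol. ip (\<lambda>v. c * f v - q v) (\<lambda>v. c * f v - q v) < \<epsilon>"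
    by (intro bexI[of _ "\<lambda>v. c * p v"] Pol_cmult p)
qed

lemma Pol_closure_sum: "(\<And>j. j \<in> A \<Longrightarrow> f j \<in> Pol_closure) \<Longrightarrow> (\<lambda>v. \<Sum>j\<in>A. f j v) \<in> Pol_closure"
  by (induction A rule: infinite_finite_induct) (auto intro: Pol_closure_add Pol_closure_Pol Pol_const)

lemma L2M_bounded_by:
  assumes w: "w \<in> L2M" and [measurable]: "f \<in> borel_measurable borel" and "\<And>v. \<bar>f v\<bar> \<le> w v"
  shows "f \<in> L2M"
  unfolding L2M_def
proof (intro CollectI conjI)
  show "integrable lborel (\<lambda>v. (f v)\<^sup>2 * maxw v)"
  proof (rule Bochner_Integration.integrable_bound)
    show "integrable lborel (\<lambda>v. (w v)\<^sup>2 * maxw v)" using w by (simp add: L2M_def)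
    have "(f v)\<^sup>2 \<le> (w v)\<^sup>2" for v using power_mono[OF assms(3)[of v], of 2] by simp
    then show "AE v in lborel. norm ((f v)\<^sup>2 * maxw v) \<le> norm ((w v)\<^sup>2 * maxw v)"
      by (intro AE_I2) (simp add: mult_right_mono)
  qed measurable
qed simp

text \<open>Dominated convergence in the weighted space. The cosine series, the scaled sines, the
  distance functions of closed sets, disjoint unions and simple functions all enter the closure
  through it.\<close>

lemma Pol_closure_lim:
  assumes fn: "\<And>n. f n \<in> Pol_closure" and w: "w \<in> L2M" and b: "\<And>n v. \<bar>f n v\<bar> \<le> w v"
    and lim: "\<And>v. (\<lambda>n. f n v) \<longlonglongrightarrow> F v"
  shows "F \<in> Pol_closure"
proof (rule Pol_closure_closed)
  have fm[measurable]: "f n \<in> borel_measurable borel" for n by (intro L2M_borel Pol_closureD fn)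
  have [measurable]: "F \<in> borel_measurable borel" using borel_measurable_LIMSEQ_metric[OF fm lim] by simp
  have Fw: "\<bar>F v\<bar> \<le> w v" for v
    using b by (intro LIMSEQ_le_const2[OF tendsto_rabs[OF lim]]) auto
  show F: "F \<in> L2M" by (rule L2M_bounded_by[OF w _ Fw]) measurable
  have "(\<lambda>n. LINT v|lborel. (F v - f n v) * (F v - f n v) * maxw v) \<longlonglongrightarrow> (LINT (v::real^'a)|lborel. 0)"
  proof (rule integral_dominated_convergence[where w = "\<lambda>v. 4 * ((w v)\<^sup>2 * maxw v)"])
    show "integrable lborel (\<lambda>v. 4 * ((w v)\<^sup>2 * maxw v))" using w by (auto simp: L2M_def)
    show "AE v in lborel. (\<lambda>n. (F v - f n v) * (F v - f n v) * maxw v) \<longlonglongrightarrow> 0"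
    proof (rule AE_I2)
      fix v
      have "(\<lambda>n. (F v - f n v) * (F v - f n v) * maxw v) \<longlonglongrightarrow> (F v - F v) * (F v - F v) * maxw v"
        by (intro tendsto_intros lim)
      then show "(\<lambda>n. (F v - f n v) * (F v - f n v) * maxw v) \<longlonglongrightarrow> 0" by simp
    qed
    show "AE v in lborel. norm ((F v - f n v) * (F v - f n v) * maxw v) \<le> 4 * ((w v)\<^sup>2 * maxw v)" for n
    proof (rule AE_I2)
      fix v
      have "\<bar>F v - f n v\<bar> \<le> 2 * w v" using b[of n v] Fw[of v] by linarith
      then have "\<bar>F v - f n v\<bar>\<^sup>2 \<le> (2 * w v)\<^sup>2" by (intro power_mono) auto
      then have "(F v - f n v) * (F v - f n v) \<le> 4 * (w v)\<^sup>2" by (simp add: power2_eq_square)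
      then have "(F v - f n v) * (F v - f n v) * maxw v \<le> 4 * (w v)\<^sup>2 * maxw v" by (rule mult_right_mono) simp
      then show "norm ((F v - f n v) * (F v - f n v) * maxw v) \<le> 4 * ((w v)\<^sup>2 * maxw v)" by (simp add: abs_mult)
    qed
  qed (measurable, use w in measurable)
  then have l0: "(\<lambda>n. ip (\<lambda>v. F v - f n v) (\<lambda>v. F v - f n v)) \<longlonglongrightarrow> 0" by (simp add: L2M_inner_def)
  fix \<epsilon> :: real assume "\<epsilon> > 0"
  with l0 have "\<forall>\<^sub>F n in sequentially. ip (\<lambda>v. F v - f n v) (\<lambda>v. F v - f n v) < \<epsilon>" by (rule order_tendstoD(2))
  then obtain n where "ip (\<lambda>v. F v - f n v) (\<lambda>v. F v - f n v) < \<epsilon>" by (auto simp: eventually_sequentially)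
  then show "\<exists>g\<in>Pol_closure. ip (\<lambda>v. F v - g v) (\<lambda>v. F v - g v) < \<epsilon>" using fn by blast
qed

lemma exp_norm_L2M: "(\<lambda>v::real^'n::finite. exp (a * norm v + b)) \<in> L2M"
  unfolding L2M_def
proof (intro CollectI conjI)
  show "integrable lborel (\<lambda>v::real^'n. (exp (a * norm v + b))\<^sup>2 * maxw v)"
  proof (rule Bochner_Integration.integrable_bound)
    have "integrable lborel (\<lambda>v::real^'n. exp (- ((norm v)\<^sup>2 / 2)))"
      using nn_integral_gauss_half[where 'n = 'n] by (intro integrableI_bounded) auto
    then show "integrable lborel (\<lambda>v::real^'n. exp (2 * a\<^sup>2 + 2 * b) * exp (- ((norm v)\<^sup>2 / 2)))" by (rule integrable_mult_right)
    show "AE v in (lborel :: (real^'n) measure). norm ((exp (a * norm v + b))\<^sup>2 * maxw v) \<le> norm (exp (2 * a\<^sup>2 + 2 * b) * exp (- ((norm v)\<^sup>2 / 2)))"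
    proof (rule AE_I2)
      fix v :: "real^'n"
      have "0 \<le> (2 * a - norm v)\<^sup>2" by simp
      then have "2 * (a * norm v + b) - (norm v)\<^sup>2 \<le> 2 * a\<^sup>2 + 2 * b - (norm v)\<^sup>2 / 2"
        by (simp add: power2_diff power_mult_distrib)
      then have "exp (2 * (a * norm v + b) - (norm v)\<^sup>2) \<le> exp (2 * a\<^sup>2 + 2 * b - (norm v)\<^sup>2 / 2)" by simp
      moreover have "(exp (a * norm v + b))\<^sup>2 * maxw v = exp (2 * (a * norm v + b) - (norm v)\<^sup>2)"
        unfolding maxw_def exp_double[symmetric] exp_add[symmetric] by simp
      moreover have "exp (2 * a\<^sup>2 + 2 * b) * exp (- ((norm v)\<^sup>2 / 2)) = exp (2 * a\<^sup>2 + 2 * b - (norm v)\<^sup>2 / 2)"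
        by (simp add: exp_add[symmetric])
      ultimately show "norm ((exp (a * norm v + b))\<^sup>2 * maxw v) \<le> norm (exp (2 * a\<^sup>2 + 2 * b) * exp (- ((norm v)\<^sup>2 / 2)))"
        by simp
    qed
  qed measurable
qed measurable

lemma Pol_inner: "(\<lambda>v. t \<bullet> v) \<in> Pol"
  unfolding inner_vec_def inner_real_def by (intro Pol_sum Pol_mult Pol_const Pol_coord)

text \<open>The partial sums of the cosine series are polynomials dominated by exp (norm t * norm v
  + |s|), which is still square integrable against the Gaussian.\<close>

lemma cos_Pol_closure: "(\<lambda>v. cos (t \<bullet> v + s)) \<in> Pol_closure"
proof (rule Pol_closure_lim)
  let ?f = "\<lambda>n v. \<Sum>k<n. cos_coeff k * (t \<bullet> v + s) ^ k"
  show "?f n \<in> Pol_closure" for n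
    by (intro Pol_closure_Pol Pol_sum Pol_cmult Pol_power Pol_add Pol_inner Pol_const)
  show "(\<lambda>n. ?f n v) \<longlonglongrightarrow> cos (t \<bullet> v + s)" for v
    using cos_converges[of "t \<bullet> v + s"] by (simp add: sums_def)
  show "(\<lambda>v. exp (norm t * norm v + \<bar>s\<bar>)) \<in> L2M" by (rule exp_norm_L2M)
  show "\<bar>?f n v\<bar> \<le> exp (norm t * norm v + \<bar>s\<bar>)" for n v
  proof -
    let ?x = "t \<bullet> v + s"
    have "\<bar>?f n v\<bar> \<le> (\<Sum>k<n. \<bar>cos_coeff k * ?x ^ k\<bar>)" by (rule sum_abs)
    also have "\<dots> \<le> (\<Sum>k<n. \<bar>?x\<bar> ^ k /\<^sub>R fact k)"
    proof (rule sum_mono)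
      fix k
      have "\<bar>cos_coeff k\<bar> \<le> 1 / fact k" by (auto simp: cos_coeff_def power_abs)
      then have "\<bar>cos_coeff k\<bar> * \<bar>?x\<bar> ^ k \<le> 1 / fact k * \<bar>?x\<bar> ^ k" by (rule mult_right_mono) simp
      then show "\<bar>cos_coeff k * ?x ^ k\<bar> \<le> \<bar>?x\<bar> ^ k /\<^sub>R fact k"
        by (simp add: abs_mult power_abs divide_inverse mult.commute)
    qed
    also have "\<dots> \<le> exp \<bar>?x\<bar>"
      unfolding exp_def by (intro sum_le_suminf summable_exp_generic) auto
    also have "\<dots> \<le> exp (norm t * norm v + \<bar>s\<bar>)"
      using Cauchy_Schwarz_ineq2[of t v] by simp
    finally show ?thesis .
  qed
qed

section \<open>Trigonometric polynomials and bounded continuous functions\<close>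

inductive_set Trig :: "(real^'n::finite \<Rightarrow> real) set" where
  Trig_cos: "(\<lambda>v. cos (t \<bullet> v + s)) \<in> Trig"
| Trig_add: "p \<in> Trig \<Longrightarrow> q \<in> Trig \<Longrightarrow> (\<lambda>v. p v + q v) \<in> Trig"
| Trig_cmult: "p \<in> Trig \<Longrightarrow> (\<lambda>v. c * p v) \<in> Trig"

lemma Trig_Pol_closure: "p \<in> Trig \<Longrightarrow> p \<in> Pol_closure"
  by (induction rule: Trig.induct) (auto intro: cos_Pol_closure Pol_closure_add Pol_closure_cmult)

lemma Trig_mult: "p \<in> Trig \<Longrightarrow> q \<in> Trig \<Longrightarrow> (\<lambda>v. p v * q v) \<in> Trig"
proof (induction rule: Trig.induct)
  case (Trig_cos t s)
  from Trig_cos show ?case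
  proof (induction rule: Trig.induct)
    case (Trig_cos t' s')
    have "(\<lambda>v. cos (t \<bullet> v + s) * cos (t' \<bullet> v + s')) = (\<lambda>v. 1/2 * (cos ((t - t') \<bullet> v + (s - s')) + cos ((t + t') \<bullet> v + (s + s'))))"
    proof
      fix v
      have "(t - t') \<bullet> v + (s - s') = (t \<bullet> v + s) - (t' \<bullet> v + s')" "(t + t') \<bullet> v + (s + s') = (t \<bullet> v + s) + (t' \<bullet> v + s')"
        by (simp_all add: inner_diff_left inner_add_left)
      then show "cos (t \<bullet> v + s) * cos (t' \<bullet> v + s') = 1/2 * (cos ((t - t') \<bullet> v + (s - s')) + cos ((t + t') \<bullet> v + (s + s')))"
        by (simp only: cos_times_cos)
    qed
    then show ?case by (simp only:) (intro Trig.intros)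
  next
    case (Trig_add p q)
    then show ?case by (simp only: distrib_left) (intro Trig.intros)
  next
    case (Trig_cmult p c)
    then show ?case using Trig.Trig_cmult[of "\<lambda>v. cos (t \<bullet> v + s) * p v" c] by (simp add: mult.left_commute)
  qed
next
  case (Trig_add p1 p2)
  then have "(\<lambda>v. p1 v * q v) \<in> Trig" "(\<lambda>v. p2 v * q v) \<in> Trig" by auto
  then show ?case by (simp only: distrib_right) (rule Trig.Trig_add)
next
  case (Trig_cmult p c)
  then show ?case using Trig.Trig_cmult by (simp add: mult.assoc)
qed

lemma Trig_sum: "finite A \<Longrightarrow> A \<noteq> {} \<Longrightarrow> (\<And>j. j \<in> A \<Longrightarrow> f j \<in> Trig) \<Longrightarrow> (\<lambda>v. \<Sum>j\<in>A. f j v) \<in> Trig"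
  by (induction A rule: finite_ne_induct) (auto intro: Trig_add)

text \<open>A sine is a cosine with phase - pi / 2, which is why \<open>Trig\<close> admits phases;
  products stay in the class by the product formula for cosines.\<close>

lemma Trig_polynomial:
  fixes f :: "real^'n::finite \<Rightarrow> real"
  assumes "real_polynomial_function f"
  shows "(\<lambda>v. f (\<chi> i. sin (r * v $ i))) \<in> Trig"
  using assms
proof (induction rule: real_polynomial_function.induct)
  case (linear f)
  then have lin: "linear f" by (rule bounded_linear.linear)
  have "f (\<chi> i. sin (r * v $ i)) = (\<Sum>i\<in>UNIV. f (axis i 1) * cos ((r *\<^sub>R axis i 1) \<bullet> v + (- (pi / 2))))" for v :: "real^'n"
  proof -
    have "(\<chi> i. sin (r * v $ i)) = (\<Sum>i\<in>UNIV. sin (r * v $ i) *\<^sub>R axis i 1)"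
      using basis_expansion[of "\<chi> i. sin (r * v $ i)"] by (simp add: scalar_mult_eq_scaleR)
    then have "f (\<chi> i. sin (r * v $ i)) = (\<Sum>i\<in>UNIV. sin (r * v $ i) * f (axis i 1))"
      by (simp add: linear_sum[OF lin] linear_scale[OF lin])
    moreover have "sin x = cos (x + (- (pi / 2)))" for x :: real
      using cos_diff[of x "pi / 2"] by simp
    ultimately show ?thesis by (simp add: inner_axis' mult.commute)
  qed
  then show ?case by (simp only:) (intro Trig_sum Trig.intros; simp)
next
  case (const c)
  have "(\<lambda>v::real^'n. c * cos (0 \<bullet> v + 0)) \<in> Trig" by (intro Trig.intros)
  then show ?case by simp
qed (auto intro: Trig_add Trig_mult)

lemma bounded_L2M:
  assumes "f \<in> borel_measurable borel" "\<And>v. \<bar>f v\<bar> \<le> B"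
  shows "f \<in> L2M"
  by (rule L2M_bounded_by[OF Pol_L2M[OF Pol_const[of B]] assms])

lemma ip_bounded:
  fixes f :: "real^'n::finite \<Rightarrow> real"
  assumes f: "f \<in> borel_measurable borel" "\<And>v. \<bar>f v\<bar> \<le> B"
  shows "ip f f \<le> B\<^sup>2 * sqrt pi ^ CARD('n)"
proof -
  have B: "(\<lambda>_::real^'n. B) \<in> L2M" by (intro Pol_L2M Pol_const)
  have "ip f f \<le> ip (\<lambda>_::real^'n. B) (\<lambda>_. B)"
    unfolding L2M_inner_def
  proof (rule Bochner_Integration.integral_mono)
    show "integrable lborel (\<lambda>v. f v * f v * maxw v)" "integrable lborel (\<lambda>v::real^'n. B * B * maxw v)"
      using L2M_mult_integrable[OF bounded_L2M[OF f] bounded_L2M[OF f]] L2M_mult_integrable[OF B B] by auto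
    fix v
    have "\<bar>f v\<bar>\<^sup>2 \<le> B\<^sup>2" using f(2) by (intro power_mono) auto
    then have "f v * f v \<le> B * B" by (simp add: power2_eq_square)
    then show "f v * f v * maxw v \<le> B * B * maxw v" by (rule mult_right_mono) simp
  qed
  also have "\<dots> = B\<^sup>2 * ip (\<lambda>_. 1) (\<lambda>_::real^'n. 1)" by (simp add: L2M_inner_def power2_eq_square mult.assoc)
  finally show ?thesis by (simp add: ip_one_one)
qed

lemma sin_scaled_tendsto: "(\<lambda>n. real (Suc n) * sin (1 / real (Suc n) * x)) \<longlonglongrightarrow> x"
proof -
  have "((\<lambda>h. sin (h * x)) has_real_derivative x) (at 0)" by (auto intro!: derivative_eq_intros)
  then have "((\<lambda>h. (sin (h * x)) / h) \<longlongrightarrow> x) (at 0)" by (simp add: DERIV_def)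
  moreover have "filterlim (\<lambda>n. 1 / real (Suc n)) (at 0) sequentially"
    unfolding filterlim_at using LIMSEQ_Suc[OF lim_1_over_n] by auto
  ultimately have "(\<lambda>n. sin (1 / real (Suc n) * x) / (1 / real (Suc n))) \<longlonglongrightarrow> x" by (rule filterlim_compose)
  then show ?thesis by (simp add: mult.commute)
qed

text \<open>Stone-Weierstrass asks for a compact set. The map with components (n + 1) sin (v $ i /
  (n + 1)) tends to the identity, while the sines stay in a cube. A polynomial approximation on the
  cube is then uniform on the whole space after composition with the sines, and it is a
  trigonometric polynomial in v.\<close>

lemma continuous_Pol_closure:
  fixes \<Psi> :: "real^'n::finite \<Rightarrow> real"
  assumes c: "continuous_on UNIV \<Psi>" and B: "\<And>v. \<bar>\<Psi> v\<bar> \<le> B"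
  shows "\<Psi> \<in> Pol_closure"
proof (rule Pol_closure_lim)
  let ?s = "\<lambda>n v. (\<chi> i. sin (1 / real (Suc n) * v $ i)) :: real^'n"
  let ?f = "\<lambda>n v. \<Psi> (real (Suc n) *\<^sub>R ?s n v)"
  let ?C = "cbox (\<chi> i. - 1) (\<chi> i. 1) :: (real^'n) set"
  have cs: "continuous_on UNIV (?s n)" for n by (intro continuous_intros continuous_on_vec_lambda)
  have cf: "continuous_on UNIV (?f n)" for n
    by (rule continuous_on_compose2[OF c]) (auto intro!: continuous_intros cs)
  have fm[measurable]: "?f n \<in> borel_measurable borel" for n by (rule borel_measurable_continuous_onI[OF cf])
  show "?f n \<in> Pol_closure" for n
  proof (rule Pol_closure_closed)
    show "?f n \<in> L2M" by (rule bounded_L2M[OF fm B])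
    fix \<epsilon> :: real assume \<epsilon>: "\<epsilon> > 0"
    define m where "m = sqrt pi ^ CARD('n)"
    have m: "m > 0" by (simp add: m_def)
    \<comment> \<open>A uniform error \<delta> contributes at most \<delta>^2 m to the squared norm,
      here \<epsilon> / 2.\<close>
    define \<delta> where "\<delta> = sqrt (\<epsilon> / (2 * m))"
    have \<delta>: "\<delta> > 0" "\<delta>\<^sup>2 * m < \<epsilon>" using \<epsilon> m by (auto simp: \<delta>_def)
    have "continuous_on ?C (\<lambda>y. \<Psi> (real (Suc n) *\<^sub>R y))"
      by (rule continuous_on_compose2[OF c]) (auto intro!: continuous_intros)
    then obtain g where g: "real_polynomial_function g" "\<And>y. y \<in> ?C \<Longrightarrow> \<bar>\<Psi> (real (Suc n) *\<^sub>R y) - g y\<bar> < \<delta>"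
      using Stone_Weierstrass_real_polynomial_function[OF compact_cbox _ \<delta>(1)] by metis
    have "?s n v \<in> ?C" for v by (auto simp: mem_box_cart)
    then have b: "\<bar>?f n v - g (?s n v)\<bar> \<le> \<delta>" for v using g(2)[of "?s n v"] by simp
    have gc: "(\<lambda>v. g (?s n v)) \<in> Pol_closure" by (rule Trig_Pol_closure[OF Trig_polynomial[OF g(1)]])
    have "ip (\<lambda>v. ?f n v - g (?s n v)) (\<lambda>v. ?f n v - g (?s n v)) \<le> \<delta>\<^sup>2 * m"
      unfolding m_def by (rule ip_bounded[OF _ b]) (intro borel_measurable_diff fm L2M_borel Pol_closureD gc)
    with \<delta>(2) gc show "\<exists>g\<in>Pol_closure. ip (\<lambda>v. ?f n v - g v) (\<lambda>v. ?f n v - g v) < \<epsilon>"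
      by (intro bexI[of _ "\<lambda>v. g (?s n v)"]) auto
  qed
  show "(\<lambda>v::real^'n. B) \<in> L2M" by (intro Pol_L2M Pol_const)
  show "\<bar>?f n v\<bar> \<le> B" for n v by (rule B)
  show "(\<lambda>n. ?f n v) \<longlonglongrightarrow> \<Psi> v" for v
  proof -
    have "(\<lambda>n. real (Suc n) *\<^sub>R ?s n v) \<longlonglongrightarrow> v"
      by (rule vec_tendstoI) (simp only: vector_scaleR_component vec_lambda_beta sin_scaled_tendsto real_scaleR_def)
    moreover have "isCont \<Psi> v" using c by (simp add: continuous_on_eq_continuous_at)
    ultimately show ?thesis by (rule isCont_tendsto_compose[rotated])
  qed
qed

text \<open>Dynkin's theorem, starting from the closed sets, whose indicators are limits of the
  continuous functions max 0 (1 - n dist (v, C)).\<close>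

lemma indicator_Pol_closure:
  fixes A :: "(real^'n::finite) set"
  assumes "A \<in> sets borel"
  shows "indicator A \<in> Pol_closure"
proof -
  have one: "(\<lambda>_::real^'n. 1) \<in> L2M" by (intro Pol_L2M Pol_const)
  have "Int_stable (Collect closed :: (real^'n) set set)" "(Collect closed :: (real^'n) set set) \<subseteq> Pow UNIV"
    "A \<in> sigma_sets UNIV (Collect closed)"
    using assms by (auto simp: borel_eq_closed Int_stable_def)
  then show ?thesis
  proof (induction rule: sigma_sets_induct_disjoint)
    case (basic C)
    then have C: "closed C" by simp
    show ?case
    proof (cases "C = {}")
      case True
      then show ?thesis using Pol_closure_Pol[OF Pol_const[of 0]] by (simp add: indicator_def)
    next
      case False
      let ?f = "\<lambda>n v. max 0 (1 - real n * infdist v C)"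
      show ?thesis
      proof (rule Pol_closure_lim[OF _ one])
        show "?f n \<in> Pol_closure" for n
        proof (rule continuous_Pol_closure[where B = 1])
          show "continuous_on UNIV (?f n)" by (intro continuous_intros)
        qed (auto simp: infdist_nonneg max_def)
        show "\<bar>?f n v\<bar> \<le> 1" for n v by (auto simp: infdist_nonneg max_def)
        show "(\<lambda>n. ?f n v) \<longlonglongrightarrow> indicator C v" for v
        proof (cases "v \<in> C")
          case True
          then show ?thesis by simp
        next
          case F: False
          then have d: "infdist v C > 0" using C False by (metis infdist_pos_not_in_closed)
          obtain N where N: "real N * infdist v C > 1" using reals_Archimedean3[OF d] by blast
          have "?f n v = indicator C v" if "n \<ge> N" for n
          proof -
            have "real N * infdist v C \<le> real n * infdist v C" using that d by (intro mult_right_mono) auto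
            then show ?thesis using N F by simp
          qed
          then show ?thesis by (intro tendsto_eventually) (auto simp: eventually_sequentially)
        qed
      qed
    qed
  next
    case empty
    then show ?case using Pol_closure_Pol[OF Pol_const[of 0]] by (simp add: indicator_def)
  next
    case (compl A)
    have "(\<lambda>v. 1 + (-1) * indicator A v) \<in> Pol_closure"
      by (intro Pol_closure_add Pol_closure_cmult compl Pol_closure_Pol Pol_const)
    also have "(\<lambda>v. 1 + (-1) * indicator A v) = (indicator (UNIV - A) :: _ \<Rightarrow> real)"
      by (auto split: split_indicator)
    finally show ?case .
  next
    case (union A)
    show ?case
    proof (rule Pol_closure_lim[OF _ one])
      let ?f = "\<lambda>n v. \<Sum>k<n. indicator (A k) v :: real"
      have eq: "?f n v = indicator (\<Union>k<n. A k) v" for n v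
        using union(1) by (subst indicator_UN_disjoint[symmetric]) (auto simp: disjoint_family_on_def)
      show "?f n \<in> Pol_closure" for n by (intro Pol_closure_sum union)
      show "\<bar>?f n v\<bar> \<le> 1" for n v unfolding eq by simp
      show "(\<lambda>n. ?f n v) \<longlonglongrightarrow> indicator (\<Union>k. A k) v" for v
      proof (cases "v \<in> (\<Union>k. A k)")
        case True
        then obtain k where k: "v \<in> A k" by blast
        have "?f n v = indicator (\<Union>k. A k) v" if "n \<ge> Suc k" for n
          unfolding eq using k that by (auto simp: indicator_def)
        then show ?thesis by (intro tendsto_eventually) (auto simp only: eventually_sequentially)
      next
        case False
        then show ?thesis by simp
      qed
    qed
  qed
qed

lemma L2M_Pol_dense:
  fixes h :: "real^'n::finite \<Rightarrow> real"
  assumes h: "h \<in> L2M"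
  shows "h \<in> Pol_closure"
proof -
  obtain F where F: "\<And>i. simple_function borel (F i)" "\<And>x. (\<lambda>i. F i x) \<longlonglongrightarrow> h x" "\<And>i x. dist (F i x) 0 \<le> 2 * dist (h x) 0"
    using borel_measurable_implies_sequence_metric[OF L2M_borel[OF h], of 0] by auto
  show ?thesis
  proof (rule Pol_closure_lim[OF _ _ _ F(2)])
    show "F n \<in> Pol_closure" for n
    proof -
      have "(\<lambda>v. \<Sum>y\<in>range (F n). y * indicator (F n -` {y}) v) \<in> Pol_closure"
        using F(1)[of n] by (intro Pol_closure_sum Pol_closure_cmult indicator_Pol_closure) (auto simp: simple_function_def)
      also have "(\<lambda>v. \<Sum>y\<in>range (F n). y * indicator (F n -` {y}) v) = F n"
      proof
        fix v
        have "(\<Sum>y\<in>range (F n). y * indicator (F n -` {y}) v) = (\<Sum>y\<in>range (F n). if y = F n v then y else 0)"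
          by (intro sum.cong) (auto simp: indicator_def)
        then show "(\<Sum>y\<in>range (F n). y * indicator (F n -` {y}) v) = F n v"
          using F(1)[of n] by (simp add: simple_function_def)
      qed
      finally show ?thesis .
    qed
    show "(\<lambda>v. 2 * \<bar>h v\<bar>) \<in> L2M" using L2M_cmult[OF h, of 2] h by (auto simp: L2M_def power_mult_distrib)
    show "\<bar>F n v\<bar> \<le> 2 * \<bar>h v\<bar>" for n v using F(3)[of n v] by simp
  qed
qed

lemma herm_proj_complete:
  assumes h: "h \<in> L2M" and "\<epsilon> > 0"
  shows "\<exists>n. ip h h - \<epsilon> \<le> (\<Sum>k\<le>n. ip (herm_proj h k) (herm_proj h k))"
proof -
  obtain q where q: "q \<in> Pol" "ip (\<lambda>v. h v - q v) (\<lambda>v. h v - q v) < \<epsilon>"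
    using L2M_Pol_dense[OF h] \<open>\<epsilon> > 0\<close> by (auto simp: Pol_closure_def)
  obtain n where "(\<Sum>k\<le>n. ip (herm_proj h k) (herm_proj h k)) \<ge> ip h h - ip (\<lambda>v. h v - q v) (\<lambda>v. h v - q v)"
    using herm_proj_approx[OF h q(1)] by blast
  then show ?thesis using q(2) by (intro exI[of _ n]) linarith
qed

section \<open>The operator on polynomials\<close>

lemma Pol_partial_commute: "p \<in> Pol \<Longrightarrow> partial_deriv i (partial_deriv j p) = partial_deriv j (partial_deriv i p)"
proof (induction rule: Pol.induct)
  case (Pol_coord k)
  then show ?case by (simp add: partial_deriv_coord)
next
  case (Pol_mult f g)
  then have "partial_deriv i (partial_deriv j (\<lambda>v. f v * g v)) v = partial_deriv j (partial_deriv i (\<lambda>v. f v * g v)) v" for v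
    by (simp add: partial_deriv_Pol_mult partial_deriv_Pol_add Pol_partial_deriv Pol.Pol_mult)
  then show ?case by blast
qed (simp_all add: partial_deriv_Pol_add Pol_partial_deriv)

lemma partial_deriv_coord_mult:
  "p \<in> Pol \<Longrightarrow> partial_deriv i (\<lambda>v. v $ j * p v) = (\<lambda>v. (if i = j then p v else 0) + v $ j * partial_deriv i p v)"
  by (auto simp: partial_deriv_Pol_mult Pol_coord partial_deriv_coord intro!: ext)

lemma lower_raise:
  assumes p: "p \<in> Pol"
  shows "partial_deriv i (raise j p) = (\<lambda>v. raise j (partial_deriv i p) v + (if i = j then 2 * p v else 0))"
proof -
  have "raise j p = (\<lambda>v. 2 * (v $ j * p v) - partial_deriv j p v)" by (simp add: raise_def mult.assoc)
  then have "partial_deriv i (raise j p) = (\<lambda>v. 2 * ((if i = j then p v else 0) + v $ j * partial_deriv i p v) - partial_deriv i (partial_deriv j p) v)"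
    by (simp add: partial_deriv_Pol_diff partial_deriv_Pol_cmult partial_deriv_coord_mult p Pol_intros)
  then show ?thesis
    by (auto simp: raise_def Pol_partial_commute[OF p, of i j] algebra_simps)
qed

section \<open>Infinitesimal rotations and the spherical Laplacian\<close>

definition rot :: "'n \<Rightarrow> 'n \<Rightarrow> (real^'n::finite \<Rightarrow> real) \<Rightarrow> real^'n \<Rightarrow> real" where
  "rot i j p = (\<lambda>v. v $ i * partial_deriv j p v - v $ j * partial_deriv i p v)"

lemma rot_eq:
  assumes "p \<in> Pol"
  shows "rot i j p = (\<lambda>v. 1/2 * (raise i (partial_deriv j p) v - raise j (partial_deriv i p) v))"
  by (auto simp: rot_def raise_def Pol_partial_commute[OF assms, of i j] algebra_simps)

lemma Pol_rot: "p \<in> Pol \<Longrightarrow> rot i j p \<in> Pol"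
  unfolding rot_def by (intro Pol_intros)

lemma Herm_rot: "p \<in> Herm k \<Longrightarrow> rot i j p \<in> Herm k"
proof -
  assume p: "p \<in> Herm k"
  have "raise i (partial_deriv j p) \<in> Herm k" for i j
    using p by (cases k) (auto simp: Herm_lower_0 raise_zero intro: Herm_zero Herm_raise Herm_lower)
  then show ?thesis unfolding rot_eq[OF Herm_Pol[OF p]] by (intro Herm_cmult Herm_diff)
qed

lemma ip_rot:
  assumes p: "p \<in> Pol" and q: "q \<in> Pol"
  shows "ip (rot i j p) q = - ip p (rot i j q)"
proof -
  have a: "ip (raise i (partial_deriv j p)) q = ip p (raise j (partial_deriv i q))" for i j
  proof -
    have "ip (raise i (partial_deriv j p)) q = ip (partial_deriv i q) (partial_deriv j p)"
      by (simp add: ip_commute[of "raise i (partial_deriv j p)"] Pol_ibp q Pol_partial_deriv p)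
    also have "\<dots> = ip p (raise j (partial_deriv i q))"
      unfolding ip_commute[of "partial_deriv i q"] by (intro Pol_ibp Pol_partial_deriv p q)
    finally show ?thesis .
  qed
  have L: "raise i (partial_deriv j r) \<in> L2M" if "r \<in> Pol" for i j r
    by (intro Pol_L2M Pol_raise Pol_partial_deriv that)
  show ?thesis
    unfolding rot_eq[OF p] rot_eq[OF q] ip_cmult_left ip_cmult_right
    by (simp add: ip_diff_left ip_diff_right L p q Pol_L2M a field_simps)
qed

text \<open>Minus the Laplace-Beltrami operator of the spheres, as the sum of the squared
  infinitesimal rotations; the 1/2 is there because each pair of indices occurs twice. The sign
  makes it nonnegative, with \<open>sph_form\<close> as its quadratic form.\<close>

definition spherical :: "(real^'n::finite \<Rightarrow> real) \<Rightarrow> real^'n \<Rightarrow> real" where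
  "spherical p = (\<lambda>v. - (1/2) * (\<Sum>i\<in>UNIV. \<Sum>j\<in>UNIV. rot i j (rot i j p) v))"

definition sph_form :: "(real^'n::finite \<Rightarrow> real) \<Rightarrow> real" where
  "sph_form p = 1/2 * (\<Sum>i\<in>UNIV. \<Sum>j\<in>UNIV. ip (rot i j p) (rot i j p))"

lemma Herm_spherical: "p \<in> Herm k \<Longrightarrow> spherical p \<in> Herm k"
  unfolding spherical_def by (intro Herm_cmult Herm_sum Herm_rot)

lemma ip_spherical:
  assumes p: "p \<in> Pol"
  shows "ip p (spherical p) = sph_form p"
proof -
  have "ip p (spherical p) = - (1/2) * (\<Sum>i\<in>UNIV. \<Sum>j\<in>UNIV. ip p (rot i j (rot i j p)))"
    unfolding spherical_def ip_cmult_right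
    by (simp add: ip_sum_right Pol_L2M Pol_rot Pol_sum p)
  also have "\<dots> = sph_form p"
    unfolding sph_form_def by (simp add: ip_rot[OF p Pol_rot[OF p]] sum_negf)
  finally show ?thesis .
qed

lemma sph_form_nonneg: "sph_form p \<ge> 0"
  unfolding sph_form_def by (intro mult_nonneg_nonneg sum_nonneg ip_self_nonneg) auto

definition lap :: "(real^'n::finite \<Rightarrow> real) \<Rightarrow> real^'n \<Rightarrow> real" where
  "lap p = (\<lambda>v. \<Sum>i\<in>UNIV. partial_deriv i (partial_deriv i p) v)"

lemma ip_grad_Herm:
  assumes p: "p \<in> Herm k"
  shows "(\<Sum>i\<in>UNIV. ip (partial_deriv i p) (partial_deriv i p)) = 2 * real k * ip p p"
proof -
  have P: "p \<in> Pol" by (rule Herm_Pol[OF p])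
  have "(\<Sum>i\<in>UNIV. ip (partial_deriv i p) (partial_deriv i p)) = (\<Sum>i\<in>UNIV. ip p (raise i (partial_deriv i p)))"
    by (intro sum.cong refl Pol_ibp P Pol_partial_deriv)
  also have "\<dots> = ip p (\<lambda>v. \<Sum>i\<in>UNIV. raise i (partial_deriv i p) v)"
    by (intro ip_sum_right[symmetric] Pol_L2M Pol_raise Pol_partial_deriv P)
  also have "\<dots> = 2 * real k * ip p p"
    unfolding Herm_number[OF p] by (rule ip_cmult_right)
  finally show ?thesis .
qed

lemma raise_norm:
  assumes f: "f \<in> Pol"
  shows "ip (raise i f) (raise i f) = ip (partial_deriv i f) (partial_deriv i f) + 2 * ip f f"
proof -
  have "ip (raise i f) (raise i f) = ip (partial_deriv i (raise i f)) f"
    by (intro Pol_ibp[symmetric] Pol_raise f)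
  also have "\<dots> = ip (raise i (partial_deriv i f)) f + 2 * ip f f"
    unfolding lower_raise[OF f]
    by (simp add: ip_add_left ip_cmult_left L2M_cmult Pol_L2M Pol_raise Pol_partial_deriv f)
  also have "ip (raise i (partial_deriv i f)) f = ip (partial_deriv i f) (partial_deriv i f)"
    unfolding ip_commute[of "raise i (partial_deriv i f)"] by (intro Pol_ibp[symmetric] Pol_partial_deriv f)
  finally show ?thesis .
qed

text \<open>With the rotations written through \<open>raise\<close> and derivatives, the squares are
  evaluated by the number operator and the mixed terms by a commutator. If \<open>lap p\<close>
  vanishes this is the classical eigenvalue k (k + N - 2); otherwise the last term measures the
  defect.\<close>

lemma casimir:
  fixes p :: "real^'n::finite \<Rightarrow> real"
  assumes p: "p \<in> Herm k"
  shows "sph_form p = real k * (real k + real CARD('n) - 2) * ip p p - 1/4 * ip (lap p) (lap p)"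
proof (cases k)
  case 0
  then show ?thesis using p by (simp add: sph_form_def rot_def lap_def Herm_lower_0)
next
  case (Suc l)
  have P: "p \<in> Pol" by (rule Herm_Pol[OF p])
  let ?G = "\<Sum>i\<in>UNIV. ip (partial_deriv i p) (partial_deriv i p)"
  note PI = Pol_raise Pol_partial_deriv P
  have "4 * ip (rot i j p) (rot i j p) = ip (raise i (partial_deriv j p)) (raise i (partial_deriv j p))
     + ip (raise j (partial_deriv i p)) (raise j (partial_deriv i p)) - 2 * ip (raise i (partial_deriv j p)) (raise j (partial_deriv i p))" for i j
    unfolding rot_eq[OF P] ip_cmult_left ip_cmult_right
    by (simp add: ip_diff_self[OF Pol_L2M Pol_L2M] PI)
  then have "8 * sph_form p = (\<Sum>i\<in>UNIV. \<Sum>j\<in>UNIV. ip (raise i (partial_deriv j p)) (raise i (partial_deriv j p)))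
     + (\<Sum>i\<in>UNIV. \<Sum>j\<in>UNIV. ip (raise j (partial_deriv i p)) (raise j (partial_deriv i p)))
     - 2 * (\<Sum>i\<in>UNIV. \<Sum>j\<in>UNIV. ip (raise i (partial_deriv j p)) (raise j (partial_deriv i p)))"
    unfolding sph_form_def sum_distrib_left by (simp add: sum.distrib sum_subtractf sum_distrib_left)
  moreover have "(\<Sum>i\<in>UNIV. \<Sum>j\<in>UNIV. ip (raise j (partial_deriv i p)) (raise j (partial_deriv i p)))
     = (\<Sum>i\<in>UNIV. \<Sum>j\<in>UNIV. ip (raise i (partial_deriv j p)) (raise i (partial_deriv j p)))"
    by (rule sum.swap)
  moreover have "(\<Sum>i\<in>UNIV. \<Sum>j\<in>UNIV. ip (raise j (partial_deriv i p)) (raise j (partial_deriv i p)))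
     = (2 * real l + 2 * real CARD('n)) * ?G"
  proof -
    have "(\<Sum>j\<in>UNIV. ip (raise j (partial_deriv i p)) (raise j (partial_deriv i p)))
      = (2 * real l + 2 * real CARD('n)) * ip (partial_deriv i p) (partial_deriv i p)" for i
    proof -
      have "partial_deriv i p \<in> Herm l" using p Suc by (simp add: Herm_lower)
      then show ?thesis
        by (simp add: raise_norm PI sum.distrib ip_grad_Herm algebra_simps)
    qed
    then show ?thesis by (simp add: sum_distrib_left)
  qed
  moreover have "(\<Sum>i\<in>UNIV. \<Sum>j\<in>UNIV. ip (raise i (partial_deriv j p)) (raise j (partial_deriv i p)))
     = ip (lap p) (lap p) + 2 * ?G"
  proof -
    \<comment> \<open>Commuting \<open>partial_deriv j\<close> past \<open>raise i\<close> produces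
      the diagonal term; the rest is moved across to form the two Laplacians.\<close>
    have "ip (raise i (partial_deriv j p)) (raise j (partial_deriv i p))
       = ip (partial_deriv j (partial_deriv j p)) (partial_deriv i (partial_deriv i p)) + (if j = i then 2 * ip (partial_deriv i p) (partial_deriv i p) else 0)" for i j
    proof -
      have "ip (raise i (partial_deriv j p)) (raise j (partial_deriv i p)) = ip (partial_deriv j (raise i (partial_deriv j p))) (partial_deriv i p)"
        by (intro Pol_ibp[symmetric] PI)
      also have "\<dots> = ip (raise i (partial_deriv j (partial_deriv j p))) (partial_deriv i p) + (if j = i then 2 * ip (partial_deriv i p) (partial_deriv i p) else 0)"
        by (simp add: lower_raise PI ip_add_left ip_cmult_left L2M_cmult Pol_L2M)
      also have "ip (raise i (partial_deriv j (partial_deriv j p))) (partial_deriv i p) = ip (partial_deriv j (partial_deriv j p)) (partial_deriv i (partial_deriv i p))"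
        unfolding ip_commute[of "raise i (partial_deriv j (partial_deriv j p))"] ip_commute[of "partial_deriv j (partial_deriv j p)"]
        by (intro Pol_ibp[symmetric] PI)
      finally show ?thesis .
    qed
    then have "(\<Sum>i\<in>UNIV. \<Sum>j\<in>UNIV. ip (raise i (partial_deriv j p)) (raise j (partial_deriv i p)))
      = (\<Sum>i\<in>UNIV. \<Sum>j\<in>UNIV. ip (partial_deriv j (partial_deriv j p)) (partial_deriv i (partial_deriv i p))) + 2 * ?G"
      by (simp add: sum.distrib sum_distrib_left)
    also have "(\<Sum>i\<in>UNIV. \<Sum>j\<in>UNIV. ip (partial_deriv j (partial_deriv j p)) (partial_deriv i (partial_deriv i p))) = ip (lap p) (lap p)"
      unfolding lap_def by (subst sum.swap) (simp add: ip_sum_left ip_sum_right Pol_L2M Pol_sum PI)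
    finally show ?thesis .
  qed
  moreover have "?G = 2 * real k * ip p p" by (rule ip_grad_Herm[OF p])
  ultimately show ?thesis using Suc by (simp add: algebra_simps)
qed

lemma Herm_lap: "p \<in> Herm (Suc (Suc k)) \<Longrightarrow> lap p \<in> Herm k"
  unfolding lap_def by (intro Herm_sum Herm_lower)

definition lap_adj :: "(real^'n::finite \<Rightarrow> real) \<Rightarrow> real^'n \<Rightarrow> real" where
  "lap_adj q = (\<lambda>v. \<Sum>i\<in>UNIV. raise i (raise i q) v)"

lemma Pol_lap_adj: "p \<in> Pol \<Longrightarrow> lap_adj p \<in> Pol"
  unfolding lap_adj_def by (intro Pol_sum Pol_raise)

lemma ip_lap:
  assumes p: "p \<in> Pol" and q: "q \<in> Pol"
  shows "ip (lap p) q = ip p (lap_adj q)"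
proof -
  have "ip (lap p) q = (\<Sum>i\<in>UNIV. ip (partial_deriv i (partial_deriv i p)) q)"
    unfolding lap_def by (intro ip_sum_left Pol_L2M Pol_partial_deriv p q)
  also have "\<dots> = (\<Sum>i\<in>UNIV. ip p (raise i (raise i q)))"
    by (simp add: Pol_ibp Pol_partial_deriv Pol_raise p q)
  also have "\<dots> = ip p (lap_adj q)"
    unfolding lap_adj_def by (intro ip_sum_right[symmetric] Pol_L2M Pol_raise p q)
  finally show ?thesis .
qed

lemma lap_lap_adj:
  fixes q :: "real^'n::finite \<Rightarrow> real"
  assumes q: "q \<in> Herm 1"
  shows "lap (lap_adj q) = (\<lambda>v. (16 + 8 * real CARD('n)) * q v)"
proof
  fix v
  have P: "q \<in> Pol" by (rule Herm_Pol[OF q])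
  note PI = Pol_raise Pol_partial_deriv P
  have z: "partial_deriv j (partial_deriv j q) = (\<lambda>_. 0)" for j
    using q by (intro Herm_lower_0 Herm_lower) simp
  have 1: "partial_deriv j (raise i (raise i q)) = (\<lambda>v. raise i (raise i (partial_deriv j q)) v + (if j = i then 4 * raise i q v else 0))" for i j
    by (auto simp: lower_raise PI raise_add raise_cmult raise_zero Pol_cmult Pol_const intro!: ext)
  have 2: "partial_deriv j (partial_deriv j (raise i (raise i q))) v = (if j = i then 8 * raise i (partial_deriv i q) v + 8 * q v else 0)" for i j
  proof -
    have "partial_deriv j (raise i (raise i (partial_deriv j q))) = (\<lambda>v. if j = i then 4 * raise i (partial_deriv j q) v else 0)"
      by (auto simp: lower_raise PI raise_add raise_cmult raise_zero Pol_cmult Pol_const z intro!: ext)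
    then show ?thesis unfolding 1
      by (cases "j = i") (simp_all add: partial_deriv_Pol_add partial_deriv_Pol_cmult PI Pol_cmult lower_raise)
  qed
  have "lap (lap_adj q) v = (\<Sum>j\<in>UNIV. \<Sum>i\<in>UNIV. partial_deriv j (partial_deriv j (raise i (raise i q))) v)"
    unfolding lap_def lap_adj_def by (simp add: partial_deriv_Pol_sum PI)
  also have "\<dots> = 8 * (\<Sum>i\<in>UNIV. raise i (partial_deriv i q) v) + 8 * real CARD('n) * q v"
    unfolding 2 by (simp add: sum.distrib sum_distrib_left)
  also have "\<dots> = (16 + 8 * real CARD('n)) * q v"
    unfolding Herm_number[OF q] by (simp add: algebra_simps)
  finally show "lap (lap_adj q) v = (16 + 8 * real CARD('n)) * q v" .
qed

text \<open>On degree 1, \<open>lap\<close> after its adjoint is the scalar c. The inequality says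
  that the remainder of p after subtracting (1 / c) \<open>lap_adj (lap p)\<close> has nonnegative
  squared norm.\<close>

lemma lap_bound_3:
  fixes p :: "real^'n::finite \<Rightarrow> real"
  assumes p: "p \<in> Herm 3"
  shows "ip (lap p) (lap p) \<le> (16 + 8 * real CARD('n)) * ip p p"
proof -
  define q where "q = lap p"
  define c where "c = 16 + 8 * real CARD('n)"
  have c: "c > 0" by (simp add: c_def add_pos_nonneg)
  have q1: "q \<in> Herm 1" unfolding q_def using p by (intro Herm_lap) (simp add: numeral_3_eq_3)
  have P: "p \<in> Pol" "q \<in> Pol" using p q1 by (auto intro: Herm_Pol)
  have 1: "ip p (lap_adj q) = ip q q" using ip_lap[OF P] by (simp add: q_def)
  have 2: "ip (lap_adj q) (lap_adj q) = c * ip q q"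
    using ip_lap[OF Pol_lap_adj[OF P(2)] P(2)] unfolding lap_lap_adj[OF q1] c_def by (simp add: ip_cmult_left)
  have "0 \<le> ip (\<lambda>v. p v - (1 / c) * lap_adj q v) (\<lambda>v. p v - (1 / c) * lap_adj q v)" by (rule ip_self_nonneg)
  also have "\<dots> = ip p p - 2 * (1 / c * ip q q) + 1 / c * (1 / c * (c * ip q q))"
    using P by (subst ip_diff_self) (auto intro!: Pol_L2M L2M_cmult Pol_lap_adj simp: ip_cmult_left ip_cmult_right 1 2 simp del: times_divide_eq_left)
  also have "\<dots> = ip p p - ip q q / c" using c by (simp add: field_simps)
  finally show ?thesis using c unfolding q_def c_def by (simp add: field_simps)
qed

text \<open>Degree 3 contains no radial function, and N - 1 is the first nonzero eigenvalue on the
  sphere. Here it appears as 3 (N + 1) - (16 + 8 N) / 4.\<close>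

lemma sph_form_3:
  fixes p :: "real^'n::finite \<Rightarrow> real"
  assumes p: "p \<in> Herm 3"
  shows "sph_form p \<ge> (real CARD('n) - 1) * ip p p"
  using casimir[OF p] lap_bound_3[OF p] by (simp add: algebra_simps)

text \<open>The local part of the operator applied to polynomials: \<open>local_flux p\<close> is the vector field
  \<open>((N - 1)/2 I + |v|\<^sup>2 I - v \<otimes> v) \<nabla>p\<close>, and \<open>local_op p\<close> its (positive) divergence in the weighted space.\<close>

definition local_flux :: "(real^'n::finite \<Rightarrow> real) \<Rightarrow> 'n \<Rightarrow> real^'n \<Rightarrow> real" where
  "local_flux p i = (\<lambda>v. (real CARD('n) - 1) / 2 * partial_deriv i p v + (\<Sum>j\<in>UNIV. v $ j * rot j i p v))"

definition local_op :: "(real^'n::finite \<Rightarrow> real) \<Rightarrow> real^'n \<Rightarrow> real" where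
  "local_op p = (\<lambda>v. \<Sum>i\<in>UNIV. raise i (local_flux p i) v)"

lemma Pol_local_flux: "p \<in> Pol \<Longrightarrow> local_flux p i \<in> Pol"
  unfolding local_flux_def by (intro Pol_intros Pol_rot)

text \<open>The part of the flux built from rotations is tangential to the spheres. The derivative
  of the Gaussian contributes nothing to its divergence, because v $ i * v $ j is symmetric and
  \<open>rot\<close> antisymmetric in the indices; the remaining derivatives reassemble into squares
  of rotations.\<close>

lemma local_op_eq:
  fixes p :: "real^'n::finite \<Rightarrow> real"
  assumes p: "p \<in> Pol"
  shows "local_op p v = (real CARD('n) - 1) / 2 * (\<Sum>i\<in>UNIV. raise i (partial_deriv i p) v) + spherical p v"
proof -
  have anti: "rot i j q v = - rot j i q v" for i j q by (simp add: rot_def)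
  have 1: "raise i (local_flux p i) v = (real CARD('n) - 1) / 2 * raise i (partial_deriv i p) v + (\<Sum>j\<in>UNIV. raise i (\<lambda>v. v $ j * rot j i p v) v)" for i
  proof -
    have "raise i (\<lambda>v. c * partial_deriv i p v + (\<Sum>j\<in>UNIV. v $ j * rot j i p v)) v
       = c * raise i (partial_deriv i p) v + (\<Sum>j\<in>UNIV. raise i (\<lambda>v. v $ j * rot j i p v) v)" for c
      by (simp add: raise_add raise_cmult raise_sum Pol_intros Pol_rot p)
    then show ?thesis unfolding local_flux_def .
  qed
  have 2: "raise i (\<lambda>v. v $ j * rot j i p v) v = 2 * v $ i * v $ j * rot j i p v - v $ j * partial_deriv i (rot j i p) v" for i j
    unfolding raise_def partial_deriv_coord_mult[OF Pol_rot[OF p]] by (simp add: rot_def)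
  have 3: "(\<Sum>i\<in>UNIV. \<Sum>j\<in>UNIV. 2 * v $ i * v $ j * rot j i p v) = 0"
  proof -
    let ?s = "\<Sum>i\<in>UNIV. \<Sum>j\<in>UNIV. 2 * v $ i * v $ j * rot j i p v"
    have "?s = (\<Sum>j\<in>UNIV. \<Sum>i\<in>UNIV. 2 * v $ i * v $ j * rot j i p v)" by (rule sum.swap)
    also have "\<dots> = (\<Sum>j\<in>UNIV. \<Sum>i\<in>UNIV. - (2 * v $ j * v $ i * rot i j p v))"
      by (intro sum.cong refl) (subst anti, simp add: mult_ac)
    also have "\<dots> = - ?s" by (simp add: sum_negf)
    finally show ?thesis by simp
  qed
  have 4: "(\<Sum>i\<in>UNIV. \<Sum>j\<in>UNIV. - (v $ j * partial_deriv i (rot j i p) v)) = spherical p v"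
  proof -
    let ?s = "\<Sum>i\<in>UNIV. \<Sum>j\<in>UNIV. v $ j * partial_deriv i (rot j i p) v"
    have "(\<Sum>i\<in>UNIV. \<Sum>j\<in>UNIV. v $ i * partial_deriv j (rot i j p) v) = ?s" by (rule sum.swap)
    moreover have "partial_deriv i (rot i j p) v = - partial_deriv i (rot j i p) v" for i j
    proof -
      have "rot i j p = (\<lambda>v. - 1 * rot j i p v)" by (auto simp: rot_def)
      then have "partial_deriv i (rot i j p) = partial_deriv i (\<lambda>v. - 1 * rot j i p v)" by (rule arg_cong)
      also have "\<dots> = (\<lambda>v. - 1 * partial_deriv i (rot j i p) v)" by (rule partial_deriv_Pol_cmult[OF Pol_rot[OF p]])
      finally show ?thesis by simp
    qed
    then have "(\<Sum>i\<in>UNIV. \<Sum>j\<in>UNIV. v $ j * partial_deriv i (rot i j p) v) = - ?s" by (simp add: sum_negf)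
    moreover have "(\<Sum>i\<in>UNIV. \<Sum>j\<in>UNIV. rot i j (rot i j p) v)
      = (\<Sum>i\<in>UNIV. \<Sum>j\<in>UNIV. v $ i * partial_deriv j (rot i j p) v) - (\<Sum>i\<in>UNIV. \<Sum>j\<in>UNIV. v $ j * partial_deriv i (rot i j p) v)"
      by (subst rot_def) (simp add: sum_subtractf)
    ultimately show ?thesis by (simp add: spherical_def sum_negf)
  qed
  have "local_op p v = (\<Sum>i\<in>UNIV. (real CARD('n) - 1) / 2 * raise i (partial_deriv i p) v)
     + ((\<Sum>i\<in>UNIV. \<Sum>j\<in>UNIV. 2 * v $ i * v $ j * rot j i p v) + (\<Sum>i\<in>UNIV. \<Sum>j\<in>UNIV. - (v $ j * partial_deriv i (rot j i p) v)))"
    unfolding local_op_def 1 2 by (simp add: sum.distrib sum_subtractf sum_negf)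
  then show ?thesis unfolding 3 4 by (simp add: sum_distrib_left)
qed

lemma local_op_Herm:
  fixes p :: "real^'n::finite \<Rightarrow> real"
  assumes p: "p \<in> Herm k"
  shows "local_op p = (\<lambda>v. (real CARD('n) - 1) * real k * p v + spherical p v)"
  using Herm_number[OF p] by (auto simp: local_op_eq[OF Herm_Pol[OF p]])

text \<open>The extra summand for \<open>k = 2\<close> is the contribution of the nonlocal part of the operator.\<close>

lemma local_gap:
  fixes p :: "real^'n::finite \<Rightarrow> real"
  assumes N: "CARD('n) \<ge> 2" and p: "p \<in> Herm k" and k: "k \<ge> 2" and k2: "k = 2 \<Longrightarrow> lap p = (\<lambda>_. 0)"
  shows "(real CARD('n) - 1) * real k * ip p p + sph_form p + (if k = 2 then 2 * ip p p else 0) \<ge> 4 * (real CARD('n) - 1) * ip p p"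
proof -
  have n: "real CARD('n) - 1 \<ge> 1" using N by simp
  have pp: "ip p p \<ge> 0" by (rule ip_self_nonneg)
  consider "k = 2" | "k = 3" | "k \<ge> 4" using k by linarith
  then show ?thesis
  proof cases
    \<comment> \<open>Degree 2: the coefficients add up to 2 (N - 1) + 2 N + 2 = 4 N.\<close>
    case 1
    then have "sph_form p = 2 * real CARD('n) * ip p p" using casimir[OF p] k2 by simp
    then show ?thesis using 1 pp by (simp add: algebra_simps)
  next
    \<comment> \<open>Degree 3 just reaches the gap: 3 (N - 1) + (N - 1).\<close>
    case 2
    then show ?thesis using sph_form_3[of p] p by (simp add: algebra_simps)
  next
    case 3
    have "4 * ((real CARD('n) - 1) * ip p p) \<le> real k * ((real CARD('n) - 1) * ip p p)"
      using 3 n pp by (intro mult_right_mono mult_nonneg_nonneg) auto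
    then show ?thesis using 3 sph_form_nonneg[of p] by (simp add: mult_ac)
  qed
qed

section \<open>The quadratic matrix of the kernel 1 and Gaussian moments\<close>

definition amat :: "real^'n::finite \<Rightarrow> 'n \<Rightarrow> 'n \<Rightarrow> real" where
  "amat z i j = (if i = j then (norm z)\<^sup>2 else 0) - z $ i * z $ j"

definition perp_bil :: "real^'n::finite \<Rightarrow> real^'n \<Rightarrow> real^'n \<Rightarrow> real" where
  "perp_bil u X Y = (u \<bullet> u) * (X \<bullet> Y) - (u \<bullet> X) * (u \<bullet> Y)"

lemma amat_mult: "(\<Sum>j\<in>UNIV. amat z i j * X $ j) = (z \<bullet> z) * X $ i - z $ i * (z \<bullet> X)"
proof -
  have "(\<Sum>j\<in>UNIV. amat z i j * X $ j) = (\<Sum>j\<in>UNIV. (if i = j then (norm z)\<^sup>2 * X $ j else 0) - z $ i * (z $ j * X $ j))"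
    unfolding amat_def by (intro sum.cong) (auto simp: algebra_simps)
  also have "\<dots> = (norm z)\<^sup>2 * X $ i - z $ i * (z \<bullet> X)"
    by (simp add: sum_subtractf sum_distrib_left[symmetric] inner_vec_def)
  finally show ?thesis by (simp add: power2_norm_eq_inner)
qed

lemma amat_perp_bil: "(\<Sum>i\<in>UNIV. X $ i * (\<Sum>j\<in>UNIV. amat u i j * Y $ j)) = perp_bil u X Y"
proof -
  have "(\<Sum>i\<in>UNIV. X $ i * (\<Sum>j\<in>UNIV. amat u i j * Y $ j)) = (\<Sum>i\<in>UNIV. (u \<bullet> u) * (X $ i * Y $ i) - (u \<bullet> Y) * (u $ i * X $ i))"
    unfolding amat_mult by (intro sum.cong) (auto simp: algebra_simps)
  also have "\<dots> = (u \<bullet> u) * (\<Sum>i\<in>UNIV. X $ i * Y $ i) - (u \<bullet> Y) * (\<Sum>i\<in>UNIV. u $ i * X $ i)"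
    by (simp add: sum_subtractf sum_distrib_left)
  finally show ?thesis by (simp add: perp_bil_def inner_vec_def mult.commute)
qed

lemma amat_minus: "amat (v - w) i j = amat (w - v) i j"
  by (simp add: amat_def norm_minus_commute) (simp add: algebra_simps)

lemma amat_sym: "amat z i j = amat z j i"
  by (simp add: amat_def)

text \<open>Separation of variables: each entry is a finite sum of products of a polynomial in v and
  one in w, so every Gaussian average over w is a polynomial in v.\<close>

lemma amat_expand:
  "amat (v - w) i j = amat v i j + amat w i j - (if i = j then 2 * (\<Sum>k\<in>UNIV. v $ k * w $ k) else 0) + v $ i * w $ j + v $ j * w $ i"
proof -
  have "(norm (v - w))\<^sup>2 = (norm v)\<^sup>2 + (norm w)\<^sup>2 - 2 * (v \<bullet> w)"
    unfolding power2_norm_eq_inner by (simp add: inner_diff_left inner_diff_right inner_commute[of w v])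
  moreover have "v \<bullet> w = (\<Sum>k\<in>UNIV. v $ k * w $ k)" by (simp add: inner_vec_def)
  ultimately show ?thesis by (simp add: amat_def algebra_simps)
qed

lemma Pol_if: "(b \<Longrightarrow> f \<in> Pol) \<Longrightarrow> (\<lambda>v. if b then f v else 0) \<in> Pol"
  by (cases b) (auto intro: Pol_const)

lemma Pol_amat: "(\<lambda>v. amat v i j) \<in> Pol"
  unfolding amat_def by (intro Pol_diff Pol_mult Pol_coord Pol_if Pol_norm_square)

lemma Pol_amat_shift: "(\<lambda>w. amat (v - w) i j) \<in> Pol"
  unfolding amat_expand
  by (intro Pol_add Pol_diff Pol_amat Pol_const Pol_mult Pol_coord Pol_if Pol_sum)

abbreviation one :: "real^'n::finite \<Rightarrow> real" where "one \<equiv> \<lambda>_. 1"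

definition mass :: "'n::finite itself \<Rightarrow> real" where "mass _ = sqrt pi ^ CARD('n)"

lemma mass_pos: "mass TYPE('n::finite) > 0"
  by (simp add: mass_def)

lemma raise_one: "raise i one = (\<lambda>v. 2 * v $ i)"
  by (simp add: raise_def)

text \<open>A coordinate is half of \<open>raise i one\<close>, so moments of p become mean values
  of its derivatives.\<close>

lemma ip_coord:
  assumes p: "p \<in> Pol"
  shows "ip p (\<lambda>w. w $ i) = 1/2 * ip (partial_deriv i p) one"
proof -
  have "ip (partial_deriv i p) one = ip p (raise i one)" by (rule Pol_ibp[OF p Pol_const])
  then show ?thesis unfolding raise_one ip_cmult_right by simp
qed

lemma ip_coord2:
  assumes p: "p \<in> Pol"
  shows "ip p (\<lambda>w. w $ i * w $ j) = 1/4 * ip (partial_deriv j (partial_deriv i p)) one + (if i = j then 1/2 * ip p one else 0)"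
proof -
  have e: "(\<lambda>w. w $ i * w $ j) = (\<lambda>w. 1/2 * (raise i (\<lambda>w. w $ j) w + (if i = j then one w else 0)))"
    by (auto simp: raise_def partial_deriv_coord)
  have "ip p (\<lambda>w. w $ i * w $ j) = 1/2 * (ip p (raise i (\<lambda>w. w $ j)) + (if i = j then ip p one else 0))"
    unfolding e ip_cmult_right
    by (cases "i = j") (simp_all add: ip_add_right Pol_L2M p Pol_raise Pol_coord Pol_const)
  also have "ip p (raise i (\<lambda>w. w $ j)) = ip (partial_deriv i p) (\<lambda>w. w $ j)" by (intro Pol_ibp[symmetric] p Pol_coord)
  also have "\<dots> = 1/2 * ip (partial_deriv j (partial_deriv i p)) one" by (intro ip_coord Pol_partial_deriv p)
  finally show ?thesis by (simp add: algebra_simps)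
qed

lemma ip_one_mass: "ip one (one :: real^'n::finite \<Rightarrow> real) = mass TYPE('n)"
  by (simp add: mass_def ip_one_one)

lemma ip_one_coord: "ip one (\<lambda>w. w $ i) = 0"
  using ip_coord[OF Pol_const[of 1], of i] by simp

lemma ip_one_coord2: "ip one (\<lambda>w::real^'n::finite. w $ i * w $ j) = (if i = j then mass TYPE('n) / 2 else 0)"
  using ip_coord2[OF Pol_const[of 1], of i j] by (simp add: ip_one_mass)

lemma ip_norm_square:
  assumes p: "p \<in> Pol"
  shows "ip p (\<lambda>w. (norm w)\<^sup>2) = (\<Sum>k\<in>UNIV. ip p (\<lambda>w. w $ k * w $ k))"
proof -
  have "(\<lambda>w. (norm w)\<^sup>2) = (\<lambda>w::real^'a. \<Sum>k\<in>UNIV. w $ k * w $ k)"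
    by (rule ext) (simp only: norm_vec_square_sum power2_eq_square[of "_ $ _"])
  then show ?thesis by (simp only:) (intro ip_sum_right Pol_L2M Pol_intros p)
qed

lemma ip_amat:
  assumes p: "p \<in> Pol"
  shows "ip p (\<lambda>w. amat w i j) = (if i = j then (\<Sum>k\<in>UNIV. ip p (\<lambda>w. w $ k * w $ k)) else 0) - ip p (\<lambda>w. w $ i * w $ j)"
proof (cases "i = j")
  case True
  then show ?thesis unfolding amat_def using ip_norm_square[OF p]
    by (simp add: ip_diff_right Pol_L2M Pol_intros p)
next
  case False
  then have "(\<lambda>w. amat w i j) = (\<lambda>w. -1 * (w $ i * w $ j))" by (auto simp: amat_def)
  then show ?thesis using False by (simp only: ip_cmult_right) simp
qed

lemma ip_amat_shift:
  assumes p: "p \<in> Pol"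
  shows "ip p (\<lambda>w. amat (v - w) i j) = amat v i j * ip p one + ip p (\<lambda>w. amat w i j)
    - (if i = j then 2 * (\<Sum>k\<in>UNIV. v $ k * ip p (\<lambda>w. w $ k)) else 0) + v $ i * ip p (\<lambda>w. w $ j) + v $ j * ip p (\<lambda>w. w $ i)"
proof -
  have e: "(\<lambda>w. amat (v - w) i j) = (\<lambda>w. ((((amat v i j * one w) + amat w i j) - (if i = j then 2 else 0) * (\<Sum>k\<in>UNIV. v $ k * w $ k)) + v $ i * w $ j) + v $ j * w $ i)"
    by (auto simp: amat_expand)
  note PI = Pol_L2M Pol_add Pol_diff Pol_cmult Pol_sum Pol_amat Pol_coord Pol_const p
  show ?thesis
    unfolding e
    by (simp only: ip_add_right ip_diff_right ip_cmult_right ip_sum_right PI) simp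
qed

lemma local_flux_amat:
  fixes v :: "real^'n::finite"
  shows "local_flux p i v = (real CARD('n) - 1) / 2 * partial_deriv i p v + (\<Sum>j\<in>UNIV. amat v i j * partial_deriv j p v)"
proof -
  have "(\<Sum>j\<in>UNIV. amat v i j * partial_deriv j p v) = (v \<bullet> v) * partial_deriv i p v - v $ i * (v \<bullet> (\<chi> j. partial_deriv j p v))"
    using amat_mult[of v i "\<chi> j. partial_deriv j p v"] by simp
  also have "\<dots> = (\<Sum>j\<in>UNIV. v $ j * rot j i p v)"
    unfolding rot_def inner_vec_def by (simp add: right_diff_distrib sum_subtractf sum_distrib_left sum_distrib_right mult_ac)
  finally show ?thesis by (simp add: local_flux_def)
qed

text \<open>The origin of the two terms of \<open>local_flux\<close>. Each coordinate has variance
  1/2 under the normalised Gaussian, so |w|^2 I - w \<otimes> w has mean (N - 1) / 2 times the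
  identity, and the terms linear in w average to 0.\<close>

lemma ip_one_amat_shift:
  fixes v :: "real^'n::finite"
  shows "ip one (\<lambda>w. amat (v - w) i j) = mass TYPE('n) * (amat v i j + (if i = j then (real CARD('n) - 1) / 2 else 0))"
  by (subst ip_amat_shift[OF Pol_const], subst ip_amat[OF Pol_const])
     (auto simp: ip_one_coord ip_one_coord2 ip_one_mass algebra_simps diff_divide_distrib)

section \<open>The collision operator on polynomials\<close>

definition nonlocal :: "(real^'n::finite \<Rightarrow> real) \<Rightarrow> 'n \<Rightarrow> real^'n \<Rightarrow> real" where
  "nonlocal p i v = (\<Sum>j\<in>UNIV. ip (partial_deriv j p) (\<lambda>w. amat (v - w) i j))"

definition flux :: "(real^'n::finite \<Rightarrow> real) \<Rightarrow> 'n \<Rightarrow> real^'n \<Rightarrow> real" where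
  "flux p i v = mass TYPE('n) * local_flux p i v - nonlocal p i v"

text \<open>The sign is that of a nonnegative operator: since \<open>raise\<close> carries minus the
  weighted divergence, this is minus the linearized Landau operator.\<close>

definition collision :: "(real^'n::finite \<Rightarrow> real) \<Rightarrow> real^'n \<Rightarrow> real" where
  "collision p = (\<lambda>v. \<Sum>i\<in>UNIV. raise i (flux p i) v)"

lemma Pol_nonlocal: "p \<in> Pol \<Longrightarrow> nonlocal p i \<in> Pol"
proof -
  assume p: "p \<in> Pol"
  show "nonlocal p i \<in> Pol"
    unfolding nonlocal_def[abs_def] ip_amat_shift[OF Pol_partial_deriv[OF p]]
    by (intro Pol_sum Pol_add Pol_diff Pol_mult Pol_const Pol_coord Pol_amat Pol_if)
qed

lemma Pol_flux: "p \<in> Pol \<Longrightarrow> flux p i \<in> Pol"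
  unfolding flux_def[abs_def] by (intro Pol_diff Pol_cmult Pol_local_flux Pol_nonlocal)

lemma Pol_collision: "p \<in> Pol \<Longrightarrow> collision p \<in> Pol"
  unfolding collision_def by (intro Pol_sum Pol_raise Pol_flux)

lemma flux_integral:
  fixes p :: "real^'n::finite \<Rightarrow> real"
  assumes p: "p \<in> Pol"
  shows "(LINT w|lborel. (\<Sum>j\<in>UNIV. amat (v - w) i j * (partial_deriv j p v - partial_deriv j p w)) * maxw w) = flux p i v"
proof -
  have I: "integrable lborel (\<lambda>w. q w * amat (v - w) i j * maxw w)" if "q \<in> Pol" for q j
    by (intro Pol_integrable Pol_mult that Pol_amat_shift)
  have "(LINT w|lborel. (\<Sum>j\<in>UNIV. amat (v - w) i j * (partial_deriv j p v - partial_deriv j p w)) * maxw w)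
    = (LINT w|lborel. (\<Sum>j\<in>UNIV. partial_deriv j p v * (one w * amat (v - w) i j * maxw w) - partial_deriv j p w * amat (v - w) i j * maxw w))"
    unfolding sum_distrib_right by (simp add: algebra_simps)
  also have "\<dots> = (\<Sum>j\<in>UNIV. (LINT w|lborel. partial_deriv j p v * (one w * amat (v - w) i j * maxw w) - partial_deriv j p w * amat (v - w) i j * maxw w))"
    by (intro Bochner_Integration.integral_sum Bochner_Integration.integrable_diff integrable_mult_right I Pol_const Pol_partial_deriv p)
  also have "\<dots> = (\<Sum>j\<in>UNIV. partial_deriv j p v * ip one (\<lambda>w. amat (v - w) i j) - ip (partial_deriv j p) (\<lambda>w. amat (v - w) i j))"
  proof (rule sum.cong)
    fix j
    show "(LINT w|lborel. partial_deriv j p v * (one w * amat (v - w) i j * maxw w) - partial_deriv j p w * amat (v - w) i j * maxw w)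
      = partial_deriv j p v * ip one (\<lambda>w. amat (v - w) i j) - ip (partial_deriv j p) (\<lambda>w. amat (v - w) i j)"
      unfolding L2M_inner_def
      by (subst Bochner_Integration.integral_diff) (intro integrable_mult_right I Pol_const Pol_partial_deriv p, intro I Pol_partial_deriv p, simp)
  qed simp
  also have "\<dots> = (\<Sum>j\<in>UNIV. partial_deriv j p v * (mass TYPE('n) * (amat v i j + (if i = j then (real CARD('n) - 1) / 2 else 0)))) - nonlocal p i v"
    unfolding ip_one_amat_shift nonlocal_def by (simp add: sum_subtractf)
  also have "(\<Sum>j\<in>UNIV. partial_deriv j p v * (mass TYPE('n) * (amat v i j + (if i = j then (real CARD('n) - 1) / 2 else 0))))
    = mass TYPE('n) * local_flux p i v"
  proof -
    have "(\<Sum>j\<in>UNIV. partial_deriv j p v * (mass TYPE('n) * (amat v i j + (if i = j then (real CARD('n) - 1) / 2 else 0))))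
      = (\<Sum>j\<in>UNIV. mass TYPE('n) * (amat v i j * partial_deriv j p v) + (if i = j then mass TYPE('n) * ((real CARD('n) - 1) / 2 * partial_deriv j p v) else 0))"
      by (intro sum.cong) (auto simp: algebra_simps)
    then show ?thesis unfolding local_flux_amat by (simp add: sum.distrib sum_distrib_left distrib_left)
  qed
  finally show ?thesis by (simp add: flux_def)
qed

lemma flux_add:
  assumes p: "p \<in> Pol" and q: "q \<in> Pol"
  shows "flux (\<lambda>v. p v + q v) i = (\<lambda>v. flux p i v + flux q i v)"
proof
  fix v
  have "nonlocal (\<lambda>v. p v + q v) i v = nonlocal p i v + nonlocal q i v"
    unfolding nonlocal_def partial_deriv_Pol_add[OF p q]
    by (simp add: ip_add_left Pol_L2M Pol_partial_deriv p q Pol_amat_shift sum.distrib)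
  then show "flux (\<lambda>v. p v + q v) i v = flux p i v + flux q i v"
    unfolding flux_def local_flux_amat partial_deriv_Pol_add[OF p q] by (simp add: sum.distrib distrib_left)
qed

lemma collision_add: "p \<in> Pol \<Longrightarrow> q \<in> Pol \<Longrightarrow> collision (\<lambda>v. p v + q v) = (\<lambda>v. collision p v + collision q v)"
  unfolding collision_def by (simp add: flux_add raise_add Pol_flux sum.distrib)

text \<open>Meant for the collision invariants: for constants and coordinates the differences of the
  gradient vanish, and for |v|^2 they are parallel to v - w, which the matrix annihilates.\<close>

lemma collision_zero_grad:
  fixes p :: "real^'n::finite \<Rightarrow> real"
  assumes p: "p \<in> Pol" and z: "\<And>v w i. (\<Sum>j\<in>UNIV. amat (v - w) i j * (partial_deriv j p v - partial_deriv j p w)) = 0"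
  shows "collision p = (\<lambda>_. 0)"
proof -
  have "flux p i = (\<lambda>_. 0)" for i using flux_integral[OF p, of _ i] unfolding z by auto
  then show ?thesis by (simp add: collision_def raise_zero)
qed

lemma collision_const: "collision (\<lambda>_. c) = (\<lambda>_. 0)"
  by (rule collision_zero_grad) (auto intro: Pol_const)

lemma collision_coord: "collision (\<lambda>v. v $ k) = (\<lambda>_. 0)"
  by (rule collision_zero_grad) (auto intro: Pol_coord simp: partial_deriv_coord)

lemma partial_deriv_norm_square: "partial_deriv j (\<lambda>v. (norm v)\<^sup>2) = (\<lambda>v. 2 * v $ j)"
  by (rule ext, subst partial_deriv_eq[OF has_derivative_norm_square]) (simp add: inner_axis)

lemma collision_norm_square: "collision (\<lambda>v. (norm v)\<^sup>2) = (\<lambda>_. 0)"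
proof (rule collision_zero_grad)
  fix v w :: "real^'a" and i
  have "(\<Sum>j\<in>UNIV. amat (v - w) i j * (2 * v $ j - 2 * w $ j)) = 2 * (\<Sum>j\<in>UNIV. amat (v - w) i j * (v - w) $ j)"
    by (simp add: sum_distrib_left algebra_simps)
  also have "\<dots> = 0" unfolding amat_mult by (simp add: mult.commute)
  finally show "(\<Sum>j\<in>UNIV. amat (v - w) i j * (partial_deriv j (\<lambda>v. (norm v)\<^sup>2) v - partial_deriv j (\<lambda>v. (norm v)\<^sup>2) w)) = 0"
    by (simp add: partial_deriv_norm_square)
qed (rule Pol_norm_square)

lemma partial_deriv_amat_shift:
  fixes v :: "real^'n::finite"
  shows "partial_deriv j (\<lambda>w. amat (v - w) i l) w
    = - (if i = l then 2 * (v $ j - w $ j) else 0) + (if j = i then v $ l - w $ l else 0) + (if j = l then v $ i - w $ i else 0)"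
proof -
  have z: "partial_deriv j (\<lambda>w. v $ k - w $ k) = (\<lambda>_. if j = k then -1 else 0)" "(\<lambda>w. v $ k - w $ k) \<in> Pol" for k
    by (auto simp: partial_deriv_Pol_diff Pol_const Pol_coord partial_deriv_coord intro: Pol_diff Pol_const Pol_coord)
  define c where "c = (if i = l then 1 else 0 :: real)"
  have e: "(\<lambda>w. amat (v - w) i l) = (\<lambda>w. c * (\<Sum>k\<in>UNIV. (v $ k - w $ k) * (v $ k - w $ k)) - (v $ i - w $ i) * (v $ l - w $ l))"
  proof -
    have "(norm (v - w))\<^sup>2 = (\<Sum>k\<in>UNIV. (v $ k - w $ k) * (v $ k - w $ k))" for w
      unfolding norm_vec_square_sum by (simp add: power2_eq_square)
    then show ?thesis by (simp add: fun_eq_iff amat_def c_def)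
  qed
  have d: "partial_deriv j (\<lambda>w. amat (v - w) i l) w
    = c * (\<Sum>k\<in>UNIV. (if j = k then -1 else 0) * (v $ k - w $ k) + (v $ k - w $ k) * (if j = k then -1 else 0))
      - ((if j = i then -1 else 0) * (v $ l - w $ l) + (v $ i - w $ i) * (if j = l then -1 else 0))"
  proof -
    have m: "(\<lambda>w. (v $ k - w $ k) * (v $ m - w $ m)) \<in> Pol" for k m by (rule Pol_mult[OF z(2) z(2)])
    have pm: "partial_deriv j (\<lambda>w. (v $ k - w $ k) * (v $ m - w $ m)) w
        = (if j = k then -1 else 0) * (v $ m - w $ m) + (v $ k - w $ k) * (if j = m then -1 else 0)" for k m
      unfolding partial_deriv_Pol_mult[OF z(2) z(2)] z(1) ..
    have s: "(\<lambda>w. \<Sum>k\<in>UNIV. (v $ k - w $ k) * (v $ k - w $ k)) \<in> Pol" by (rule Pol_sum) (rule m)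
    show ?thesis
      unfolding e partial_deriv_Pol_diff[OF Pol_cmult[OF s] m] partial_deriv_Pol_cmult[OF s]
        partial_deriv_Pol_sum[OF m] pm ..
  qed
  have "(if j = k then -1 else 0) * (v $ k - w $ k) + (v $ k - w $ k) * (if j = k then -1 else 0)
     = (if j = k then - 2 * (v $ k - w $ k) else 0)" for k
    by (cases "j = k") (simp_all only: if_True if_False, simp_all)
  then have s: "(\<Sum>k\<in>UNIV. (if j = k then -1 else 0) * (v $ k - w $ k) + (v $ k - w $ k) * (if j = k then -1 else 0))
     = - 2 * (v $ j - w $ j)" by (simp only: sum.delta' finite UNIV_I if_True)
  have x1: "c * (- 2 * (v $ j - w $ j)) = - (if i = l then 2 * (v $ j - w $ j) else 0)"
    unfolding c_def by (cases "i = l") (simp_all only: refl if_True if_False mult_1_left mult_zero_left minus_zero mult_minus_left)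
  have x: "(if b then -1 else 0) * x = - (if b then x else 0)" for b and x :: real
    by (cases b) simp_all
  have x': "x * (if b then -1 else 0) = - (if b then x else 0)" for b and x :: real
    by (cases b) simp_all
  have arith_aux: "- x - (- y + - z) = - x + y + z" for x y z :: real by simp
  show ?thesis unfolding d unfolding s unfolding x1 unfolding x x'
    by (rule arith_aux)
qed

text \<open>Since \<open>a(z) z = 0\<close>, integrating by parts leaves a field that is only quadratic in \<open>w\<close>.\<close>

lemma nonlocal_eq:
  fixes p :: "real^'n::finite \<Rightarrow> real"
  assumes p: "p \<in> Pol"
  shows "nonlocal p i v = 2 * v $ i * (\<Sum>k\<in>UNIV. ip p (\<lambda>w. w $ k * w $ k)) - 2 * (\<Sum>k\<in>UNIV. v $ k * ip p (\<lambda>w. w $ i * w $ k))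
     + (2 * (norm v)\<^sup>2 + (real CARD('n) - 1)) * ip p (\<lambda>w. w $ i) - 2 * v $ i * (\<Sum>k\<in>UNIV. v $ k * ip p (\<lambda>w. w $ k)) - (real CARD('n) - 1) * v $ i * ip p one"
proof -
  let ?q = "\<lambda>w. \<Sum>j\<in>UNIV. raise j (\<lambda>w. amat (v - w) i j) w"
  have "nonlocal p i v = (\<Sum>j\<in>UNIV. ip p (raise j (\<lambda>w. amat (v - w) i j)))"
    unfolding nonlocal_def by (intro sum.cong refl Pol_ibp p Pol_amat_shift)
  also have "\<dots> = ip p ?q"
    by (intro ip_sum_right[symmetric] Pol_L2M Pol_raise Pol_amat_shift p)
  also have "?q = (\<lambda>w. ((((2 * v $ i) * (\<Sum>k\<in>UNIV. w $ k * w $ k) - 2 * (\<Sum>k\<in>UNIV. v $ k * (w $ i * w $ k)))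
     + (2 * (norm v)\<^sup>2 + (real CARD('n) - 1)) * w $ i) - (2 * v $ i) * (\<Sum>k\<in>UNIV. v $ k * w $ k)) - ((real CARD('n) - 1) * v $ i) * one w)"
  proof
    fix w
    let ?z = "v - w"
    have s1: "(\<Sum>j\<in>UNIV. partial_deriv j (\<lambda>w. amat (v - w) i j) w) = (real CARD('n) - 1) * (v $ i - w $ i)"
      unfolding partial_deriv_amat_shift by (simp add: sum.distrib sum_negf sum_subtractf algebra_simps)
    have "(\<Sum>j\<in>UNIV. amat ?z i j * ?z $ j) = 0" unfolding amat_mult by simp
    then have "(\<Sum>j\<in>UNIV. amat ?z i j * w $ j) = (\<Sum>j\<in>UNIV. amat ?z i j * v $ j)"
      by (simp add: algebra_simps sum_subtractf)
    also have "\<dots> = (?z \<bullet> ?z) * v $ i - ?z $ i * (?z \<bullet> v)" by (rule amat_mult)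
    also have "\<dots> = v $ i * (w \<bullet> w) - w $ i * (v \<bullet> w) + (norm v)\<^sup>2 * w $ i - v $ i * (v \<bullet> w)"
      unfolding power2_norm_eq_inner by (simp add: inner_diff_left inner_diff_right inner_commute[of w v] algebra_simps)
    finally have s2: "(\<Sum>j\<in>UNIV. amat ?z i j * w $ j) = v $ i * (w \<bullet> w) - w $ i * (v \<bullet> w) + (norm v)\<^sup>2 * w $ i - v $ i * (v \<bullet> w)" .
    have "?q w = 2 * (\<Sum>j\<in>UNIV. amat ?z i j * w $ j) - (\<Sum>j\<in>UNIV. partial_deriv j (\<lambda>w. amat (v - w) i j) w)"
      unfolding raise_def by (simp add: sum_subtractf sum_distrib_left mult_ac)
    then show "?q w = ((((2 * v $ i) * (\<Sum>k\<in>UNIV. w $ k * w $ k) - 2 * (\<Sum>k\<in>UNIV. v $ k * (w $ i * w $ k)))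
     + (2 * (norm v)\<^sup>2 + (real CARD('n) - 1)) * w $ i) - (2 * v $ i) * (\<Sum>k\<in>UNIV. v $ k * w $ k)) - ((real CARD('n) - 1) * v $ i) * one w"
      unfolding s1 s2 inner_vec_def by (simp add: sum_distrib_left algebra_simps)
  qed
  also have "ip p \<dots> = (((2 * v $ i) * (\<Sum>k\<in>UNIV. ip p (\<lambda>w. w $ k * w $ k)) - 2 * (\<Sum>k\<in>UNIV. v $ k * ip p (\<lambda>w. w $ i * w $ k)))
     + (2 * (norm v)\<^sup>2 + (real CARD('n) - 1)) * ip p (\<lambda>w. w $ i)) - (2 * v $ i) * (\<Sum>k\<in>UNIV. v $ k * ip p (\<lambda>w. w $ k)) - ((real CARD('n) - 1) * v $ i) * ip p one"
    by (simp only: ip_add_right ip_diff_right ip_cmult_right ip_sum_right Pol_L2M Pol_add Pol_diff Pol_cmult Pol_mult Pol_sum Pol_coord Pol_const p)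
  finally show ?thesis by simp
qed

section \<open>Action on the Hermite spaces\<close>

lemma one_Herm: "(one :: real^'n::finite \<Rightarrow> real) \<in> Herm 0"
proof -
  have "herm (\<lambda>_::'n. 0) \<in> Herm 0" by (rule Herm_basis) (simp add: mdeg_def)
  moreover have "herm (\<lambda>_::'n. 0) = one" by (auto simp: herm_def)
  ultimately show "(one :: real^'n \<Rightarrow> real) \<in> Herm 0" by simp
qed

lemma Herm_moments:
  assumes p: "p \<in> Herm k"
  shows "k \<ge> 1 \<Longrightarrow> ip p one = 0" "k \<ge> 2 \<Longrightarrow> ip p (\<lambda>w. w $ i) = 0" "k \<ge> 3 \<Longrightarrow> ip p (\<lambda>w. w $ i * w $ j) = 0"
proof -
  have a: "ip p one = 0" if "p \<in> Herm k" "k \<ge> 1" for p :: "real^'n::finite \<Rightarrow> real" and k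
    using Herm_orthogonal[OF that(1) one_Herm] that(2) by simp
  show "k \<ge> 1 \<Longrightarrow> ip p one = 0" using a[OF p] by simp
  show "ip p (\<lambda>w. w $ i) = 0" if "k \<ge> 2"
  proof -
    have "partial_deriv i p \<in> Herm (k - 1)" using p that by (intro Herm_lower) simp
    then show ?thesis using a that by (subst ip_coord[OF Herm_Pol[OF p]]) fastforce
  qed
  show "ip p (\<lambda>w. w $ i * w $ j) = 0" if "k \<ge> 3"
  proof -
    have "p \<in> Herm (Suc (Suc (k - 2)))" using p that by (simp add: numeral_2_eq_2 Suc_diff_Suc)
    then have "partial_deriv j (partial_deriv i p) \<in> Herm (k - 2)" by (intro Herm_lower)
    then have "ip (partial_deriv j (partial_deriv i p)) one = 0" using a that by fastforce
    moreover have "ip p one = 0" using a[OF p] that by simp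
    ultimately show ?thesis by (subst ip_coord2[OF Herm_Pol[OF p]]) simp
  qed
qed

text \<open>The nonlocal field involves only the moments of p of order at most 2, and these vanish
  in degree at least 3.\<close>

lemma flux_Herm_ge3:
  fixes p :: "real^'n::finite \<Rightarrow> real"
  assumes p: "p \<in> Herm k" and k: "k \<ge> 3"
  shows "flux p i = (\<lambda>v. mass TYPE('n) * local_flux p i v)"
proof -
  have m: "ip p one = 0" "ip p (\<lambda>w. w $ i) = 0" "ip p (\<lambda>w. w $ i * w $ j) = 0" for i j
    using Herm_moments[OF p] k by simp_all
  have "nonlocal p i v = 0" for i v
    unfolding nonlocal_eq[OF Herm_Pol[OF p]] m by simp
  then show ?thesis by (simp add: flux_def fun_eq_iff)
qed

lemma collision_Herm_ge3:
  fixes p :: "real^'n::finite \<Rightarrow> real"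
  assumes p: "p \<in> Herm k" and k: "k \<ge> 3"
  shows "collision p = (\<lambda>v. mass TYPE('n) * local_op p v)"
proof
  fix v
  have "raise i (flux p i) v = mass TYPE('n) * raise i (local_flux p i) v" for i
    unfolding flux_Herm_ge3[OF p k] raise_cmult[OF Pol_local_flux[OF Herm_Pol[OF p]]] ..
  then show "collision p v = mass TYPE('n) * local_op p v"
    by (simp only: collision_def local_op_def sum_distrib_left)
qed

lemma Herm_1_linear:
  assumes f: "f \<in> Herm 1"
  shows "f v = (\<Sum>j\<in>UNIV. v $ j * partial_deriv j f v)"
proof -
  have "partial_deriv j f \<in> Herm 0" for j using f by (intro Herm_lower) simp
  then have "raise j (partial_deriv j f) v = 2 * (v $ j * partial_deriv j f v)" for j
    by (simp add: raise_def Herm_lower_0 fun_eq_iff)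
  then show ?thesis using Herm_number[OF f, of v] by (simp add: sum_distrib_left[symmetric])
qed

lemma Herm_0_const: "p \<in> Herm 0 \<Longrightarrow> p = (\<lambda>_. p 0)"
proof (induction rule: Herm.induct)
  case (Herm_basis m)
  then have "herm m = (\<lambda>_. 1)" by (auto simp: herm_def mdeg_def)
  then show ?case by simp
next
  case Herm_zero
  show ?case by (rule refl)
next
  case (Herm_add p q)
  show ?case
    by (rule ext, rule arg_cong2[where f = "(+)"]; rule fun_cong[OF Herm_add.IH(1)] fun_cong[OF Herm_add.IH(2)])
next
  case (Herm_cmult p c)
  show ?case by (rule ext, rule arg_cong[where f = "\<lambda>x. c * x"], rule fun_cong[OF Herm_cmult.IH])
qed

text \<open>The second derivatives are constant, and the second moments are mass / 4 times them.
  With trace zero the nonlocal field is therefore - (mass / 2) times the gradient of p; half of the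
  number operator in degree 2 is the extra 2 p.\<close>

lemma collision_Herm_2:
  fixes p :: "real^'n::finite \<Rightarrow> real"
  assumes p: "p \<in> Herm 2" and l: "lap p = (\<lambda>_. 0)"
  shows "collision p = (\<lambda>v. mass TYPE('n) * (local_op p v + 2 * p v))"
proof -
  have P: "p \<in> Pol" by (rule Herm_Pol[OF p])
  have d1: "partial_deriv i p \<in> Herm 1" for i using p by (intro Herm_lower) (simp add: numeral_2_eq_2)
  have d2: "partial_deriv j (partial_deriv i p) \<in> Herm 0" for i j
    by (rule Herm_lower) (use d1[of i] in simp)
  have m0: "ip p one = 0" "\<And>i. ip p (\<lambda>w. w $ i) = 0" using Herm_moments[OF p] by auto
  have m2: "ip p (\<lambda>w. w $ i * w $ k) = 1/4 * mass TYPE('n) * partial_deriv k (partial_deriv i p) v" for i k v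
  proof -
    have e: "partial_deriv k (partial_deriv i p) = (\<lambda>w. partial_deriv k (partial_deriv i p) v * one w)"
    proof
      fix w show "partial_deriv k (partial_deriv i p) w = partial_deriv k (partial_deriv i p) v * one w"
        using fun_cong[OF Herm_0_const[OF d2[of k i]], of w] fun_cong[OF Herm_0_const[OF d2[of k i]], of v] by linarith
    qed
    have "ip (partial_deriv k (partial_deriv i p)) one = partial_deriv k (partial_deriv i p) v * mass TYPE('n)"
      by (subst e) (simp only: ip_cmult_left ip_one_mass)
    then show ?thesis unfolding ip_coord2[OF P] m0 by simp
  qed
  have "nonlocal p i v = - (mass TYPE('n) / 2) * partial_deriv i p v" for i v
  proof -
    have "(\<Sum>k\<in>UNIV. ip p (\<lambda>w. w $ k * w $ k)) = 1/4 * mass TYPE('n) * lap p v"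
      unfolding m2[of _ _ v] lap_def by (simp add: sum_distrib_left)
    moreover have "(\<Sum>k\<in>UNIV. v $ k * ip p (\<lambda>w. w $ i * w $ k)) = 1/4 * mass TYPE('n) * partial_deriv i p v"
      unfolding m2[of _ _ v] by (subst Herm_1_linear[OF d1]) (simp add: sum_distrib_left mult_ac)
    ultimately show ?thesis unfolding nonlocal_eq[OF P] l by (simp add: m0)
  qed
  then have f: "flux p i = (\<lambda>v. mass TYPE('n) * (local_flux p i v + 1/2 * partial_deriv i p v))" for i
    by (auto simp: flux_def algebra_simps)
  have r: "raise i (flux p i) v = mass TYPE('n) * (raise i (local_flux p i) v + 1/2 * raise i (partial_deriv i p) v)" for i v
    unfolding f raise_cmult[OF Pol_add[OF Pol_local_flux[OF P] Pol_cmult[OF Pol_partial_deriv[OF P]]]]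
      raise_add[OF Pol_local_flux[OF P] Pol_cmult[OF Pol_partial_deriv[OF P]]] raise_cmult[OF Pol_partial_deriv[OF P]] ..
  have "collision p v = mass TYPE('n) * (local_op p v + 1/2 * (\<Sum>i\<in>UNIV. raise i (partial_deriv i p) v))" for v
    unfolding collision_def local_op_def r by (simp only: sum.distrib sum_distrib_left distrib_left)
  then show ?thesis unfolding Herm_number[OF p] by auto
qed

definition lam1 :: "'n::finite itself \<Rightarrow> real" where
  "lam1 _ = 4 * (real CARD('n) - 1) * mass TYPE('n)"

lemma lap_adj_one: "lap_adj one = (\<lambda>v::real^'n::finite. 4 * (norm v)\<^sup>2 - 2 * real CARD('n) * one v)"
proof
  fix v :: "real^'n"
  have "raise i (raise i one) v = 4 * (v $ i)\<^sup>2 - 2" for i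
    unfolding raise_one by (simp add: raise_cmult Pol_coord) (simp add: raise_def partial_deriv_coord power2_eq_square)
  then show "lap_adj one v = 4 * (norm v)\<^sup>2 - 2 * real CARD('n) * one v"
    unfolding lap_adj_def norm_vec_square_sum by (simp add: sum_subtractf sum_distrib_left)
qed

lemma lap_adj_Herm: "p \<in> Herm k \<Longrightarrow> lap_adj p \<in> Herm (Suc (Suc k))"
  unfolding lap_adj_def by (intro Herm_sum Herm_raise)

text \<open>\<open>h\<close> enters only through pairings with polynomials, so the estimate serves
  both for functions of finite dissipation and for eigenfunctions. In degrees 0 and 1 the
  orthogonality conditions make the projection vanish in norm.\<close>

lemma ip_Herm_collision:
  fixes h :: "real^'n::finite \<Rightarrow> real"
  assumes N: "CARD('n) \<ge> 2" and h: "h \<in> L2M"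
    and orth: "ip h one = 0" "\<And>i. ip h (\<lambda>v. v $ i) = 0" "ip h (\<lambda>v. (norm v)\<^sup>2) = 0"
  shows "collision (herm_proj h k) \<in> Herm k \<and>
    ip h (collision (herm_proj h k)) \<ge> lam1 TYPE('n) * ip (herm_proj h k) (herm_proj h k)"
proof -
  let ?p = "herm_proj h k"
  have p: "?p \<in> Herm k" by (rule herm_proj_Herm)
  have P: "?p \<in> Pol" by (rule Herm_Pol[OF p])
  have self: "ip ?p ?p = ip h ?p" using herm_proj_ip[OF h p] by simp
  consider "k = 0" | "k = 1" | "k \<ge> 2" by linarith
  then show ?thesis
  proof cases
    case 1
    then obtain c where c: "?p = (\<lambda>v. c * one v)" using Herm_0_const[of ?p] p by auto
    have "ip h ?p = c * ip h one" unfolding c by (rule ip_cmult_right)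
    then have "ip ?p ?p = 0" using orth(1) self by simp
    moreover have "collision ?p = (\<lambda>_. 0)" by (subst c) (simp add: collision_const)
    ultimately show ?thesis by (simp add: L2M_inner_def Herm_zero)
  next
    case 2
    then have p1: "?p \<in> Herm 1" using p by simp
    have d: "partial_deriv j ?p = (\<lambda>_. partial_deriv j ?p 0)" for j
      by (rule Herm_0_const) (use p1 in \<open>auto intro: Herm_lower\<close>)
    have e: "?p = (\<lambda>v. \<Sum>j\<in>UNIV. partial_deriv j ?p 0 * v $ j)"
    proof
      fix v show "?p v = (\<Sum>j\<in>UNIV. partial_deriv j ?p 0 * v $ j)"
        unfolding Herm_1_linear[OF p1, of v] by (intro sum.cong refl) (simp only: fun_cong[OF d, of _ v] mult.commute)
    qed
    have "ip h ?p = (\<Sum>j\<in>UNIV. partial_deriv j ?p 0 * ip h (\<lambda>v. v $ j))"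
      by (subst (1) e) (simp add: ip_sum_right ip_cmult_right Pol_L2M Pol_cmult Pol_coord h)
    then have "ip ?p ?p = 0" using orth(2) self by simp
    moreover have "collision ?p = (\<lambda>_. 0)"
    proof (rule collision_zero_grad[OF P])
      fix v w i
      have "partial_deriv j ?p v = partial_deriv j ?p w" for j
        using fun_cong[OF d[of j], of v] fun_cong[OF d[of j], of w] by linarith
      then show "(\<Sum>j\<in>UNIV. amat (v - w) i j * (partial_deriv j ?p v - partial_deriv j ?p w)) = 0" by simp
    qed
    ultimately show ?thesis by (simp add: L2M_inner_def Herm_zero)
  next
    case 3
    \<comment> \<open>In degree 2 the Laplacian of the projection is a constant, and its mean equals
      the pairing of \<open>h\<close> with 4 |v|^2 - 2 N; this is where orthogonality to |v|^2
      enters.\<close>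
    have l2: "lap ?p = (\<lambda>_. 0)" if "k = 2"
    proof -
      have "(lap_adj one :: real^'n \<Rightarrow> real) \<in> Herm 2"
        using lap_adj_Herm[OF one_Herm] by (simp add: numeral_2_eq_2)
      then have "ip ?p (lap_adj one) = ip h (\<lambda>v. 4 * (norm v)\<^sup>2 - 2 * real CARD('n) * one v)"
        using herm_proj_ip[OF h, of "lap_adj one" k] that by (simp add: lap_adj_one)
      also have "\<dots> = 0"
        by (simp only: ip_diff_right ip_cmult_right Pol_L2M Pol_cmult Pol_norm_square Pol_const h orth mult_zero_right diff_self)
      finally have "ip (lap ?p) one = 0" using ip_lap[OF P Pol_const[of 1]] by simp
      moreover have "lap ?p \<in> Herm 0" using p that by (intro Herm_lap) (simp add: numeral_2_eq_2)
      then have e: "lap ?p = (\<lambda>v. lap ?p 0 * one v)" using Herm_0_const[of "lap ?p"] by auto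
      moreover have "ip (lap ?p) one = lap ?p 0 * mass TYPE('n)"
        by (subst e) (simp only: ip_cmult_left ip_one_mass)
      ultimately have "lap ?p 0 = 0" using mass_pos[where 'n = 'n] by simp
      then show ?thesis by (subst e) simp
    qed
    have op: "local_op ?p = (\<lambda>v. (real CARD('n) - 1) * real k * ?p v + spherical ?p v)" by (rule local_op_Herm[OF p])
    have S: "spherical ?p \<in> Herm k" by (rule Herm_spherical[OF p])
    have c: "collision ?p = (\<lambda>v. mass TYPE('n) * (((real CARD('n) - 1) * real k * ?p v + spherical ?p v) + (if k = 2 then 2 else 0) * ?p v))"
    proof (cases "k = 2")
      case True
      then show ?thesis using collision_Herm_2[of ?p] p l2 op by simp
    next
      case False
      then show ?thesis using collision_Herm_ge3[OF p] 3 op by simp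
    qed
    then have coll: "collision ?p \<in> Herm k" using p S by (auto intro!: Herm_cmult Herm_add)
    then have "ip h (collision ?p) = ip ?p (collision ?p)" by (rule herm_proj_ip[OF h])
    also have "\<dots> = mass TYPE('n) * ((real CARD('n) - 1) * real k * ip ?p ?p + sph_form ?p + (if k = 2 then 2 else 0) * ip ?p ?p)"
      unfolding c using Herm_L2M[OF p] Herm_L2M[OF S]
      by (simp only: ip_cmult_right ip_add_right L2M_add L2M_cmult ip_spherical[OF P])
    also have "\<dots> \<ge> mass TYPE('n) * (4 * (real CARD('n) - 1) * ip ?p ?p)"
      using local_gap[OF N p 3 l2] mass_pos[where 'n = 'n] by (intro mult_left_mono) (auto split: if_splits)
    finally show ?thesis using coll by (simp add: lam1_def mult_ac)
  qed
qed

section \<open>The spectral gap for the dissipation\<close>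

lemma perp_form_commute: "perp_form u X = perp_form X u"
  by (simp add: perp_form_def inner_commute mult.commute)

lemma perp_form_parallelogram:
  "perp_form u (X + Y) + perp_form u (X - Y) = 2 * perp_form u X + 2 * perp_form u Y"
  unfolding perp_form_def
  by (simp add: inner_add_left inner_add_right inner_diff_left inner_diff_right inner_commute[of Y X] power2_eq_square algebra_simps)

lemma perp_form_diff_le: "perp_form u (X - Y) \<le> 2 * perp_form u X + 2 * perp_form u Y"
  using perp_form_parallelogram[of u X Y] perp_form_nonneg[of u "X + Y"] by linarith

lemma perp_form_diff_le_left: "perp_form (u - u') X \<le> 2 * perp_form u X + 2 * perp_form u' X"
  using perp_form_diff_le[of X u u'] by (simp only: perp_form_commute[of X])

lemma perp_form_axis: "perp_form (axis i 1 :: real^'n::finite) X = (norm X)\<^sup>2 - (X $ i)\<^sup>2"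
  by (simp add: perp_form_def inner_axis' power2_norm_eq_inner inner_axis_axis)

lemma perp_form_Pol: "(\<lambda>w. perp_form (u - w) X) \<in> Pol"
  unfolding perp_form_def inner_vec_def power2_eq_square vector_minus_component inner_real_def
  by (intro Pol_diff Pol_mult Pol_sum Pol_const Pol_coord)

lemma locally_integrable_borel:
  fixes f :: "real^'n::finite \<Rightarrow> 'b::{banach, second_countable_topology}"
  assumes f: "locally_integrable f"
  shows "f \<in> borel_measurable borel"
proof -
  have m: "(\<lambda>v. indicator (cball 0 (real n)) v *\<^sub>R f v) \<in> borel_measurable borel" for n
  proof -
    have "integrable lborel (\<lambda>v. indicator (cball 0 (real n)) v *\<^sub>R f v)"
      using f by (auto simp: locally_integrable_def set_integrable_def)
    then show ?thesis using borel_measurable_integrable by fastforce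
  qed
  show ?thesis
  proof (rule borel_measurable_LIMSEQ_metric[OF m])
    fix v :: "real^'n"
    obtain N where N: "norm v \<le> real N" using real_arch_simple by blast
    have "eventually (\<lambda>n. indicator (cball 0 (real n)) v *\<^sub>R f v = f v) sequentially"
      using eventually_ge_at_top[of N] by eventually_elim (use N in \<open>auto split: split_indicator\<close>)
    then show "(\<lambda>n. indicator (cball 0 (real n)) v *\<^sub>R f v) \<longlonglongrightarrow> f v" by (rule tendsto_eventually)
  qed
qed

lemma AE_lborel_translate:
  fixes c :: "'a::euclidean_space"
  assumes "AE x in lborel. P x"
  shows "AE x in lborel. P (c + x)"
proof -
  obtain N where N: "{x \<in> space lborel. \<not> P x} \<subseteq> N" "emeasure lborel N = 0" "N \<in> sets lborel"
    using assms by (rule AE_E)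
  have [measurable]: "N \<in> sets borel" using N(3) by simp
  have "AE x in distr lborel borel ((+) c). x \<notin> N"
    unfolding lborel_distr_plus using N by (intro AE_not_in) auto
  then have "AE x in lborel. c + x \<notin> N" by (subst (asm) AE_distr_iff) auto
  then show ?thesis by eventually_elim (use N(1) in auto)
qed

text \<open>Seen from one base point u, the dissipation controls only the part of g(w) orthogonal to
  u - w. Two base points that differ by an axis vector suffice: the form is quadratic in its first
  argument, so it is also controlled with that axis vector there, and this dominates the squares of
  all components but one.\<close>

lemma finite_dissipation_gradient_L2M:
  fixes g :: "real^'n::finite \<Rightarrow> real^'n"
  assumes card: "CARD('n) \<ge> 2" and g[measurable]: "g \<in> borel_measurable borel"
    and fin: "(\<integral>\<^sup>+v. \<integral>\<^sup>+w. ennreal (perp_form (v - w) (g v - g w) * (maxw v * maxw w)) \<partial>lborel \<partial>lborel) < \<infinity>"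
  shows "(\<lambda>v. g v $ i) \<in> L2M"
proof -
  define I where "I v = (\<integral>\<^sup>+w. ennreal (perp_form (v - w) (g v - g w) * maxw w) \<partial>lborel)" for v
  have I[measurable]: "I \<in> borel_measurable borel" unfolding I_def[abs_def] by measurable
  have e: "(\<integral>\<^sup>+w. ennreal (perp_form (v - w) (g v - g w) * (maxw v * maxw w)) \<partial>lborel) = ennreal (maxw v) * I v" for v
    unfolding I_def by (subst nn_integral_cmult[symmetric]) (auto simp: ennreal_mult'[symmetric] mult_ac intro!: nn_integral_cong)
  have "AE v in lborel. ennreal (maxw v) * I v \<noteq> \<infinity>"
    using fin unfolding e by (intro nn_integral_PInf_AE) auto
  then have AE0: "AE v in lborel. I v < \<infinity>"
    by eventually_elim (auto simp: ennreal_mult_eq_top_iff less_top[symmetric])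
  have "AE v in lborel. \<forall>i\<in>UNIV. I (axis i 1 + v) < \<infinity>"
    by (rule AE_finite_allI) (simp, rule AE_lborel_translate[OF AE0])
  with AE0 have "AE v in lborel. I v < \<infinity> \<and> (\<forall>i. I (axis i 1 + v) < \<infinity>)" by eventually_elim auto
  from AE_lborel_ball[OF this, of 1 0] obtain v where v: "I v < \<infinity>" "\<And>i. I (axis i 1 + v) < \<infinity>" by auto
  have J: "integrable lborel (\<lambda>w. perp_form (u - w) (g w) * maxw w)" if "I u < \<infinity>" for u
  proof (rule Bochner_Integration.integrable_bound)
    have 1: "integrable lborel (\<lambda>w. perp_form (u - w) (g u - g w) * maxw w)"
      using that unfolding I_def by (intro integrableI_nonneg) auto
    show "integrable lborel (\<lambda>w. 2 * (perp_form (u - w) (g u) * maxw w) + 2 * (perp_form (u - w) (g u - g w) * maxw w))"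
      by (intro Bochner_Integration.integrable_add integrable_mult_right 1 Pol_integrable perp_form_Pol)
    show "AE w in lborel. norm (perp_form (u - w) (g w) * maxw w)
        \<le> norm (2 * (perp_form (u - w) (g u) * maxw w) + 2 * (perp_form (u - w) (g u - g w) * maxw w))"
    proof (rule AE_I2)
      fix w
      have "perp_form (u - w) (g w) \<le> 2 * perp_form (u - w) (g u) + 2 * perp_form (u - w) (g u - g w)"
        using perp_form_diff_le[of "u - w" "g u" "g u - g w"] by simp
      from mult_right_mono[OF this, of "maxw w"]
      have "perp_form (u - w) (g w) * maxw w \<le> 2 * (perp_form (u - w) (g u) * maxw w) + 2 * (perp_form (u - w) (g u - g w) * maxw w)"
        by (simp add: algebra_simps)
      then show "norm (perp_form (u - w) (g w) * maxw w)
        \<le> norm (2 * (perp_form (u - w) (g u) * maxw w) + 2 * (perp_form (u - w) (g u - g w) * maxw w))"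
        by (simp add: abs_mult)
    qed
  qed measurable
  obtain j where j: "j \<noteq> i"
    using card by (metis One_nat_def UNIV_eq_I card_2_iff' card_1_singleton_iff ex_card subset_UNIV singletonI insert_iff)
  have "integrable lborel (\<lambda>w. (g w $ i)\<^sup>2 * maxw w)"
  proof (rule Bochner_Integration.integrable_bound)
    show "integrable lborel (\<lambda>w. 2 * (perp_form (axis j 1 + v - w) (g w) * maxw w) + 2 * (perp_form (v - w) (g w) * maxw w))"
      by (intro Bochner_Integration.integrable_add integrable_mult_right J v)
    show "AE w in lborel. norm ((g w $ i)\<^sup>2 * maxw w)
        \<le> norm (2 * (perp_form (axis j 1 + v - w) (g w) * maxw w) + 2 * (perp_form (v - w) (g w) * maxw w))"
    proof (rule AE_I2)
      fix w
      have "(g w $ i)\<^sup>2 + (g w $ j)\<^sup>2 = (\<Sum>k\<in>{i, j}. (g w $ k)\<^sup>2)" using j by simp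
      also have "\<dots> \<le> (\<Sum>k\<in>UNIV. (g w $ k)\<^sup>2)" by (rule sum_mono2) auto
      finally have "(g w $ i)\<^sup>2 \<le> perp_form (axis j 1) (g w)" unfolding perp_form_axis norm_vec_square_sum by linarith
      also have "axis j 1 = (axis j 1 + v - w) - (v - w)" by simp
      also have "perp_form \<dots> (g w) \<le> 2 * perp_form (axis j 1 + v - w) (g w) + 2 * perp_form (v - w) (g w)"
        by (rule perp_form_diff_le_left)
      finally have "(g w $ i)\<^sup>2 * maxw w \<le> (2 * perp_form (axis j 1 + v - w) (g w) + 2 * perp_form (v - w) (g w)) * maxw w"
        by (rule mult_right_mono) simp
      then show "norm ((g w $ i)\<^sup>2 * maxw w)
        \<le> norm (2 * (perp_form (axis j 1 + v - w) (g w) * maxw w) + 2 * (perp_form (v - w) (g w) * maxw w))"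
        by (simp add: algebra_simps)
    qed
  qed measurable
  then show ?thesis by (simp add: L2M_def)
qed

lemma integrable_pair_mult:
  fixes f g :: "'a::euclidean_space \<Rightarrow> real"
  assumes f: "integrable lborel f" and g: "integrable lborel g"
  shows "integrable (lborel \<Otimes>\<^sub>M lborel) (\<lambda>(v, w). f v * g w)"
proof (rule lborel_pair.Fubini_integrable)
  note [measurable] = borel_measurable_integrable[OF f] borel_measurable_integrable[OF g]
  show "(\<lambda>(v, w). f v * g w) \<in> borel_measurable (lborel \<Otimes>\<^sub>M lborel)" by measurable
  show "integrable lborel (\<lambda>v. LINT w|lborel. norm (case (v, w) of (v, w) \<Rightarrow> f v * g w))"
    using f by (simp add: abs_mult)
  show "AE v in lborel. integrable lborel (\<lambda>w. case (v, w) of (v, w) \<Rightarrow> f v * g w)"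
    using g by simp
qed

section \<open>The bilinear form of the dissipation\<close>

definition skew_field :: "(real^'n::finite \<Rightarrow> real) \<Rightarrow> 'n \<Rightarrow> real^'n \<Rightarrow> real^'n \<Rightarrow> real" where
  "skew_field p i v w = (\<Sum>j\<in>UNIV. amat (v - w) i j * (partial_deriv j p v - partial_deriv j p w))"

lemma skew_field_swap: "skew_field p i w v = - skew_field p i v w"
  unfolding skew_field_def sum_negf[symmetric] amat_minus[of w v] by (simp add: algebra_simps)

text \<open>Bounding by a product in separate variables reduces joint integrability to integrability
  in each variable.\<close>

lemma skew_field_bound:
  fixes p :: "real^'n::finite \<Rightarrow> real"
  assumes p: "p \<in> Pol"
  shows "\<exists>A\<in>Pol. \<forall>v w i. \<bar>skew_field p i v w\<bar> \<le> A v * A w"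
proof -
  define q where "q v = 1 + (\<Sum>j\<in>UNIV. (partial_deriv j p v)\<^sup>2)" for v
  define N where "N = 8 * real CARD('n)"
  define A where "A v = N * ((1 + (norm v)\<^sup>2) * q v)" for v
  have N: "N \<ge> 1" unfolding N_def using one_le_card_finite[where 'a = 'n] by linarith
  have q1: "q v \<ge> 1" for v by (simp add: q_def sum_nonneg)
  have qd: "\<bar>partial_deriv j p v\<bar> \<le> q v" for j v
  proof -
    have "\<bar>partial_deriv j p v\<bar> \<le> 1 + (partial_deriv j p v)\<^sup>2"
      using norm_le_1_plus_square[of "partial_deriv j p v"] by simp
    also have "\<dots> \<le> q v" unfolding q_def by (intro add_left_mono member_le_sum) auto
    finally show ?thesis .
  qed
  have "A \<in> Pol"
    unfolding A_def[abs_def] q_def by (intro Pol_cmult Pol_mult Pol_add Pol_const Pol_norm_square Pol_sum Pol_power Pol_partial_deriv p)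
  moreover have "\<bar>skew_field p i v w\<bar> \<le> A v * A w" for v w i
  proof -
    let ?V = "1 + (norm v)\<^sup>2" and ?W = "1 + (norm w)\<^sup>2"
    have am: "\<bar>amat (v - w) i j\<bar> \<le> 4 * (?V * ?W)" for j
    proof -
      have "\<bar>amat z i j\<bar> \<le> 2 * (norm z)\<^sup>2" for z :: "real^'n"
      proof -
        have "\<bar>z $ i * z $ j\<bar> \<le> norm z * norm z"
          unfolding abs_mult by (intro mult_mono component_le_norm_cart) auto
        moreover have "\<bar>(if i = j then n else 0) - x\<bar> \<le> 2 * n" if "\<bar>x\<bar> \<le> n" for x n :: real
          using that by (cases "i = j") auto
        ultimately show ?thesis unfolding amat_def power2_eq_square by blast
      qed
      also have "(norm (v - w))\<^sup>2 \<le> 2 * (norm v)\<^sup>2 + 2 * (norm w)\<^sup>2"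
      proof -
        have "(norm (v - w))\<^sup>2 + (norm (v + w))\<^sup>2 = 2 * (norm v)\<^sup>2 + 2 * (norm w)\<^sup>2"
          by (simp add: power2_norm_eq_inner inner_add_left inner_add_right inner_diff_left inner_diff_right inner_commute)
        then show ?thesis using zero_le_power2[of "norm (v + w)"] by linarith
      qed
      also have "2 * (2 * (norm v)\<^sup>2 + 2 * (norm w)\<^sup>2) \<le> 4 * (?V * ?W)"
        by (simp add: algebra_simps)
      finally show ?thesis by simp
    qed
    have d: "\<bar>partial_deriv j p v - partial_deriv j p w\<bar> \<le> 2 * (q v * q w)" for j
    proof -
      have "\<bar>partial_deriv j p v - partial_deriv j p w\<bar> \<le> q v + q w" using qd[of j v] qd[of j w] by linarith
      also have "\<dots> \<le> q v * q w + q v * q w"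
        using q1[of v] q1[of w] mult_left_mono[of 1 "q w" "q v"] mult_right_mono[of 1 "q v" "q w"] by linarith
      finally show ?thesis by simp
    qed
    have "\<bar>skew_field p i v w\<bar> \<le> (\<Sum>j\<in>(UNIV :: 'n set). (4 * (?V * ?W)) * (2 * (q v * q w)))"
      unfolding skew_field_def by (rule order_trans[OF sum_abs]) (unfold abs_mult, intro sum_mono mult_mono am d, auto)
    also have "\<dots> = 1 * N * (?V * q v) * (?W * q w)" by (simp add: N_def)
    also have "\<dots> \<le> N * N * (?V * q v) * (?W * q w)"
      using N q1[of v] q1[of w] by (intro mult_right_mono) auto
    also have "\<dots> = A v * A w" by (simp add: A_def mult_ac)
    finally show ?thesis .
  qed
  ultimately show ?thesis by blast
qed

text \<open>\<open>U\<close> keeps only the gradient of \<open>h\<close> at v; exchanging v and w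
  yields the other half of the integrand, whence the 2. Integrating \<open>U\<close> over w produces
  the flux of p, and integration by parts then moves the derivative off \<open>h\<close>.\<close>

lemma dissipation_bilinear:
  fixes h :: "real^'n::finite \<Rightarrow> real"
  assumes g: "weak_gradient h g" and h: "h \<in> L2M" and gL: "\<And>i. (\<lambda>v. g v $ i) \<in> L2M" and p: "p \<in> Pol"
  defines "B \<equiv> \<lambda>(v, w). perp_bil (v - w) (g v - g w) ((\<chi> j. partial_deriv j p v) - (\<chi> j. partial_deriv j p w)) * (maxw v * maxw w)"
  shows "integrable (lborel \<Otimes>\<^sub>M lborel) B" "integral\<^sup>L (lborel \<Otimes>\<^sub>M lborel) B = 2 * ip h (collision p)"
proof -
  obtain A where A: "A \<in> Pol" "\<And>v w i. \<bar>skew_field p i v w\<bar> \<le> A v * A w" using skew_field_bound[OF p] by blast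
  have [measurable]: "(\<lambda>v. g v $ i) \<in> borel_measurable borel" for i by (rule L2M_borel[OF gL])
  have [measurable]: "partial_deriv j p \<in> borel_measurable borel" for j by (rule Pol_borel[OF Pol_partial_deriv[OF p]])
  have [measurable]: "(\<lambda>x. skew_field p i (fst x) (snd x)) \<in> borel_measurable (borel \<Otimes>\<^sub>M borel)" for i
    unfolding skew_field_def amat_def by measurable
  define U where "U i = (\<lambda>(v, w). g v $ i * skew_field p i v w * (maxw v * maxw w))" for i
  have Um[measurable]: "U i \<in> borel_measurable (lborel \<Otimes>\<^sub>M lborel)" for i
    unfolding U_def split_beta by measurable
  have U: "integrable (lborel \<Otimes>\<^sub>M lborel) (U i)" for i
  proof (rule Bochner_Integration.integrable_bound)
    show "integrable (lborel \<Otimes>\<^sub>M lborel) (\<lambda>(v, w). (g v $ i * A v * maxw v) * (A w * maxw w))"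
      by (intro integrable_pair_mult L2M_Pol_integrable gL A Pol_integrable)
    show "AE x in lborel \<Otimes>\<^sub>M lborel. norm (U i x) \<le> norm (case x of (v, w) \<Rightarrow> (g v $ i * A v * maxw v) * (A w * maxw w))"
    proof (rule AE_I2)
      fix x :: "(real^'n) \<times> (real^'n)"
      obtain v w where x: "x = (v, w)" by (cases x)
      have "\<bar>g v $ i\<bar> * \<bar>skew_field p i v w\<bar> * (maxw v * maxw w) \<le> \<bar>g v $ i\<bar> * \<bar>A v * A w\<bar> * (maxw v * maxw w)"
        using A(2)[of i v w] by (intro mult_right_mono mult_left_mono) auto
      then show "norm (U i x) \<le> norm (case x of (v, w) \<Rightarrow> (g v $ i * A v * maxw v) * (A w * maxw w))"
        by (simp add: x U_def abs_mult mult_ac)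
    qed
  qed (rule Um)
  have Us: "integrable (lborel \<Otimes>\<^sub>M lborel) (\<lambda>x. \<Sum>i\<in>UNIV. U i x)" by (intro Bochner_Integration.integrable_sum U)
  have Us': "integrable (lborel \<Otimes>\<^sub>M lborel) (\<lambda>(v, w). \<Sum>i\<in>UNIV. U i (w, v))"
    using lborel_pair.integrable_product_swap[OF Us] by simp
  have B: "B = (\<lambda>x. (\<Sum>i\<in>UNIV. U i x) + (case x of (v, w) \<Rightarrow> \<Sum>i\<in>UNIV. U i (w, v)))"
  proof
    fix x :: "(real^'n) \<times> (real^'n)"
    obtain v w where x: "x = (v, w)" by (cases x)
    have "B (v, w) = (\<Sum>i\<in>UNIV. (g v - g w) $ i * skew_field p i v w) * (maxw v * maxw w)"
      unfolding B_def amat_perp_bil[symmetric] by (simp add: skew_field_def)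
    also have "\<dots> = (\<Sum>i\<in>UNIV. U i (v, w) + U i (w, v))"
      unfolding U_def sum_distrib_right by (intro sum.cong) (auto simp: skew_field_swap[of p _ w v] algebra_simps)
    finally show "B x = (\<Sum>i\<in>UNIV. U i x) + (case x of (v, w) \<Rightarrow> \<Sum>i\<in>UNIV. U i (w, v))"
      by (simp add: sum.distrib x)
  qed
  show "integrable (lborel \<Otimes>\<^sub>M lborel) B" unfolding B by (intro Bochner_Integration.integrable_add Us Us')
  have "integral\<^sup>L (lborel \<Otimes>\<^sub>M lborel) B = 2 * integral\<^sup>L (lborel \<Otimes>\<^sub>M lborel) (\<lambda>x. \<Sum>i\<in>UNIV. U i x)"
    unfolding B using lborel_pair.integral_product_swap[OF borel_measurable_integrable[OF Us]]
    by (subst Bochner_Integration.integral_add[OF Us Us']) simp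
  also have "integral\<^sup>L (lborel \<Otimes>\<^sub>M lborel) (\<lambda>x. \<Sum>i\<in>UNIV. U i x) = (\<Sum>i\<in>UNIV. integral\<^sup>L (lborel \<Otimes>\<^sub>M lborel) (U i))"
    by (intro Bochner_Integration.integral_sum U)
  also have "\<dots> = (\<Sum>i\<in>UNIV. LINT v|lborel. g v $ i * flux p i v * maxw v)"
  proof (intro sum.cong refl)
    fix i
    have "integral\<^sup>L (lborel \<Otimes>\<^sub>M lborel) (U i) = (LINT v|lborel. LINT w|lborel. U i (v, w))"
      by (rule lborel_pair.integral_fst'[OF U, symmetric])
    also have "\<dots> = (LINT v|lborel. g v $ i * flux p i v * maxw v)"
    proof (intro Bochner_Integration.integral_cong refl)
      fix v
      have "(LINT w|lborel. U i (v, w)) = (LINT w|lborel. (g v $ i * maxw v) * (skew_field p i v w * maxw w))"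
        by (simp add: U_def mult_ac)
      also have "\<dots> = (g v $ i * maxw v) * flux p i v"
        using flux_integral[OF p, of v i] by (simp add: skew_field_def)
      finally show "(LINT w|lborel. U i (v, w)) = g v $ i * flux p i v * maxw v" by (simp add: mult_ac)
    qed
    finally show "integral\<^sup>L (lborel \<Otimes>\<^sub>M lborel) (U i) = (LINT v|lborel. g v $ i * flux p i v * maxw v)" .
  qed
  also have "\<dots> = (LINT v|lborel. (\<Sum>i\<in>UNIV. g v $ i * flux p i v) * maxw v)"
    unfolding sum_distrib_right by (intro Bochner_Integration.integral_sum[symmetric] L2M_Pol_integrable gL Pol_flux p)
  also have "\<dots> = ip h (collision p)"
    unfolding collision_def
  proof (rule weak_ibp[OF g h Pol_flux[OF p]])
    show "integrable lborel (\<lambda>v. (\<Sum>i\<in>UNIV. g v $ i * flux p i v) * maxw v)"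
      unfolding sum_distrib_right by (intro Bochner_Integration.integrable_sum L2M_Pol_integrable gL Pol_flux p)
  qed
  finally show "integral\<^sup>L (lborel \<Otimes>\<^sub>M lborel) B = 2 * ip h (collision p)" .
qed

lemma collision_sum_atMost:
  assumes f: "\<And>k. f k \<in> Pol"
  shows "collision (\<lambda>v. \<Sum>k\<le>n. f k v) = (\<lambda>v. \<Sum>k\<le>(n::nat). collision (f k) v)"
proof (induction n)
  case (Suc n)
  have "collision (\<lambda>v. (\<Sum>k\<le>n. f k v) + f (Suc n) v) = (\<lambda>v. collision (\<lambda>v. \<Sum>k\<le>n. f k v) v + collision (f (Suc n)) v)"
    by (intro collision_add Pol_sum f)
  then show ?case by (simp only: sum.atMost_Suc Suc)
qed simp

lemma dissipation_one_eq:
  assumes "\<exists>g. weak_gradient h g"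
  shows "landau_dissipation (\<lambda>_. 1) h = ennreal (1/2) * (\<integral>\<^sup>+v. \<integral>\<^sup>+w.
    ennreal (perp_form (v - w) ((SOME g. weak_gradient h g) v - (SOME g. weak_gradient h g) w) * (maxw v * maxw w)) \<partial>lborel \<partial>lborel)"
proof -
  have e: "1 * (norm z)\<^sup>2 * (norm (perp_proj z *v x))\<^sup>2 * a * b = perp_form z x * (a * b)" for z x :: "real^'a" and a b :: real
    unfolding perp_proj_form[symmetric] by simp
  show ?thesis unfolding landau_dissipation_def Let_def if_P[OF assms] e ..
qed

text \<open>Only a lower bound for the dissipation is sought. The truncations therefore may fail to
  converge in the dissipation form; convergence of their norms in the weighted space is what the
  limit uses.\<close>

lemma spectral_gap_dissipation:
  fixes h :: "real^'n::finite \<Rightarrow> real"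
  assumes N: "CARD('n) \<ge> 2" and h: "h \<in> L2M"
    and orth: "ip h one = 0" "\<And>i. ip h (\<lambda>v. v $ i) = 0" "ip h (\<lambda>v. (norm v)\<^sup>2) = 0"
  shows "landau_dissipation (\<lambda>_. 1) h \<ge> ennreal (lam1 TYPE('n) * ip h h)"
proof (cases "\<exists>g. weak_gradient h g")
  case False
  then show ?thesis by (simp add: landau_dissipation_def)
next
  case True
  define g where "g = (SOME g. weak_gradient h g)"
  have g: "weak_gradient h g" unfolding g_def using True by (rule someI_ex)
  then have [measurable]: "g \<in> borel_measurable borel" by (auto simp: weak_gradient_def intro: locally_integrable_borel)
  define K where "K = (\<lambda>(v, w). perp_form (v - w) (g v - g w) * (maxw v * maxw w))"
  have K0: "K x \<ge> 0" for x by (cases x) (simp add: K_def)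
  have Km[measurable]: "K \<in> borel_measurable (lborel \<Otimes>\<^sub>M lborel)" unfolding K_def split_beta by measurable
  let ?D = "\<integral>\<^sup>+v. \<integral>\<^sup>+w. ennreal (perp_form (v - w) (g v - g w) * (maxw v * maxw w)) \<partial>lborel \<partial>lborel"
  have D: "landau_dissipation (\<lambda>_. 1) h = ennreal (1/2) * ?D" unfolding g_def by (rule dissipation_one_eq[OF True])
  show ?thesis
  proof (cases "?D < \<infinity>")
    case False
    then have "?D = \<infinity>" by (simp only: infinity_ennreal_def not_less top_unique)
    then show ?thesis unfolding D by (simp add: ennreal_mult_top)
  next
    case fin: True
    have DK: "?D = (\<integral>\<^sup>+x. ennreal (K x) \<partial>(lborel \<Otimes>\<^sub>M lborel))"
      by (subst lborel.nn_integral_fst[symmetric]) (simp_all add: K_def)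
    have K: "integrable (lborel \<Otimes>\<^sub>M lborel) K"
      using fin K0 unfolding DK by (intro integrableI_nonneg Km) auto
    define \<kappa> where "\<kappa> = integral\<^sup>L (lborel \<Otimes>\<^sub>M lborel) K"
    have D\<kappa>: "?D = ennreal \<kappa>" unfolding DK \<kappa>_def by (rule nn_integral_eq_integral[OF K]) (simp add: K0)
    have gL: "(\<lambda>v. g v $ i) \<in> L2M" for i by (rule finite_dissipation_gradient_L2M[OF N _ fin]) measurable
    let ?h = "herm_proj h"
    have hP: "?h k \<in> Pol" for k by (rule Herm_Pol[OF herm_proj_Herm])
    have C: "collision (?h k) \<in> Herm k" "ip h (collision (?h k)) \<ge> lam1 TYPE('n) * ip (?h k) (?h k)" for k
      using ip_Herm_collision[OF N h orth] by auto
    have lam: "lam1 TYPE('n) \<ge> 0" using N mass_pos[where 'n = 'n] by (simp add: lam1_def)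
    have main: "lam1 TYPE('n) * (\<Sum>k\<le>n. ip (?h k) (?h k)) \<le> \<kappa> / 2" for n
    proof -
      define p where "p = (\<lambda>v. \<Sum>k\<le>n. ?h k v)"
      have p: "p \<in> Pol" unfolding p_def by (intro Pol_sum hP)
      have cp: "collision p = (\<lambda>v. \<Sum>k\<le>n. collision (?h k) v)" unfolding p_def by (rule collision_sum_atMost[OF hP])
      have hcp: "ip h (collision p) = (\<Sum>k\<le>n. ip h (collision (?h k)))"
        unfolding cp by (intro ip_sum_right Pol_L2M Pol_collision hP h)
      \<comment> \<open>\<open>collision\<close> preserves the degree of each projection, so p and
        \<open>h\<close> pair equally with it. Hence B and Q have the same integral, and 2 B - Q
        integrates to that value.\<close>
      have "ip p (collision (?h k)) = ip h (collision (?h k))" if "k \<le> n" for k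
      proof -
        have "ip p (collision (?h k)) = (\<Sum>l\<le>n. ip (?h l) (collision (?h k)))"
          unfolding p_def by (intro ip_sum_left Pol_L2M Pol_collision hP)
        also have "\<dots> = (\<Sum>l\<le>n. if l = k then ip (?h k) (collision (?h k)) else 0)"
          by (intro sum.cong refl) (auto intro: Herm_orthogonal[OF herm_proj_Herm C(1)])
        also have "\<dots> = ip (?h k) (collision (?h k))" using that by simp
        also have "\<dots> = ip h (collision (?h k))" by (rule herm_proj_ip[OF h C(1), symmetric])
        finally show ?thesis .
      qed
      moreover have "ip p (collision p) = (\<Sum>k\<le>n. ip p (collision (?h k)))"
        unfolding cp by (intro ip_sum_right Pol_L2M Pol_collision hP p)
      ultimately have pcp: "ip p (collision p) = ip h (collision p)" by (simp add: hcp)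
      let ?gp = "\<lambda>v. \<chi> j. partial_deriv j p v"
      have gp: "weak_gradient p ?gp" by (intro smooth_weak_gradient Pol_smooth p)
      have gpL: "(\<lambda>v. ?gp v $ i) \<in> L2M" for i by (simp add: Pol_L2M Pol_partial_deriv p)
      define B where "B = (\<lambda>(v, w). perp_bil (v - w) (g v - g w) (?gp v - ?gp w) * (maxw v * maxw w))"
      define Q where "Q = (\<lambda>(v, w). perp_bil (v - w) (?gp v - ?gp w) (?gp v - ?gp w) * (maxw v * maxw w))"
      have B: "integrable (lborel \<Otimes>\<^sub>M lborel) B" "integral\<^sup>L (lborel \<Otimes>\<^sub>M lborel) B = 2 * ip h (collision p)"
        unfolding B_def using dissipation_bilinear[OF g h gL p] by auto
      have Q: "integrable (lborel \<Otimes>\<^sub>M lborel) Q" "integral\<^sup>L (lborel \<Otimes>\<^sub>M lborel) Q = 2 * ip p (collision p)"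
        unfolding Q_def using dissipation_bilinear[OF gp Pol_L2M[OF p] gpL p] by auto
      \<comment> \<open>Nonnegativity of the form at the difference of the two gradient
        increments.\<close>
      have "2 * B x - Q x \<le> K x" for x
      proof (cases x)
        case (Pair v w)
        let ?u = "v - w" and ?X = "g v - g w" and ?Y = "?gp v - ?gp w"
        have "perp_form ?u (?X - ?Y) = perp_form ?u ?X - 2 * perp_bil ?u ?X ?Y + perp_bil ?u ?Y ?Y"
          by (simp add: perp_form_def perp_bil_def inner_diff_right inner_diff_left inner_commute[of ?Y ?X] power2_eq_square del: vector_minus_component)
             (simp add: algebra_simps inner_commute)
        then have "2 * perp_bil ?u ?X ?Y - perp_bil ?u ?Y ?Y \<le> perp_form ?u ?X"
          using perp_form_nonneg[of ?u "?X - ?Y"] by linarith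
        from mult_right_mono[OF this, of "maxw v * maxw w"]
        show ?thesis unfolding Pair B_def Q_def K_def by (simp only: prod.case left_diff_distrib mult.assoc mult_nonneg_nonneg maxw_nonneg simp_thms)
      qed
      then have "integral\<^sup>L (lborel \<Otimes>\<^sub>M lborel) (\<lambda>x. 2 * B x - Q x) \<le> \<kappa>"
        unfolding \<kappa>_def by (intro integral_mono Bochner_Integration.integrable_diff integrable_mult_right B Q K)
      then have "2 * ip h (collision p) \<le> \<kappa>"
        using B Q pcp by (simp add: Bochner_Integration.integral_diff)
      moreover have "lam1 TYPE('n) * (\<Sum>k\<le>n. ip (?h k) (?h k)) \<le> ip h (collision p)"
        unfolding hcp sum_distrib_left by (intro sum_mono C(2))
      ultimately show ?thesis by linarith
    qed
    have "lam1 TYPE('n) * ip h h \<le> \<kappa> / 2"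
    proof (rule field_le_epsilon)
      fix e :: real assume "e > 0"
      define \<epsilon> where "\<epsilon> = e / (lam1 TYPE('n) + 1)"
      have \<epsilon>: "\<epsilon> > 0" "lam1 TYPE('n) * \<epsilon> \<le> e" using lam \<open>e > 0\<close> by (auto simp: \<epsilon>_def field_simps)
      obtain n where "ip h h - \<epsilon> \<le> (\<Sum>k\<le>n. ip (?h k) (?h k))" using herm_proj_complete[OF h \<epsilon>(1)] by blast
      from mult_left_mono[OF this lam] main[of n] \<epsilon>(2) show "lam1 TYPE('n) * ip h h \<le> \<kappa> / 2 + e"
        by (simp add: right_diff_distrib)
    qed
    then have "ennreal (lam1 TYPE('n) * ip h h) \<le> ennreal (1/2 * \<kappa>)" by (intro ennreal_leI) simp
    also have "\<dots> = ennreal (1/2) * ?D" unfolding D\<kappa> by (subst ennreal_mult') auto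
    finally show ?thesis unfolding D .
  qed
qed

section \<open>The first nonzero eigenvalue\<close>

lemma landau_integrand_one:
  "landau_integrand (\<lambda>_. 1) g v w $ i = maxw v * (\<Sum>j\<in>UNIV. amat (v - w) i j * (g v - g w) $ j * maxw w)"
proof -
  have "landau_matrix (\<lambda>_. 1) z $ i $ j = amat z i j" for z :: "real^'a" and j
    by (cases "z = 0") (auto simp: landau_matrix_def perp_proj_def amat_def right_diff_distrib)
  then show ?thesis
    by (simp add: landau_integrand_def matrix_vector_mult_def sum_distrib_left mult_ac)
qed

lemma amat_add:
  "amat (z + x) i j = amat z i j + amat x i j + (if i = j then 2 * (z \<bullet> x) else 0) - z $ i * x $ j - x $ i * z $ j"
  using amat_expand[of z "- x" i j]
  by (auto simp: amat_def inner_vec_def sum_negf algebra_simps)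

text \<open>An exact Taylor expansion whose linear coefficients are written as differences: for a
  quadratic a, the polar part in direction e is a(z + e) - a(z) - a(e). Only values at z and its
  axis shifts occur, and there integrability against the gradient is known.\<close>

lemma amat_taylor:
  fixes z x :: "real^'n::finite"
  shows "amat (z + x) i j = amat z i j + (\<Sum>k\<in>UNIV. x $ k * (amat (z + axis k 1) i j - amat z i j - amat (axis k 1) i j)) + amat x i j"
proof -
  have ax: "z \<bullet> axis k 1 = z $ k" "axis k 1 $ l = (if k = l then 1 else 0 :: real)" for k l :: 'n
    by (simp add: inner_axis) (simp add: axis_def)
  have "(\<Sum>k\<in>UNIV. x $ k * (amat (z + axis k 1) i j - amat z i j - amat (axis k 1) i j))
    = (\<Sum>k\<in>UNIV. (if i = j then 2 * (z $ k * x $ k) else 0) - (if k = j then z $ i * x $ k else 0) - (if k = i then z $ j * x $ k else 0))"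
    unfolding amat_add by (intro sum.cong refl) (auto simp: ax algebra_simps)
  also have "\<dots> = (if i = j then 2 * (z \<bullet> x) else 0) - z $ i * x $ j - x $ i * z $ j"
    by (simp add: sum_subtractf inner_vec_def sum_distrib_left mult.commute)
  finally show ?thesis by (simp add: amat_add)
qed

text \<open>The integrals \<open>T\<close> of \<open>a(v - w) g(w) M(w)\<close> exist a priori only for almost all \<open>v\<close>. As \<open>a\<close> is quadratic,
  second differences in \<open>v\<close> show that \<open>g M\<close> is integrable, after which \<open>T\<close> exists for all \<open>v\<close> and is
  quadratic in \<open>v\<close>. The gradient itself need not be in the weighted space.\<close>

lemma landau_op_ip_collision:
  fixes h :: "real^'n::finite \<Rightarrow> real"
  assumes N: "CARD('n) \<ge> 2" and op: "landau_op (\<lambda>_. 1) h f" and p: "p \<in> Pol"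
  shows "ip f p = - ip h (collision p)"
proof -
  have h: "h \<in> L2M" and f: "f \<in> L2M" using op by (auto simp: landau_op_def)
  obtain g where g: "weak_gradient h g" and AEg: "AE v in lborel. integrable lborel (landau_integrand (\<lambda>_. 1) g v)"
    and div: "weak_divergence (\<lambda>v. LINT w|lborel. landau_integrand (\<lambda>_. 1) g v w) (\<lambda>v. maxw v * f v)"
    using op by (auto simp: landau_op_def)
  have gb[measurable]: "g \<in> borel_measurable borel" using g by (auto simp: weak_gradient_def intro: locally_integrable_borel)
  define G where "G j w = g w $ j * maxw w" for j w
  define T where "T i v w = (\<Sum>j\<in>UNIV. amat (v - w) i j * G j w)" for i v w
  have PI: "integrable lborel (\<lambda>w. amat (v - w) i j * x * maxw w)" for v i j x
    by (intro Pol_integrable Pol_mult Pol_amat_shift Pol_const)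
  have PI': "integrable lborel (\<lambda>w. \<Sum>j\<in>UNIV. amat (v - w) i j * g v $ j * maxw w)" for v i
    by (intro Bochner_Integration.integrable_sum PI)
  have split: "(\<Sum>j\<in>UNIV. amat (v - w) i j * (g v - g w) $ j * maxw w)
      = (\<Sum>j\<in>UNIV. amat (v - w) i j * g v $ j * maxw w) - T i v w" for v w i
    by (simp add: T_def G_def sum_subtractf[symmetric] algebra_simps)
  have good: "integrable lborel (T i v)" if "integrable lborel (landau_integrand (\<lambda>_. 1) g v)" for i v
  proof -
    have "integrable lborel (\<lambda>w. landau_integrand (\<lambda>_. 1) g v w $ i)"
      by (rule integrable_bounded_linear[OF bounded_linear_vec_nth that])
    then have "integrable lborel (\<lambda>w. \<Sum>j\<in>UNIV. amat (v - w) i j * (g v - g w) $ j * maxw w)"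
      unfolding landau_integrand_one by (subst (asm) integrable_mult_left_iff) auto
    from Bochner_Integration.integrable_diff[OF PI'[of v i] this] show ?thesis unfolding split by simp
  qed
  have AE0: "AE v in lborel. \<forall>i. integrable lborel (T i v)" using AEg by eventually_elim (auto intro: good)
  have "AE v in lborel. \<forall>k\<in>UNIV. \<forall>i. integrable lborel (T i (axis k 1 + v))"
    by (rule AE_finite_allI) (simp, rule AE_lborel_translate[OF AE0])
  moreover have "AE v in lborel. \<forall>k\<in>UNIV. \<forall>i. integrable lborel (T i (- axis k 1 + v))"
    by (rule AE_finite_allI) (simp, rule AE_lborel_translate[OF AE0])
  ultimately have "AE v in lborel. (\<forall>i. integrable lborel (T i v)) \<and> (\<forall>k i. integrable lborel (T i (axis k 1 + v)))
      \<and> (\<forall>k i. integrable lborel (T i (- axis k 1 + v)))"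
    using AE0 by eventually_elim auto
  \<comment> \<open>A single base point at which, together with its shifts by plus and minus every
    axis vector, the integrals exist; all differences below are taken there.\<close>
  from AE_lborel_ball[OF this zero_less_one, of 0] obtain z where z: "\<And>i. integrable lborel (T i z)"
    "\<And>i k. integrable lborel (T i (axis k 1 + z))" "\<And>i k. integrable lborel (T i (- axis k 1 + z))" by blast
  have G: "integrable lborel (G i)" for i
  proof -
    \<comment> \<open>In a direction k other than i, the second difference of row i of the matrix is
      twice row i of the identity, so it isolates \<open>G i\<close>.\<close>
    obtain k where k: "k \<noteq> i"
      using N by (metis One_nat_def UNIV_eq_I card_2_iff' card_1_singleton_iff ex_card subset_UNIV singletonI insert_iff)
    have ax: "axis k (1::real) $ i = 0" using k by (simp add: axis_def)
    have "integrable lborel (\<lambda>w. T i (axis k 1 + z) w + T i (- axis k 1 + z) w - 2 * T i z w)"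
      by (intro Bochner_Integration.integrable_diff Bochner_Integration.integrable_add integrable_mult_right z)
    also have "(\<lambda>w. T i (axis k 1 + z) w + T i (- axis k 1 + z) w - 2 * T i z w) = (\<lambda>w. 2 * G i w)"
    proof
      fix w
      have e2: "amat (axis k 1 + z - w) i j + amat (- axis k 1 + z - w) i j - 2 * amat (z - w) i j = (if i = j then 2 else 0)" for j
      proof -
        have e: "axis k 1 + z - w = (z - w) + axis k 1" "- axis k 1 + z - w = (z - w) + - axis k 1" by simp_all
        have "amat (axis k 1) i j = (if i = j then 1 else 0)" "amat (- axis k 1) i j = (if i = j then 1 else 0)"
          by (simp_all add: amat_def ax norm_axis_1)
        then show ?thesis unfolding e amat_add[of "z - w"]
          by (cases "i = j") (simp_all add: ax inner_minus_right del: vector_minus_component)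
      qed
      have "a * x + b * x - 2 * (c * x) = (a + b - 2 * c) * x" for a b c x :: real by (simp add: algebra_simps)
      then have "T i (axis k 1 + z) w + T i (- axis k 1 + z) w - 2 * T i z w = (\<Sum>j\<in>UNIV. (if i = j then 2 else 0) * G j w)"
        unfolding T_def sum_distrib_left sum.distrib[symmetric] sum_subtractf[symmetric]
        by (simp only: e2)
      also have "\<dots> = (\<Sum>j\<in>UNIV. if i = j then 2 * G j w else 0)" by (intro sum.cong) auto
      finally show "T i (axis k 1 + z) w + T i (- axis k 1 + z) w - 2 * T i z w = 2 * G i w" by simp
    qed
    finally show ?thesis by simp
  qed
  \<comment> \<open>The coefficient of (v - z) $ k in the expansion of \<open>T\<close> at
    z.\<close>
  define L where "L i k w = T i (axis k 1 + z) w - T i z w - (\<Sum>j\<in>UNIV. amat (axis k 1) i j * G j w)" for i k w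
  have L: "integrable lborel (L i k)" for i k
    unfolding L_def by (intro Bochner_Integration.integrable_diff Bochner_Integration.integrable_sum integrable_mult_right z G)
  have T_eq: "T i v w = T i z w + (\<Sum>k\<in>UNIV. (v - z) $ k * L i k w) + (\<Sum>j\<in>UNIV. amat (v - z) i j * G j w)" for i v w
  proof -
    have "T i v w = (\<Sum>j\<in>UNIV. amat ((z - w) + (v - z)) i j * G j w)" by (simp add: T_def)
    also have "\<dots> = T i z w + (\<Sum>j\<in>UNIV. \<Sum>k\<in>UNIV. (v - z) $ k * ((amat (z - w + axis k 1) i j - amat (z - w) i j - amat (axis k 1) i j) * G j w))
        + (\<Sum>j\<in>UNIV. amat (v - z) i j * G j w)"
      unfolding amat_taylor[of "z - w" "v - z"] T_def
      by (simp only: distrib_right sum.distrib sum_distrib_right mult.assoc)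
    also have "(\<Sum>j\<in>UNIV. \<Sum>k\<in>UNIV. (v - z) $ k * ((amat (z - w + axis k 1) i j - amat (z - w) i j - amat (axis k 1) i j) * G j w))
       = (\<Sum>k\<in>UNIV. (v - z) $ k * (\<Sum>j\<in>UNIV. (amat (z - w + axis k 1) i j - amat (z - w) i j - amat (axis k 1) i j) * G j w))"
      unfolding sum_distrib_left by (rule sum.swap)
    also have "\<dots> = (\<Sum>k\<in>UNIV. (v - z) $ k * L i k w)"
    proof (intro sum.cong refl arg_cong[where f = "\<lambda>x. _ * x"])
      fix k
      have "z - w + axis k 1 = axis k 1 + z - w" by simp
      then show "(\<Sum>j\<in>UNIV. (amat (z - w + axis k 1) i j - amat (z - w) i j - amat (axis k 1) i j) * G j w) = L i k w"
        unfolding L_def T_def by (simp only: left_diff_distrib sum_subtractf)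
    qed
    finally show ?thesis .
  qed
  have T: "integrable lborel (T i v)" for i v
    unfolding T_eq[of i v] by (intro Bochner_Integration.integrable_add Bochner_Integration.integrable_sum integrable_mult_right z G L)
  define P where "P i v = integral\<^sup>L lborel (T i v)" for i v
  have P_eq: "P i v = P i z + (\<Sum>k\<in>UNIV. (v - z) $ k * integral\<^sup>L lborel (L i k)) + (\<Sum>j\<in>UNIV. amat (v - z) i j * integral\<^sup>L lborel (G j))" for i v
    unfolding P_def T_eq[of i v]
    by (simp add: Bochner_Integration.integral_add Bochner_Integration.integral_sum Bochner_Integration.integrable_sum z G L del: vector_minus_component)
  have amz: "(\<lambda>v. amat (v - z) i j) \<in> Pol" for i j using Pol_amat_shift[of z i j] by (simp add: amat_minus[of z])
  have cz: "(\<lambda>v. (v - z) $ k) \<in> Pol" for k unfolding vector_minus_component by (intro Pol_diff Pol_coord Pol_const)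
  have P: "P i \<in> Pol" for i
  proof -
    have "P i = (\<lambda>v. P i z + (\<Sum>k\<in>UNIV. (v - z) $ k * integral\<^sup>L lborel (L i k)) + (\<Sum>j\<in>UNIV. amat (v - z) i j * integral\<^sup>L lborel (G j)))"
      by (rule ext) (rule P_eq)
    then show ?thesis by (rule ssubst) (intro Pol_add Pol_sum Pol_mult Pol_const cz amz)
  qed
  note PL = Pol_L2M Pol_add Pol_cmult Pol_sum Pol_const cz amz
  have ip_comb: "ip q (\<lambda>v. a * one v + (\<Sum>k\<in>UNIV. b k * (v - z) $ k) + (\<Sum>j\<in>UNIV. c j * amat (v - z) i j))
     = a * ip q one + (\<Sum>k\<in>UNIV. b k * ip q (\<lambda>v. (v - z) $ k)) + (\<Sum>j\<in>UNIV. c j * ip q (\<lambda>v. amat (v - z) i j))"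
    if "q \<in> Pol" for q a b i and c :: "'n \<Rightarrow> real"
    by (simp only: ip_add_right ip_cmult_right ip_sum_right PL that)
  \<comment> \<open>For fixed w, \<open>T\<close> is a polynomial in v whose coefficients are
    integrable in w; exchanging the pairing in v with the integral over w thus reduces to finite
    sums.\<close>
  have ipP: "(\<lambda>w. \<Sum>j\<in>UNIV. ip q (\<lambda>v. amat (v - w) i j) * G j w) = (\<lambda>w. ip q (\<lambda>v. T i v w))"
    "integrable lborel (\<lambda>w. ip q (\<lambda>v. T i v w))"
    "integral\<^sup>L lborel (\<lambda>w. ip q (\<lambda>v. T i v w)) = ip q (P i)" if q: "q \<in> Pol" for q i
  proof -
    show "(\<lambda>w. \<Sum>j\<in>UNIV. ip q (\<lambda>v. amat (v - w) i j) * G j w) = (\<lambda>w. ip q (\<lambda>v. T i v w))"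
    proof
      fix w
      have "(\<lambda>v. amat (v - w) i j) \<in> Pol" for j using Pol_amat_shift[of w i j] by (simp add: amat_minus[of w])
      then have "ip q (\<lambda>v. \<Sum>j\<in>UNIV. G j w * amat (v - w) i j) = (\<Sum>j\<in>UNIV. G j w * ip q (\<lambda>v. amat (v - w) i j))"
        by (simp only: ip_cmult_right ip_sum_right Pol_L2M Pol_cmult q)
      then show "(\<Sum>j\<in>UNIV. ip q (\<lambda>v. amat (v - w) i j) * G j w) = ip q (\<lambda>v. T i v w)"
        unfolding T_def by (simp add: mult.commute)
    qed
    have e: "ip q (\<lambda>v. T i v w) = T i z w * ip q one + (\<Sum>k\<in>UNIV. L i k w * ip q (\<lambda>v. (v - z) $ k)) + (\<Sum>j\<in>UNIV. G j w * ip q (\<lambda>v. amat (v - z) i j))" for w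
    proof -
      have "(\<lambda>v. T i v w) = (\<lambda>v. T i z w * one v + (\<Sum>k\<in>UNIV. L i k w * (v - z) $ k) + (\<Sum>j\<in>UNIV. G j w * amat (v - z) i j))"
        by (rule ext, subst T_eq) (simp only: mult.commute[of "G _ _"] mult.commute[of "L _ _ _"] mult_1_right)
      then show ?thesis by (rule ssubst) (rule ip_comb[OF q])
    qed
    show "integrable lborel (\<lambda>w. ip q (\<lambda>v. T i v w))"
      unfolding e by (intro Bochner_Integration.integrable_add Bochner_Integration.integrable_sum integrable_mult_left z G L)
    have "integral\<^sup>L lborel (\<lambda>w. ip q (\<lambda>v. T i v w)) = P i z * ip q one + (\<Sum>k\<in>UNIV. integral\<^sup>L lborel (L i k) * ip q (\<lambda>v. (v - z) $ k))
        + (\<Sum>j\<in>UNIV. integral\<^sup>L lborel (G j) * ip q (\<lambda>v. amat (v - z) i j))"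
      unfolding e P_def
      by (simp add: Bochner_Integration.integral_add Bochner_Integration.integral_sum Bochner_Integration.integrable_sum z G L del: vector_minus_component)
    also have "\<dots> = ip q (P i)"
    proof -
      have "P i = (\<lambda>v. P i z * one v + (\<Sum>k\<in>UNIV. integral\<^sup>L lborel (L i k) * (v - z) $ k) + (\<Sum>j\<in>UNIV. integral\<^sup>L lborel (G j) * amat (v - z) i j))"
        by (rule ext, subst P_eq) (simp only: mult.commute[of "integral\<^sup>L _ _"] mult_1_right)
      then have "ip q (P i) = ip q (\<lambda>v. P i z * one v + (\<Sum>k\<in>UNIV. integral\<^sup>L lborel (L i k) * (v - z) $ k) + (\<Sum>j\<in>UNIV. integral\<^sup>L lborel (G j) * amat (v - z) i j))"
        by (rule arg_cong)
      then show ?thesis using ip_comb[OF q, of "P i z" "\<lambda>k. integral\<^sup>L lborel (L i k)" "\<lambda>j. integral\<^sup>L lborel (G j)" i]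
        by (simp only:)
    qed
    finally show "integral\<^sup>L lborel (\<lambda>w. ip q (\<lambda>v. T i v w)) = ip q (P i)" .
  qed
  \<comment> \<open>Symmetry and evenness of the matrix transfer the nonlocal operator from
    \<open>h\<close> to p: what meets the gradient of \<open>h\<close> is the nonlocal field of
    p.\<close>
  have nl: "(\<Sum>i\<in>UNIV. ip (partial_deriv i p) (\<lambda>v. T i v w)) = (\<Sum>j\<in>UNIV. g w $ j * nonlocal p j w) * maxw w" for w
  proof -
    have "(\<Sum>i\<in>UNIV. ip (partial_deriv i p) (\<lambda>v. T i v w)) = (\<Sum>i\<in>UNIV. \<Sum>j\<in>UNIV. ip (partial_deriv i p) (\<lambda>v. amat (v - w) i j) * G j w)"
      by (intro sum.cong refl fun_cong[OF ipP(1), symmetric] Pol_partial_deriv p)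
    also have "\<dots> = (\<Sum>j\<in>UNIV. (\<Sum>i\<in>UNIV. ip (partial_deriv i p) (\<lambda>v. amat (v - w) i j)) * G j w)"
      unfolding sum_distrib_right by (rule sum.swap)
    also have "\<dots> = (\<Sum>j\<in>UNIV. nonlocal p j w * G j w)"
    proof (intro sum.cong refl arg_cong[where f = "\<lambda>x. x * _"])
      fix j show "(\<Sum>i\<in>UNIV. ip (partial_deriv i p) (\<lambda>v. amat (v - w) i j)) = nonlocal p j w"
        unfolding nonlocal_def by (intro sum.cong refl) (simp only: amat_minus[of w] amat_sym[of _ j])
    qed
    finally show ?thesis unfolding G_def sum_distrib_right by (simp only: mult_ac)
  qed
  have "(\<Sum>i\<in>UNIV. ip (partial_deriv i p) (P i)) = integral\<^sup>L lborel (\<lambda>w. \<Sum>i\<in>UNIV. ip (partial_deriv i p) (\<lambda>v. T i v w))"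
    by (subst Bochner_Integration.integral_sum) (simp_all add: ipP(2,3) Pol_partial_deriv p)
  also have "\<dots> = ip h (\<lambda>v. \<Sum>j\<in>UNIV. raise j (nonlocal p j) v)"
    unfolding nl
  proof (rule weak_ibp[OF g h Pol_nonlocal[OF p]])
    show "integrable lborel (\<lambda>w. (\<Sum>j\<in>UNIV. g w $ j * nonlocal p j w) * maxw w)"
      unfolding nl[symmetric] by (intro Bochner_Integration.integrable_sum ipP(2) Pol_partial_deriv p)
  qed
  finally have SP: "(\<Sum>i\<in>UNIV. ip (partial_deriv i p) (P i)) = (\<Sum>j\<in>UNIV. ip h (raise j (nonlocal p j)))"
    by (simp add: ip_sum_right Pol_L2M Pol_raise Pol_nonlocal p h)
  \<comment> \<open>The matrix a(v - w) integrated over w against the Gaussian.\<close>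
  define A where "A i j v = mass TYPE('n) * (amat v i j + (if i = j then (real CARD('n) - 1) / 2 else 0))" for i j and v :: "real^'n"
  have A: "A i j \<in> Pol" for i j unfolding A_def[abs_def] by (intro Pol_cmult Pol_add Pol_amat Pol_if Pol_const)
  define F where "F v = (LINT w|lborel. landau_integrand (\<lambda>_. 1) g v w)" for v
  have F_eq: "F v $ i = maxw v * ((\<Sum>j\<in>UNIV. A i j v * g v $ j) - P i v)"
    if v: "integrable lborel (landau_integrand (\<lambda>_. 1) g v)" for v i
  proof -
    have "F v $ i = (LINT w|lborel. landau_integrand (\<lambda>_. 1) g v w $ i)"
      unfolding F_def by (rule integral_bounded_linear[OF bounded_linear_vec_nth v, symmetric])
    also have "\<dots> = maxw v * (LINT w|lborel. (\<Sum>j\<in>UNIV. amat (v - w) i j * g v $ j * maxw w) - T i v w)"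
      unfolding landau_integrand_one split by simp
    also have "(LINT w|lborel. (\<Sum>j\<in>UNIV. amat (v - w) i j * g v $ j * maxw w) - T i v w)
        = (LINT w|lborel. (\<Sum>j\<in>UNIV. amat (v - w) i j * g v $ j * maxw w)) - P i v"
      unfolding P_def by (intro Bochner_Integration.integral_diff PI' T)
    also have "(LINT w|lborel. (\<Sum>j\<in>UNIV. amat (v - w) i j * g v $ j * maxw w)) = (\<Sum>j\<in>UNIV. LINT w|lborel. amat (v - w) i j * g v $ j * maxw w)"
      by (intro Bochner_Integration.integral_sum PI)
    also have "\<dots> = (\<Sum>j\<in>UNIV. A i j v * g v $ j)"
    proof (intro sum.cong refl)
      fix j
      have "(LINT w|lborel. amat (v - w) i j * g v $ j * maxw w) = g v $ j * ip one (\<lambda>w. amat (v - w) i j)"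
        unfolding L2M_inner_def by (subst integral_mult_right_zero[symmetric]) (simp add: mult_ac)
      then show "(LINT w|lborel. amat (v - w) i j * g v $ j * maxw w) = A i j v * g v $ j"
        unfolding ip_one_amat_shift A_def by simp
    qed
    finally show ?thesis .
  qed
  let ?d = "\<lambda>i. partial_deriv i p"
  define a where "a i j n = (LINT v|lborel. g v $ j * (cut n v * (A i j v * ?d i v) * maxw v))" for i j n
  define b where "b i j n = (LINT v|lborel. g v $ j * (partial_deriv i (cut n) v * (A i j v * p v) * maxw v))" for i j n
  define c where "c i n = (LINT v|lborel. cut n v * (?d i v * P i v * maxw v))" for i n
  define e where "e i n = (LINT v|lborel. partial_deriv i (cut n) v * (p v * P i v * maxw v))" for i n
  define r where "r n = (LINT v|lborel. cut n v * (f v * p v * maxw v))" for n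
  have AP: "(\<lambda>v. A i j v * ?d i v) \<in> Pol" "(\<lambda>v. A i j v * p v) \<in> Pol" for i j by (intro Pol_mult A Pol_partial_deriv p)+
  \<comment> \<open>The weak divergence equation tested with the cutoff times p and split by the
    product rule. The terms \<open>b\<close> and \<open>e\<close> carry the derivative of the cutoff
    and disappear in the limit.\<close>
  have id: "(\<Sum>i\<in>UNIV. (\<Sum>j\<in>UNIV. a i j n + b i j n) - (c i n + e i n)) = - r n" for n
  proof -
    define \<phi> where "\<phi> = (\<lambda>v. cut n v * p v)"
    have t: "test_function \<phi>" unfolding \<phi>_def by (intro cut_mult_test_function Pol_smooth p)
    have d\<phi>: "partial_deriv i \<phi> v = partial_deriv i (cut n) v * p v + cut n v * ?d i v" for i v
      unfolding \<phi>_def by (intro smooth_cut_mult_deriv Pol_smooth p)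
    define H where "H i v = (\<Sum>j\<in>UNIV. g v $ j * (cut n v * (A i j v * ?d i v) * maxw v) + g v $ j * (partial_deriv i (cut n) v * (A i j v * p v) * maxw v))
        - (cut n v * (?d i v * P i v * maxw v) + partial_deriv i (cut n) v * (p v * P i v * maxw v))" for i v
    obtain B where B: "\<And>v::real^'n. \<bar>cut n v\<bar> \<le> B"
      using compact_support_bounded[OF smooth_continuous[OF cut_smooth[of n]] cut_support[of n]] by blast
    have pc: "partial_deriv i (cut n) v = 0" if "norm v > real (Suc n)" for i and v :: "real^'n"
      by (rule test_function_partial_support[OF cut_support that])
    have i1: "integrable lborel (\<lambda>v. cut n v * (?d i v * P i v * maxw v))" for i
      by (rule integrable_mult_bounded[OF Pol_integrable[OF Pol_mult[OF Pol_partial_deriv[OF p] P]] smooth_borel[OF cut_smooth] B])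
    have i2: "integrable lborel (\<lambda>v. partial_deriv i (cut n) v * (p v * P i v * maxw v))" for i
    proof -
      obtain B where B: "\<And>v::real^'n. \<bar>partial_deriv i (cut n) v\<bar> \<le> B"
        using compact_support_bounded[OF smooth_continuous[OF smooth_partial_deriv[OF cut_smooth[of n]]] pc] by blast
      show ?thesis
        by (rule integrable_mult_bounded[OF Pol_integrable[OF Pol_mult[OF p P]] smooth_borel[OF smooth_partial_deriv[OF cut_smooth]] B])
    qed
    note wi = weak_cut_tendsto(3)[OF g h AP(1)] weak_cut_tendsto(4)[OF g h AP(2)]
    have Hi: "integrable lborel (H i)" for i
      unfolding H_def by (intro Bochner_Integration.integrable_diff Bochner_Integration.integrable_add Bochner_Integration.integrable_sum wi i1 i2)
    have HI: "integral\<^sup>L lborel (H i) = (\<Sum>j\<in>UNIV. a i j n + b i j n) - (c i n + e i n)" for i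
      unfolding H_def a_def b_def c_def e_def
      by (simp add: Bochner_Integration.integral_diff Bochner_Integration.integral_add Bochner_Integration.integral_sum
        Bochner_Integration.integrable_sum Bochner_Integration.integrable_add wi i1 i2)
    have Fm[measurable]: "F \<in> borel_measurable borel"
      using div unfolding F_def[abs_def] weak_divergence_def by (auto intro: locally_integrable_borel)
    have "(LINT v|lborel. (\<Sum>i\<in>UNIV. F v $ i * partial_deriv i \<phi> v)) = (LINT v|lborel. (\<Sum>i\<in>UNIV. H i v))"
    proof (rule integral_cong_AE)
      have [measurable]: "partial_deriv i \<phi> \<in> borel_measurable borel" for i
        by (rule borel_measurable_continuous_onI[OF test_functionD(3)[OF t]])
      show "(\<lambda>v. \<Sum>i\<in>UNIV. F v $ i * partial_deriv i \<phi> v) \<in> borel_measurable lborel" by measurable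
      show "(\<lambda>v. \<Sum>i\<in>UNIV. H i v) \<in> borel_measurable lborel"
        by (intro borel_measurable_sum borel_measurable_integrable Hi)
      show "AE v in lborel. (\<Sum>i\<in>UNIV. F v $ i * partial_deriv i \<phi> v) = (\<Sum>i\<in>UNIV. H i v)"
        using AEg
      proof eventually_elim
        case (elim v)
        show ?case
        proof (intro sum.cong refl)
          fix i
          have "(\<Sum>j\<in>UNIV. g v $ j * (cut n v * (A i j v * ?d i v) * maxw v) + g v $ j * (partial_deriv i (cut n) v * (A i j v * p v) * maxw v))
            = (\<Sum>j\<in>UNIV. A i j v * g v $ j) * (maxw v * partial_deriv i \<phi> v)"
            unfolding d\<phi> sum_distrib_right by (intro sum.cong refl) (simp add: algebra_simps)
          then show "F v $ i * partial_deriv i \<phi> v = H i v"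
            unfolding F_eq[OF elim] H_def by (simp add: d\<phi> algebra_simps)
        qed
      qed
    qed
    also have "\<dots> = (\<Sum>i\<in>UNIV. (\<Sum>j\<in>UNIV. a i j n + b i j n) - (c i n + e i n))"
      by (subst Bochner_Integration.integral_sum) (simp_all add: Hi HI)
    finally have "(\<Sum>i\<in>UNIV. (\<Sum>j\<in>UNIV. a i j n + b i j n) - (c i n + e i n)) = - (LINT v|lborel. maxw v * f v * \<phi> v)"
      using div t by (simp add: weak_divergence_def F_def)
    also have "(LINT v|lborel. maxw v * f v * \<phi> v) = r n" by (simp add: r_def \<phi>_def mult_ac)
    finally show ?thesis .
  qed
  have "(\<lambda>n. \<Sum>i\<in>UNIV. (\<Sum>j\<in>UNIV. a i j n + b i j n) - (c i n + e i n))
     \<longlonglongrightarrow> (\<Sum>i\<in>UNIV. (\<Sum>j\<in>UNIV. ip h (raise j (\<lambda>v. A i j v * ?d i v)) + 0) - (ip (?d i) (P i) + 0))"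
    unfolding a_def b_def c_def e_def
    by (intro tendsto_sum tendsto_diff tendsto_add weak_cut_tendsto(1,2)[OF g h] AP cut_L2M_tendsto cut_deriv_tendsto Pol_L2M Pol_partial_deriv p P)
  moreover have "(\<lambda>n. - r n) \<longlonglongrightarrow> - ip f p"
    unfolding r_def by (intro tendsto_minus cut_L2M_tendsto f p)
  ultimately have lim: "(\<Sum>i\<in>UNIV. (\<Sum>j\<in>UNIV. ip h (raise j (\<lambda>v. A i j v * ?d i v)) + 0) - (ip (?d i) (P i) + 0)) = - ip f p"
    unfolding id by (rule LIMSEQ_unique)
  have lf: "(\<Sum>i\<in>UNIV. A i j v * ?d i v) = mass TYPE('n) * local_flux p j v" for j v
  proof -
    have "(\<Sum>i\<in>UNIV. A i j v * ?d i v) = (\<Sum>i\<in>UNIV. mass TYPE('n) * (amat v j i * ?d i v) + (if i = j then mass TYPE('n) * ((real CARD('n) - 1) / 2 * ?d i v) else 0))"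
      by (intro sum.cong refl) (auto simp: A_def amat_sym[of v j] algebra_simps)
    then show ?thesis unfolding local_flux_amat by (simp add: sum.distrib sum_distrib_left distrib_left)
  qed
  have "(\<Sum>i\<in>UNIV. \<Sum>j\<in>UNIV. ip h (raise j (\<lambda>v. A i j v * ?d i v))) = (\<Sum>j\<in>UNIV. \<Sum>i\<in>UNIV. ip h (raise j (\<lambda>v. A i j v * ?d i v)))"
    by (rule sum.swap)
  also have "\<dots> = (\<Sum>j\<in>UNIV. ip h (raise j (\<lambda>v. mass TYPE('n) * local_flux p j v)))"
  proof (intro sum.cong refl)
    fix j
    have "(\<Sum>i\<in>UNIV. ip h (raise j (\<lambda>v. A i j v * ?d i v))) = ip h (\<lambda>v. \<Sum>i\<in>UNIV. raise j (\<lambda>v. A i j v * ?d i v) v)"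
      by (intro ip_sum_right[symmetric] Pol_L2M Pol_raise AP h)
    also have "(\<lambda>v. \<Sum>i\<in>UNIV. raise j (\<lambda>v. A i j v * ?d i v) v) = raise j (\<lambda>v. \<Sum>i\<in>UNIV. A i j v * ?d i v)"
      by (rule raise_sum[symmetric]) (rule AP)
    finally show "(\<Sum>i\<in>UNIV. ip h (raise j (\<lambda>v. A i j v * ?d i v))) = ip h (raise j (\<lambda>v. mass TYPE('n) * local_flux p j v))"
      unfolding lf .
  qed
  finally have SA: "(\<Sum>i\<in>UNIV. \<Sum>j\<in>UNIV. ip h (raise j (\<lambda>v. A i j v * ?d i v))) = (\<Sum>j\<in>UNIV. ip h (raise j (\<lambda>v. mass TYPE('n) * local_flux p j v)))" .
  have "ip h (collision p) = (\<Sum>j\<in>UNIV. ip h (raise j (flux p j)))"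
    unfolding collision_def by (intro ip_sum_right Pol_L2M Pol_raise Pol_flux p h)
  also have "\<dots> = (\<Sum>j\<in>UNIV. ip h (raise j (\<lambda>v. mass TYPE('n) * local_flux p j v)) - ip h (raise j (nonlocal p j)))"
  proof (intro sum.cong refl)
    fix j
    have ml: "(\<lambda>v. mass TYPE('n) * local_flux p j v) \<in> Pol" by (intro Pol_cmult Pol_local_flux p)
    show "ip h (raise j (flux p j)) = ip h (raise j (\<lambda>v. mass TYPE('n) * local_flux p j v)) - ip h (raise j (nonlocal p j))"
      unfolding flux_def[abs_def] raise_diff[OF ml Pol_nonlocal[OF p]]
      by (intro ip_diff_right Pol_L2M Pol_raise Pol_nonlocal ml p h)
  qed
  finally show ?thesis using lim SA SP by (simp add: sum_subtractf)
qed

section \<open>A radial eigenfunction\<close>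

lemma raise_radial:
  "raise i (\<lambda>v::real^'n::finite. a * (norm v)\<^sup>2 + b) = (\<lambda>v. v $ i * (2 * a * (norm v)\<^sup>2 + (2 * b - 2 * a)))"
proof
  fix v :: "real^'n"
  have "partial_deriv i (\<lambda>v::real^'n. a * (norm v)\<^sup>2 + b) v = a * (2 * v $ i)"
    by (simp only: partial_deriv_Pol_add[OF Pol_cmult[OF Pol_norm_square] Pol_const] partial_deriv_Pol_cmult[OF Pol_norm_square]
      partial_deriv_norm_square) simp
  then show "raise i (\<lambda>v. a * (norm v)\<^sup>2 + b) v = v $ i * (2 * a * (norm v)\<^sup>2 + (2 * b - 2 * a))"
    by (simp add: raise_def algebra_simps)
qed

lemma raise_coord_radial:
  "raise i (\<lambda>v::real^'n::finite. v $ i * (a * (norm v)\<^sup>2 + b)) v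
    = (2 * (v $ i)\<^sup>2 - 1) * (a * (norm v)\<^sup>2 + b) - 2 * a * (v $ i)\<^sup>2"
proof -
  have P: "(\<lambda>v::real^'n. a * (norm v)\<^sup>2 + b) \<in> Pol" by (intro Pol_add Pol_cmult Pol_norm_square Pol_const)
  have "partial_deriv i (\<lambda>v::real^'n. a * (norm v)\<^sup>2 + b) v = a * (2 * v $ i)"
    by (simp only: partial_deriv_Pol_add[OF Pol_cmult[OF Pol_norm_square] Pol_const] partial_deriv_Pol_cmult[OF Pol_norm_square]
      partial_deriv_norm_square) simp
  then show ?thesis
    unfolding raise_def partial_deriv_Pol_mult[OF Pol_coord P] partial_deriv_coord
    by (simp add: power2_eq_square algebra_simps)
qed

lemma lap_adj_radial:
  fixes v :: "real^'n::finite"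
  shows "lap_adj (\<lambda>v. a * (norm v)\<^sup>2 + b) v
    = 4 * a * (norm v)^4 + (4 * b - 4 * a - (2 * real CARD('n) + 4) * a) * (norm v)\<^sup>2 - real CARD('n) * (2 * b - 2 * a)"
proof -
  let ?r = "2 * a * (norm v)\<^sup>2 + (2 * b - 2 * a)"
  have "lap_adj (\<lambda>v. a * (norm v)\<^sup>2 + b) v = (\<Sum>i\<in>UNIV. (2 * (v $ i)\<^sup>2 - 1) * ?r - 2 * (2 * a) * (v $ i)\<^sup>2)"
    unfolding lap_adj_def raise_radial raise_coord_radial ..
  also have "\<dots> = (\<Sum>i\<in>UNIV. (2 * ?r - 4 * a) * (v $ i)\<^sup>2 - ?r)"
    by (intro sum.cong refl) (simp add: algebra_simps)
  also have "\<dots> = (2 * ?r - 4 * a) * (norm v)\<^sup>2 - real CARD('n) * ?r"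
    unfolding norm_vec_square_sum[of v] by (simp add: sum_subtractf flip: sum_distrib_left)
  also have "\<dots> = 4 * a * (norm v)^4 + (4 * b - 4 * a - (2 * real CARD('n) + 4) * a) * (norm v)\<^sup>2 - real CARD('n) * (2 * b - 2 * a)"
    by (simp add: algebra_simps power2_eq_square power4_eq_xxxx)
  finally show ?thesis .
qed

text \<open>A multiple of \<open>|v|\<^sup>4 - (N + 2) |v|\<^sup>2 + N (N + 2) / 4\<close>, for which the bound in \<open>local_gap\<close> is attained.\<close>

definition radial_mode :: "real^'n::finite \<Rightarrow> real" where
  "radial_mode = lap_adj (lap_adj one)"

lemma radial_mode_Herm: "radial_mode \<in> Herm 4"
  using lap_adj_Herm[OF lap_adj_Herm[OF one_Herm]] by (simp add: radial_mode_def numeral_eq_Suc)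

text \<open>Only the constant term is made explicit: its being nonzero shows that the mode does not
  vanish near the origin, while for the rotations it is enough that the mode is radial.\<close>

lemma radial_mode_eq:
  "\<exists>a b. radial_mode = (\<lambda>v::real^'n::finite. a * ((norm v)\<^sup>2)\<^sup>2 + b * (norm v)\<^sup>2 + 4 * real CARD('n) * (real CARD('n) + 2))"
proof -
  let ?N = "real CARD('n)"
  have "lap_adj one = (\<lambda>v::real^'n. 4 * (norm v)\<^sup>2 + - 2 * ?N)" unfolding lap_adj_one by simp
  then have "radial_mode v = 16 * ((norm v)\<^sup>2)\<^sup>2 + (- 8 * ?N - 16 - (2 * ?N + 4) * 4) * (norm v)\<^sup>2 + 4 * ?N * (?N + 2)" for v :: "real^'n"
    unfolding radial_mode_def by (simp only: lap_adj_radial) (simp add: algebra_simps)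
  then show ?thesis by blast
qed

lemma spherical_radial_mode: "spherical (radial_mode :: real^'n::finite \<Rightarrow> real) = (\<lambda>_. 0)"
proof -
  obtain a b where e: "(radial_mode :: real^'n \<Rightarrow> real) = (\<lambda>v. a * ((norm v)\<^sup>2)\<^sup>2 + b * (norm v)\<^sup>2 + 4 * real CARD('n) * (real CARD('n) + 2))"
    using radial_mode_eq by blast
  note P = Pol_norm_square
  have "partial_deriv i (radial_mode :: real^'n \<Rightarrow> real) v = (4 * a * (norm v)\<^sup>2 + 2 * b) * v $ i" for i v
    unfolding e power2_eq_square[of "(norm _)\<^sup>2"]
      partial_deriv_Pol_add[OF Pol_add[OF Pol_cmult[OF Pol_mult[OF P P]] Pol_cmult[OF P]] Pol_const]
      partial_deriv_Pol_add[OF Pol_cmult[OF Pol_mult[OF P P]] Pol_cmult[OF P]]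
      partial_deriv_Pol_cmult[OF Pol_mult[OF P P]] partial_deriv_Pol_cmult[OF P] partial_deriv_Pol_mult[OF P P] partial_deriv_norm_square
    by (simp add: algebra_simps)
  then have "rot i j (radial_mode :: real^'n \<Rightarrow> real) = (\<lambda>_. 0)" for i j by (simp add: rot_def fun_eq_iff)
  then show ?thesis by (simp add: spherical_def rot_def)
qed

lemma collision_radial_mode: "collision radial_mode = (\<lambda>v::real^'n::finite. lam1 TYPE('n) * radial_mode v)"
proof -
  have "collision radial_mode = (\<lambda>v::real^'n. mass TYPE('n) * local_op radial_mode v)"
    by (rule collision_Herm_ge3[OF radial_mode_Herm]) simp
  then show ?thesis
    unfolding local_op_Herm[OF radial_mode_Herm] spherical_radial_mode lam1_def by (simp add: mult_ac)
qed

lemma radial_mode_not_AE_zero: "\<not> (AE v in lborel. radial_mode (v :: real^'n::finite) = 0)"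
proof
  assume AE: "AE v in lborel. radial_mode (v :: real^'n) = 0"
  obtain a b where e: "(radial_mode :: real^'n \<Rightarrow> real) = (\<lambda>v. a * ((norm v)\<^sup>2)\<^sup>2 + b * (norm v)\<^sup>2 + 4 * real CARD('n) * (real CARD('n) + 2))"
    using radial_mode_eq by blast
  have "continuous (at 0) (radial_mode :: real^'n \<Rightarrow> real)" unfolding e by (intro continuous_intros)
  moreover have "radial_mode (0 :: real^'n) \<noteq> 0" unfolding e by (simp add: add_nonneg_eq_0_iff)
  ultimately obtain r where "r > 0" "\<And>v :: real^'n. dist 0 v < r \<Longrightarrow> radial_mode v \<noteq> 0"
    using continuous_at_avoid[of 0 radial_mode 0] by blast
  then show False using AE_lborel_ball[OF AE \<open>r > 0\<close>, of 0] by auto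
qed

text \<open>Polynomials lie in the maximal domain, with classical derivatives and convergent
  integrals at every v. This makes the radial mode an eigenfunction of the operator itself and not
  only of \<open>collision\<close>.\<close>

lemma landau_op_Pol:
  fixes p :: "real^'n::finite \<Rightarrow> real"
  assumes p: "p \<in> Pol"
  shows "landau_op (\<lambda>_. 1) p (\<lambda>v. - collision p v)"
proof -
  let ?g = "\<lambda>v. \<chi> i. partial_deriv i p v"
  have c: "(\<lambda>v. - collision p v) \<in> Pol" using Pol_cmult[OF Pol_collision[OF p], of "-1"] by simp
  have comp: "landau_integrand (\<lambda>_. 1) ?g v w $ i
      = maxw v * ((\<Sum>j\<in>UNIV. amat (v - w) i j * (partial_deriv j p v - partial_deriv j p w)) * maxw w)" for v w i
    unfolding landau_integrand_one by (simp add: sum_distrib_right)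
  have "(\<lambda>w. \<Sum>j\<in>UNIV. amat (v - w) i j * (partial_deriv j p v - partial_deriv j p w)) \<in> Pol" for v i
    by (intro Pol_sum Pol_mult Pol_diff Pol_amat_shift Pol_const Pol_partial_deriv p)
  then have ci: "integrable lborel (\<lambda>w. landau_integrand (\<lambda>_. 1) ?g v w $ i)" for v i
    unfolding comp by (intro integrable_mult_right Pol_integrable)
  have int: "integrable lborel (landau_integrand (\<lambda>_. 1) ?g v)" for v
  proof -
    have "integrable lborel (\<lambda>w. \<Sum>i\<in>UNIV. (landau_integrand (\<lambda>_. 1) ?g v w $ i) *\<^sub>R (axis i 1 :: real^'n))"
      by (intro Bochner_Integration.integrable_sum integrable_scaleR_left ci)
    moreover have "(\<Sum>i\<in>UNIV. (x $ i) *\<^sub>R (axis i 1 :: real^'n)) = x" for x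
      using basis_expansion[of x] by (simp add: scalar_mult_eq_scaleR)
    ultimately show ?thesis by (simp only:)
  qed
  have F: "(\<lambda>v. LINT w|lborel. landau_integrand (\<lambda>_. 1) ?g v w) = (\<lambda>v. \<chi> i. flux p i v * maxw v)"
  proof (rule ext, rule vec_eq_iff[THEN iffD2], rule allI)
    fix v i
    have "(LINT w|lborel. landau_integrand (\<lambda>_. 1) ?g v w) $ i = (LINT w|lborel. landau_integrand (\<lambda>_. 1) ?g v w $ i)"
      by (rule integral_bounded_linear[OF bounded_linear_vec_nth int, symmetric])
    also have "\<dots> = maxw v * flux p i v" unfolding comp by (simp add: flux_integral[OF p])
    finally show "(LINT w|lborel. landau_integrand (\<lambda>_. 1) ?g v w) $ i = (\<chi> i. flux p i v * maxw v) $ i"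
      by (simp add: mult.commute)
  qed
  have u: "(\<lambda>v. maxw v * - collision p v) = (\<lambda>v. \<Sum>i\<in>UNIV. partial_deriv i (\<lambda>v. flux p i v * maxw v) v)"
  proof
    fix v
    have "partial_deriv i (\<lambda>v. flux p i v * maxw v) v = - raise i (flux p i) v * maxw v" for i
      unfolding Pol_maxw_deriv[OF Pol_flux[OF p]] raise_def by (simp add: algebra_simps)
    then show "maxw v * - collision p v = (\<Sum>i\<in>UNIV. partial_deriv i (\<lambda>v. flux p i v * maxw v) v)"
      by (simp add: collision_def sum_negf sum_distrib_left mult.commute)
  qed
  have "weak_divergence (\<lambda>v. LINT w|lborel. landau_integrand (\<lambda>_. 1) ?g v w) (\<lambda>v. maxw v * - collision p v)"
    unfolding F u by (intro smooth_weak_divergence smooth_mult Pol_smooth Pol_flux p smooth_maxw)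
  then show ?thesis
    unfolding landau_op_def using int smooth_weak_gradient[OF Pol_smooth[OF p]] Pol_L2M[OF p] Pol_L2M[OF c] by auto
qed

lemma L2M_eigenvalue_lam1: "L2M_eigenvalue (landau_op (\<lambda>_. 1) :: (real^'n::finite \<Rightarrow> real) \<Rightarrow> _) (- lam1 TYPE('n))"
  unfolding L2M_eigenvalue_def
proof (intro bexI conjI)
  have P: "(radial_mode :: real^'n \<Rightarrow> real) \<in> Pol" by (rule Herm_Pol[OF radial_mode_Herm])
  show "landau_op (\<lambda>_. 1) (radial_mode :: real^'n \<Rightarrow> real) (\<lambda>v. - lam1 TYPE('n) * radial_mode v)"
    using landau_op_Pol[OF P] by (simp add: collision_radial_mode)
qed (rule radial_mode_not_AE_zero Herm_L2M[OF radial_mode_Herm])+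

text \<open>Testing with the collision invariants shows, as \<nu> is nonzero, that the eigenfunction
  is orthogonal to them. By completeness some Hermite projection is nonzero, and testing with that
  projection alone compares \<nu> with \<open>- lam1\<close>; the sign of \<nu> comes out as
  well.\<close>

lemma eigenvalue_bound:
  assumes N: "CARD('n::finite) \<ge> 2" and ev: "L2M_eigenvalue (landau_op (\<lambda>_. 1) :: (real^'n \<Rightarrow> real) \<Rightarrow> _) \<nu>" and "\<nu> \<noteq> 0"
  shows "\<nu> \<le> - lam1 TYPE('n)"
proof -
  obtain h :: "real^'n \<Rightarrow> real" where h: "h \<in> L2M" "\<not> (AE v in lborel. h v = 0)" and op: "landau_op (\<lambda>_. 1) h (\<lambda>v. \<nu> * h v)"
    using ev by (auto simp: L2M_eigenvalue_def)
  have ev: "\<nu> * ip h p = - ip h (collision p)" if "p \<in> Pol" for p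
    using landau_op_ip_collision[OF N op that] by (simp add: ip_cmult_left)
  have z: "ip h p = 0" if "p \<in> Pol" "collision p = (\<lambda>_. 0)" for p
    using ev[OF that(1)] that(2) \<open>\<nu> \<noteq> 0\<close> by (simp add: L2M_inner_def)
  note orth = z[OF Pol_const collision_const] z[OF Pol_coord collision_coord] z[OF Pol_norm_square collision_norm_square]
  have pos: "ip h h > 0"
  proof (rule ccontr)
    assume "\<not> ip h h > 0"
    then have "ip h h = 0" using ip_self_nonneg[of h] by linarith
    then have "(LINT v|lborel. (h v)\<^sup>2 * maxw v) = 0" by (simp add: L2M_inner_def power2_eq_square)
    moreover have "integrable lborel (\<lambda>v. (h v)\<^sup>2 * maxw v)" using h by (simp add: L2M_def)
    ultimately have "AE v in lborel. (h v)\<^sup>2 * maxw v = 0"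
      by (subst (asm) integral_nonneg_eq_0_iff_AE) auto
    then show False using h(2) by (auto elim: eventually_mono)
  qed
  obtain n where "ip h h - ip h h / 2 \<le> (\<Sum>k\<le>n. ip (herm_proj h k) (herm_proj h k))"
    using herm_proj_complete[OF h(1), of "ip h h / 2"] pos by auto
  then have "(\<Sum>k\<le>n. ip (herm_proj h k) (herm_proj h k)) > 0" using pos by linarith
  then obtain k where k: "ip (herm_proj h k) (herm_proj h k) > 0"
    using sum_nonpos[of "{..n}" "\<lambda>k. ip (herm_proj h k) (herm_proj h k)"] by (meson not_le)
  have "\<nu> * ip h (herm_proj h k) \<le> - (lam1 TYPE('n) * ip (herm_proj h k) (herm_proj h k))"
    using ev[OF Herm_Pol[OF herm_proj_Herm], of h k] ip_Herm_collision[OF N h(1) orth, of k] by simp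
  then have "\<nu> * ip (herm_proj h k) (herm_proj h k) \<le> - lam1 TYPE('n) * ip (herm_proj h k) (herm_proj h k)"
    using herm_proj_ip[OF h(1) herm_proj_Herm[of h k]] by simp
  then show ?thesis by (rule mult_right_le_imp_le) (rule k)
qed

lemma first_nonzero_eigenvalue_lam1:
  assumes N: "CARD('n::finite) \<ge> 2"
  shows "lam1 TYPE('n) > 0"
    and "first_nonzero_eigenvalue (landau_op (\<lambda>_. 1) :: (real^'n \<Rightarrow> real) \<Rightarrow> _) (- lam1 TYPE('n))"
proof -
  show l: "lam1 TYPE('n) > 0" using N mass_pos[where 'n = 'n] by (simp add: lam1_def)
  show "first_nonzero_eigenvalue (landau_op (\<lambda>_. 1) :: (real^'n \<Rightarrow> real) \<Rightarrow> _) (- lam1 TYPE('n))"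
    unfolding first_nonzero_eigenvalue_def
  proof (intro conjI allI impI)
    fix \<nu> assume "L2M_eigenvalue (landau_op (\<lambda>_. 1) :: (real^'n \<Rightarrow> real) \<Rightarrow> _) \<nu> \<and> \<nu> \<noteq> 0"
    then have "\<nu> \<le> - lam1 TYPE('n)" using eigenvalue_bound[OF N] by blast
    then show "\<bar>- lam1 TYPE('n)\<bar> \<le> \<bar>\<nu>\<bar>" using l by linarith
  qed (use l L2M_eigenvalue_lam1 in auto)
qed

section \<open>Comparison of the dissipations and conclusion\<close>

lemma dissipation_comparison:
  fixes h :: "real^'n::finite \<Rightarrow> real"
  assumes N: "CARD('n) \<ge> 2" and \<Phi>: "\<And>r. r \<ge> 0 \<Longrightarrow> \<Phi> r \<ge> 0" and R: "R \<ge> 0" and c: "c > 0"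
    and \<Phi>c: "\<And>r. r \<ge> R \<Longrightarrow> \<Phi> r \<ge> c"
  shows "landau_dissipation \<Phi> h \<ge> ennreal (landau_const CARD('n) c R) * landau_dissipation (\<lambda>_. 1) h"
proof (cases "\<exists>g. weak_gradient h g")
  case False
  then show ?thesis by (simp add: landau_dissipation_def)
next
  case True
  define g where "g = (SOME g. weak_gradient h g)"
  have "weak_gradient h g" unfolding g_def using True by (rule someI_ex)
  then have g[measurable]: "g \<in> borel_measurable borel" by (auto simp: weak_gradient_def intro: locally_integrable_borel)
  define K where "K v w = ennreal (perp_form (v - w) (g v - g w) * (maxw v * maxw w))" for v w
  have [measurable]: "(\<lambda>x. K (fst x) (snd x)) \<in> borel_measurable (borel \<Otimes>\<^sub>M borel)" unfolding K_def by measurable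
  let ?D = "\<integral>\<^sup>+v. \<integral>\<^sup>+w. K v w \<partial>lborel \<partial>lborel" and ?E = "\<integral>\<^sup>+v. \<integral>\<^sup>+w. indicator {R..} (norm (v - w)) * K v w \<partial>lborel \<partial>lborel"
  let ?a = "alpha_const CARD('n)" and ?b = "beta_const CARD('n) R"
  have a: "?a > 0" unfolding alpha_const_eq by simp
  have far: "ennreal ?b * ?D \<le> ennreal (8 * ?a) * ?E"
    unfolding K_def by (rule far_dissipation_inequality[OF N R g])
  have D1: "landau_dissipation (\<lambda>_. 1) h = ennreal (1/2) * ?D"
    unfolding K_def g_def by (rule dissipation_one_eq[OF True])
  have "landau_dissipation \<Phi> h = ennreal (1/2) * (\<integral>\<^sup>+v. \<integral>\<^sup>+w. ennreal (\<Phi> (norm (v - w)) * (norm (v - w))\<^sup>2 *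
              (norm (perp_proj (v - w) *v (g v - g w)))\<^sup>2 * maxw v * maxw w) \<partial>lborel \<partial>lborel)"
    unfolding landau_dissipation_def Let_def if_P[OF True] g_def ..
  \<comment> \<open>Pairs closer than R are dropped, and on the others \<Phi> is replaced by its
    lower bound c.\<close>
  also have "\<dots> \<ge> ennreal (1/2) * (\<integral>\<^sup>+v. \<integral>\<^sup>+w. ennreal c * (indicator {R..} (norm (v - w)) * K v w) \<partial>lborel \<partial>lborel)"
  proof (intro mult_left_mono nn_integral_mono)
    fix v w :: "real^'n"
    let ?z = "v - w"
    have e: "\<Phi> (norm ?z) * (norm ?z)\<^sup>2 * (norm (perp_proj ?z *v (g v - g w)))\<^sup>2 * maxw v * maxw w
        = \<Phi> (norm ?z) * (perp_form ?z (g v - g w) * (maxw v * maxw w))"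
      unfolding perp_proj_form[symmetric] by (simp add: mult_ac)
    show "ennreal c * (indicator {R..} (norm ?z) * K v w) \<le> ennreal (\<Phi> (norm ?z) * (norm ?z)\<^sup>2 *
              (norm (perp_proj ?z *v (g v - g w)))\<^sup>2 * maxw v * maxw w)"
      unfolding e K_def using c \<Phi>c[of "norm ?z"]
      by (cases "norm ?z \<ge> R") (auto simp: ennreal_mult'[symmetric] intro!: ennreal_leI mult_right_mono)
  qed simp
  also have "(\<integral>\<^sup>+v. \<integral>\<^sup>+w. ennreal c * (indicator {R..} (norm (v - w)) * K v w) \<partial>lborel \<partial>lborel) = ennreal c * ?E"
  proof -
    have "(\<integral>\<^sup>+w. ennreal c * (indicator {R..} (norm (v - w)) * K v w) \<partial>lborel)
        = ennreal c * (\<integral>\<^sup>+w. indicator {R..} (norm (v - w)) * K v w \<partial>lborel)" for v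
      unfolding K_def by (rule nn_integral_cmult) measurable
    moreover have "(\<lambda>v. \<integral>\<^sup>+w. indicator {R..} (norm (v - w)) * K v w \<partial>lborel) \<in> borel_measurable lborel"
      unfolding K_def by measurable
    ultimately show ?thesis by (simp only: nn_integral_cmult)
  qed
  finally have D\<Phi>: "ennreal (1/2) * (ennreal c * ?E) \<le> landau_dissipation \<Phi> h" .
  have "ennreal (landau_const CARD('n) c R) * landau_dissipation (\<lambda>_. 1) h
      = ennreal (1/2) * (ennreal (c / (8 * ?a)) * (ennreal ?b * ?D))"
  proof -
    have "landau_const CARD('n) c R = c / (8 * ?a) * ?b" by (simp add: landau_const_def)
    then have "ennreal (landau_const CARD('n) c R) = ennreal (c / (8 * ?a)) * ennreal ?b"
      using c a beta_const_nonneg[of "CARD('n)" R] by (simp only:) (intro ennreal_mult, auto)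
    then show ?thesis unfolding D1 by (simp only: mult_ac)
  qed
  also have "\<dots> \<le> ennreal (1/2) * (ennreal (c / (8 * ?a)) * (ennreal (8 * ?a) * ?E))"
    by (intro mult_left_mono far) auto
  also have "ennreal (c / (8 * ?a)) * (ennreal (8 * ?a) * ?E) = ennreal c * ?E"
    using a c by (simp add: mult.assoc[symmetric] ennreal_mult[symmetric])
  finally show ?thesis using D\<Phi> by (rule order_trans)
qed

theorem theorem1p2:
  fixes \<Phi> :: "real \<Rightarrow> real" and R c :: real
  assumes "CARD('n::finite) \<ge> 2"
    and "\<And>r. r \<ge> 0 \<Longrightarrow> \<Phi> r \<ge> 0"
    and "R \<ge> 0" and "c > 0"
    and "\<And>r. r \<ge> R \<Longrightarrow> \<Phi> r \<ge> c"
  shows "(\<forall>h\<in>(L2M :: (real^'n \<Rightarrow> real) set).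
            landau_dissipation \<Phi> h
              \<ge> ennreal (landau_const CARD('n) c R) * landau_dissipation (\<lambda>_. 1) h)
       \<and> (\<exists>lam0. first_nonzero_eigenvalue
                   (landau_op (\<lambda>_. 1) :: (real^'n \<Rightarrow> real) \<Rightarrow> (real^'n \<Rightarrow> real) \<Rightarrow> bool) lam0
            \<and> (\<forall>h\<in>(L2M :: (real^'n \<Rightarrow> real) set).
                  L2M_inner h (\<lambda>v. 1) = 0 \<and> (\<forall>i. L2M_inner h (\<lambda>v. v $ i) = 0)
                    \<and> L2M_inner h (\<lambda>v. (norm v)\<^sup>2) = 0 \<longrightarrow>
                  landau_dissipation \<Phi> h
                    \<ge> ennreal (landau_const CARD('n) c R * \<bar>lam0\<bar> * (L2M_norm h)\<^sup>2))
            \<and> (CARD('n) = 3 \<longrightarrow> \<bar>lam0\<bar> \<ge> 2 * pi))"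
proof (rule conjI)
  note comparison = dissipation_comparison[OF assms]
  let ?l = "lam1 TYPE('n)" and ?C = "landau_const CARD('n) c R"
  have l: "?l > 0" by (rule first_nonzero_eigenvalue_lam1(1)[OF assms(1)])
  have C: "?C \<ge> 0"
    unfolding landau_const_def alpha_const_eq using assms(4) beta_const_nonneg[of "CARD('n)" R] by simp
  show "\<forall>h\<in>(L2M :: (real^'n \<Rightarrow> real) set). landau_dissipation \<Phi> h \<ge> ennreal ?C * landau_dissipation (\<lambda>_. 1) h"
    by (intro ballI comparison)
  show "\<exists>lam0. first_nonzero_eigenvalue
                   (landau_op (\<lambda>_. 1) :: (real^'n \<Rightarrow> real) \<Rightarrow> (real^'n \<Rightarrow> real) \<Rightarrow> bool) lam0
            \<and> (\<forall>h\<in>(L2M :: (real^'n \<Rightarrow> real) set).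
                  L2M_inner h (\<lambda>v. 1) = 0 \<and> (\<forall>i. L2M_inner h (\<lambda>v. v $ i) = 0)
                    \<and> L2M_inner h (\<lambda>v. (norm v)\<^sup>2) = 0 \<longrightarrow>
                  landau_dissipation \<Phi> h
                    \<ge> ennreal (?C * \<bar>lam0\<bar> * (L2M_norm h)\<^sup>2))
            \<and> (CARD('n) = 3 \<longrightarrow> \<bar>lam0\<bar> \<ge> 2 * pi)"
  proof (intro exI[of _ "- ?l"] conjI ballI impI)
    show "first_nonzero_eigenvalue (landau_op (\<lambda>_. 1) :: (real^'n \<Rightarrow> real) \<Rightarrow> (real^'n \<Rightarrow> real) \<Rightarrow> bool) (- ?l)"
      by (rule first_nonzero_eigenvalue_lam1(2)[OF assms(1)])
  next
    fix h :: "real^'n \<Rightarrow> real"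
    assume h: "h \<in> L2M" and orth: "ip h (\<lambda>v. 1) = 0 \<and> (\<forall>i. ip h (\<lambda>v. v $ i) = 0) \<and> ip h (\<lambda>v. (norm v)\<^sup>2) = 0"
    have "ennreal (?C * \<bar>- ?l\<bar> * (L2M_norm h)\<^sup>2) = ennreal ?C * ennreal (?l * ip h h)"
      using l C ip_self_nonneg[of h] by (simp add: L2M_norm_square ennreal_mult[symmetric] mult.assoc)
    also have "\<dots> \<le> ennreal ?C * landau_dissipation (\<lambda>_. 1) h"
      using orth by (intro mult_left_mono spectral_gap_dissipation assms(1) h) auto
    also have "\<dots> \<le> landau_dissipation \<Phi> h" by (rule comparison)
    finally show "ennreal (?C * \<bar>- ?l\<bar> * (L2M_norm h)\<^sup>2) \<le> landau_dissipation \<Phi> h" .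
  next
    assume "CARD('n) = 3"
    \<comment> \<open>In dimension 3 the gap is 4 * 2 * pi^(3/2); the bound by 2 pi leaves room, and
      sqrt pi >= 1 is enough.\<close>
    then have "?l = 8 * (pi * sqrt pi)" by (simp add: lam1_def mass_def power3_eq_cube)
    moreover have "pi * 1 \<le> pi * sqrt pi" using pi_gt3 by (intro mult_left_mono) simp_all
    ultimately show "2 * pi \<le> \<bar>- ?l\<bar>" using pi_gt3 by linarith
  qed
qed

end
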